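(* Let $M$ be a three dimensional strictly pseudoconvex CR manifold, and let $\lambda\in\mathbb{R}$. Then, for each integer $k\ge1$, there exists a CR invariant linear differential operator $$P^\lambda_{2k}:\mathcal{E}(k/2-1,\,k/2-1)\longrightarrow\mathcal{E}(-k/2-1,\,-k/2-1)$$ which is a polynomial in $\lambda$ of degree $\le k/3$, and has the principal part $\Delta_b^k$.
   Context: **CR structure.** $M$ is a $C^\infty$ 3-manifold with a rank 2 subbundle $H\subset TM$ and an almost complex structure $J$ on $H$ (integrability is automatic in dimension three); $T^{1,0}M\subset\mathbb{C}H$ is the $i$-eigenbundle of $J$. For a real 1-form $\theta$ with $\ker\theta=H$, the Levi form is $h_\theta(Z,\overline W)=-i\,d\theta(Z,\overline W)$, $Z,W\in T^{1,0}M$. $M$ is strictly pseudoconvex if $h_\theta$ is positive definite for some $\theta$; such $\theta$ are called contact forms, and any two differ by a positive factor, $\hat\theta=e^\Upsilon\theta$. The Reeb field $T$ satisfies $\theta(T)=1$, $T\lrcorner d\theta=0$. An admissible frame is $\{T,Z_1,Z_{\overline1}=\overline{Z_1}\}$ with $Z_1$ a local frame of $T^{1,0}M$; the dual coframe $\{\theta,\theta^1,\theta^{\overline1}\}$ satisfies $d\theta=ih_{1\overline1}\theta^1\wedge\theta^{\overline1}$. **Tanaka–Webster connection.** For a fixed $\theta$, it is the linear connection $\nabla$ on $TM$ preserving $T^{1,0}M$ with $\nabla T=0$, $\nabla h_\theta=0$ and $d\theta^1=\theta^1\wedge\omega_1{}^1+A^1{}_{\overline1}\theta\wedge\theta^{\overline1}$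 with connection form $\omega_1{}^1$; $A_{11}=\overline{A_{\overline1\overline1}}$ (indices lowered with $h_{1\overline1}$) is its torsion, and its scalar curvature $\mathrm{Scal}$ is the coefficient of $h_{1\overline1}\theta^1\wedge\theta^{\overline1}$ in $d\omega_1{}^1$. **Densities.** For real $w$, $\mathcal{E}(w,w)$ is the space of CR densities of weight $(w,w)$; an element is equivalent to an assignment $\theta\mapsto f_\theta\in C^\infty(M,\mathbb{C})$ with $f_{e^\Upsilon\theta}=e^{w\Upsilon}f_\theta$. The sublaplacian is $\Delta_bf=-h^{1\overline1}(\nabla_1\nabla_{\overline1}+\nabla_{\overline1}\nabla_1)f$ (defined for a choice of $\theta$, mapping $\mathcal{E}(w,w)$ to $\mathcal{E}(w-1,w-1)$ when the weighted Levi form is used). **CR invariant operator.** A linear differential operator between density spaces is CR invariant if, for a contact form $\theta$, it is given by a universal expression in the Tanaka–Webster connection of $\theta$, its torsion and curvature, and if the resulting operator between densities is independent of the choice of $\theta$. That the principal part is $\Delta_b^k$ means that $P^\lambda_{2k}-\Delta_b^k$ has order strictly less than $2k$ as a differential operator in the usual sense. That $P^\lambda_{2k}$ is a polynomial in $\lambda$ refers to the dependence of the family $(P^\lambda_{2k})_{\lambda\in\mathbb{R}}$ on $\lambda$ for fixed $k$. *)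

theory Defs
  imports "HOL-Analysis.Analysis"
begin

section \<open>Smooth functions and smooth 3-manifolds\<close>

text \<open>Used for open \<^term>\<open>S\<close> only; \<^term>\<open>Ck_on n S f\<close> says that \<^term>\<open>f\<close> is \<open>C\<^sup>n\<close> on \<^term>\<open>S\<close>.\<close>

fun Ck_on :: "nat \<Rightarrow> 'a::euclidean_space set \<Rightarrow> ('a \<Rightarrow> 'b::real_normed_vector) \<Rightarrow> bool" where
  "Ck_on 0 S f \<longleftrightarrow> continuous_on S f"
| "Ck_on (Suc n) S f \<longleftrightarrow> (\<forall>x\<in>S. f differentiable (at x)) \<and>
     (\<forall>v. Ck_on n S (\<lambda>x. frechet_derivative f (at x) v))"

definition Cinf_on :: "'a::euclidean_space set \<Rightarrow> ('a \<Rightarrow> 'b::real_normed_vector) \<Rightarrow> bool" where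
  "Cinf_on S f \<longleftrightarrow> (\<forall>n. Ck_on n S f)"

text \<open>
  Tangent vectors are complexified throughout: an element of \<open>\<complex>T\<^sub>pM\<close> is a complex derivation on the
  complex-valued functions smooth near \<open>p\<close> (see \<open>ctangent\<close>). A vector field or a 1-form is a total
  function on the point type, whose values outside the open set under consideration are irrelevant.
\<close>

type_synonym 'a tvec = "('a \<Rightarrow> complex) \<Rightarrow> complex"
type_synonym 'a vfield = "'a \<Rightarrow> 'a tvec"
type_synonym 'a oneform = "'a \<Rightarrow> 'a tvec \<Rightarrow> complex"

text \<open>
  The data of a CR 3-manifold: the topological space with an atlas of charts \<open>(U, \<phi>)\<close> to \<open>\<real>\<^sup>3\<close>, the
  plane field \<open>p \<mapsto> H\<^sub>p\<close> and the endomorphisms \<open>p \<mapsto> J\<^sub>p\<close>. The axioms are in \<open>cr_manifold\<close>.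
\<close>

record 'a crdata =
  mtop :: "'a topology"
  atlas :: "('a set \<times> ('a \<Rightarrow> real^3)) set"
  Hplane :: "'a \<Rightarrow> 'a tvec set"
  Jmap :: "'a \<Rightarrow> 'a tvec \<Rightarrow> 'a tvec"

definition is_chart :: "'a topology \<Rightarrow> 'a set \<Rightarrow> ('a \<Rightarrow> real^3) \<Rightarrow> bool" where
  "is_chart X U \<phi> \<longleftrightarrow> openin X U \<and> open (\<phi> ` U) \<and>
     homeomorphic_map (subtopology X U) (top_of_set (\<phi> ` U)) \<phi>"

definition smooth_3manifold :: "'a crdata \<Rightarrow> bool" where
  "smooth_3manifold M \<longleftrightarrow>
     Hausdorff_space (mtop M) \<and> second_countable (mtop M) \<and>
     (\<forall>(U, \<phi>) \<in> atlas M. is_chart (mtop M) U \<phi>) \<and>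
     topspace (mtop M) = (\<Union>(U, \<phi>) \<in> atlas M. U) \<and>
     (\<forall>(U, \<phi>) \<in> atlas M. \<forall>(V, \<psi>) \<in> atlas M.
        Cinf_on (\<phi> ` (U \<inter> V)) (\<psi> \<circ> inv_into U \<phi>))"

definition smooth_fun :: "'a crdata \<Rightarrow> 'a set \<Rightarrow> ('a \<Rightarrow> complex) \<Rightarrow> bool" where
  "smooth_fun M W f \<longleftrightarrow> (\<forall>(U, \<phi>) \<in> atlas M. Cinf_on (\<phi> ` (U \<inter> W)) (f \<circ> inv_into U \<phi>))"

definition smooth_at :: "'a crdata \<Rightarrow> 'a \<Rightarrow> ('a \<Rightarrow> complex) \<Rightarrow> bool" where
  "smooth_at M p f \<longleftrightarrow> (\<exists>U. openin (mtop M) U \<and> p \<in> U \<and> smooth_fun M U f)"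


section \<open>Tangent vectors, vector fields, 1-forms\<close>

definition tadd :: "'a tvec \<Rightarrow> 'a tvec \<Rightarrow> 'a tvec" where
  "tadd v w = (\<lambda>f. v f + w f)"

definition tscale :: "complex \<Rightarrow> 'a tvec \<Rightarrow> 'a tvec" where
  "tscale c v = (\<lambda>f. c * v f)"

definition tzero :: "'a tvec" where
  "tzero = (\<lambda>f. 0)"

definition tconj :: "'a tvec \<Rightarrow> 'a tvec" where
  "tconj v = (\<lambda>f. cnj (v (\<lambda>q. cnj (f q))))"

text \<open>
  The functions are total but only smooth near \<open>p\<close>, so the Leibniz rule may be applied to indicator
  functions of complements of neighbourhoods of \<open>p\<close>; hence \<open>v f\<close> depends only on the germ of \<open>f\<close>
  at \<open>p\<close>. The last clause only normalises the values on functions that are not smooth at \<open>p\<close>.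
\<close>

definition ctangent :: "'a crdata \<Rightarrow> 'a \<Rightarrow> 'a tvec set" where
  "ctangent M p = {v.
     (\<forall>f g. smooth_at M p f \<longrightarrow> smooth_at M p g \<longrightarrow>
        v (\<lambda>q. f q + g q) = v f + v g \<and>
        v (\<lambda>q. f q * g q) = v f * g p + f p * v g) \<and>
     (\<forall>c f. smooth_at M p f \<longrightarrow> v (\<lambda>q. c * f q) = c * v f) \<and>
     (\<forall>f. \<not> smooth_at M p f \<longrightarrow> v f = 0)}"

definition rtangent :: "'a crdata \<Rightarrow> 'a \<Rightarrow> 'a tvec set" where
  "rtangent M p = {v \<in> ctangent M p. tconj v = v}"

definition smooth_vfield :: "'a crdata \<Rightarrow> 'a set \<Rightarrow> 'a vfield \<Rightarrow> bool" where
  "smooth_vfield M U X \<longleftrightarrow>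
     (\<forall>p\<in>U. X p \<in> ctangent M p) \<and>
     (\<forall>V f. openin (mtop M) V \<longrightarrow> V \<subseteq> U \<longrightarrow> smooth_fun M V f \<longrightarrow> smooth_fun M V (\<lambda>p. X p f))"

definition vconj :: "'a vfield \<Rightarrow> 'a vfield" where
  "vconj X = (\<lambda>p. tconj (X p))"

definition lie_bracket :: "'a crdata \<Rightarrow> 'a vfield \<Rightarrow> 'a vfield \<Rightarrow> 'a vfield" where
  "lie_bracket M X Y = (\<lambda>p f. if smooth_at M p f
     then X p (\<lambda>q. Y q f) - Y p (\<lambda>q. X q f) else 0)"

definition smooth_oneform :: "'a crdata \<Rightarrow> 'a set \<Rightarrow> 'a oneform \<Rightarrow> bool" where
  "smooth_oneform M U \<alpha> \<longleftrightarrow>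
     (\<forall>p\<in>U. \<forall>v\<in>ctangent M p. \<forall>w\<in>ctangent M p. \<alpha> p (tadd v w) = \<alpha> p v + \<alpha> p w) \<and>
     (\<forall>p\<in>U. \<forall>v\<in>ctangent M p. \<forall>c. \<alpha> p (tscale c v) = c * \<alpha> p v) \<and>
     (\<forall>V X. openin (mtop M) V \<longrightarrow> V \<subseteq> U \<longrightarrow> smooth_vfield M V X \<longrightarrow>
        smooth_fun M V (\<lambda>p. \<alpha> p (X p)))"

definition fconj :: "'a oneform \<Rightarrow> 'a oneform" where
  "fconj \<alpha> = (\<lambda>p v. cnj (\<alpha> p (tconj v)))"

definition wedge :: "'a oneform \<Rightarrow> 'a oneform \<Rightarrow> 'a vfield \<Rightarrow> 'a vfield \<Rightarrow> 'a \<Rightarrow> complex" where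
  "wedge \<alpha> \<beta> X Y p = \<alpha> p (X p) * \<beta> p (Y p) - \<alpha> p (Y p) * \<beta> p (X p)"

definition ext_d :: "'a crdata \<Rightarrow> 'a oneform \<Rightarrow> 'a vfield \<Rightarrow> 'a vfield \<Rightarrow> 'a \<Rightarrow> complex" where
  "ext_d M \<alpha> X Y p =
     X p (\<lambda>q. \<alpha> q (Y q)) - Y p (\<lambda>q. \<alpha> q (X q)) - \<alpha> p (lie_bracket M X Y p)"


section \<open>CR structures and contact forms\<close>

definition cr_manifold :: "'a crdata \<Rightarrow> bool" where
  "cr_manifold M \<longleftrightarrow> smooth_3manifold M \<and>
     (\<forall>p\<in>topspace (mtop M). Hplane M p \<subseteq> rtangent M p) \<and>
     (\<forall>p\<in>topspace (mtop M). \<exists>U X Y. openin (mtop M) U \<and> p \<in> U \<and>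
        smooth_vfield M U X \<and> smooth_vfield M U Y \<and>
        (\<forall>q\<in>U.
           Hplane M q = {tadd (tscale (of_real a) (X q)) (tscale (of_real b) (Y q)) | a b :: real. True} \<and>
           (\<forall>a b :: real. tadd (tscale (of_real a) (X q)) (tscale (of_real b) (Y q)) = tzero
              \<longrightarrow> a = 0 \<and> b = 0))) \<and>
     (\<forall>p\<in>topspace (mtop M). \<forall>v\<in>Hplane M p. \<forall>w\<in>Hplane M p. \<forall>a :: real.
        Jmap M p v \<in> Hplane M p \<and>
        Jmap M p (tadd v w) = tadd (Jmap M p v) (Jmap M p w) \<and>
        Jmap M p (tscale (of_real a) v) = tscale (of_real a) (Jmap M p v) \<and>
        Jmap M p (Jmap M p v) = tscale (- 1) v) \<and>
     (\<forall>U X. openin (mtop M) U \<longrightarrow> smooth_vfield M U X \<longrightarrow> (\<forall>p\<in>U. X p \<in> Hplane M p) \<longrightarrow>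
        smooth_vfield M U (\<lambda>p. Jmap M p (X p)))"

text \<open>The vectors \<open>x + i y\<close> with \<open>x, y \<in> H\<^sub>p\<close> and \<open>J(x + i y) = i (x + i y)\<close>, that is
  \<open>J x = - y\<close> and \<open>J y = x\<close>.\<close>

definition T10 :: "'a crdata \<Rightarrow> 'a \<Rightarrow> 'a tvec set" where
  "T10 M p = {tadd x (tscale \<i> y) | x y.
     x \<in> Hplane M p \<and> y \<in> Hplane M p \<and> Jmap M p x = tscale (- 1) y \<and> Jmap M p y = x}"

definition T10_section :: "'a crdata \<Rightarrow> 'a set \<Rightarrow> 'a vfield \<Rightarrow> bool" where
  "T10_section M U Z \<longleftrightarrow> smooth_vfield M U Z \<and> (\<forall>p\<in>U. Z p \<in> T10 M p)"

text \<open>\<open>levi M \<theta> Z W\<close> is \<open>h\<^sub>\<theta>\<close> applied to \<open>Z\<close> and the conjugate of \<open>W\<close>.\<close>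

definition levi :: "'a crdata \<Rightarrow> 'a oneform \<Rightarrow> 'a vfield \<Rightarrow> 'a vfield \<Rightarrow> 'a \<Rightarrow> complex" where
  "levi M \<theta> Z W p = - \<i> * ext_d M \<theta> Z (vconj W) p"

definition contact_form :: "'a crdata \<Rightarrow> 'a oneform \<Rightarrow> bool" where
  "contact_form M \<theta> \<longleftrightarrow>
     smooth_oneform M (topspace (mtop M)) \<theta> \<and>
     (\<forall>p\<in>topspace (mtop M). \<forall>v\<in>ctangent M p. \<theta> p (tconj v) = cnj (\<theta> p v)) \<and>
     (\<forall>p\<in>topspace (mtop M). {v \<in> rtangent M p. \<theta> p v = 0} = Hplane M p) \<and>
     (\<forall>U Z. openin (mtop M) U \<longrightarrow> T10_section M U Z \<longrightarrow>
        (\<forall>p\<in>U. Z p \<noteq> tzero \<longrightarrow> (\<exists>r>0. levi M \<theta> Z Z p = complex_of_real r)))"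

definition strictly_pseudoconvex :: "'a crdata \<Rightarrow> bool" where
  "strictly_pseudoconvex M \<longleftrightarrow> (\<exists>\<theta>. contact_form M \<theta>)"

definition reeb_field :: "'a crdata \<Rightarrow> 'a oneform \<Rightarrow> 'a vfield \<Rightarrow> bool" where
  "reeb_field M \<theta> T \<longleftrightarrow>
     smooth_vfield M (topspace (mtop M)) T \<and>
     (\<forall>p\<in>topspace (mtop M). T p \<in> rtangent M p \<and> \<theta> p (T p) = 1) \<and>
     (\<forall>U X. openin (mtop M) U \<longrightarrow> smooth_vfield M U X \<longrightarrow> (\<forall>p\<in>U. ext_d M \<theta> T X p = 0))"

text \<open>The admissible frame on \<open>U\<close> is \<open>T, Z, vconj Z\<close>; \<open>coframe1 T Z\<close> is the member \<open>\<theta>\<^sup>1\<close> of its dual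
  coframe, whose other members are \<open>\<theta>\<close> and \<open>fconj (coframe1 T Z)\<close>.\<close>

definition frame_vector :: "'a crdata \<Rightarrow> 'a set \<Rightarrow> 'a vfield \<Rightarrow> bool" where
  "frame_vector M U Z \<longleftrightarrow> openin (mtop M) U \<and> T10_section M U Z \<and> (\<forall>p\<in>U. Z p \<noteq> tzero)"

definition coframe1 :: "'a vfield \<Rightarrow> 'a vfield \<Rightarrow> 'a oneform" where
  "coframe1 T Z p v = (THE b. \<exists>a c.
     v = tadd (tscale a (T p)) (tadd (tscale b (Z p)) (tscale c (vconj Z p))))"


section \<open>The Tanaka--Webster connection\<close>

text \<open>\<open>nab p v Y\<close> is \<open>\<nabla>\<^sub>v Y \<in> \<complex>T\<^sub>pM\<close> for \<open>v \<in> \<complex>T\<^sub>pM\<close> and a vector field \<open>Y\<close> smooth near \<open>p\<close>.\<close>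

type_synonym 'a connection = "'a \<Rightarrow> 'a tvec \<Rightarrow> 'a vfield \<Rightarrow> 'a tvec"

definition nab_field :: "'a connection \<Rightarrow> 'a vfield \<Rightarrow> 'a vfield \<Rightarrow> 'a vfield" where
  "nab_field nab X Y = (\<lambda>p. nab p (X p) Y)"

text \<open>A linear connection on \<open>TM\<close>, extended complex linearly; the last clause says that it comes from
  the real tangent bundle.\<close>

definition linear_connection :: "'a crdata \<Rightarrow> 'a connection \<Rightarrow> bool" where
  "linear_connection M nab \<longleftrightarrow>
     (\<forall>U X Y. openin (mtop M) U \<longrightarrow> smooth_vfield M U X \<longrightarrow> smooth_vfield M U Y \<longrightarrow>
        smooth_vfield M U (nab_field nab X Y)) \<and>
     (\<forall>U Y. openin (mtop M) U \<longrightarrow> smooth_vfield M U Y \<longrightarrow>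
        (\<forall>p\<in>U. \<forall>v\<in>ctangent M p. \<forall>w\<in>ctangent M p. \<forall>c.
           nab p (tadd v w) Y = tadd (nab p v Y) (nab p w Y) \<and>
           nab p (tscale c v) Y = tscale c (nab p v Y))) \<and>
     (\<forall>U Y Y'. openin (mtop M) U \<longrightarrow> smooth_vfield M U Y \<longrightarrow> smooth_vfield M U Y' \<longrightarrow>
        (\<forall>p\<in>U. \<forall>v\<in>ctangent M p.
           nab p v (\<lambda>q. tadd (Y q) (Y' q)) = tadd (nab p v Y) (nab p v Y'))) \<and>
     (\<forall>U f Y. openin (mtop M) U \<longrightarrow> smooth_fun M U f \<longrightarrow> smooth_vfield M U Y \<longrightarrow>
        (\<forall>p\<in>U. \<forall>v\<in>ctangent M p.
           nab p v (\<lambda>q. tscale (f q) (Y q)) =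
             tadd (tscale (v f) (Y p)) (tscale (f p) (nab p v Y)))) \<and>
     (\<forall>U Y. openin (mtop M) U \<longrightarrow> smooth_vfield M U Y \<longrightarrow>
        (\<forall>p\<in>U. \<forall>v\<in>ctangent M p. nab p (tconj v) (vconj Y) = tconj (nab p v Y)))"

text \<open>The connection form \<open>\<omega>\<^sub>1\<^sup>1\<close>, for a connection with \<open>\<nabla>Z = \<omega>\<^sub>1\<^sup>1 \<otimes> Z\<close>.\<close>

definition conn_form :: "'a connection \<Rightarrow> 'a vfield \<Rightarrow> 'a vfield \<Rightarrow> 'a oneform" where
  "conn_form nab T Z p v = coframe1 T Z p (nab p v Z)"

text \<open>In the fourth clause, \<open>\<nabla>h\<^sub>\<theta> = 0\<close> is written out using that \<open>\<nabla>\<^sub>X\<close> of the conjugate of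
  \<open>W\<close> is the conjugate of \<open>\<nabla>\<close> of \<open>W\<close> along the conjugate of \<open>X\<close>.\<close>

definition tanaka_webster :: "'a crdata \<Rightarrow> 'a oneform \<Rightarrow> 'a vfield \<Rightarrow> 'a connection \<Rightarrow> bool" where
  "tanaka_webster M \<theta> T nab \<longleftrightarrow>
     linear_connection M nab \<and>
     (\<forall>U X Z. openin (mtop M) U \<longrightarrow> smooth_vfield M U X \<longrightarrow> T10_section M U Z \<longrightarrow>
        T10_section M U (nab_field nab X Z)) \<and>
     (\<forall>p\<in>topspace (mtop M). \<forall>v\<in>ctangent M p. nab p v T = tzero) \<and>
     (\<forall>U X Z W. openin (mtop M) U \<longrightarrow> smooth_vfield M U X \<longrightarrow>
        T10_section M U Z \<longrightarrow> T10_section M U W \<longrightarrow>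
        (\<forall>p\<in>U. X p (levi M \<theta> Z W) =
           levi M \<theta> (nab_field nab X Z) W p + levi M \<theta> Z (nab_field nab (vconj X) W) p)) \<and>
     (\<forall>U Z. frame_vector M U Z \<longrightarrow>
        (\<exists>A. smooth_fun M U A \<and>
           (\<forall>V X Y. openin (mtop M) V \<longrightarrow> V \<subseteq> U \<longrightarrow> smooth_vfield M V X \<longrightarrow> smooth_vfield M V Y \<longrightarrow>
              (\<forall>p\<in>V. ext_d M (coframe1 T Z) X Y p =
                 wedge (coframe1 T Z) (conn_form nab T Z) X Y p +
                 A p * wedge \<theta> (fconj (coframe1 T Z)) X Y p))))"

text \<open>The Levi form component, the torsion components with both indices lowered,
  \<open>A\<^sub>1\<^sub>1 = tw_A\<close> (the conjugate of \<open>h\<close> times the coefficient in the structure equation), and the scalar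
  curvature, each relative to an admissible frame. Coefficients of 2-forms are read off by evaluation
  on frame vectors.\<close>

definition h11 :: "'a crdata \<Rightarrow> 'a oneform \<Rightarrow> 'a vfield \<Rightarrow> 'a \<Rightarrow> complex" where
  "h11 M \<theta> Z p = levi M \<theta> Z Z p"

definition tw_A :: "'a crdata \<Rightarrow> 'a oneform \<Rightarrow> 'a vfield \<Rightarrow> 'a connection \<Rightarrow> 'a vfield \<Rightarrow> 'a \<Rightarrow> complex" where
  "tw_A M \<theta> T nab Z p = cnj (h11 M \<theta> Z p *
     (ext_d M (coframe1 T Z) T (vconj Z) p - wedge (coframe1 T Z) (conn_form nab T Z) T (vconj Z) p))"

definition tw_Scal :: "'a crdata \<Rightarrow> 'a oneform \<Rightarrow> 'a vfield \<Rightarrow> 'a connection \<Rightarrow> 'a vfield \<Rightarrow> 'a \<Rightarrow> complex" where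
  "tw_Scal M \<theta> T nab Z p = ext_d M (conn_form nab T Z) Z (vconj Z) p / h11 M \<theta> Z p"

definition tw_frame ::
  "'a crdata \<Rightarrow> 'a oneform \<Rightarrow> 'a vfield \<Rightarrow> 'a connection \<Rightarrow> 'a set \<Rightarrow> 'a vfield \<Rightarrow> bool" where
  "tw_frame M \<theta> T nab U Z \<longleftrightarrow>
     contact_form M \<theta> \<and> reeb_field M \<theta> T \<and> tanaka_webster M \<theta> T nab \<and> frame_vector M U Z"


section \<open>Covariant derivatives and the sublaplacian\<close>

text \<open>A covariant tensor of rank \<open>r\<close> is a function on lists of \<open>r\<close> vector fields. The new argument of
  the covariant derivative comes first, so that \<open>\<nabla>\<^sub>a\<nabla>\<^sub>b f\<close> is the second covariant derivative of \<open>f\<close>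
  evaluated on \<open>[Z\<^sub>a, Z\<^sub>b]\<close>.\<close>

type_synonym 'a tensor = "'a vfield list \<Rightarrow> 'a \<Rightarrow> complex"

fun cov_deriv :: "'a connection \<Rightarrow> 'a tensor \<Rightarrow> 'a tensor" where
  "cov_deriv nab t [] = (\<lambda>p. 0)"
| "cov_deriv nab t (X # Ys) =
     (\<lambda>p. X p (t Ys) - (\<Sum>i<length Ys. t (Ys[i := nab_field nab X (Ys ! i)]) p))"

definition scalar_tensor :: "('a \<Rightarrow> complex) \<Rightarrow> 'a tensor" where
  "scalar_tensor f = (\<lambda>Xs. f)"

text \<open>By invariance the value at \<open>p\<close> does not depend on the frame.\<close>

definition sublaplacian :: "'a crdata \<Rightarrow> 'a oneform \<Rightarrow> ('a \<Rightarrow> complex) \<Rightarrow> 'a \<Rightarrow> complex" where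
  "sublaplacian M \<theta> f p = (THE c. \<forall>T nab U Z. tw_frame M \<theta> T nab U Z \<longrightarrow> p \<in> U \<longrightarrow>
     c = - (((cov_deriv nab ^^ 2) (scalar_tensor f) [Z, vconj Z] p +
             (cov_deriv nab ^^ 2) (scalar_tensor f) [vconj Z, Z] p) / h11 M \<theta> Z p))"


section \<open>Densities\<close>

type_synonym 'a density = "'a oneform \<Rightarrow> 'a \<Rightarrow> complex"

text \<open>The space \<open>\<E>(w, w)\<close>. Values off \<open>M\<close> and on 1-forms that are not contact forms are irrelevant.\<close>

definition densities :: "'a crdata \<Rightarrow> real \<Rightarrow> 'a density set" where
  "densities M w = {F.
     (\<forall>\<theta>. contact_form M \<theta> \<longrightarrow> smooth_fun M (topspace (mtop M)) (F \<theta>)) \<and>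
     (\<forall>\<theta> \<theta>' \<Upsilon>. contact_form M \<theta> \<longrightarrow> contact_form M \<theta>' \<longrightarrow>
        smooth_fun M (topspace (mtop M)) (\<lambda>p. complex_of_real (\<Upsilon> p)) \<longrightarrow>
        (\<forall>p\<in>topspace (mtop M). \<forall>v\<in>ctangent M p. \<theta>' p v = complex_of_real (exp (\<Upsilon> p)) * \<theta> p v) \<longrightarrow>
        (\<forall>p\<in>topspace (mtop M). F \<theta>' p = complex_of_real (exp (w * \<Upsilon> p)) * F \<theta> p))}"


section \<open>CR invariant operators\<close>

text \<open>
  Universal expressions linear in \<open>f\<close>: sums of monomials \<open>c \<cdot> \<Prod>\<^sub>j \<nabla>\<^sup>r B\<^sub>j \<cdot> \<nabla>\<^sup>s f\<close>, where each \<open>B\<^sub>j\<close> is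
  \<open>A\<^sub>1\<^sub>1\<close>, its conjugate, or \<open>Scal\<close>, completely contracted with the inverse of the Levi form. In dimension
  three all indices have a single value of each type, so a complete contraction is just a product of
  components with as many indices \<open>1\<close> as conjugate indices, times the corresponding power of \<open>1/h\<^sub>1\<^sub>1\<close>.
  Indices \<open>0\<close> (the Reeb direction) occur freely. The expressions involve neither a manifold nor its
  point type.
\<close>

datatype idx = Ix0 | Ix1 | Ix1bar
datatype curv = Tor | TorBar | ScalCurv

type_synonym monomial = "complex \<times> (curv \<times> idx list) list \<times> idx list"
type_synonym universal_expr = "monomial list"

fun curv_indices :: "curv \<Rightarrow> idx list" where
  "curv_indices Tor = [Ix1, Ix1]"
| "curv_indices TorBar = [Ix1bar, Ix1bar]"
| "curv_indices ScalCurv = []"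

fun monomial_indices :: "monomial \<Rightarrow> idx list" where
  "monomial_indices (c, Bs, ds) = concat (map (\<lambda>(B, js). js @ curv_indices B) Bs) @ ds"

definition well_formed :: "universal_expr \<Rightarrow> bool" where
  "well_formed E \<longleftrightarrow> (\<forall>m \<in> set E.
     count_list (monomial_indices m) Ix1 = count_list (monomial_indices m) Ix1bar)"

fun frame_field :: "'a vfield \<Rightarrow> 'a vfield \<Rightarrow> idx \<Rightarrow> 'a vfield" where
  "frame_field T Z Ix0 = T"
| "frame_field T Z Ix1 = Z"
| "frame_field T Z Ix1bar = vconj Z"

fun curv_tensor ::
  "'a crdata \<Rightarrow> 'a oneform \<Rightarrow> 'a vfield \<Rightarrow> 'a connection \<Rightarrow> 'a vfield \<Rightarrow> curv \<Rightarrow> 'a tensor" where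
  "curv_tensor M \<theta> T nab Z Tor = (\<lambda>Xs p. tw_A M \<theta> T nab Z p *
     coframe1 T Z p ((Xs ! 0) p) * coframe1 T Z p ((Xs ! 1) p))"
| "curv_tensor M \<theta> T nab Z TorBar = (\<lambda>Xs p. cnj (tw_A M \<theta> T nab Z p) *
     fconj (coframe1 T Z) p ((Xs ! 0) p) * fconj (coframe1 T Z) p ((Xs ! 1) p))"
| "curv_tensor M \<theta> T nab Z ScalCurv = scalar_tensor (tw_Scal M \<theta> T nab Z)"

fun monomial_value ::
  "'a crdata \<Rightarrow> 'a oneform \<Rightarrow> 'a vfield \<Rightarrow> 'a connection \<Rightarrow> 'a vfield \<Rightarrow> ('a \<Rightarrow> complex) \<Rightarrow> 'a
     \<Rightarrow> monomial \<Rightarrow> complex" where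
  "monomial_value M \<theta> T nab Z f p (c, Bs, ds) =
     c * (\<Prod>(B, js) \<leftarrow> Bs. (cov_deriv nab ^^ length js) (curv_tensor M \<theta> T nab Z B)
                           (map (frame_field T Z) (js @ curv_indices B)) p)
       * (cov_deriv nab ^^ length ds) (scalar_tensor f) (map (frame_field T Z) ds) p
       / h11 M \<theta> Z p ^ count_list (monomial_indices (c, Bs, ds)) Ix1"

definition expr_value ::
  "'a crdata \<Rightarrow> 'a oneform \<Rightarrow> 'a vfield \<Rightarrow> 'a connection \<Rightarrow> 'a vfield \<Rightarrow> universal_expr
     \<Rightarrow> ('a \<Rightarrow> complex) \<Rightarrow> 'a \<Rightarrow> complex" where
  "expr_value M \<theta> T nab Z E f p = (\<Sum>m \<leftarrow> E. monomial_value M \<theta> T nab Z f p m)"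

text \<open>
  A CR invariant linear differential operator \<open>\<E>(w, w) \<rightarrow> \<E>(w', w')\<close>, as an operator \<open>P M\<close> for every
  strictly pseudoconvex \<open>M\<close>, given by one expression for all \<open>M\<close> and all contact forms. Independence of
  the contact form is the condition \<open>P M F \<in> densities M w'\<close>: the expression, evaluated for \<open>\<theta>\<close> on
  the representative \<open>F \<theta>\<close>, transforms with weight \<open>w'\<close>. Linearity in \<open>F\<close> is automatic.
\<close>

definition cr_invariant_operator ::
  "real \<Rightarrow> real \<Rightarrow> ('a crdata \<Rightarrow> 'a density \<Rightarrow> 'a density) \<Rightarrow> bool" where
  "cr_invariant_operator w w' P \<longleftrightarrow> (\<exists>E. well_formed E \<and>
     (\<forall>M. cr_manifold M \<longrightarrow> strictly_pseudoconvex M \<longrightarrow>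
        (\<forall>F \<in> densities M w. P M F \<in> densities M w' \<and>
           (\<forall>\<theta> T nab U Z. tw_frame M \<theta> T nab U Z \<longrightarrow>
              (\<forall>p\<in>U. P M F \<theta> p = expr_value M \<theta> T nab Z E (F \<theta>) p)))))"


section \<open>Order and principal part\<close>

text \<open>Iterated partial derivatives on \<open>\<real>\<^sup>3\<close>; a list of indices plays the role of a multi-index.\<close>

fun partials :: "3 list \<Rightarrow> (real^3 \<Rightarrow> complex) \<Rightarrow> real^3 \<Rightarrow> complex" where
  "partials [] g = g"
| "partials (i # is) g = (\<lambda>x. frechet_derivative (partials is g) (at x) (axis i 1))"

definition diff_op_order_less ::
  "'a crdata \<Rightarrow> nat \<Rightarrow> (('a \<Rightarrow> complex) \<Rightarrow> 'a \<Rightarrow> complex) \<Rightarrow> bool" where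
  "diff_op_order_less M m D \<longleftrightarrow> (\<forall>(U, \<phi>) \<in> atlas M. \<exists>a :: 3 list \<Rightarrow> 'a \<Rightarrow> complex.
     (\<forall>is. smooth_fun M U (a is)) \<and>
     (\<forall>f. smooth_fun M (topspace (mtop M)) f \<longrightarrow>
        (\<forall>p\<in>U. D f p = (\<Sum>is | length is < m. a is p * partials is (f \<circ> inv_into U \<phi>) (\<phi> p)))))"

definition principal_part_sublaplacian_power ::
  "'a crdata \<Rightarrow> real \<Rightarrow> nat \<Rightarrow> ('a density \<Rightarrow> 'a density) \<Rightarrow> bool" where
  "principal_part_sublaplacian_power M w k P \<longleftrightarrow>
     (\<forall>\<theta>. contact_form M \<theta> \<longrightarrow> (\<exists>D. diff_op_order_less M (2 * k) D \<and>
        (\<forall>F \<in> densities M w. \<forall>p\<in>topspace (mtop M).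
           P F \<theta> p - (sublaplacian M \<theta> ^^ k) (F \<theta>) p = D (F \<theta>) p)))"

text \<open>The coefficients \<open>Q\<^sub>j\<close> need not be assumed to be operators of the same kind: by interpolation
  they are linear combinations of finitely many \<open>P \<mu>\<close>.\<close>

definition polynomial_family ::
  "'a crdata \<Rightarrow> real \<Rightarrow> real \<Rightarrow> (real \<Rightarrow> 'a density \<Rightarrow> 'a density) \<Rightarrow> bool" where
  "polynomial_family M w d P \<longleftrightarrow>
     (\<exists>Q :: nat \<Rightarrow> 'a density \<Rightarrow> 'a density. \<forall>\<mu>. \<forall>F \<in> densities M w. \<forall>\<theta>. contact_form M \<theta> \<longrightarrow>
        (\<forall>p\<in>topspace (mtop M).
           P \<mu> F \<theta> p = (\<Sum>j | real j \<le> d. complex_of_real (\<mu> ^ j) * Q j F \<theta> p)))"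

end

theory Submission
  imports Defs "HOL-Library.Function_Algebras" "HOL-Library.Multiset" "HOL-Computational_Algebra.Polynomial"
begin

text \<open>The operator is taken constant in \<open>\<lambda>\<close>. Fix a scale and let the derivatives \<open>\<nabla>\<^sub>1\<close>, \<open>\<nabla>\<^sup>1\<close>, corrected by torsion and scalar
  curvature, act in place of the two lowering operators of the free Verma module of highest weight \<open>(l, l)\<close>,
  \<open>l = k/2 - 1\<close>. Each vector of the module thereby becomes a differential operator on \<open>\<E>(l, l)\<close>. Along a path of
  scales the operator of \<open>v\<close> changes at the rate given by the operators of \<open>f\<^sub>1 v\<close>, \<open>f\<^sub>2 v\<close> and \<open>[f\<^sub>1, f\<^sub>2] v\<close> for the raising
  operators \<open>f\<^sub>1, f\<^sub>2\<close>, because the curvature corrections satisfy the Serre-type relations between third derivatives of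
  functions. A singular vector of degree \<open>(k, k)\<close> therefore yields a CR invariant operator. Such a vector can be
  written down explicitly, and the sum of its coefficients does not vanish. Since \<open>\<nabla>\<^sub>1\<close> and \<open>\<nabla>\<^sup>1\<close> commute to top order,
  the operator is, after normalisation, \<open>\<Delta>\<^sub>b\<^sup>k\<close> up to terms of lower order.\<close>

section \<open>The free Verma module\<close>

text \<open>No relation is imposed between e_1 and e_2, since on a curved manifold the corrected
  derivatives cannot be expected to obey the Serre relations of sl_3. The raising operators act all
  the same: [f_c, e_b] = delta_bc h_c and the weights determine them. The price is that a singular
  vector has to be killed in the free module, not merely modulo the Serre relations, and so is
  written down explicitly. The weight l = k/2 - 1 comes from 2(l + 1) = k: the \<rho>-shifted weight
  takes the value k on the highest root, which is where the Verma module of sl_3 has a singular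
  vector of degree (k, k). Along the path e^(s\<Upsilon>)\<theta> the frame is rescaled as well, so
  that all data are polynomials in s with functions as coefficients, and a formal derivative in s
  suffices. The Serre relation for \<Upsilon> enters only in showing that the path ends at the
  curvature correction of the new scale. The laws for torsion and scalar curvature are derived by
  expanding the bracket relations of the new frame in the old one and comparing
  coefficients.\<close>

text \<open>The letters \<open>True\<close> and \<open>False\<close> stand for lowering operators \<open>e\<^sub>1\<close> and \<open>e\<^sub>2\<close> acting freely on a vector of highest
  weight \<open>(l, l)\<close>, and \<open>\<phi>\<close> is a linear functional on words. Then \<open>rem c l \<phi>\<close> is \<open>\<phi>\<close> composed with the raising
  operator \<open>f\<^sub>c\<close>, which removes one letter \<open>c\<close> with the weight \<open>wt c l\<close> of the rest as coefficient, and \<open>rem0 l \<phi>\<close> is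
  \<open>\<phi>\<close> composed with \<open>[f\<^sub>1, f\<^sub>2]\<close>.\<close>

definition wt :: "bool \<Rightarrow> 'r::comm_ring_1 \<Rightarrow> bool list \<Rightarrow> 'r" where
  "wt c l w = l - 2 * of_nat (count_list w c) + of_nat (count_list w (\<not> c))"

text \<open>When Z_1 is replaced by g Z_1, a derivative along Z_1 scales by g and one along Z^1 by
  1/g. The charge is therefore the multiple of the connection form that enters the covariant
  derivative of the component belonging to \<open>w\<close>.\<close>

definition chg :: "bool list \<Rightarrow> 'r::comm_ring_1" where
  "chg w = of_nat (count_list w True) - of_nat (count_list w False)"

definition sgb :: "bool \<Rightarrow> 'r::comm_ring_1" where
  "sgb b = (if b then 1 else - 1)"

fun rem :: "bool \<Rightarrow> 'r::comm_ring_1 \<Rightarrow> (bool list \<Rightarrow> 'r) \<Rightarrow> bool list \<Rightarrow> 'r" where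
  "rem c l \<phi> [] = 0"
| "rem c l \<phi> (b # w) = (if b = c then wt c l w * \<phi> w else 0) + rem c l (\<lambda>v. \<phi> (b # v)) w"

fun rem0 :: "'r::comm_ring_1 \<Rightarrow> (bool list \<Rightarrow> 'r) \<Rightarrow> bool list \<Rightarrow> 'r" where
  "rem0 l \<phi> [] = 0"
| "rem0 l \<phi> (b # w) = rem0 l (\<lambda>v. \<phi> (b # v)) w - sgb b * rem (\<not> b) l \<phi> w"

lemma wt_Cons: "wt c l (b # w) = wt c l w + (if b = c then - 2 else 1)"
  by (auto simp: wt_def)

lemma sgb_simps [simp]: "sgb True = 1" "sgb False = - 1" "sgb (\<not> b) = - sgb b" "sgb b * sgb b = 1"
  "sgb b * (sgb b * r) = r"
  by (auto simp: sgb_def)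

lemma rem_add: "rem c l (\<lambda>v. \<phi> v + \<psi> v) w = rem c l \<phi> w + rem c l \<psi> w"
  by (induction w arbitrary: \<phi> \<psi>) (auto simp: algebra_simps)

lemma rem_smult: "rem c l (\<lambda>v. r * \<phi> v) w = r * rem c l \<phi> w"
  by (induction w arbitrary: \<phi>) (auto simp: algebra_simps)

lemma rem_diff: "rem c l (\<lambda>v. \<phi> v - \<psi> v) w = rem c l \<phi> w - rem c l \<psi> w"
  by (induction w arbitrary: \<phi> \<psi>) (auto simp: algebra_simps)

lemma rem0_add: "rem0 l (\<lambda>v. \<phi> v + \<psi> v) w = rem0 l \<phi> w + rem0 l \<psi> w"
  by (induction w arbitrary: \<phi> \<psi>) (auto simp: algebra_simps rem_add)

lemma rem0_diff: "rem0 l (\<lambda>v. \<phi> v - \<psi> v) w = rem0 l \<phi> w - rem0 l \<psi> w"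
  by (induction w arbitrary: \<phi> \<psi>) (auto simp: algebra_simps rem_diff)

lemma rem0_smult: "rem0 l (\<lambda>v. r * \<phi> v) w = r * rem0 l \<phi> w"
  by (induction w arbitrary: \<phi>) (auto simp: algebra_simps rem_smult)

lemma rem_count:
  "rem c l (\<lambda>v. of_nat (count_list v d) * \<phi> v) w
     = (of_nat (count_list w d) - (if c = d then 1 else 0)) * rem c l \<phi> w"
proof (induction w arbitrary: \<phi>)
  case (Cons b w)
  have "(\<lambda>v. of_nat (count_list (b # v) d) * \<phi> (b # v))
      = (\<lambda>v. of_nat (count_list v d) * \<phi> (b # v) + (if b = d then 1 else 0) * \<phi> (b # v))"
    by (auto simp: algebra_simps)
  then show ?case
    by (simp only: rem.simps rem_add rem_smult Cons.IH) (auto simp: algebra_simps)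
qed simp

text \<open>The shifts 2 and -1 are entries of the Cartan matrix of sl_3: taking away one letter
  \<open>c\<close> moves the weight for \<open>d\<close> by this amount.\<close>

lemma rem_wt: "rem c l (\<lambda>v. wt d l v * \<phi> v) w = (wt d l w + (if c = d then 2 else - 1)) * rem c l \<phi> w"
proof -
  have "(\<lambda>v. wt d l v * \<phi> v) = (\<lambda>v. l * \<phi> v - 2 * (of_nat (count_list v d) * \<phi> v)
      + of_nat (count_list v (\<not> d)) * \<phi> v)"
    by (auto simp: wt_def algebra_simps)
  then show ?thesis
    by (simp only: rem_add rem_diff rem_smult rem_count)
      (cases c; cases d; simp add: wt_def algebra_simps)
qed

lemma rem_chg: "rem c l (\<lambda>v. chg v * \<phi> v) w = (chg w - sgb c) * rem c l \<phi> w"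
proof -
  have "(\<lambda>v. chg v * \<phi> v) = (\<lambda>v. of_nat (count_list v True) * \<phi> v
      - of_nat (count_list v False) * \<phi> v)"
    by (auto simp: chg_def algebra_simps)
  then show ?thesis
    by (simp only: rem_diff rem_count) (cases c; simp add: chg_def algebra_simps)
qed

lemma rem_wt_shift: "rem c l (\<lambda>v. (wt d l v + r) * \<phi> v) w
    = (wt d l w + r + (if c = d then 2 else - 1)) * rem c l \<phi> w"
proof -
  have "(\<lambda>v. (wt d l v + r) * \<phi> v) = (\<lambda>v. wt d l v * \<phi> v + r * \<phi> v)"
    by (simp add: distrib_right)
  then show ?thesis by (simp only: rem_add rem_smult rem_wt) (simp add: algebra_simps)
qed

lemma rem_chg_shift: "rem c l (\<lambda>v. (chg v - r) * \<phi> v) w = (chg w - r - sgb c) * rem c l \<phi> w"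
proof -
  have "(\<lambda>v. (chg v - r) * \<phi> v) = (\<lambda>v. chg v * \<phi> v - r * \<phi> v)"
    by (simp add: left_diff_distrib)
  then show ?thesis by (simp only: rem_diff rem_smult rem_chg) (simp add: algebra_simps)
qed

lemmas rem_wt_fun = ext[of "rem c l (\<lambda>v. wt d l v * \<phi> v)" "\<lambda>w. _ w * _ w" for c l d \<phi>, OF rem_wt]
lemmas rem_chg_fun = ext[of "rem c l (\<lambda>v. chg v * \<phi> v)" "\<lambda>w. _ w * _ w" for c l \<phi>, OF rem_chg]

lemma rem_cong: "(\<And>v. Suc (length v) = length w \<Longrightarrow> \<phi> v = \<psi> v) \<Longrightarrow> rem c l \<phi> w = rem c l \<psi> w"
proof (induction w arbitrary: \<phi> \<psi>)
  case (Cons b w)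
  have "rem c l (\<lambda>v. \<phi> (b # v)) w = rem c l (\<lambda>v. \<psi> (b # v)) w"
    by (rule Cons.IH) (auto intro: Cons.prems)
  then show ?case using Cons.prems[of w] by simp
qed simp

lemma rem0_cong: "(\<And>v. Suc (Suc (length v)) = length w \<Longrightarrow> \<phi> v = \<psi> v) \<Longrightarrow> rem0 l \<phi> w = rem0 l \<psi> w"
proof (induction w arbitrary: \<phi> \<psi>)
  case (Cons b w)
  have "rem0 l (\<lambda>v. \<phi> (b # v)) w = rem0 l (\<lambda>v. \<psi> (b # v)) w"
    by (rule Cons.IH) (auto intro: Cons.prems)
  moreover have "rem (\<not> b) l \<phi> w = rem (\<not> b) l \<psi> w"
    by (rule rem_cong) (auto intro: Cons.prems)
  ultimately show ?case by simp
qed simp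

text \<open>Justifies the recursion of \<open>rem0\<close>: pairs of removals commute except that
  removing one letter changes the weight charged for the other kind by 1. Functionals compose in
  reverse, so the left-hand side is \<phi> composed with f_1 f_2 - f_2 f_1.\<close>

lemma rem_commute:
  "rem False l (rem True l \<phi>) w - rem True l (rem False l \<phi>) w = rem0 l \<phi> w"
proof (induction w arbitrary: \<phi>)
  case (Cons b w)
  show ?case
    using Cons.IH[of "\<lambda>v. \<phi> (b # v)"]
    by (cases b) (simp_all add: rem_add rem_wt, (simp_all add: algebra_simps)?)
qed simp

lemma rem_commute': "rem (\<not> b) l (rem b l \<phi>) w - rem b l (rem (\<not> b) l \<phi>) w = sgb b * rem0 l \<phi> w"
  using rem_commute[of l \<phi> w] by (cases b) (simp_all add: algebra_simps)

lemma rem0_wt: "rem0 l (\<lambda>v. wt d l v * \<phi> v) w = (wt d l w + 1) * rem0 l \<phi> w"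
  by (cases d; simp only: rem_commute[symmetric] rem_wt_fun rem_wt_shift; simp add: algebra_simps)

lemma rem0_chg: "rem0 l (\<lambda>v. chg v * \<phi> v) w = chg w * rem0 l \<phi> w"
  by (simp only: rem_commute[symmetric] rem_chg_fun rem_chg_shift; simp add: algebra_simps)

text \<open>These are the Serre relations of the raising operators. They hold although the lowering
  operators are free: the relation commutes with every e_b and holds on the highest weight vector.
  The induction over the word is this argument.\<close>

lemma rem0_rem: "rem0 l (rem c l \<phi>) w = rem c l (rem0 l \<phi>) w"
proof (induction w arbitrary: \<phi>)
  case (Cons b w)
  show ?case
  proof (cases "b = c")
    case True
    have "rem0 l (rem c l \<phi>) (b # w) = rem0 l (\<lambda>v. wt c l v * \<phi> v) w
        + rem0 l (rem c l (\<lambda>v. \<phi> (c # v))) w - sgb c * rem (\<not> c) l (rem c l \<phi>) w"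
      using True by (simp add: rem0_add)
    also have "\<dots> = (wt c l w + 1) * rem0 l \<phi> w + rem c l (rem0 l (\<lambda>v. \<phi> (c # v))) w
        - sgb c * rem (\<not> c) l (rem c l \<phi>) w"
      by (simp add: rem0_wt Cons.IH)
    finally show ?thesis
      using True rem_commute'[of c l \<phi> w] by (simp add: rem_diff rem_smult algebra_simps)
  next
    case False
    then have c: "c = (\<not> b)" by auto
    show ?thesis
      unfolding c by (simp add: Cons.IH[unfolded c] rem_diff rem_smult)
  qed
qed simp

text \<open>The value of a word in the two lowering operators of the free Verma module, computed along a
  choice of scale: \<open>al\<close>, \<open>sg\<close>, \<open>t\<close> are the components of the Rho tensor, paired with the raising
  operators.\<close>

function phi :: "'r::comm_ring_1 \<Rightarrow> (bool \<Rightarrow> bool list \<Rightarrow> 'r \<Rightarrow> 'r) \<Rightarrow> (bool \<Rightarrow> 'r) \<Rightarrow> 'r \<Rightarrow> (bool \<Rightarrow> 'r) \<Rightarrow> 'r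
    \<Rightarrow> bool list \<Rightarrow> 'r" where
  "phi l D al sg t f [] = f"
| "phi l D al sg t f (b # w) = D b w (phi l D al sg t f w)
     + al b * rem b l (\<lambda>v. if length v < Suc (length w) then phi l D al sg t f v else 0) w
     + sg * rem (\<not> b) l (\<lambda>v. if length v < Suc (length w) then phi l D al sg t f v else 0) w
     + t b * rem0 l (\<lambda>v. if length v < Suc (length w) then phi l D al sg t f v else 0) w"
  by pat_completeness auto
termination by (relation "Wellfounded.measure (\<lambda>(l, D, al, sg, t, f, w). length w)") auto

text \<open>The length guard in \<open>phi\<close> serves the termination proof. It is always
  satisfied, because removal shortens words.\<close>

lemma phi_Cons: "phi l D al sg t f (b # w) = D b w (phi l D al sg t f w)
     + al b * rem b l (phi l D al sg t f) w + sg * rem (\<not> b) l (phi l D al sg t f) w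
     + t b * rem0 l (phi l D al sg t f) w"
proof -
  have "rem c l (\<lambda>v. if length v < Suc (length w) then phi l D al sg t f v else 0) w
      = rem c l (phi l D al sg t f) w" for c
    by (rule rem_cong) simp
  moreover have "rem0 l (\<lambda>v. if length v < Suc (length w) then phi l D al sg t f v else 0) w
      = rem0 l (phi l D al sg t f) w"
    by (rule rem0_cong) simp
  ultimately show ?thesis by (simp only: phi.simps)
qed

declare phi.simps(2) [simp del]

section \<open>Derivations of subrings and the flow in the scale parameter\<close>

locale subring =
  fixes S :: "'r::comm_ring_1 set"
  assumes S_add: "f \<in> S \<Longrightarrow> g \<in> S \<Longrightarrow> f + g \<in> S"
    and S_mult: "f \<in> S \<Longrightarrow> g \<in> S \<Longrightarrow> f * g \<in> S"
    and S_uminus: "f \<in> S \<Longrightarrow> - f \<in> S"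
    and S_0: "0 \<in> S" and S_1: "1 \<in> S"
begin

lemma S_diff: "f \<in> S \<Longrightarrow> g \<in> S \<Longrightarrow> f - g \<in> S"
  using S_add[of f "- g"] S_uminus[of g] by simp

lemma S_nat: "of_nat n \<in> S" by (induction n) (auto intro: S_0 S_1 S_add)

lemma S_numeral: "numeral n \<in> S" using S_nat[of "numeral n"] by simp

lemma S_power: "f \<in> S \<Longrightarrow> f ^ n \<in> S" by (induction n) (auto intro: S_1 S_mult)

lemma S_sum: "(\<And>i. i \<in> I \<Longrightarrow> f i \<in> S) \<Longrightarrow> sum f I \<in> S"
  by (induction I rule: infinite_finite_induct) (auto intro: S_0 S_add)

lemma S_sgb: "sgb b \<in> S" by (simp add: sgb_def S_1 S_uminus)

lemma S_chg: "chg w \<in> S" by (simp add: chg_def S_diff S_nat)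

lemma S_wt: "l \<in> S \<Longrightarrow> wt c l w \<in> S" 
  by (simp add: wt_def S_diff S_nat S_add S_mult S_numeral)

lemma S_rem: "l \<in> S \<Longrightarrow> (\<And>v. \<phi> v \<in> S) \<Longrightarrow> rem c l \<phi> w \<in> S"
  by (induction w arbitrary: \<phi>) (simp_all add: S_0 S_add S_mult S_wt)

lemma S_rem0: "l \<in> S \<Longrightarrow> (\<And>v. \<phi> v \<in> S) \<Longrightarrow> rem0 l \<phi> w \<in> S"
  by (induction w arbitrary: \<phi>) (simp_all add: S_0 S_diff S_mult S_sgb S_rem)

lemmas S_closed = S_add S_mult S_uminus S_0 S_1 S_diff S_nat S_numeral S_power S_sgb S_chg S_wt S_rem S_rem0

lemma S_phi:
  assumes "\<And>b w m. m \<in> S \<Longrightarrow> D b w m \<in> S" "\<And>b. al b \<in> S" "sg \<in> S" "\<And>b. t b \<in> S" "l \<in> S" "f \<in> S"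
  shows "phi l D al sg t f w \<in> S"
proof (induction w rule: length_induct)
  case (1 w)
  show ?case
  proof (cases w)
    case (Cons b v)
    have *: "phi l D al sg t f v \<in> S" using 1 Cons by simp
    have **: "(if length u < Suc (length v) then phi l D al sg t f u else 0) \<in> S" for u
      using 1 Cons S_0 by simp
    show ?thesis
      unfolding Cons phi.simps by (intro S_add S_mult assms * S_rem S_rem0 **)
  qed (use assms in simp)
qed

end

text \<open>The rules are demanded on \<open>S\<close> only: the derivations will be vector fields
  applied to total functions, which satisfy them just for functions that are smooth on the open set
  in question.\<close>

locale deriv_on = subring S for S :: "'r::comm_ring_1 set" +
  fixes X :: "'r \<Rightarrow> 'r"
  assumes X_closed: "f \<in> S \<Longrightarrow> X f \<in> S"
    and X_add: "f \<in> S \<Longrightarrow> g \<in> S \<Longrightarrow> X (f + g) = X f + X g"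
    and X_mult: "f \<in> S \<Longrightarrow> g \<in> S \<Longrightarrow> X (f * g) = X f * g + f * X g"
begin

lemma X_0 [simp]: "X 0 = 0" using X_add[of 0 0] S_0 by simp
lemma X_1 [simp]: "X 1 = 0" using X_mult[of 1 1] S_1 by simp
lemma X_uminus: "f \<in> S \<Longrightarrow> X (- f) = - X f"
  using X_add[of f "- f"] S_uminus by (simp add: eq_neg_iff_add_eq_0 add.commute)
lemma X_diff: "f \<in> S \<Longrightarrow> g \<in> S \<Longrightarrow> X (f - g) = X f - X g"
  using X_add[of f "- g"] S_uminus by (simp add: X_uminus)
lemma X_nat [simp]: "X (of_nat n) = 0" by (induction n) (simp_all add: X_add S_1 S_nat)
lemma X_numeral [simp]: "X (numeral n) = 0" using X_nat[of "numeral n"] by simp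
lemma X_sum: "(\<And>i. i \<in> I \<Longrightarrow> f i \<in> S) \<Longrightarrow> X (sum f I) = (\<Sum>i\<in>I. X (f i))"
  by (induction I rule: infinite_finite_induct) (auto simp: X_add S_sum)
lemma X_sgb [simp]: "X (sgb b) = 0" by (simp add: sgb_def X_uminus S_1)
lemma X_chg [simp]: "X (chg w) = 0" by (simp add: chg_def X_diff S_nat)
lemma X_wt: "l \<in> S \<Longrightarrow> X l = 0 \<Longrightarrow> X (wt c l w) = 0"
  by (simp add: wt_def X_diff X_add X_mult S_closed)
lemma X_const: "X c = 0 \<Longrightarrow> c \<in> S \<Longrightarrow> f \<in> S \<Longrightarrow> X (c * f) = c * X f" by (simp add: X_mult)

lemma X_rem: "l \<in> S \<Longrightarrow> X l = 0 \<Longrightarrow> (\<And>v. \<phi> v \<in> S) \<Longrightarrow> rem c l (\<lambda>v. X (\<phi> v)) w = X (rem c l \<phi> w)"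
  by (induction w arbitrary: \<phi>) (auto simp: X_add X_mult X_wt S_closed X_closed)

lemma X_rem0: "l \<in> S \<Longrightarrow> X l = 0 \<Longrightarrow> (\<And>v. \<phi> v \<in> S) \<Longrightarrow> rem0 l (\<lambda>v. X (\<phi> v)) w = X (rem0 l \<phi> w)"
  by (induction w arbitrary: \<phi>) (auto simp: X_diff X_mult X_rem S_closed X_closed)

end

text \<open>Algebraic model of the path e^(s\<Upsilon>)\<theta>: \<open>P\<close> is d/ds,
  \<open>x\<close> the gradient of \<Upsilon>, and \<open>z\<close> the antisymmetric part of its
  second derivatives. The frame is rescaled along with s, so that \<open>X\<close> and
  \<open>u\<close> stay fixed and s enters derivatives through the weight term of \<open>DD\<close>
  alone. \<open>P_al\<close> and \<open>P_sg\<close> are the classical laws for torsion and scalar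
  curvature differentiated in s; \<open>P_t\<close> is the law that lets the recursion for
  \<open>phi\<close> close up.\<close>

locale flow = subring S for S :: "'r::comm_ring_1 set" +
  fixes X :: "bool \<Rightarrow> 'r \<Rightarrow> 'r" and P :: "'r \<Rightarrow> 'r"
    and l f s z sg :: 'r and u x al t :: "bool \<Rightarrow> 'r"
  assumes X: "deriv_on S (X b)" and P: "deriv_on S P"
    and PX: "g \<in> S \<Longrightarrow> P (X b g) = X b (P g)"
    and S: "l \<in> S" "f \<in> S" "s \<in> S" "z \<in> S" "sg \<in> S" "u b \<in> S" "x b \<in> S" "al b \<in> S" "t b \<in> S"
    and X_l: "X b l = 0" "X b s = 0"
    and P_l: "P l = 0" "P f = 0" "P s = 1" "P (u b) = 0" "P (x b) = 0" "P z = 0"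
    and P_al: "P (al b) = - (X b (x b) - sgb b * u b * x b) + 2 * s * x b * x b"
    and P_sg: "P sg = - (X b (x (\<not> b)) + sgb b * u b * x (\<not> b) + sgb b * z) - s * x b * x (\<not> b)"
    and P_t: "P (t b) = - X b z + s * x b * z + sgb b * (al b * x (\<not> b) - sg * x b)"
begin

definition "DD b w m = X b m - chg w * u b * m + wt b l w * s * x b * m"

abbreviation "ph \<equiv> phi l DD al sg t f"

lemma DD_closed: "m \<in> S \<Longrightarrow> DD b w m \<in> S"
  using deriv_on.X_closed[OF X] S by (simp add: DD_def S_closed)

lemma ph_closed: "ph w \<in> S"
  by (rule S_phi) (auto intro: DD_closed S)

definition "HH \<psi> w = x True * rem True l \<psi> w + x False * rem False l \<psi> w + z * rem0 l \<psi> w"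

lemma HH_Cons: "HH \<psi> (b # w) = HH (\<lambda>v. \<psi> (b # v)) w + x b * wt b l w * \<psi> w - sgb b * z * rem (\<not> b) l \<psi> w"
  by (cases b) (simp_all add: HH_def algebra_simps)

lemma HH_alt: "HH \<psi> w = x b * rem b l \<psi> w + x (\<not> b) * rem (\<not> b) l \<psi> w + z * rem0 l \<psi> w"
  by (cases b) (simp_all add: HH_def algebra_simps)

lemma HH_add: "HH (\<lambda>v. \<phi> v + \<psi> v) w = HH \<phi> w + HH \<psi> w"
  and HH_smult: "HH (\<lambda>v. r * \<phi> v) w = r * HH \<phi> w"
  by (simp_all add: HH_def rem_add rem_smult rem0_add rem0_smult algebra_simps)

text \<open>Of the three terms of \<open>HH\<close> only the one for the opposite letter fails to
  commute with \<open>rem b\<close>, and it contributes the bracket.\<close>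

lemma HH_rem: "HH (rem b l \<psi>) w = rem b l (HH \<psi>) w + sgb b * x (\<not> b) * rem0 l \<psi> w"
  using rem_commute'[of b l \<psi> w]
  by (simp add: HH_alt[of _ _ b] HH_alt[of _ _ b, abs_def] rem_add rem_smult rem0_rem algebra_simps)

lemma HH_rem0: "HH (rem0 l \<psi>) w = rem0 l (HH \<psi>) w"
  by (simp add: HH_def HH_def[abs_def] rem0_add rem0_smult rem0_rem)

lemma rem_DD:
  assumes "\<And>v. \<psi> v \<in> S"
  shows "rem c l (\<lambda>v. DD b v (\<psi> v)) w = DD b w (rem c l \<psi> w) + sgb c * u b * rem c l \<psi> w
     + (if c = b then 2 else - 1) * s * x b * rem c l \<psi> w"
    and "rem0 l (\<lambda>v. DD b v (\<psi> v)) w = DD b w (rem0 l \<psi> w) + s * x b * rem0 l \<psi> w"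
proof -
  interpret X: deriv_on S "X b" by (rule X)
  have *: "(\<lambda>v. DD b v (\<psi> v)) = (\<lambda>v. X b (\<psi> v) - u b * (chg v * \<psi> v) + s * x b * (wt b l v * \<psi> v))"
    by (auto simp: DD_def algebra_simps)
  show "rem c l (\<lambda>v. DD b v (\<psi> v)) w = DD b w (rem c l \<psi> w) + sgb c * u b * rem c l \<psi> w
     + (if c = b then 2 else - 1) * s * x b * rem c l \<psi> w"
    unfolding * by (simp only: rem_add rem_diff rem_smult rem_wt rem_chg X.X_rem[OF S(1) X_l(1) assms])
      (auto simp: DD_def algebra_simps)
  show "rem0 l (\<lambda>v. DD b v (\<psi> v)) w = DD b w (rem0 l \<psi> w) + s * x b * rem0 l \<psi> w"
    unfolding * by (simp only: rem0_add rem0_diff rem0_smult rem0_wt rem0_chg X.X_rem0[OF S(1) X_l(1) assms])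
      (auto simp: DD_def algebra_simps)
qed

lemma DD_mult:
  assumes "r \<in> S" "m \<in> S"
  shows "DD b w (r * m) = r * DD b w m + X b r * m"
proof -
  interpret X: deriv_on S "X b" by (rule X)
  show ?thesis using assms by (simp add: DD_def X.X_mult algebra_simps)
qed

lemma DD_add:
  assumes "r \<in> S" "m \<in> S"
  shows "DD b w (r + m) = DD b w r + DD b w m"
proof -
  interpret X: deriv_on S "X b" by (rule X)
  show ?thesis using assms by (simp add: DD_def X.X_add algebra_simps)
qed

lemma P_rem:
  assumes "\<And>v. \<psi> v \<in> S"
  shows "P (rem c l \<psi> w) = rem c l (\<lambda>v. P (\<psi> v)) w" "P (rem0 l \<psi> w) = rem0 l (\<lambda>v. P (\<psi> v)) w"
  using deriv_on.X_rem[OF P S(1) P_l(1) assms] deriv_on.X_rem0[OF P S(1) P_l(1) assms] by simp_all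

lemma P_DD:
  assumes m: "m \<in> S"
  shows "P (DD b w m) = DD b w (P m) + wt b l w * x b * m"
proof -
  interpret P: deriv_on S P by (rule P)
  interpret X: deriv_on S "X b" by (rule X)
  show ?thesis using m S
    by (simp add: DD_def P.X_add P.X_diff P.X_mult S_closed X.X_closed P_l PX P.X_wt algebra_simps)
qed

text \<open>The infinitesimal change of scale acts by raising operators.\<close>

theorem P_ph: "P (ph w) = HH ph w"
proof (induction w rule: length_induct)
  case (1 w)
  show ?case
  proof (cases w)
    case Nil
    then show ?thesis by (simp add: HH_def P_l)
  next
    case (Cons b v)
    interpret P: deriv_on S P by (rule P)
    have IH: "P (ph y) = HH ph y" if "length y \<le> length v" for y using 1 Cons that by simp
    let ?c = "\<not> b"
    let ?r1 = "rem b l ph v" and ?r2 = "rem ?c l ph v" and ?r0 = "rem0 l ph v"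
    have cl: "ph y \<in> S" "rem d l ph y \<in> S" "rem0 l ph y \<in> S" for d y
      using S ph_closed by (auto intro: S_rem S_rem0)
    have e1: "rem d l (\<lambda>y. P (ph y)) v = rem d l (HH ph) v" for d
      by (rule rem_cong) (simp add: IH)
    have e0: "rem0 l (\<lambda>y. P (ph y)) v = rem0 l (HH ph) v"
      by (rule rem0_cong) (simp add: IH)
    have L: "P (ph w) = DD b v (HH ph v) + wt b l v * x b * ph v
        + P (al b) * ?r1 + al b * rem b l (HH ph) v
        + P sg * ?r2 + sg * rem ?c l (HH ph) v + P (t b) * ?r0 + t b * rem0 l (HH ph) v"
      unfolding Cons phi_Cons
      using cl S by (simp add: P.X_add P.X_mult S_closed DD_closed P_DD P_rem e1 e0 IH algebra_simps)
    have R: "HH ph w = HH (\<lambda>y. DD b y (ph y)) v + al b * HH (rem b l ph) v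
        + sg * HH (rem ?c l ph) v + t b * HH (rem0 l ph) v + x b * wt b l v * ph v - sgb b * z * ?r2"
      unfolding Cons HH_Cons phi_Cons by (simp add: HH_add HH_smult)
    have D: "DD b v (HH ph v) = x b * DD b v ?r1 + X b (x b) * ?r1 + x ?c * DD b v ?r2 + X b (x ?c) * ?r2
        + z * DD b v ?r0 + X b z * ?r0"
      unfolding HH_alt[of _ _ b] using cl S by (simp add: DD_add DD_mult S_closed)
    have H: "HH (\<lambda>y. DD b y (ph y)) v = x b * (DD b v ?r1 + sgb b * u b * ?r1 + 2 * s * x b * ?r1)
        + x ?c * (DD b v ?r2 - sgb b * u b * ?r2 - s * x b * ?r2) + z * (DD b v ?r0 + s * x b * ?r0)"
      unfolding HH_alt[of _ _ b] using cl by (simp add: rem_DD algebra_simps)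
    have q: "HH (rem ?c l ph) v = rem ?c l (HH ph) v - sgb b * x b * ?r0"
      using HH_rem[of ?c ph v] by simp
    \<comment> \<open>Both sides are now expressed through ?r1, ?r2, ?r0, their derivatives and
      iterated removals. The laws \<open>P_al\<close>, \<open>P_sg\<close> and \<open>P_t\<close>
      have precisely the form for which the coefficients of ?r1, ?r2 and ?r0 agree.\<close>
    show ?thesis
      unfolding L R D H HH_rem q HH_rem0 P_al P_sg[of b] P_t
      by (simp add: algebra_simps)
  qed
qed

end

section \<open>Change of scale\<close>

text \<open>Formal differentiation in the scale parameter. The coefficients will be functions on the
  manifold, a ring with zero divisors.\<close>

definition pd :: "'r::comm_ring_1 poly \<Rightarrow> 'r poly" where
  "pd p = Abs_poly (\<lambda>n. of_nat (Suc n) * coeff p (Suc n))"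

lemma coeff_pd: "coeff (pd p) n = of_nat (Suc n) * coeff p (Suc n)"
proof -
  have "\<forall>i>degree p. of_nat (Suc i) * coeff p (Suc i) = 0" by (simp add: coeff_eq_0)
  then show ?thesis unfolding pd_def by (subst coeff_Abs_poly) auto
qed

lemma pd_pCons: "pd (pCons a p) = p + pCons 0 (pd p)"
  by (rule poly_eqI) (simp add: coeff_pd coeff_pCons algebra_simps split: nat.split)

lemma pd_add: "pd (p + q) = pd p + pd q"
  by (rule poly_eqI) (simp add: coeff_pd algebra_simps)

lemma pd_smult: "pd (smult a p) = smult a (pd p)"
  by (rule poly_eqI) (simp add: coeff_pd algebra_simps)

lemma pd_0 [simp]: "pd 0 = 0" by (rule poly_eqI) (simp add: coeff_pd)

lemma pd_mult: "pd (p * q) = pd p * q + p * pd q"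
  by (induction p) (simp_all add: pd_pCons pd_add pd_smult algebra_simps)

definition poly_over :: "'r::comm_ring_1 set \<Rightarrow> 'r poly set" where
  "poly_over S = {p. \<forall>n. coeff p n \<in> S}"

context subring begin

lemma poly_over_pCons [simp]: "pCons a p \<in> poly_over S \<longleftrightarrow> a \<in> S \<and> p \<in> poly_over S"
  unfolding poly_over_def
  by (auto simp: coeff_pCons split: nat.splits)

lemma poly_over_0 [simp]: "0 \<in> poly_over S" by (simp add: poly_over_def S_0)

lemma subring_poly: "subring (poly_over S)"
proof
  fix p q assume "p \<in> poly_over S" "q \<in> poly_over S"
  then show "p + q \<in> poly_over S" "p * q \<in> poly_over S" "- p \<in> poly_over S"
    by (auto simp: poly_over_def coeff_mult intro!: S_sum S_mult S_add S_uminus)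
next
  show "0 \<in> poly_over S" "1 \<in> poly_over S"
    using S_0 S_1 by (auto simp: poly_over_def coeff_eq_0)
qed

lemma deriv_pd: "deriv_on (poly_over S) pd"
proof -
  interpret P: subring "poly_over S" by (rule subring_poly)
  show ?thesis
    by unfold_locales (auto simp: poly_over_def coeff_pd pd_add pd_mult intro!: S_mult S_add S_nat S_1)
qed

end

context deriv_on begin

lemma coeff_map_X: "coeff (map_poly X p) n = X (coeff p n)"
  by (simp add: coeff_map_poly)

lemma map_X_pCons: "map_poly X (pCons a p) = pCons (X a) (map_poly X p)"
  by (rule poly_eqI) (simp add: coeff_map_X coeff_pCons split: nat.split)

lemma deriv_map_X: "deriv_on (poly_over S) (map_poly X)"
proof -
  interpret P: subring "poly_over S" by (rule subring_poly)
  show ?thesis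
  proof
    fix p q assume pq: "p \<in> poly_over S" "q \<in> poly_over S"
    show "map_poly X p \<in> poly_over S"
      using pq by (auto simp: poly_over_def coeff_map_X intro: X_closed)
    show "map_poly X (p + q) = map_poly X p + map_poly X q"
      using pq by (intro poly_eqI) (auto simp: poly_over_def coeff_map_X X_add)
    show "map_poly X (p * q) = map_poly X p * q + p * map_poly X q"
      using pq
      by (intro poly_eqI)
        (auto simp: poly_over_def coeff_map_X coeff_mult X_sum X_mult S_mult sum.distrib)
  qed
qed

lemma poly_closed: "p \<in> poly_over S \<Longrightarrow> a \<in> S \<Longrightarrow> poly p a \<in> S"
  by (induction p) (auto intro: S_0 S_add S_mult)

lemma poly_map_X: "p \<in> poly_over S \<Longrightarrow> a \<in> S \<Longrightarrow> X a = 0 \<Longrightarrow> poly (map_poly X p) a = X (poly p a)"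
  by (induction p) (auto simp: map_X_pCons X_add X_mult S_mult poly_closed)

lemma pd_map_X: "p \<in> poly_over S \<Longrightarrow> pd (map_poly X p) = map_poly X (pd p)"
  by (rule poly_eqI) (auto simp: coeff_pd coeff_map_X poly_over_def X_mult S_closed X_add simp del: of_nat_Suc)

end

lemma poly_chg: "poly (chg w) a = chg w" by (simp add: chg_def)
lemma poly_sgb: "poly (sgb b) a = sgb b" by (simp add: sgb_def)
lemma poly_wt: "poly (wt c l w) a = wt c (poly l a) w" by (simp add: wt_def)

lemma poly_rem: "poly (rem c l \<psi> w) a = rem c (poly l a) (\<lambda>v. poly (\<psi> v) a) w"
  by (induction w arbitrary: \<psi>) (auto simp: poly_wt)

lemma poly_rem0: "poly (rem0 l \<psi> w) a = rem0 (poly l a) (\<lambda>v. poly (\<psi> v) a) w"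
  by (induction w arbitrary: \<psi>) (auto simp: poly_rem poly_sgb)

lemma coeff_wt: "wt c [:l:] w = [:wt c l w:]"
  by (simp add: wt_def of_nat_poly numeral_poly)

lemma coeff_rem: "coeff (rem c [:l:] \<psi> w) n = rem c l (\<lambda>v. coeff (\<psi> v) n) w"
  by (induction w arbitrary: \<psi>) (auto simp: coeff_wt)

text \<open>Evaluation at a value of the scale parameter is a ring homomorphism, and apart from
  \<open>D\<close> the recursion uses ring operations only. It is applied at the two ends 0 and 1 of
  the path.\<close>

lemma poly_phi:
  assumes "\<And>b w. poly (D b w (phi l D al sg t f w)) a = D' b w (poly (phi l D al sg t f w) a)"
  shows "poly (phi l D al sg t f w) a
    = phi (poly l a) D' (\<lambda>b. poly (al b) a) (poly sg a) (\<lambda>b. poly (t b) a) (poly f a) w"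
proof (induction w rule: length_induct)
  case (1 w)
  show ?case
  proof (cases w)
    case (Cons b v)
    have "rem c (poly l a) (\<lambda>v. poly (phi l D al sg t f v) a) v
        = rem c (poly l a) (phi (poly l a) D' (\<lambda>b. poly (al b) a) (poly sg a) (\<lambda>b. poly (t b) a) (poly f a)) v" for c
      by (rule rem_cong) (use 1 Cons in auto)
    moreover have "rem0 (poly l a) (\<lambda>v. poly (phi l D al sg t f v) a) v
        = rem0 (poly l a) (phi (poly l a) D' (\<lambda>b. poly (al b) a) (poly sg a) (\<lambda>b. poly (t b) a) (poly f a)) v"
      by (rule rem0_cong) (use 1 Cons in auto)
    moreover have "poly (phi l D al sg t f v) a
        = phi (poly l a) D' (\<lambda>b. poly (al b) a) (poly sg a) (\<lambda>b. poly (t b) a) (poly f a) v"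
      using 1 Cons by simp
    ultimately show ?thesis
      unfolding Cons phi_Cons by (simp add: poly_rem poly_rem0 assms)
  qed simp
qed

definition singular :: "'r::comm_ring_1 \<Rightarrow> ('r \<times> bool list) list \<Rightarrow> bool" where
  "singular l W \<longleftrightarrow> (\<forall>d \<psi>. (\<Sum>(c, w)\<leftarrow>W. c * rem d l \<psi> w) = 0)"

text \<open>A vector killed by f_1 and f_2 is killed by their bracket, which is needed because the
  rate of change \<open>HH\<close> contains all three operators.\<close>

lemma singular_rem0:
  assumes "singular l W" shows "(\<Sum>(c, w)\<leftarrow>W. c * rem0 l \<psi> w) = 0"
proof -
  have "(\<Sum>(c, w)\<leftarrow>W. c * rem0 l \<psi> w)
      = (\<Sum>(c, w)\<leftarrow>W. c * rem False l (rem True l \<psi>) w) - (\<Sum>(c, w)\<leftarrow>W. c * rem True l (rem False l \<psi>) w)"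
    by (induction W) (auto simp: rem_commute[symmetric] algebra_simps)
  then show ?thesis using assms by (simp add: singular_def)
qed

text \<open>Calculus for a fixed scale: \<open>X True = Z\<^sub>1\<close>, \<open>X False = Z\<^sup>1\<close>, and \<open>al True\<close>, \<open>al False\<close>, \<open>sg\<close>
  are multiples of the torsion, its conjugate and the scalar curvature.\<close>

locale scale_calc = subring S for S :: "'r::comm_ring_1 set" +
  fixes X :: "bool \<Rightarrow> 'r \<Rightarrow> 'r" and l half third sg :: 'r and u al :: "bool \<Rightarrow> 'r"
  assumes X: "deriv_on S (X b)"
    and S: "l \<in> S" "half \<in> S" "third \<in> S" "sg \<in> S" "u b \<in> S" "al b \<in> S"
    and const: "X b l = 0" "X b half = 0" "X b third = 0"
    and half: "2 * half = 1" and third: "3 * third = 1"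
begin

text \<open>The covariant derivative of a component of charge \<open>p\<close>, with
  \<open>u\<close> the connection form on Z_1 and Z^1.\<close>

definition "E b p g = X b g - p * u b * g"

text \<open>For \<open>b = True\<close> this is, up to sign, the component T_1 = (\<nabla>_1 P - i
  \<nabla>^1 A_11) / (n + 2) of the CR Schouten tensor with n = 1 and P = Scal / 4;
  \<open>b = False\<close> is its conjugate counterpart.\<close>

definition "Rho b = third * sgb b * (E (\<not> b) (2 * sgb b) (al b) - E b 0 sg)"

definition "D0 b w m = X b m - chg w * u b * m"

abbreviation "phi0 f \<equiv> phi l D0 al sg Rho f"

text \<open>The Serre element [e_b, [e_b, e_c]] for the other letter c, written out with covariant
  derivatives acting on a function of charge 0. The charges passed to \<open>E\<close> are those of
  the components already formed.\<close>

definition "serre b g = E b 0 (E b (- sgb b) (E (\<not> b) 0 g)) - 2 * E b 0 (E (\<not> b) (sgb b) (E b 0 g))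
   + E (\<not> b) (2 * sgb b) (E b (sgb b) (E b 0 g))"

text \<open>With \<open>x\<close> the gradient of \<Upsilon>, \<open>al1\<close> and
  \<open>sg1\<close> are the classical values of i A_11 and Scal / 4 in the scale e^\<Upsilon>
  \<theta>, after the frame factors have been taken out. \<open>D1\<close> is the new covariant
  derivative after taking out the factors of the letters and of the density.\<close>

definition "D1 x b w m = X b m - chg w * u b * m + wt b l w * x b * m"
definition "al1 x b = al b - E b (sgb b) (x b) + x b * x b"
definition "mix x = half * (E True (- 1) (x False) + E False 1 (x True))"
definition "sg1 x = sg - mix x - half * x True * x False"
definition "Rho1 x b = third * sgb b * ((E (\<not> b) (2 * sgb b) (al1 x b) + 2 * x (\<not> b) * al1 x b) 
   - (E b 0 (sg1 x) - x b * sg1 x))"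

abbreviation "phi1 x f \<equiv> phi l (D1 x) (al1 x) (sg1 x) (Rho1 x) f"

end

text \<open>The assumption \<open>serre\<close> is how the geometry of the frame acts on \<Upsilon>
  here; \<open>serre_relation\<close> supplies it for every smooth function. The last assumption
  allows a polynomial to be recovered as constant from its vanishing derivative.\<close>

locale scale_change = scale_calc +
  fixes ups :: 'a and x
  defines "x \<equiv> \<lambda>b. X b ups"
  assumes ups: "ups \<in> S"
    and serre: "serre b ups = - al b * E (\<not> b) 0 ups + 4 * sg * E b 0 ups"
    and torsion_free: "of_nat (Suc n) * (g::'a) = 0 \<Longrightarrow> g = 0"
begin

text \<open>In a CR frame this is half of i times the Reeb derivative of \<Upsilon>, by
  \<open>commE\<close> with charge 0. The present locale has no Reeb field, hence the formula by
  second derivatives.\<close>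

definition "z = half * (E False 1 (x True) - E True (- 1) (x False))"

lemma Xd: "deriv_on S (X b)" by (rule X)

lemma SX: "g \<in> S \<Longrightarrow> X b g \<in> S" using deriv_on.X_closed[OF X] .

lemma x_S: "x b \<in> S" by (simp add: x_def SX ups)

lemma E_S: "p \<in> S \<Longrightarrow> g \<in> S \<Longrightarrow> E b p g \<in> S" by (simp add: E_def S_closed SX S)

lemma z_S: "z \<in> S" by (simp add: z_def S_closed S E_S x_S)
lemma mix_S: "mix x \<in> S" by (simp add: mix_def S_closed S E_S x_S)
lemma sg1_S: "sg1 x \<in> S" by (simp add: sg1_def S_closed S mix_S x_S)
lemma al1_S: "al1 x b \<in> S" by (simp add: al1_def S_closed S E_S x_S)
lemma Rho_S: "Rho b \<in> S" by (simp add: Rho_def S_closed S E_S)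

lemma half': "half + half = 1" using half by (simp add: mult_2[symmetric])
lemma half'': "half * r + half * r = r" using half' by (simp add: distrib_right[symmetric])

lemma mix_z: "mix x = E b (- sgb b) (x (\<not> b)) + sgb b * z"
proof -
  have *: "half * p + half * q = p + half * (q - p)" for p q
    using half''[of p] by (simp add: algebra_simps)
  show ?thesis
    unfolding mix_def z_def distrib_left
    using *[of "E True (- 1) (x False)"] *[of "E False 1 (x True)" "E True (- 1) (x False)"] 
    by (cases b) (simp_all add: algebra_simps)
qed

lemma mix_z': "mix x = E (\<not> b) (sgb b) (x b) - sgb b * z"
  using mix_z[of "\<not> b"] by simp

text \<open>The Rho components along the scales \<open>e\<^sup>s\<^sup>\<Upsilon>\<theta>\<close> are cubic polynomials in \<open>s\<close>, obtained by integrating the equation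
  \<open>P_t\<close> of the locale \<open>flow\<close>; that the value at \<open>s = 1\<close> is \<open>Rho1\<close> depends on the Serre relation for \<open>ups\<close>.\<close>

definition "ttc1 b = - X b z + sgb b * (al b * x (\<not> b) - sg * x b)"
definition "ttc2 b = half * (x b * z + sgb b * (- E b (sgb b) (x b) * x (\<not> b) + mix x * x b))"
definition "ttc3 b = half * sgb b * x b * x b * x (\<not> b)"

definition "tt b = [: Rho b, ttc1 b, ttc2 b, ttc3 b :]"

lemma cancel3: "third * (3 * r) = r"
  using third by (metis mult.assoc mult.commute mult.left_neutral)

text \<open>\<open>Rho1\<close> contains the third derivatives of \<Upsilon> that come from
  differentiating the new torsion and scalar curvature, while the integrated polynomial contains a
  derivative of \<open>z\<close>. The Serre relation is the identity among third derivatives that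
  matches the two.\<close>

lemma Rho1_eq: "Rho1 x b = poly (tt b) 1"
proof -
  let ?c = "\<not> b" and ?s = "sgb b :: 'a"
  interpret B: deriv_on S "X b" by (rule X)
  interpret C: deriv_on S "X ?c" by (rule X)
  \<comment> \<open>Solved for the one third derivative that is not a derivative along
    \<open>b\<close> of a mixed second derivative. The others are then expressed by
    \<open>mix x\<close> and \<open>z\<close> through m1 and m2.\<close>
  have ser: "E ?c (2 * ?s) (E b ?s (x b)) = - al b * x ?c + 4 * sg * x b - E b 0 (E b (- ?s) (x ?c)) + 2 * E b 0 (E ?c ?s (x b))"
    using serre[of b] by (simp add: serre_def x_def E_def algebra_simps)
  have m1: "E b (- ?s) (x ?c) = mix x - ?s * z" using mix_z[of b] by simp
  have m2: "E ?c ?s (x b) = mix x + ?s * z" using mix_z'[of b] by simp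
  have s1: "sg1 x = sg - mix x - half * (x b * x ?c)" by (cases b) (auto simp: sg1_def algebra_simps)
  have A: "E ?c (2 * ?s) (al1 x b) = E ?c (2 * ?s) (al b) - E ?c (2 * ?s) (E b ?s (x b)) + 2 * x b * E ?c ?s (x b)"
    unfolding al1_def
    by (simp add: E_def C.X_add C.X_diff C.X_mult S_closed S x_S SX algebra_simps)
  have Bq: "E b 0 (sg1 x) = E b 0 sg - E b 0 (mix x) - half * (x ?c * E b ?s (x b) + x b * E b (- ?s) (x ?c))"
    unfolding s1
    by (simp add: E_def B.X_add B.X_diff B.X_mult S_closed S x_S SX mix_S const algebra_simps)
  have e1: "E b 0 (mix x - ?s * z) = E b 0 (mix x) - ?s * X b z"
       "E b 0 (mix x + ?s * z) = E b 0 (mix x) + ?s * X b z"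
    by (simp_all add: E_def B.X_add B.X_diff B.X_mult S_closed S x_S SX mix_S z_S)
  define a where "a = E b ?s (x b)"
  define m where "m = mix x"
  define Em where "Em = E b 0 m"
  have h: "3 * (half * r) = r + half * r" for r using half''[of r] by (simp add: algebra_simps)
  \<comment> \<open>hb and hc are half of \<open>x b\<close> and half of \<open>x ?c\<close>. With
    them every coefficient becomes an integer and the identity can be checked by ring
    normalisation.\<close>
  obtain hb hc where hb: "x b = 2 * hb" "\<And>r. half * (x b * r) = hb * r"
      and hc: "x ?c = 2 * hc" "\<And>r. half * (x ?c * r) = hc * r"
  proof
    show "x b = 2 * (half * x b)" "x ?c = 2 * (half * x ?c)"
      using half by (simp_all add: mult.assoc[symmetric])
  qed (simp_all add: mult.assoc)
  have Bq': "E b 0 (sg1 x) = E b 0 sg - Em - (hc * a + hb * (m - ?s * z))"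
    unfolding Bq m1 distrib_left hb(2) hc(2) by (simp add: a_def m_def Em_def)
  have s1': "sg1 x = sg - m - hb * x ?c"
    unfolding s1 hb(2) by (simp add: m_def)
  have t2: "ttc2 b = hb * z + ?s * (hb * m - hc * a)"
    using hb(2)[of z] hb(2)[of "?s * m"] hc(2)[of "?s * a"]
    by (simp add: ttc2_def a_def m_def algebra_simps)
  have t3: "ttc3 b = ?s * hb * x b * x ?c"
    using hb(2)[of "?s * x b * x ?c"] by (simp add: ttc3_def algebra_simps)
  have al1': "al1 x b = al b - a + x b * x b" by (simp add: al1_def a_def)
  have "E ?c (2 * ?s) (al1 x b) + 2 * x ?c * al1 x b - (E b 0 (sg1 x) - x b * sg1 x)
    = (E ?c (2 * ?s) (al b) - E b 0 sg)
      + 3 * (?s * (ttc1 b + ttc2 b + ttc3 b))"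
    unfolding A Bq' ser m1 m2 e1
    unfolding s1' al1' ttc1_def t2 t3 a_def[symmetric] m_def[symmetric] Em_def[symmetric]
    by (simp add: hb(1) hc(1) algebra_simps)
  then have "Rho1 x b = third * ?s * ((E ?c (2 * ?s) (al b) - E b 0 sg) + 3 * (?s * (ttc1 b + ttc2 b + ttc3 b)))"
    by (simp only: Rho1_def)
  also have "\<dots> = Rho b + third * (3 * (ttc1 b + ttc2 b + ttc3 b))"
    by (simp add: Rho_def algebra_simps)
  finally show ?thesis
    by (simp add: tt_def cancel3 algebra_simps)
qed

lemma numeral_poly': "(numeral n :: 'a poly) = [:numeral n:]"
  by (simp add: numeral_poly)

lemma tt_S: "ttc1 b \<in> S" "ttc2 b \<in> S" "ttc3 b \<in> S"
  by (simp_all add: ttc1_def ttc2_def ttc3_def S_closed S SX z_S x_S E_S mix_S)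

lemma sgb_poly: "(sgb b :: 'a poly) = [:sgb b:]"
  by (simp add: sgb_def one_pCons)

text \<open>The polynomial [:0, 1:] is the parameter s itself, and the derivations act on
  coefficients. Torsion and scalar curvature are quadratic in s and the Rho component is cubic. The
  two expressions demanded for the derivative of \<open>sg\<close>, one for each letter, agree
  because of \<open>mix_z\<close>.\<close>

lemma flow: "flow (poly_over S) (\<lambda>b. map_poly (X b)) pd [:l:] [:f:] [:0, 1:] [:z:]
    [:sg, - mix x, - half * x True * x False:] (\<lambda>b. [:u b:]) (\<lambda>b. [:x b:])
    (\<lambda>b. [:al b, - E b (sgb b) (x b), x b * x b:]) tt" if "f \<in> S" for f
proof -
  interpret P: subring "poly_over S" by (rule subring_poly)
  have m: "map_poly (X b) (pCons a p) = pCons (X b a) (map_poly (X b) p)" for b a p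
    by (rule deriv_on.map_X_pCons[OF X])
  have X1: "X b 1 = 0" "X b 0 = 0" for b
    using deriv_on.X_1[OF X] deriv_on.X_0[OF X] by auto
  show ?thesis
  proof (intro flow.intro flow_axioms.intro)
    show "deriv_on (poly_over S) (map_poly (X b))" for b by (rule deriv_on.deriv_map_X[OF X])
    show "deriv_on (poly_over S) pd" by (rule deriv_pd)
    show "pd (map_poly (X b) g) = map_poly (X b) (pd g)" if "g \<in> poly_over S" for b g
      using that by (rule deriv_on.pd_map_X[OF X])
    show "pd [:sg, - mix x, - half * x True * x False:] =
          - (map_poly (X b) [:x (\<not> b):] + sgb b * [:u b:] * [:x (\<not> b):] + sgb b * [:z:])
          - [:0, 1:] * [:x b:] * [:x (\<not> b):]" for b
    proof -
      have 1: "mix x = X b (x (\<not> b)) + sgb b * u b * x (\<not> b) + sgb b * z"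
        using mix_z[of b] by (simp add: E_def)
      have 2: "half * x True * x False + half * x True * x False = x b * x (\<not> b)"
        using half''[of "x True * x False"] by (cases b) (simp_all add: algebra_simps)
      have 3: "pd [:sg, - mix x, - half * x True * x False:]
        = [:- mix x, - (half * x True * x False + half * x True * x False):]"
        by (simp add: pd_pCons)
      show ?thesis
        unfolding 3 2 unfolding 1 by (simp add: m sgb_poly)
    qed
    show "pd (tt b) = - map_poly (X b) [:z:] + [:0, 1:] * [:x b:] * [:z:]
        + sgb b * ([:al b, - E b (sgb b) (x b), x b * x b:] * [:x (\<not> b):]
        - [:sg, - mix x, - half * x True * x False:] * [:x b:])" for b
    proof -
      have a: "ttc2 b + ttc2 b = x b * z + sgb b * (- E b (sgb b) (x b) * x (\<not> b) + mix x * x b)"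
        unfolding ttc2_def by (rule half'')
      have h: "half * x True * x False = half * x b * x (\<not> b)" by (cases b) (simp_all add: algebra_simps)
      have c: "ttc3 b + ttc3 b + ttc3 b = sgb b * (x b * x b * x (\<not> b) + half * x b * x (\<not> b) * x b)"
        using half''[of "sgb b * x b * x b * x (\<not> b)"] by (simp add: ttc3_def algebra_simps)
      have 3: "pd (tt b) = [:ttc1 b, ttc2 b + ttc2 b, ttc3 b + ttc3 b + ttc3 b:]"
        by (simp add: tt_def pd_pCons algebra_simps)
      show ?thesis
        unfolding 3 a c ttc1_def minus_mult_left[symmetric] h
        by (simp add: m sgb_poly algebra_simps)
    qed
    show "pd [:al b, - E b (sgb b) (x b), x b * x b:] =
         - (map_poly (X b) [:x b:] - sgb b * [:u b:] * [:x b:])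
         + 2 * [:0, 1:] * [:x b:] * [:x b:]" for b
      by (simp add: pd_pCons m sgb_poly E_def numeral_poly')
  qed (rule subring_poly, simp_all add: S that S_closed z_S mix_S x_S E_S tt_def Rho_S tt_S m const X1 pd_pCons one_pCons)
qed

text \<open>The weighted sum of words is a polynomial q in s. By the flow equation its derivative is
  a combination of sums of \<open>rem\<close> and \<open>rem0\<close>, all zero for a singular
  combination; so q takes equal values at s = 0 and s = 1.\<close>

theorem scale_invariance:
  assumes W: "singular l W" "\<And>c w. (c, w) \<in> set W \<Longrightarrow> c \<in> S" and f: "f \<in> S"
  shows "(\<Sum>(c, w)\<leftarrow>W. c * phi1 x f w) = (\<Sum>(c, w)\<leftarrow>W. c * phi0 f w)"
proof -
  interpret F: flow "poly_over S" "\<lambda>b. map_poly (X b)" pd "[:l:]" "[:f:]" "[:0, 1:]" "[:z:]"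
    "[:sg, - mix x, - half * x True * x False:]" "\<lambda>b. [:u b:]" "\<lambda>b. [:x b:]"
    "\<lambda>b. [:al b, - E b (sgb b) (x b), x b * x b:]" tt
    using f by (rule flow)
  interpret Pd: deriv_on "poly_over S" pd by (rule deriv_pd)
  have ev: "poly (map_poly (X b) p) s = X b (poly p s)" if "p \<in> poly_over S" "s = 0 \<or> s = 1" for b p s
    using that S_0 S_1 deriv_on.X_0[OF X] deriv_on.X_1[OF X] by (auto intro!: deriv_on.poly_map_X[OF X])
  have D: "poly (F.DD b w m) 0 = D0 b w (poly m 0)" "poly (F.DD b w m) 1 = D1 x b w (poly m 1)"
    if "m \<in> poly_over S" for b w m
    using that ev by (simp_all add: F.DD_def D0_def D1_def poly_chg poly_wt)
  have p0: "poly (F.ph w) 0 = phi0 f w" for w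
    by (subst poly_phi[where D' = D0]) (simp_all only: D F.ph_closed, simp add: tt_def)
  have sg: "poly [:sg, - mix x, - half * x True * x False:] 1 = sg1 x"
    by (simp add: sg1_def)
  have al: "poly [:al b, - E b (sgb b) (x b), x b * x b:] 1 = al1 x b" for b
    by (simp add: al1_def)
  have p1: "poly (F.ph w) 1 = phi1 x f w" for w
    by (subst poly_phi[where D' = "D1 x"]) (simp_all only: D F.ph_closed al sg, simp add: Rho1_eq[abs_def])
  define q where "q = (\<Sum>(c, w)\<leftarrow>W. [:c:] * F.ph w)"
  have "q \<in> poly_over S \<and> pd q = (\<Sum>(c, w)\<leftarrow>W. [:c:] * F.HH F.ph w)"
    using W(2) unfolding q_def
  proof (induction W)
    case (Cons cw W)
    obtain c w where cw: "cw = (c, w)" by force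
    let ?Q = "\<Sum>(c, w)\<leftarrow>W. [:c:] * F.ph w"
    have prems: "c \<in> S" if "(c, w) \<in> set W" for c w
      using Cons.prems[of c w] that by simp
    have IH: "?Q \<in> poly_over S" "pd ?Q = (\<Sum>(c, w)\<leftarrow>W. [:c:] * F.HH F.ph w)"
      using Cons.IH prems by blast+
    have c: "[:c:] \<in> poly_over S" using Cons.prems[of c w] cw by simp
    have m: "[:c:] * F.ph w \<in> poly_over S" by (rule F.S_mult[OF c F.ph_closed])
    have "pd ([:c:] * F.ph w + ?Q) = pd [:c:] * F.ph w + [:c:] * F.HH F.ph w + pd ?Q"
      by (simp only: Pd.X_add[OF m IH(1)] Pd.X_mult[OF c F.ph_closed] F.P_ph)
    moreover have "pd [:c:] = 0" by (simp add: pd_pCons)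
    ultimately show ?case
      using F.S_add[OF m IH(1)] by (simp only: cw IH(2) list.map sum_list.Cons prod.case mult_zero_left add_0_left)
  qed (simp add: F.S_0)
  moreover have "(\<Sum>(c, w)\<leftarrow>W. [:c:] * F.HH F.ph w) = 0"
  proof -
    have r: "(\<Sum>(c, w)\<leftarrow>W. [:c:] * rem d [:l:] F.ph w) = 0" for d
    proof (rule poly_eqI)
      fix n
      have "coeff (\<Sum>(c, w)\<leftarrow>W. [:c:] * rem d [:l:] F.ph w) n
          = (\<Sum>(c, w)\<leftarrow>W. c * rem d l (\<lambda>v. coeff (F.ph v) n) w)"
        by (induction W) (auto simp: coeff_rem)
      then show "coeff (\<Sum>(c, w)\<leftarrow>W. [:c:] * rem d [:l:] F.ph w) n = coeff 0 n"
        using W(1) by (simp add: singular_def)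
    qed
    have r0: "(\<Sum>(c, w)\<leftarrow>W. [:c:] * rem0 [:l:] F.ph w) = 0"
    proof (rule poly_eqI)
      fix n
      have "coeff (rem0 [:l:] \<psi> w) n = rem0 l (\<lambda>v. coeff (\<psi> v) n) w" for \<psi> w
        by (induction w arbitrary: \<psi>) (auto simp: coeff_rem sgb_poly)
      then have "coeff (\<Sum>(c, w)\<leftarrow>W. [:c:] * rem0 [:l:] F.ph w) n
          = (\<Sum>(c, w)\<leftarrow>W. c * rem0 l (\<lambda>v. coeff (F.ph v) n) w)"
        by (induction W) auto
      then show "coeff (\<Sum>(c, w)\<leftarrow>W. [:c:] * rem0 [:l:] F.ph w) n = coeff 0 n"
        using singular_rem0[OF W(1)] by simp
    qed
    have "(\<Sum>(c, w)\<leftarrow>W. [:c:] * F.HH F.ph w)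
       = [:x True:] * (\<Sum>(c, w)\<leftarrow>W. [:c:] * rem True [:l:] F.ph w)
       + [:x False:] * (\<Sum>(c, w)\<leftarrow>W. [:c:] * rem False [:l:] F.ph w)
       + [:z:] * (\<Sum>(c, w)\<leftarrow>W. [:c:] * rem0 [:l:] F.ph w)"
      by (induction W) (auto simp: F.HH_def algebra_simps simp del: mult_pCons_left mult_pCons_right)
    then show ?thesis by (simp only: r r0) simp
  qed
  ultimately have "pd q = 0" by simp
  \<comment> \<open>The coefficient of the derivative carries the factor n + 1, which is cancelled
    by absence of torsion.\<close>
  then have "coeff q (Suc n) = 0" for n
    using coeff_pd[of q n] torsion_free[of n "coeff q (Suc n)"] by simp
  then have "q = [:coeff q 0:]"
    by (intro poly_eqI) (auto simp: coeff_pCons split: nat.split)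
  then have "poly q 1 = poly q 0" by (metis mult_zero_right poly_0 poly_pCons)
  moreover have "poly q s = (\<Sum>(c, w)\<leftarrow>W. c * poly (F.ph w) s)" for s
    unfolding q_def by (induction W) auto
  ultimately show ?thesis by (simp only: p0 p1)
qed

end

section \<open>Singular vectors\<close>

text \<open>The last clause concerns the principal symbol: all words with k letters of each kind
  have the same top order part, so this sum is the factor by which it is multiplied and must be
  invertible for the normalisation.\<close>

definition singular_vector :: "nat \<Rightarrow> (complex \<times> bool list) list \<Rightarrow> bool" where
  "singular_vector k W \<longleftrightarrow> (\<forall>d \<psi>. (\<Sum>(c, w)\<leftarrow>W. c * rem d (of_nat k / 2 - 1) \<psi> w) = 0) \<and>
     (\<forall>(c, w)\<in>set W. count_list w True = k \<and> count_list w False = k) \<and> (\<Sum>(c, w)\<leftarrow>W. c) \<noteq> 0"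

lemma wt_replicate:
  "wt c l (replicate n b @ w) = wt c l w + of_nat n * (if b = c then - 2 else 1)"
  by (induction n) (simp_all add: wt_Cons algebra_simps)

text \<open>The sl_2 formula f e^n v = n (\<mu> - n + 1) e^(n-1) v for the first block, where \<mu>
  is the weight of the word behind it. At n = 0 the truncated subtraction is harmless because of the
  factor n.\<close>

lemma rem_append_replicate:
  "rem c l \<phi> (replicate n b @ w)
     = (if b = c then of_nat n * (wt c l w - of_nat (n - 1)) * \<phi> (replicate (n - 1) b @ w) else 0)
       + rem c l (\<lambda>v. \<phi> (replicate n b @ v)) w"
proof (induction n arbitrary: \<phi>)
  case (Suc n)
  show ?case
    using Suc.IH[of "\<lambda>v. \<phi> (b # v)"]
    by (cases n) (auto simp: wt_replicate wt_Cons replicate_app_Cons_same algebra_simps)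
qed simp

lemma rem_replicate:
  "rem c l \<phi> (replicate n b) = (if b = c then of_nat n * (l - of_nat (n - 1)) * \<phi> (replicate (n - 1) b) else 0)"
  using rem_append_replicate[of c l \<phi> n b "[]"] by (simp add: wt_def)

lemma count_replicate: "count_list (replicate n b) c = (if b = c then n else 0)"
  by (induction n) auto

text \<open>Binomials and signs aside, these are the coefficients of the singular combination. The
  recursion in \<open>d\<close> is the ratio forced by f_2, and the starting row 1/(k/2 - c)
  satisfies the ratio forced by f_1.\<close>

fun Gc :: "nat \<Rightarrow> nat \<Rightarrow> nat \<Rightarrow> complex" where
  "Gc k 0 c = 1 / (of_nat k / 2 - of_nat c)"
| "Gc k (Suc d) c = (of_nat k / 2 + of_nat d - of_nat c) / (of_nat k / 2 - of_nat d - 1) * Gc k d c"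

text \<open>All denominators in the coefficients are of this kind. For even \<open>k\<close> the one
  with j = k/2 vanishes, which is why the parities are treated by different vectors.\<close>

lemma half_odd: "odd k \<Longrightarrow> of_nat k / 2 - of_nat j \<noteq> (0::complex)"
proof
  assume "odd k" "of_nat k / 2 - of_nat j = (0::complex)"
  then have "(of_nat k :: complex) = of_nat (2 * j)" by (simp add: field_simps)
  then have "k = 2 * j" using of_nat_eq_iff by blast
  then show False using \<open>odd k\<close> by simp
qed

lemma half_odd_Suc: "odd k \<Longrightarrow> of_nat k / 2 - of_nat j - 1 \<noteq> (0::complex)"
  using half_odd[of k "Suc j"] by (simp add: algebra_simps)

text \<open>Compatibility of the two systems of ratios: passing from d to d + 1 multiplies
  neighbouring columns by factors that differ exactly by the shift of d in the ratio forced by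
  f_1.\<close>

lemma Gc_step:
  assumes "odd k"
  shows "(of_nat k / 2 - of_nat c) * Gc k d c = (of_nat k / 2 + of_nat d - of_nat c - 1) * Gc k d (Suc c)"
proof (induction d)
  case 0
  show ?case using half_odd[OF assms, of c] half_odd[OF assms, of "Suc c"] by (simp add: algebra_simps)
next
  case (Suc d)
  have "(of_nat k / 2 - of_nat c) * Gc k (Suc d) c
    = (of_nat k / 2 + of_nat d - of_nat c) / (of_nat k / 2 - of_nat d - 1) * ((of_nat k / 2 - of_nat c) * Gc k d c)"
    by simp
  also have "\<dots> = (of_nat k / 2 + of_nat d - of_nat c) * Gc k (Suc d) (Suc c)"
    unfolding Suc.IH by (simp add: diff_diff_eq add.commute)
  also have "of_nat k / 2 + of_nat d - of_nat c = (of_nat k / 2 + of_nat (Suc d) - of_nat c - 1 :: complex)"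
    by simp
  finally show ?case .
qed

text \<open>The n-th finite difference at 0, up to sign. It appears as the sum of the coefficients
  over \<open>c\<close>, whose binomials and signs are those of a difference.\<close>

definition asum :: "nat \<Rightarrow> (nat \<Rightarrow> complex) \<Rightarrow> complex" where
  "asum n f = (\<Sum>c\<le>n. (- 1) ^ c * of_nat (n choose c) * f c)"

lemma asum_Suc: "asum (Suc n) f = asum n (\<lambda>c. f c - f (Suc c))"
proof -
  have "asum (Suc n) f = f 0 + (\<Sum>c\<le>n. (- 1) ^ Suc c * of_nat (Suc n choose Suc c) * f (Suc c))"
    by (simp add: asum_def sum.atMost_Suc_shift del: sum.atMost_Suc)
  also have "\<dots> = f 0 + (\<Sum>c\<le>n. (- 1) ^ Suc c * of_nat (n choose Suc c) * f (Suc c))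
      - (\<Sum>c\<le>n. (- 1) ^ c * of_nat (n choose c) * f (Suc c))"
    by (simp add: algebra_simps sum.distrib sum_subtractf sum_negf)
  also have "f 0 + (\<Sum>c\<le>n. (- 1) ^ Suc c * of_nat (n choose Suc c) * f (Suc c)) = asum n f"
  proof -
    have "asum n f = (\<Sum>c\<le>Suc n. (- 1) ^ c * of_nat (n choose c) * f c)"
      by (simp add: asum_def)
    then show ?thesis by (simp only: sum.atMost_Suc_shift) simp
  qed
  finally show ?thesis by (simp add: asum_def algebra_simps sum_subtractf)
qed

lemma asum_smult: "asum n (\<lambda>c. r * f c) = r * asum n f"
  by (simp add: asum_def sum_distrib_left algebra_simps)

text \<open>A Pochhammer symbol is a polynomial of degree m in c, and one difference turns it into a
  multiple of the symbol of degree m - 1; more than m differences leave zero.\<close>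

lemma asum_pochhammer: "m < n \<Longrightarrow> asum n (\<lambda>c. pochhammer (\<beta> - of_nat c) m) = 0"
proof (induction n arbitrary: m)
  case (Suc n)
  show ?case
  proof (cases m)
    case 0 then show ?thesis by (simp add: asum_Suc) (simp add: asum_def)
  next
    case (Suc m')
    have "pochhammer (\<beta> - of_nat c) (Suc m') - pochhammer (\<beta> - of_nat (Suc c)) (Suc m')
      = of_nat (Suc m') * pochhammer (\<beta> - of_nat c) m'" for c
    proof -
      have "pochhammer (\<beta> - of_nat c) (Suc m') = pochhammer (\<beta> - of_nat c) m' * (\<beta> - of_nat c + of_nat m')"
        by (simp add: pochhammer_rec' algebra_simps)
      moreover have *: "\<beta> - of_nat (Suc c) + 1 = \<beta> - of_nat c" by simp
      moreover have "pochhammer (\<beta> - of_nat (Suc c)) (Suc m') = (\<beta> - of_nat (Suc c)) * pochhammer (\<beta> - of_nat c) m'"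
        by (simp only: pochhammer_rec[of "\<beta> - of_nat (Suc c)"] *)
      ultimately show ?thesis
        by (simp only:) (simp add: ring_distribs)
    qed
    then show ?thesis using Suc Suc.IH[of m'] Suc.prems by (simp only: asum_Suc asum_smult) simp
  qed
qed simp

text \<open>The difference of the reciprocal of a product of consecutive factors is a nonzero
  multiple of the reciprocal of a product with one more factor. Hence no iterated difference
  vanishes, and the induction has to run over all \<open>m\<close>.\<close>

lemma asum_inverse:
  assumes "\<And>j. \<gamma> - of_nat j \<noteq> 0"
  shows "asum n (\<lambda>c. 1 / (\<Prod>i\<le>m. \<gamma> - of_nat (c + i))) \<noteq> 0"
proof (induction n arbitrary: m)
  case 0
  then show ?case using assms by (simp add: asum_def)
next
  case (Suc n)
  have "1 / (\<Prod>i\<le>m. \<gamma> - of_nat (c + i)) - 1 / (\<Prod>i\<le>m. \<gamma> - of_nat (Suc c + i))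
      = - of_nat (Suc m) * (1 / (\<Prod>i\<le>Suc m. \<gamma> - of_nat (c + i)))" for c
  proof -
    let ?P = "\<Prod>i\<le>m. \<gamma> - of_nat (Suc c + i)"
    have 1: "(\<Prod>i\<le>Suc m. \<gamma> - of_nat (c + i)) = (\<gamma> - of_nat c) * ?P"
      by (simp only: prod.atMost_Suc_shift) simp
    have 2: "(\<Prod>i\<le>Suc m. \<gamma> - of_nat (c + i)) = (\<Prod>i\<le>m. \<gamma> - of_nat (c + i)) * (\<gamma> - of_nat (c + Suc m))"
      by simp
    have nz: "?P \<noteq> 0" "(\<Prod>i\<le>m. \<gamma> - of_nat (c + i)) \<noteq> 0" "\<gamma> - of_nat c \<noteq> 0" "\<gamma> - of_nat (c + Suc m) \<noteq> 0"
      using assms by (auto simp del: of_nat_add of_nat_Suc)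
    have "1 / (\<Prod>i\<le>m. \<gamma> - of_nat (c + i)) = (\<gamma> - of_nat (c + Suc m)) / (\<Prod>i\<le>Suc m. \<gamma> - of_nat (c + i))"
      unfolding 2 using nz by simp
    moreover have "1 / ?P = (\<gamma> - of_nat c) / (\<Prod>i\<le>Suc m. \<gamma> - of_nat (c + i))"
      unfolding 1 using nz by simp
    ultimately show ?thesis by (simp only: diff_divide_distrib[symmetric]) simp
  qed
  then have "asum (Suc n) (\<lambda>c. 1 / (\<Prod>i\<le>m. \<gamma> - of_nat (c + i)))
     = - of_nat (Suc m) * asum n (\<lambda>c. 1 / (\<Prod>i\<le>Suc m. \<gamma> - of_nat (c + i)))"
    by (simp only: asum_Suc asum_smult)
  then show ?case using Suc.IH[of "Suc m"] by (simp del: of_nat_Suc prod.atMost_Suc)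
qed

lemma Gc_pochhammer:
  assumes "odd k"
  shows "Gc k (Suc d) c = (\<Prod>i\<le>d. 1 / (of_nat k / 2 - of_nat i - 1)) * pochhammer (of_nat k / 2 + 1 - of_nat c) d"
proof (induction d)
  case 0
  show ?case using half_odd[OF assms, of c] by simp
next
  case (Suc d)
  have "Gc k (Suc (Suc d)) c = (1 / (of_nat k / 2 - of_nat (Suc d) - 1) * (\<Prod>i\<le>d. 1 / (of_nat k / 2 - of_nat i - 1)))
      * (pochhammer (of_nat k / 2 + 1 - of_nat c) d * (of_nat k / 2 + 1 - of_nat c + of_nat d))"
    unfolding Gc.simps(2)[of k "Suc d"] Suc.IH by (simp add: ac_simps)
  then show ?case by (simp only: pochhammer_Suc prod.atMost_Suc mult.commute)
qed

text \<open>For even \<open>k\<close> the word \<open>e\<^sub>1\<^sup>k\<^sup>/\<^sup>2 e\<^sub>2\<^sup>k e\<^sub>1\<^sup>k\<^sup>/\<^sup>2\<close> is singular. For odd \<open>k\<close> a combination of the words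
  \<open>e\<^sub>1\<^sup>k\<^sup>-\<^sup>c e\<^sub>2\<^sup>k\<^sup>-\<^sup>d e\<^sub>1\<^sup>c e\<^sub>2\<^sup>d\<close> is needed; annihilation by \<open>f\<^sub>1\<close> and \<open>f\<^sub>2\<close> fixes the ratios of its coefficients in
  the directions of \<open>c\<close> and \<open>d\<close>.\<close>

definition "Codd k c d = (- 1) ^ c * of_nat (k choose c) * of_nat (k choose d) * Gc k d c"

lemma choose_step: "of_nat (k - c) * of_nat (k choose c) = (of_nat (Suc c) * of_nat (k choose Suc c) :: complex)"
  using binomial_absorb_comp[of k c] binomial_absorption[of c k]
  by (cases "c \<le> k") (metis of_nat_mult mult.commute times_binomial_minus1_eq binomial_absorption, simp add: binomial_eq_0)

text \<open>The word with blocks k - c - 1, k - d, c, d arises under f_1 from two words of the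
  combination: from column c by shortening the first block, and from column c + 1 by shortening the
  third. The two contributions cancel.\<close>

lemma Codd_c:
  assumes "odd k" "c < k"
  shows "of_nat (k - c) * (of_nat k / 2 - of_nat c) * Codd k c d
     + of_nat (Suc c) * (of_nat k / 2 + of_nat d - of_nat c - 1) * Codd k (Suc c) d = 0"
proof -
  have "of_nat (k - c) * (of_nat k / 2 - of_nat c) * Codd k c d
    = (of_nat (k - c) * of_nat (k choose c)) * ((of_nat k / 2 - of_nat c) * Gc k d c) * ((- 1) ^ c * of_nat (k choose d))"
    by (simp add: Codd_def)
  also have "\<dots> = of_nat (Suc c) * (of_nat k / 2 + of_nat d - of_nat c - 1) * - Codd k (Suc c) d"
    unfolding choose_step Gc_step[OF assms(1)] by (simp add: Codd_def)
  finally show ?thesis by simp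
qed

lemma Codd_d:
  assumes "odd k" "d < k"
  shows "of_nat (k - d) * (of_nat c - of_nat d - of_nat k / 2) * Codd k c d
     + of_nat (Suc d) * (of_nat k / 2 - of_nat d - 1) * Codd k c (Suc d) = 0"
proof -
  have "of_nat (Suc d) * (of_nat k / 2 - of_nat d - 1) * Codd k c (Suc d)
    = (of_nat (Suc d) * of_nat (k choose Suc d)) * ((of_nat k / 2 - of_nat d - 1) * Gc k (Suc d) c) * ((- 1) ^ c * of_nat (k choose c))"
    by (simp add: Codd_def del: Gc.simps)
  also have "(of_nat k / 2 - of_nat d - 1) * Gc k (Suc d) c = (of_nat k / 2 + of_nat d - of_nat c) * Gc k d c"
    using half_odd_Suc[OF assms(1), of d] by simp
  finally show ?thesis unfolding choose_step[symmetric] by (simp add: Codd_def algebra_simps)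
qed

definition word4 :: "nat \<Rightarrow> nat \<Rightarrow> nat \<Rightarrow> nat \<Rightarrow> bool list" where
  "word4 a b c d = replicate a True @ replicate b False @ replicate c True @ replicate d False"

definition Wodd :: "nat \<Rightarrow> (complex \<times> bool list) list" where
  "Wodd k = [(Codd k c d, word4 (k - c) (k - d) c d). c \<leftarrow> [0..<Suc k], d \<leftarrow> [0..<Suc k]]"

lemma sum_Wodd: "(\<Sum>(c, w)\<leftarrow>Wodd k. F c w) = (\<Sum>c\<le>k. \<Sum>d\<le>k. F (Codd k c d) (word4 (k - c) (k - d) c d))"
  for F :: "complex \<Rightarrow> bool list \<Rightarrow> complex"
proof -
  have "(\<Sum>(c, w)\<leftarrow>concat (map (\<lambda>c. map (\<lambda>d. (g c d, h c d)) ys) xs). F c w)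
      = (\<Sum>c\<leftarrow>xs. \<Sum>d\<leftarrow>ys. F (g c d) (h c d))" for g h and xs ys :: "nat list"
    by (induction xs) (simp_all add: o_def)
  moreover have "(\<Sum>c\<leftarrow>[0..<Suc k]. f c) = (\<Sum>c\<le>k. f c)" for f :: "nat \<Rightarrow> complex"
    by (simp only: interv_sum_list_conv_sum_set_nat) (simp add: atLeast0LessThan lessThan_Suc_atMost[symmetric] add.commute)
  ultimately show ?thesis by (simp only: Wodd_def)
qed

lemma rem_word4:
  "rem True l \<psi> (word4 a b c d) = of_nat a * (l - 2 * of_nat c + of_nat b + of_nat d - of_nat (a - 1)) * \<psi> (word4 (a - 1) b c d)
     + of_nat c * (l + of_nat d - of_nat (c - 1)) * \<psi> (word4 a b (c - 1) d)"
  "rem False l \<psi> (word4 a b c d) = of_nat b * (l - 2 * of_nat d + of_nat c - of_nat (b - 1)) * \<psi> (word4 a (b - 1) c d)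
     + of_nat d * (l - of_nat (d - 1)) * \<psi> (word4 a b c (d - 1))"
  by (simp_all add: word4_def rem_replicate rem_append_replicate[where w = "_ @ _"] rem_append_replicate[where w = "replicate _ _"]
   wt_replicate wt_replicate[where w = "[]", simplified] count_replicate wt_def algebra_simps)

text \<open>Each block has length one more than the weight of the word behind it: these weights are
  j - 1, 2 j - 1 and j - 1, reading from the right. So every factor \<mu> - n + 1 in the sl_2
  formula is zero. This is the chain of simple reflections s_1 s_2 s_1.\<close>

lemma singular_even: "singular_vector (2 * j) [(1, word4 j (2 * j) j 0)]"
proof -
  have "rem d (of_nat j - 1) \<psi> (word4 j (2 * j) j 0) = (0 :: complex)" for d \<psi>
    by (cases d; cases j) (simp_all add: rem_word4)
  then show ?thesis
    by (simp add: singular_vector_def) (simp add: word4_def count_replicate)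
qed

text \<open>The shift pairs the two ways in which a given word is reached; \<open>f k\<close> and
  \<open>g 0\<close> are the ends, where one of the blocks is empty.\<close>

lemma telescope:
  assumes "\<And>c. c < k \<Longrightarrow> f c + g (Suc c) = (0::complex)" "f k = 0" "g 0 = 0"
  shows "(\<Sum>c\<le>k. f c + g c) = 0"
proof -
  have "(\<Sum>c\<le>n. f c + g c) = f n" if "n \<le> k" for n
    using that
  proof (induction n)
    case 0
    then show ?case using assms(3) by simp
  next
    case (Suc n)
    then have "f n + g (Suc n) = 0" "(\<Sum>c\<le>n. f c + g c) = f n" using assms(1)[of n] by auto
    then show ?case by (simp only: sum.atMost_Suc) (simp add: algebra_simps)
  qed
  then show ?thesis using assms(2) by (metis order_refl)
qed

lemma singular_odd: assumes k: "odd k" shows "singular_vector k (Wodd k)"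
proof -
  let ?l = "of_nat k / 2 - 1 :: complex"
  have T: "(\<Sum>(c, w)\<leftarrow>Wodd k. c * rem True ?l \<psi> w) = 0" for \<psi>
  proof -
    have "(\<Sum>c\<le>k. Codd k c d * rem True ?l \<psi> (word4 (k - c) (k - d) c d)) = 0" if "d \<le> k" for d
    proof -
      let ?f = "\<lambda>c. Codd k c d * (of_nat (k - c) * (?l - 2 * of_nat c + of_nat (k - d) + of_nat d - of_nat (k - c - 1))
         * \<psi> (word4 (k - c - 1) (k - d) c d))"
      let ?g = "\<lambda>c. Codd k c d * (of_nat c * (?l + of_nat d - of_nat (c - 1)) * \<psi> (word4 (k - c) (k - d) (c - 1) d))"
      have "(\<Sum>c\<le>k. ?f c + ?g c) = 0"
      proof (rule telescope)
        fix c assume c: "c < k"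
        have "?f c + ?g (Suc c) = (of_nat (k - c) * (of_nat k / 2 - of_nat c) * Codd k c d
           + of_nat (Suc c) * (of_nat k / 2 + of_nat d - of_nat c - 1) * Codd k (Suc c) d)
           * \<psi> (word4 (k - c - 1) (k - d) c d)"
          using c that by (simp add: of_nat_diff algebra_simps)
        then show "?f c + ?g (Suc c) = 0" using Codd_c[OF k c] by simp
      qed auto
      then show ?thesis by (simp only: rem_word4 distrib_left)
    qed
    then show ?thesis
      unfolding sum_Wodd by (subst sum.swap) simp
  qed
  have F: "(\<Sum>(c, w)\<leftarrow>Wodd k. c * rem False ?l \<psi> w) = 0" for \<psi>
  proof -
    have "(\<Sum>d\<le>k. Codd k c d * rem False ?l \<psi> (word4 (k - c) (k - d) c d)) = 0" if "c \<le> k" for c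
    proof -
      let ?f = "\<lambda>d. Codd k c d * (of_nat (k - d) * (?l - 2 * of_nat d + of_nat c - of_nat (k - d - 1))
         * \<psi> (word4 (k - c) (k - d - 1) c d))"
      let ?g = "\<lambda>d. Codd k c d * (of_nat d * (?l - of_nat (d - 1)) * \<psi> (word4 (k - c) (k - d) c (d - 1)))"
      have "(\<Sum>d\<le>k. ?f d + ?g d) = 0"
      proof (rule telescope)
        fix d assume d: "d < k"
        have "?f d + ?g (Suc d) = (of_nat (k - d) * (of_nat c - of_nat d - of_nat k / 2) * Codd k c d
           + of_nat (Suc d) * (of_nat k / 2 - of_nat d - 1) * Codd k c (Suc d))
           * \<psi> (word4 (k - c) (k - d - 1) c d)"
          using d that by (simp add: of_nat_diff algebra_simps)
        then show "?f d + ?g (Suc d) = 0" using Codd_d[OF k d] by simp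
      qed auto
      then show ?thesis by (simp only: rem_word4 distrib_left)
    qed
    then show ?thesis
      unfolding sum_Wodd by simp
  qed
  have S: "(\<Sum>(c, w)\<leftarrow>Wodd k. c) \<noteq> 0"
  proof -
    have "(\<Sum>(c, w)\<leftarrow>Wodd k. c) = (\<Sum>d\<le>k. of_nat (k choose d) * asum k (Gc k d))"
      unfolding sum_Wodd by (subst sum.swap) (simp add: Codd_def asum_def sum_distrib_left algebra_simps)
    \<comment> \<open>For d > 0 the function \<open>Gc k d\<close> is a polynomial in c of degree d
      - 1 < k and is annihilated by the k-th difference. There remains the row 1/(k/2 - c), whose
      difference is not zero.\<close>
    also have "\<dots> = (\<Sum>d\<in>{0}. of_nat (k choose d) * asum k (Gc k d))"
    proof (rule sum.mono_neutral_right)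
      show "\<forall>d\<in>{..k} - {0}. of_nat (k choose d) * asum k (Gc k d) = 0"
      proof
        fix d assume d: "d \<in> {..k} - {0}"
        then obtain d' where d': "d = Suc d'" "d' < k" by (cases d) auto
        show "of_nat (k choose d) * asum k (Gc k d) = 0"
          unfolding d'(1) Gc_pochhammer[OF k, abs_def] asum_smult asum_pochhammer[OF d'(2)] by simp
      qed
    qed auto
    also have "\<dots> = asum k (\<lambda>c. 1 / (\<Prod>i\<le>0. of_nat k / 2 - of_nat (c + i)))"
      by (simp add: asum_def)
    also have "\<dots> \<noteq> 0" by (rule asum_inverse) (rule half_odd[OF k])
    finally show ?thesis .
  qed
  have B: "count_list w True = k \<and> count_list w False = k" if "(c, w) \<in> set (Wodd k)" for c w
    using that by (auto simp: Wodd_def word4_def count_replicate)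
  show ?thesis
    unfolding singular_vector_def
    by (intro conjI allI) (metis (full_types) T F, use B in auto, use S in auto)
qed

theorem singular_vector_exists: "\<exists>W. singular_vector k W"
proof (cases "even k")
  case True
  then obtain j where "k = 2 * j" by blast
  then show ?thesis using singular_even by blast
next
  case False then show ?thesis using singular_odd by blast
qed

section \<open>Compatibility of the word calculus with homomorphisms and rescaling\<close>

lemma rem_hom:
  assumes "\<And>x y. h (x + y) = h x + h y" "\<And>c w x. h (wt c l w * x) = wt c l' w * h x" "h 0 = 0"
  shows "h (rem c l \<psi> w) = rem c l' (\<lambda>v. h (\<psi> v)) w"
  by (induction w arbitrary: \<psi>) (auto simp: assms)

lemma rem0_hom:
  assumes "\<And>x y. h (x + y) = h x + h y" "\<And>c w x. h (wt c l w * x) = wt c l' w * h x" "h 0 = 0"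
  shows "h (rem0 l \<psi> w) = rem0 l' (\<lambda>v. h (\<psi> v)) w"
proof (induction w arbitrary: \<psi>)
  case (Cons b w)
  have "h (- x) = - h x" for x using assms(1)[of x "- x"] assms(3) by (simp add: eq_neg_iff_add_eq_0 add.commute)
  then have "h (x - sgb b * y) = h x - sgb b * h y" for x y
    using assms(1)[of x "- (sgb b * y)"] assms(1)[of x y] by (cases b) auto
  then show ?case by (simp add: Cons.IH rem_hom[where h = h, OF assms])
qed (use assms in simp)

text \<open>\<open>h\<close> is merely additive and compatible with the coefficients, not a ring
  homomorphism, so that it can be the truncation of functions to an open set.\<close>

lemma phi_hom:
  assumes "\<And>x y. h (x + y) = h x + h y" "\<And>c w x. h (wt c l w * x) = wt c l' w * h x" "h 0 = 0"
    and "\<And>b x. h (al b * x) = al' b * h x" "\<And>x. h (sg * x) = sg' * h x" "\<And>b x. h (t b * x) = t' b * h x"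
    and D: "\<And>b w. length w < n \<Longrightarrow> h (D b w (phi l D al sg t f w)) = D' b w (h (phi l D al sg t f w))"
  shows "length w \<le> n \<Longrightarrow> h (phi l D al sg t f w) = phi l' D' al' sg' t' (h f) w"
proof (induction w rule: length_induct)
  case (1 w)
  show ?case
  proof (cases w)
    case (Cons b v)
    have "rem c l' (\<lambda>v. h (phi l D al sg t f v)) v = rem c l' (phi l' D' al' sg' t' (h f)) v" for c
      by (rule rem_cong) (use 1 Cons in auto)
    moreover have "rem0 l' (\<lambda>v. h (phi l D al sg t f v)) v = rem0 l' (phi l' D' al' sg' t' (h f)) v"
      by (rule rem0_cong) (use 1 Cons in auto)
    moreover have "h (phi l D al sg t f v) = phi l' D' al' sg' t' (h f) v"
      using 1 Cons by simp
    ultimately show ?thesis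
      using 1 unfolding Cons phi_Cons
      by (simp add: assms(1,4-6) D rem_hom[where h = h, OF assms(1-3)] rem0_hom[where h = h, OF assms(1-3)])
  qed simp
qed

text \<open>Effect of rescaling the letters by \<open>g\<close>, that is of a change of frame combined with the density
  weight of a change of scale.\<close>

lemma rem_scale:
  "g d * rem d l (\<lambda>v. prod_list (map g v) * c * \<phi> v) w = prod_list (map g w) * c * rem d l \<phi> w"
proof (induction w arbitrary: c \<phi>)
  case (Cons b w)
  have "(\<lambda>v. prod_list (map g (b # v)) * c * \<phi> (b # v)) = (\<lambda>v. prod_list (map g v) * (g b * c) * \<phi> (b # v))"
    by (simp add: algebra_simps)
  then show ?case
    using Cons.IH[of "g b * c" "\<lambda>v. \<phi> (b # v)"] by (simp add: algebra_simps)
qed simp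

lemma rem0_scale:
  "g True * g False * rem0 l (\<lambda>v. prod_list (map g v) * c * \<phi> v) w = prod_list (map g w) * c * rem0 l \<phi> w"
proof -
  have *: "g d * rem d l (rem e l (\<lambda>v. prod_list (map g v) * c * \<phi> v)) w * g e = prod_list (map g w) * c * rem d l (rem e l \<phi>) w"
    for d e
  proof -
    have e: "(\<lambda>w. g e * rem e l (\<lambda>v. prod_list (map g v) * c * \<phi> v) w)
        = (\<lambda>w. prod_list (map g w) * c * rem e l \<phi> w)"
      by (rule ext) (rule rem_scale)
    have "g d * rem d l (rem e l (\<lambda>v. prod_list (map g v) * c * \<phi> v)) w * g e
        = g d * rem d l (\<lambda>w. g e * rem e l (\<lambda>v. prod_list (map g v) * c * \<phi> v) w) w"
      unfolding rem_smult by (simp only: mult_ac)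
    then show ?thesis by (simp only: e rem_scale)
  qed
  show ?thesis
    using *[of False True] *[of True False] by (simp add: rem_commute[symmetric] algebra_simps)
qed

text \<open>Each correction term trades letters: together with the new letter \<open>b\<close>, the
  removed ones account for the factors g b * g b for the torsion, g b * g (not b) for the scalar
  curvature, and three factors for the bracket term. So all terms of the recursion scale
  alike.\<close>

lemma phi_scale:
  assumes "\<And>b w. D' b w (prod_list (map g w) * c * phi l D al sg t f w) = g b * (prod_list (map g w) * c * D b w (phi l D al sg t f w))"
    and "\<And>b. al' b = g b * g b * al b" "sg' = g True * g False * sg" "\<And>b. t' b = g b * (g True * g False) * t b"
  shows "phi l D' al' sg' t' (c * f) w = prod_list (map g w) * c * phi l D al sg t f w"
proof (induction w rule: length_induct)
  case (1 w)
  show ?case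
  proof (cases w)
    case (Cons b v)
    let ?K = "prod_list (map g v) * c" and ?p = "phi l D al sg t f"
    let ?q = "\<lambda>v. prod_list (map g v) * c * phi l D al sg t f v"
    have r: "rem d l (phi l D' al' sg' t' (c * f)) v = rem d l ?q v" for d
      by (rule rem_cong) (use 1 Cons in auto)
    have r0: "rem0 l (phi l D' al' sg' t' (c * f)) v = rem0 l ?q v"
      by (rule rem0_cong) (use 1 Cons in auto)
    have ind: "phi l D' al' sg' t' (c * f) v = ?q v" using 1 Cons by simp
    have sg: "sg' = g b * g (\<not> b) * sg" using assms(3) by (cases b) simp_all
    have "phi l D' al' sg' t' (c * f) w = D' b v (?q v) + al' b * rem b l ?q v + sg' * rem (\<not> b) l ?q v + t' b * rem0 l ?q v"
      unfolding Cons phi_Cons r r0 ind ..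
    also have "\<dots> = g b * (?K * D b v (?p v))
       + g b * al b * (g b * rem b l ?q v) + g b * sg * (g (\<not> b) * rem (\<not> b) l ?q v)
       + g b * t b * (g True * g False * rem0 l ?q v)"
      unfolding assms(1) assms(2) sg assms(4) by (simp only: mult_ac)
    finally have "phi l D' al' sg' t' (c * f) w = g b * (?K * D b v (?p v))
       + g b * al b * (g b * rem b l ?q v) + g b * sg * (g (\<not> b) * rem (\<not> b) l ?q v)
       + g b * t b * (g True * g False * rem0 l ?q v)" .
    then show ?thesis
      unfolding rem_scale rem0_scale Cons by (simp add: phi_Cons algebra_simps)
  qed simp
qed

section \<open>Universal expressions\<close>

text \<open>Monomials with derivatives along Z_1 and Z^1 only. The Reeb derivative does not have to
  be listed, since the recursion for words never applies it.\<close>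

type_synonym nmon = "complex \<times> (curv \<times> bool list) list \<times> bool list"

fun cchg :: "curv \<Rightarrow> int" where
  "cchg Tor = 2" | "cchg TorBar = - 2" | "cchg ScalCurv = 0"

definition ichg :: "bool list \<Rightarrow> int" where
  "ichg w = int (count_list w True) - int (count_list w False)"

lemma ichg_Cons: "ichg (b # w) = ichg w + (if b then 1 else - 1)"
  by (auto simp: ichg_def)

lemma of_int_ichg: "of_int (ichg w) = chg w" by (simp add: ichg_def chg_def)

fun mchg :: "nmon \<Rightarrow> int" where
  "mchg (c, Bs, ds) = (\<Sum>(B, w)\<leftarrow>Bs. cchg B + ichg w) + ichg ds"

definition cst :: "complex \<Rightarrow> 'a \<Rightarrow> complex" where "cst c = (\<lambda>_. c)"

lemma cst_simps: "cst (x + y) = cst x + cst y" "cst (x * y) = cst x * cst y" "cst (x - y) = cst x - cst y"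
  "cst (- x) = - cst x" "cst 0 = 0" "cst 1 = 1" "cst (of_nat n) = of_nat n" "cst (numeral v) = numeral v"
  by (auto simp: cst_def fun_eq_iff)

lemma cst_wt: "cst (wt c l w) = wt c (cst l) w"
  by (simp add: wt_def cst_simps)

lemma cst_sgb: "cst (sgb b) = sgb b" by (simp add: sgb_def cst_simps)

text \<open>The derivatives and the connection form are those along \<open>Z\<^sub>1\<close> (index \<open>True\<close>) and \<open>Z\<^sup>1\<close> (index \<open>False\<close>), so
  that no power of \<open>h\<^sub>1\<^sub>1\<close> appears in a complete contraction.\<close>

datatype 'a frame_data = Frame_data (fS: "('a \<Rightarrow> complex) set") (fX: "bool \<Rightarrow> ('a \<Rightarrow> complex) \<Rightarrow> 'a \<Rightarrow> complex")
  (fu: "bool \<Rightarrow> 'a \<Rightarrow> complex") (fC: "curv \<Rightarrow> 'a \<Rightarrow> complex") (ff: "'a \<Rightarrow> complex")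

definition good_data :: "'a frame_data \<Rightarrow> bool" where
  "good_data F \<longleftrightarrow> (\<forall>b. deriv_on (fS F) (fX F b)) \<and> (\<forall>c b. cst c \<in> fS F \<and> fX F b (cst c) = 0) \<and>
     (\<forall>b. fu F b \<in> fS F) \<and> (\<forall>B. fC F B \<in> fS F) \<and> ff F \<in> fS F"

definition fE :: "'a frame_data \<Rightarrow> bool \<Rightarrow> int \<Rightarrow> ('a \<Rightarrow> complex) \<Rightarrow> 'a \<Rightarrow> complex" where
  "fE F b p g = fX F b g - of_int p * fu F b * g"

fun Ew :: "'a frame_data \<Rightarrow> int \<Rightarrow> bool list \<Rightarrow> ('a \<Rightarrow> complex) \<Rightarrow> 'a \<Rightarrow> complex" where
  "Ew F p [] g = g"
| "Ew F p (b # w) g = fE F b (p + ichg w) (Ew F p w g)"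

fun nval :: "'a frame_data \<Rightarrow> nmon \<Rightarrow> 'a \<Rightarrow> complex" where
  "nval F (c, Bs, ds) = cst c * (\<Prod>(B, w)\<leftarrow>Bs. Ew F (cchg B) w (fC F B)) * Ew F 0 ds (ff F)"

definition nvals :: "'a frame_data \<Rightarrow> nmon list \<Rightarrow> 'a \<Rightarrow> complex" where
  "nvals F E = (\<Sum>m\<leftarrow>E. nval F m)"

fun dBs :: "bool \<Rightarrow> (curv \<times> bool list) list \<Rightarrow> (curv \<times> bool list) list list" where
  "dBs b [] = []"
| "dBs b ((B, w) # Bs) = ((B, b # w) # Bs) # map ((#) (B, w)) (dBs b Bs)"

fun dmon :: "bool \<Rightarrow> nmon \<Rightarrow> nmon list" where
  "dmon b (c, Bs, ds) = (c, Bs, b # ds) # map (\<lambda>Bs'. (c, Bs', ds)) (dBs b Bs)"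

text \<open>The list is chosen before the frame data, and this uniformity is what makes the
  expression universal. The charge is recorded because it decides which covariant derivative applies
  to a product.\<close>

definition representable :: "int \<Rightarrow> ('a frame_data \<Rightarrow> 'a \<Rightarrow> complex) \<Rightarrow> bool" where
  "representable p v \<longleftrightarrow> (\<exists>E. (\<forall>m\<in>set E. mchg m = p) \<and> (\<forall>F. good_data F \<longrightarrow> nvals F E = v F))"

context
  fixes F :: "'a frame_data" assumes F: "good_data F"
begin

lemma fd: "deriv_on (fS F) (fX F b)" and f_cst: "cst c \<in> fS F" "fX F b (cst c) = 0"
  and f_S: "fu F b \<in> fS F" "fC F B \<in> fS F" "ff F \<in> fS F"
  using F by (auto simp: good_data_def)

lemma f_subring: "subring (fS F)" using fd[of True] by (simp add: deriv_on_def)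

lemma of_int_cst: "(of_int p :: 'a \<Rightarrow> complex) = cst (of_int p)"
  by (cases p) (simp_all add: cst_simps)

lemma fE_S: "g \<in> fS F \<Longrightarrow> fE F b p g \<in> fS F"
  using subring.S_diff[OF f_subring] subring.S_mult[OF f_subring] deriv_on.X_closed[OF fd] f_S f_cst
  by (simp add: fE_def of_int_cst)

lemma Ew_S: "g \<in> fS F \<Longrightarrow> Ew F p w g \<in> fS F"
  by (induction w) (auto intro: fE_S)

lemma fE_add: "g \<in> fS F \<Longrightarrow> h \<in> fS F \<Longrightarrow> fE F b p (g + h) = fE F b p g + fE F b p h"
  by (simp add: fE_def deriv_on.X_add[OF fd] algebra_simps)

lemma fE_mult: "g \<in> fS F \<Longrightarrow> h \<in> fS F \<Longrightarrow> fE F b (p + q) (g * h) = fE F b p g * h + g * fE F b q h"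
  by (simp add: fE_def deriv_on.X_mult[OF fd] algebra_simps)

lemma fE_cst: "g \<in> fS F \<Longrightarrow> fE F b p (cst c * g) = cst c * fE F b p g"
  by (simp add: fE_def deriv_on.X_mult[OF fd] f_cst algebra_simps)

lemma fE_0: "fE F b p 0 = 0" by (simp add: fE_def deriv_on.X_0[OF fd])

lemma Bs_S: "(\<Prod>(B, w)\<leftarrow>Bs. Ew F (cchg B) w (fC F B)) \<in> fS F"
  using subring.S_1[OF f_subring] subring.S_mult[OF f_subring] Ew_S f_S by (induction Bs) auto

lemma nval_S: "nval F m \<in> fS F"
proof -
  obtain c Bs ds where m: "m = (c, Bs, ds)" by (metis prod.exhaust)
  show ?thesis unfolding m nval.simps by (intro subring.S_mult[OF f_subring] Bs_S Ew_S f_cst f_S)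
qed

lemma fE_Bs: "fE F b (\<Sum>(B, w)\<leftarrow>Bs. cchg B + ichg w) (\<Prod>(B, w)\<leftarrow>Bs. Ew F (cchg B) w (fC F B))
   = (\<Sum>Bs'\<leftarrow>dBs b Bs. \<Prod>(B, w)\<leftarrow>Bs'. Ew F (cchg B) w (fC F B))"
proof (induction Bs)
  case Nil
  have "fE F b 0 1 = 0" by (simp add: fE_def deriv_on.X_1[OF fd])
  then show ?case by (simp only: list.map prod_list.Nil sum_list.Nil dBs.simps)
next
  case (Cons Bw Bs)
  obtain B w where Bw: "Bw = (B, w)" by force
  have s: "(\<Sum>Bs'\<leftarrow>map ((#) (B, w)) L. \<Prod>(B, w)\<leftarrow>Bs'. Ew F (cchg B) w (fC F B))
     = Ew F (cchg B) w (fC F B) * (\<Sum>Bs'\<leftarrow>L. \<Prod>(B, w)\<leftarrow>Bs'. Ew F (cchg B) w (fC F B))" for L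
    by (induction L) (simp_all add: algebra_simps)
  show ?case
    unfolding Bw dBs.simps list.map prod_list.Cons sum_list.Cons prod.case s Cons.IH[symmetric]
      fE_mult[OF Ew_S[OF f_S(2)] Bs_S] Ew.simps ..
qed

text \<open>The Leibniz rule for covariant derivatives: charges of factors add up, so a derivative
  of the total charge distributes over the curvature factors and the derivative of f.\<close>

lemma nvals_dmon: "nvals F (dmon b m) = fE F b (mchg m) (nval F m)"
proof -
  obtain c Bs ds where m: "m = (c, Bs, ds)" by (metis prod.exhaust)
  let ?B = "\<Prod>(B, w)\<leftarrow>Bs. Ew F (cchg B) w (fC F B)" and ?f = "Ew F 0 ds (ff F)"
  have "nval F m = cst c * (?B * ?f)" by (simp add: m)
  moreover have "?B * ?f \<in> fS F" by (intro subring.S_mult[OF f_subring] Bs_S Ew_S f_S)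
  ultimately have "fE F b (mchg m) (nval F m) = cst c * fE F b (mchg m) (?B * ?f)"
    by (simp add: fE_cst)
  also have "\<dots> = cst c * ((\<Sum>Bs'\<leftarrow>dBs b Bs. \<Prod>(B, w)\<leftarrow>Bs'. Ew F (cchg B) w (fC F B)) * ?f + ?B * Ew F 0 (b # ds) (ff F))"
    by (simp add: m fE_mult Bs_S Ew_S f_S fE_Bs)
  also have "\<dots> = nvals F (dmon b m)"
  proof -
    have "(\<Sum>m\<leftarrow>map (\<lambda>Bs'. (c, Bs', ds)) L. nval F m)
       = cst c * (\<Sum>Bs'\<leftarrow>L. \<Prod>(B, w)\<leftarrow>Bs'. Ew F (cchg B) w (fC F B)) * ?f" for L
      by (induction L) (simp_all add: algebra_simps)
    then show ?thesis by (simp add: nvals_def m algebra_simps)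
  qed
  finally show ?thesis by simp
qed

end

lemma mchg_dmon: "m' \<in> set (dmon b m) \<Longrightarrow> mchg m' = mchg m + (if b then 1 else - 1)"
proof -
  obtain c Bs ds where m: "m = (c, Bs, ds)" by (metis prod.exhaust)
  have "Bs' \<in> set (dBs b Bs) \<Longrightarrow> (\<Sum>(B, w)\<leftarrow>Bs'. cchg B + ichg w) = (\<Sum>(B, w)\<leftarrow>Bs. cchg B + ichg w) + (if b then 1 else - 1)" for Bs'
    by (induction b Bs arbitrary: Bs' rule: dBs.induct) (auto simp: ichg_Cons)
  then show "m' \<in> set (dmon b m) \<Longrightarrow> mchg m' = mchg m + (if b then 1 else - 1)"
    by (auto simp: m ichg_Cons)
qed

lemma representable_0: "representable p (\<lambda>F. 0)"
  unfolding representable_def by (rule exI[of _ "[]"]) (simp add: nvals_def)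

lemma representable_add:
  assumes "representable p v" "representable p v'" shows "representable p (\<lambda>F. v F + v' F)"
proof -
  obtain E E' where "\<forall>m\<in>set E. mchg m = p" "\<forall>m\<in>set E'. mchg m = p"
    "\<forall>F. good_data F \<longrightarrow> nvals F E = v F" "\<forall>F. good_data F \<longrightarrow> nvals F E' = v' F"
    using assms unfolding representable_def by blast
  then show ?thesis
    unfolding representable_def by (intro exI[of _ "E @ E'"]) (auto simp: nvals_def)
qed

lemma representable_cst:
  assumes "representable p v" shows "representable p (\<lambda>F. cst c * v F)"
proof -
  obtain E where E: "\<forall>m\<in>set E. mchg m = p" "\<forall>F. good_data F \<longrightarrow> nvals F E = v F"
    using assms unfolding representable_def by blast
  have "nvals F (map (\<lambda>(c', Bs, ds). (c * c', Bs, ds)) E) = cst c * nvals F E" for F :: "'a frame_data"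
    by (induction E) (auto simp: nvals_def cst_simps algebra_simps)
  then show ?thesis
    using E unfolding representable_def by (intro exI[of _ "map (\<lambda>(c', Bs, ds). (c * c', Bs, ds)) E"]) auto
qed

lemma representable_uminus: "representable p v \<Longrightarrow> representable p (\<lambda>F. - v F)"
  using representable_cst[of p v "- 1"] by (simp add: cst_simps)

lemma representable_diff:
  "representable p v \<Longrightarrow> representable p v' \<Longrightarrow> representable p (\<lambda>F. v F - v' F)"
  using representable_add[OF _ representable_uminus, of p v v'] by simp

lemma representable_curv:
  assumes "representable p v"
  shows "representable (cchg B + ichg w + p) (\<lambda>F. Ew F (cchg B) w (fC F B) * v F)"
proof -
  obtain E where E: "\<forall>m\<in>set E. mchg m = p" "\<forall>F. good_data F \<longrightarrow> nvals F E = v F"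
    using assms unfolding representable_def by blast
  have "nvals F (map (\<lambda>(c', Bs, ds). (c', (B, w) # Bs, ds)) E) = Ew F (cchg B) w (fC F B) * nvals F E" for F :: "'a frame_data"
    by (induction E) (auto simp: nvals_def algebra_simps)
  then show ?thesis
    using E unfolding representable_def by (intro exI[of _ "map (\<lambda>(c', Bs, ds). (c', (B, w) # Bs, ds)) E"]) fastforce
qed

lemma representable_fE:
  assumes "representable p v"
  shows "representable (p + (if b then 1 else - 1)) (\<lambda>F. fE F b p (v F))"
proof -
  obtain E where E: "\<forall>m\<in>set E. mchg m = p" "\<forall>F. good_data F \<longrightarrow> nvals F E = v F"
    using assms unfolding representable_def by blast
  have "nvals F (concat (map (dmon b) E)) = fE F b p (nvals F E)" if F: "good_data F" for F :: "'a frame_data"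
    using E(1)
  proof (induction E)
    case Nil then show ?case using fE_0[OF F] by (simp only: nvals_def list.map concat.simps sum_list.Nil)
  next
    case (Cons m E)
    have "(\<Sum>m\<leftarrow>E. nval F m) \<in> fS F"
      using subring.S_0[OF f_subring[OF F]] subring.S_add[OF f_subring[OF F]] nval_S[OF F] by (induction E) auto
    then have a: "fE F b p (nval F m + (\<Sum>m\<leftarrow>E. nval F m)) = fE F b p (nval F m) + fE F b p (\<Sum>m\<leftarrow>E. nval F m)"
      by (intro fE_add[OF F nval_S[OF F]])
    have m: "mchg m = p" and IH: "nvals F (concat (map (dmon b) E)) = fE F b p (nvals F E)"
      using Cons by auto
    show ?case
      using nvals_dmon[OF F, of b m] IH
      unfolding nvals_def list.map concat.simps map_append sum_list_append sum_list.Cons a m by (simp only:)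
  qed
  then show ?thesis
    using E unfolding representable_def
    by (intro exI[of _ "concat (map (dmon b) E)"]) (auto simp: mchg_dmon)
qed

lemma representable_f: "representable 0 ff"
  unfolding representable_def by (rule exI[of _ "[(1, [], [])]"]) (simp add: nvals_def ichg_def cst_simps)

lemma representable_rem:
  assumes "\<And>v. Suc (length v) = length w \<Longrightarrow> representable (q + ichg v) (\<psi> v)"
  shows "representable (q + ichg w - (if c then 1 else - 1)) (\<lambda>F. rem c (cst l) (\<lambda>v. \<psi> v F) w)"
  using assms
proof (induction w arbitrary: q \<psi>)
  case (Cons b w)
  have 1: "representable ((q + (if b then 1 else - 1)) + ichg w - (if c then 1 else - 1)) (\<lambda>F. rem c (cst l) (\<lambda>v. \<psi> (b # v) F) w)"
  proof (rule Cons.IH)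
    fix v :: "bool list" assume "Suc (length v) = length w"
    then show "representable (q + (if b then 1 else - 1) + ichg v) (\<psi> (b # v))"
      using Cons.prems[of "b # v"] by (simp add: ichg_Cons add_ac)
  qed
  have 2: "representable (q + ichg (b # w) - (if c then 1 else - 1)) (\<lambda>F. if b = c then cst (wt c l w) * \<psi> w F else 0)"
    using Cons.prems[of w] by (cases "b = c") (auto intro!: representable_cst representable_0 simp: ichg_Cons)
  have "representable (q + ichg (b # w) - (if c then 1 else - 1)) (\<lambda>F. rem c (cst l) (\<lambda>v. \<psi> (b # v) F) w)"
    using 1 by (simp add: ichg_Cons add_ac)
  from representable_add[OF 2 this] show ?case
    unfolding rem.simps cst_wt[symmetric] .
qed (simp add: representable_0)

lemma representable_rem0:
  assumes "\<And>v. Suc (Suc (length v)) = length w \<Longrightarrow> representable (q + ichg v) (\<psi> v)"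
  shows "representable (q + ichg w) (\<lambda>F. rem0 (cst l) (\<lambda>v. \<psi> v F) w)"
  using assms
proof (induction w arbitrary: q \<psi>)
  case (Cons b w)
  have 1: "representable ((q + (if b then 1 else - 1)) + ichg w) (\<lambda>F. rem0 (cst l) (\<lambda>v. \<psi> (b # v) F) w)"
  proof (rule Cons.IH)
    fix v :: "bool list" assume "Suc (Suc (length v)) = length w"
    then show "representable (q + (if b then 1 else - 1) + ichg v) (\<psi> (b # v))"
      using Cons.prems[of "b # v"] by (simp add: ichg_Cons add_ac)
  qed
  have 2: "representable (q + ichg w - (if \<not> b then 1 else - 1)) (\<lambda>F. cst (sgb b) * rem (\<not> b) (cst l) (\<lambda>v. \<psi> v F) w)"
    by (intro representable_cst representable_rem Cons.prems) simp
  have 3: "representable (q + ichg (b # w)) (\<lambda>F. rem0 (cst l) (\<lambda>v. \<psi> (b # v) F) w)"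
    using 1 by (simp add: ichg_Cons add_ac)
  have 4: "representable (q + ichg (b # w)) (\<lambda>F. cst (sgb b) * rem (\<not> b) (cst l) (\<lambda>v. \<psi> v F) w)"
    using 2 by (cases b) (simp_all add: ichg_Cons add.assoc add_diff_eq)
  from representable_diff[OF 3 4] show ?case
    unfolding rem0.simps cst_sgb .
qed (simp add: representable_0)

definition fD :: "'a frame_data \<Rightarrow> bool \<Rightarrow> bool list \<Rightarrow> ('a \<Rightarrow> complex) \<Rightarrow> 'a \<Rightarrow> complex" where
  "fD F b w m = fE F b (ichg w) m"

text \<open>The factor i makes the torsion enter the Serre relation with a coefficient free of i,
  see \<open>serre_relation\<close>.\<close>

definition fal :: "'a frame_data \<Rightarrow> bool \<Rightarrow> 'a \<Rightarrow> complex" where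
  "fal F b = (if b then cst \<i> * fC F Tor else cst (- \<i>) * fC F TorBar)"

text \<open>The trace P = Scal / (2 (n + 1)) of the CR Schouten tensor in the case n = 1.\<close>

definition fsg :: "'a frame_data \<Rightarrow> 'a \<Rightarrow> complex" where
  "fsg F = cst (1 / 4) * fC F ScalCurv"

definition fRho :: "'a frame_data \<Rightarrow> bool \<Rightarrow> 'a \<Rightarrow> complex" where
  "fRho F b = cst (1 / 3) * sgb b * (fE F (\<not> b) (if b then 2 else - 2) (fal F b) - fE F b 0 (fsg F))"

abbreviation "fphi l F \<equiv> phi (cst l) (fD F) (fal F) (fsg F) (fRho F) (ff F)"

text \<open>Every term of the recursion preserves the charge: a torsion factor brings plus or minus
  2 where a letter of that sign is removed, and the removal of an opposite pair costs
  nothing.\<close>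

lemma representable_phi: "representable (ichg w) (\<lambda>F :: 'a frame_data. fphi l F w)"
proof (induction w rule: length_induct)
  case (1 w)
  show ?case
  proof (cases w)
    case Nil
    then show ?thesis using representable_f by (simp add: ichg_def)
  next
    case (Cons b v)
    let ?e = "if b then 1 else - 1 :: int"
    have IH: "representable (0 + ichg y) (\<lambda>F :: 'a frame_data. fphi l F y)" if "length y \<le> length v" for y
      unfolding add_0_left by (rule 1[rule_format]) (use Cons that in simp)
    have a: "representable (ichg v + ?e) (\<lambda>F :: 'a frame_data. fD F b v (fphi l F v))"
      using representable_fE[OF IH[of v], of b] by (simp add: fD_def[of _ b v])
    have r: "representable (0 + ichg v - (if c then 1 else - 1)) (\<lambda>F :: 'a frame_data. rem c (cst l) (fphi l F) v)" for c
      by (rule representable_rem) (rule IH, simp)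
    have r0: "representable (0 + ichg v) (\<lambda>F :: 'a frame_data. rem0 (cst l) (fphi l F) v)"
      by (rule representable_rem0) (rule IH, simp)
    have b1: "representable (ichg v + ?e) (\<lambda>F :: 'a frame_data. fal F b * rem b (cst l) (fphi l F) v)"
    proof -
      have "representable (ichg v + ?e) (\<lambda>F :: 'a frame_data. cst (if b then \<i> else - \<i>) *
          (Ew F (cchg (if b then Tor else TorBar)) [] (fC F (if b then Tor else TorBar)) * rem b (cst l) (fphi l F) v))"
        using representable_cst[OF representable_curv[OF r[of b], of "if b then Tor else TorBar" "[]"], of "if b then \<i> else - \<i>"]
        by (cases b) (simp_all add: ichg_def algebra_simps)
      then show ?thesis by (cases b) (simp_all add: fal_def mult.assoc)
    qed
    have b2: "representable (ichg v + ?e) (\<lambda>F :: 'a frame_data. fsg F * rem (\<not> b) (cst l) (fphi l F) v)"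
    proof -
      have "representable (ichg v + ?e) (\<lambda>F :: 'a frame_data. cst (1 / 4) * (Ew F (cchg ScalCurv) [] (fC F ScalCurv) * rem (\<not> b) (cst l) (fphi l F) v))"
        using representable_cst[OF representable_curv[OF r[of "\<not> b"], of ScalCurv "[]"], of "1 / 4"]
        by (cases b) (simp_all add: ichg_def)
      then show ?thesis by (simp add: fsg_def mult.assoc)
    qed
    have b3: "representable (ichg v + ?e) (\<lambda>F :: 'a frame_data. fRho F b * rem0 (cst l) (fphi l F) v)"
    proof -
      let ?B = "if b then Tor else TorBar"
      have A: "representable (ichg v + ?e) (\<lambda>F :: 'a frame_data. cst (if b then \<i> else - \<i>) * (Ew F (cchg ?B) [\<not> b] (fC F ?B) * rem0 (cst l) (fphi l F) v))"
        using representable_cst[OF representable_curv[OF r0, of ?B "[\<not> b]"], of "if b then \<i> else - \<i>"]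
        by (cases b) (simp_all add: ichg_def algebra_simps)
      have B: "representable (ichg v + ?e) (\<lambda>F :: 'a frame_data. cst (1 / 4) * (Ew F (cchg ScalCurv) [b] (fC F ScalCurv) * rem0 (cst l) (fphi l F) v))"
        using representable_cst[OF representable_curv[OF r0, of ScalCurv "[b]"], of "1 / 4"]
        by (cases b) (simp_all add: ichg_def algebra_simps)
      have C: "representable (ichg v + ?e) (\<lambda>F :: 'a frame_data. cst (1 / 3 * sgb b) *
          (cst (if b then \<i> else - \<i>) * (Ew F (cchg ?B) [\<not> b] (fC F ?B) * rem0 (cst l) (fphi l F) v)
          - cst (1 / 4) * (Ew F (cchg ScalCurv) [b] (fC F ScalCurv) * rem0 (cst l) (fphi l F) v)))" (is "representable _ ?V")
        by (intro representable_cst representable_diff A B)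
      have "?V F = fRho F b * rem0 (cst l) (fphi l F) v" if F: "good_data F" for F :: "'a frame_data"
      proof -
        have "fRho F b = cst (1 / 3 * sgb b) * (cst (if b then \<i> else - \<i>) * Ew F (cchg ?B) [\<not> b] (fC F ?B)
            - cst (1 / 4) * Ew F (cchg ScalCurv) [b] (fC F ScalCurv))"
          unfolding fRho_def fal_def fsg_def using fE_cst[OF F f_S(2)[OF F]]
          by (cases b) (simp_all add: ichg_def cst_simps(2) cst_sgb cst_simps(4)[of "1 / 3"])
        then show ?thesis
          by (simp only: left_diff_distrib right_diff_distrib mult.assoc)
      qed
      then show ?thesis using C unfolding representable_def by metis
    qed
    have "representable (ichg v + ?e) (\<lambda>F :: 'a frame_data. fphi l F w)"
      using representable_add[OF representable_add[OF representable_add[OF a b1] b2] b3]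
      by (simp add: Cons phi_Cons)
    then show ?thesis by (simp add: Cons ichg_Cons)
  qed
qed

theorem representable_word_sum:
  assumes "\<forall>(c, w)\<in>set W. ichg w = p"
  shows "representable p (\<lambda>F :: 'a frame_data. \<Sum>(c, w)\<leftarrow>W. cst c * fphi l F w)"
  using assms
proof (induction W)
  case (Cons cw W)
  obtain c w where cw: "cw = (c, w)" by force
  have "representable p (\<lambda>F :: 'a frame_data. cst c * fphi l F w + (\<Sum>(c, w)\<leftarrow>W. cst c * fphi l F w))"
  proof (rule representable_add)
    have "ichg w = p" using Cons.prems cw by simp
    then show "representable p (\<lambda>F :: 'a frame_data. cst c * fphi l F w)"
      using representable_cst[OF representable_phi[of w]] by blast
    show "representable p (\<lambda>F :: 'a frame_data. \<Sum>(c, w)\<leftarrow>W. cst c * fphi l F w)"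
      by (rule Cons.IH) (use Cons.prems in simp)
  qed
  then show ?case unfolding cw list.map sum_list.Cons prod.case .
next
  case Nil
  show ?case unfolding list.map sum_list.Nil by (rule representable_0)
qed

section \<open>Smooth functions\<close>

lemma Ck_on_cong:
  "open S \<Longrightarrow> (\<And>x. x \<in> S \<Longrightarrow> f x = g x) \<Longrightarrow> Ck_on n S f \<Longrightarrow> Ck_on n S g"
proof (induction n arbitrary: f g)
  case 0
  then show ?case by (auto intro: continuous_on_eq)
next
  case (Suc n)
  have d: "(f has_derivative f') (at x) \<Longrightarrow> (g has_derivative f') (at x)" if "x \<in> S" for x f'
    using Suc.prems that by (auto intro: has_derivative_transform_within_open)
  have 1: "g differentiable at x" if "x \<in> S" for x
    using Suc.prems(3) d[OF that] that unfolding Ck_on.simps differentiable_def by blast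
  have "frechet_derivative f (at x) = frechet_derivative g (at x)" if "x \<in> S" for x
    using Suc.prems(3) that d[OF that] frechet_derivative_at frechet_derivative_works by (metis Ck_on.simps(2))
  then have "Ck_on n S (\<lambda>x. frechet_derivative g (at x) v)" for v
    using Suc.IH[OF Suc.prems(1), of "\<lambda>x. frechet_derivative f (at x) v" "\<lambda>x. frechet_derivative g (at x) v"] Suc.prems(3) by auto
  then show ?case using 1 by simp
qed

lemma Ck_on_subset: "Ck_on n S f \<Longrightarrow> T \<subseteq> S \<Longrightarrow> Ck_on n T f"
  by (induction n arbitrary: f) (auto intro: continuous_on_subset)

lemma Ck_on_local:
  "(\<And>x. x \<in> S \<Longrightarrow> \<exists>T. open T \<and> x \<in> T \<and> Ck_on n T f) \<Longrightarrow> Ck_on n S f"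
proof (induction n arbitrary: f)
  case 0
  have "isCont f x" if x: "x \<in> S" for x
    using 0[OF x] by (auto simp: continuous_on_eq_continuous_at)
  then show ?case by (simp add: continuous_at_imp_continuous_on)
next
  case (Suc n)
  have "f differentiable at x" if x: "x \<in> S" for x using Suc.prems[OF x] by auto
  moreover have "Ck_on n S (\<lambda>x. frechet_derivative f (at x) v)" for v
    by (rule Suc.IH) (use Suc.prems in fastforce)
  ultimately show ?case by simp
qed

lemma Ck_on_SucI:
  assumes "open S" "\<And>x. x \<in> S \<Longrightarrow> (f has_derivative f' x) (at x)" "\<And>v. Ck_on n S (\<lambda>x. f' x v)"
  shows "Ck_on (Suc n) S f"
proof -
  have "frechet_derivative f (at x) = f' x" if "x \<in> S" for x
    using assms(2)[OF that] frechet_derivative_at by metis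
  then have "Ck_on n S (\<lambda>x. frechet_derivative f (at x) v)" for v
    using Ck_on_cong[OF assms(1) _ assms(3)[of v], of "\<lambda>x. frechet_derivative f (at x) v"] by simp
  then show ?thesis using assms(2) by (auto simp: differentiable_def)
qed

lemma Ck_on_deriv:
  assumes "Ck_on (Suc n) S f" "x \<in> S"
  shows "(f has_derivative frechet_derivative f (at x)) (at x)"
  using assms frechet_derivative_works by auto

lemma Ck_on_Suc: "Ck_on (Suc n) S f \<Longrightarrow> Ck_on n S f"
proof (induction n arbitrary: f)
  case 0
  then show ?case
    by (auto intro!: continuous_at_imp_continuous_on differentiable_imp_continuous_within)
next
  case (Suc n)
  have "f differentiable at x" if "x \<in> S" for x using Suc.prems that by (simp del: Ck_on.simps(2) add: Ck_on.simps(2)[of "Suc n" S f])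
  moreover have "Ck_on n S (\<lambda>x. frechet_derivative f (at x) v)" for v
    using Suc.prems by (intro Suc.IH) (simp del: Ck_on.simps(2) add: Ck_on.simps(2)[of "Suc n" S f])
  ultimately show ?case by simp
qed

lemma Ck_on_const: "Ck_on n S (\<lambda>x. c)"
proof (induction n arbitrary: c)
  case (Suc n)
  have "frechet_derivative (\<lambda>x. c) (at x) v = 0" for x v
    by (simp add: frechet_derivative_const)
  then show ?case using Suc by simp
qed simp

lemma Ck_on_linear: "open S \<Longrightarrow> bounded_linear L \<Longrightarrow> Ck_on n S f \<Longrightarrow> Ck_on n S (\<lambda>x. L (f x))"
proof (induction n arbitrary: f)
  case 0
  then show ?case by (auto intro: bounded_linear.continuous_on)
next
  case (Suc n)
  show ?case
  proof (rule Ck_on_SucI[OF Suc.prems(1)])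
    show "((\<lambda>x. L (f x)) has_derivative (\<lambda>v. L (frechet_derivative f (at x) v))) (at x)" if "x \<in> S" for x
      using bounded_linear.has_derivative[OF Suc.prems(2) Ck_on_deriv[OF Suc.prems(3) that]] .
    show "Ck_on n S (\<lambda>x. L (frechet_derivative f (at x) v))" for v
      using Suc by simp
  qed
qed

lemma Ck_on_add: "open S \<Longrightarrow> Ck_on n S f \<Longrightarrow> Ck_on n S g \<Longrightarrow> Ck_on n S (\<lambda>x. f x + g x)"
proof (induction n arbitrary: f g)
  case 0
  then show ?case by (auto intro: continuous_on_add)
next
  case (Suc n)
  show ?case
  proof (rule Ck_on_SucI[OF Suc.prems(1)])
    show "((\<lambda>x. f x + g x) has_derivative (\<lambda>v. frechet_derivative f (at x) v + frechet_derivative g (at x) v)) (at x)" if "x \<in> S" for x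
      by (intro has_derivative_add Ck_on_deriv[OF Suc.prems(2) that] Ck_on_deriv[OF Suc.prems(3) that])
    show "Ck_on n S (\<lambda>x. frechet_derivative f (at x) v + frechet_derivative g (at x) v)" for v
      using Suc by simp
  qed
qed

lemma Ck_on_sum: "open S \<Longrightarrow> (\<And>i. i \<in> I \<Longrightarrow> Ck_on n S (f i)) \<Longrightarrow> Ck_on n S (\<lambda>x. \<Sum>i\<in>I. f i x)"
  by (induction I rule: infinite_finite_induct) (auto intro: Ck_on_add Ck_on_const)

lemma Ck_on_bilinear:
  "open S \<Longrightarrow> bounded_bilinear B \<Longrightarrow> Ck_on n S f \<Longrightarrow> Ck_on n S g \<Longrightarrow> Ck_on n S (\<lambda>x. B (f x) (g x))"
proof (induction n arbitrary: f g)
  case 0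
  then show ?case by (auto intro: bounded_bilinear.continuous_on)
next
  case (Suc n)
  show ?case
  proof (rule Ck_on_SucI[OF Suc.prems(1)])
    show "((\<lambda>x. B (f x) (g x)) has_derivative
       (\<lambda>v. B (f x) (frechet_derivative g (at x) v) + B (frechet_derivative f (at x) v) (g x))) (at x)" if "x \<in> S" for x
      by (intro bounded_bilinear.FDERIV[OF Suc.prems(2)] Ck_on_deriv[OF Suc.prems(3) that] Ck_on_deriv[OF Suc.prems(4) that])
    show "Ck_on n S (\<lambda>x. B (f x) (frechet_derivative g (at x) v) + B (frechet_derivative f (at x) v) (g x))" for v
      using Suc Ck_on_Suc[OF Suc.prems(3)] Ck_on_Suc[OF Suc.prems(4)] by (intro Ck_on_add Suc.IH) auto
  qed
qed

lemmas Ck_on_mult = Ck_on_bilinear[OF _ bounded_bilinear_mult]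
lemmas Ck_on_scaleR = Ck_on_bilinear[OF _ bounded_bilinear_scaleR]

lemma Ck_on_inverse:
  fixes f :: "'a::euclidean_space \<Rightarrow> complex"
  shows "open S \<Longrightarrow> (\<And>x. x \<in> S \<Longrightarrow> f x \<noteq> 0) \<Longrightarrow> Ck_on n S f \<Longrightarrow> Ck_on n S (\<lambda>x. inverse (f x))"
proof (induction n)
  case 0
  then show ?case by (auto intro: continuous_on_inverse)
next
  case (Suc n)
  show ?case
  proof (rule Ck_on_SucI[OF Suc.prems(1)])
    show "((\<lambda>x. inverse (f x)) has_derivative (\<lambda>v. - 1 * (inverse (f x) * (frechet_derivative f (at x) v * inverse (f x))))) (at x)" if "x \<in> S" for x
      using Deriv.has_derivative_inverse[OF Suc.prems(2)[OF that] Ck_on_deriv[OF Suc.prems(3) that]] by (simp add: mult.assoc)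
    show "Ck_on n S (\<lambda>x. - 1 * (inverse (f x) * (frechet_derivative f (at x) v * inverse (f x))))" for v
      using Suc Ck_on_Suc[OF Suc.prems(3)] by (intro Ck_on_mult Ck_on_const Suc.IH) auto
  qed
qed

lemma Ck_on_exp:
  fixes f :: "'a::euclidean_space \<Rightarrow> complex"
  shows "open S \<Longrightarrow> Ck_on n S f \<Longrightarrow> Ck_on n S (\<lambda>x. exp (f x))"
proof (induction n)
  case 0
  then show ?case by (auto intro: continuous_on_exp)
next
  case (Suc n)
  show ?case
  proof (rule Ck_on_SucI[OF Suc.prems(1)])
    show "((\<lambda>x. exp (f x)) has_derivative (\<lambda>v. exp (f x) * frechet_derivative f (at x) v)) (at x)" if "x \<in> S" for x
    proof -
      have "(exp has_derivative (\<lambda>y. exp (f x) * y)) (at (f x))"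
        using DERIV_exp[of "f x"] by (simp add: has_field_derivative_def)
      from has_derivative_compose[OF Ck_on_deriv[OF Suc.prems(2) that] this] show ?thesis .
    qed
    show "Ck_on n S (\<lambda>x. exp (f x) * frechet_derivative f (at x) v)" for v
      using Suc Ck_on_Suc[OF Suc.prems(2)] by (intro Ck_on_mult) auto
  qed
qed

lemma Ck_on_compose:
  fixes \<tau> :: "'a::euclidean_space \<Rightarrow> 'b::euclidean_space"
  shows "open S \<Longrightarrow> open T \<Longrightarrow> \<tau> ` S \<subseteq> T \<Longrightarrow> Ck_on n S \<tau> \<Longrightarrow> Ck_on n T g \<Longrightarrow> Ck_on n S (\<lambda>x. g (\<tau> x))"
proof (induction n arbitrary: g)
  case 0
  then show ?case using continuous_on_compose2[of T g S \<tau>] by simp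
next
  case (Suc n)
  have t: "\<tau> x \<in> T" if "x \<in> S" for x using Suc.prems(3) that by auto
  show ?case
  proof (rule Ck_on_SucI[OF Suc.prems(1)])
    \<comment> \<open>\<open>Ck_on\<close> speaks of derivatives in a fixed direction, whereas the
      chain rule differentiates g in a direction that moves with x. Expansion in the basis turns
      this into products with fixed directions.\<close>
    show "((\<lambda>x. g (\<tau> x)) has_derivative
       (\<lambda>v. \<Sum>b\<in>Basis. (frechet_derivative \<tau> (at x) v \<bullet> b) *\<^sub>R frechet_derivative g (at (\<tau> x)) b)) (at x)" if "x \<in> S" for x
    proof -
      have g: "(g has_derivative frechet_derivative g (at (\<tau> x))) (at (\<tau> x))"
        using Ck_on_deriv[OF Suc.prems(5) t[OF that]] .
      have eq: "frechet_derivative g (at (\<tau> x)) y = (\<Sum>b\<in>Basis. (y \<bullet> b) *\<^sub>R frechet_derivative g (at (\<tau> x)) b)" for y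
      proof -
        have lin: "linear (frechet_derivative g (at (\<tau> x)))" using has_derivative_linear[OF g] .
        have eq: "frechet_derivative g (at (\<tau> x)) y = frechet_derivative g (at (\<tau> x)) (\<Sum>b\<in>Basis. (y \<bullet> b) *\<^sub>R b)"
          by (simp only: euclidean_representation)
        also have "\<dots> = (\<Sum>b\<in>Basis. (y \<bullet> b) *\<^sub>R frechet_derivative g (at (\<tau> x)) b)"
          by (simp only: linear_sum[OF lin] linear_scale[OF lin])
        finally show ?thesis .
      qed
      have "((\<lambda>x. g (\<tau> x)) has_derivative (\<lambda>v. frechet_derivative g (at (\<tau> x)) (frechet_derivative \<tau> (at x) v))) (at x)"
        using has_derivative_compose[OF Ck_on_deriv[OF Suc.prems(4) that] g] .
      then show ?thesis by (rule has_derivative_eq_rhs) (rule ext, rule eq)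
    qed
    show "Ck_on n S (\<lambda>x. \<Sum>b\<in>Basis. (frechet_derivative \<tau> (at x) v \<bullet> b) *\<^sub>R frechet_derivative g (at (\<tau> x)) b)" for v
    proof (intro Ck_on_sum Ck_on_scaleR Suc.prems)
      fix b :: 'b
      show "Ck_on n S (\<lambda>x. frechet_derivative \<tau> (at x) v \<bullet> b)"
        using Suc.prems by (intro Ck_on_linear[where L = "\<lambda>y. y \<bullet> b"]) (auto intro: bounded_linear_inner_left)
      show "Ck_on n S (\<lambda>x. frechet_derivative g (at (\<tau> x)) b)"
        using Suc.prems Ck_on_Suc[OF Suc.prems(4)] by (intro Suc.IH) auto
    qed
  qed
qed

lemma Cinf_on_deriv: "Cinf_on S f \<Longrightarrow> Cinf_on S (\<lambda>x. frechet_derivative f (at x) v)"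
  unfolding Cinf_on_def using Ck_on.simps(2)[of _ S f] by blast

lemma Cinf_on_has_derivative:
  "Cinf_on S f \<Longrightarrow> x \<in> S \<Longrightarrow> (f has_derivative frechet_derivative f (at x)) (at x)"
  unfolding Cinf_on_def using Ck_on_deriv by blast

lemma Ck_on_id: "open S \<Longrightarrow> Ck_on n S (\<lambda>x. x)"
proof (cases n)
  case (Suc m)
  assume "open S"
  then show ?thesis unfolding Suc by (rule Ck_on_SucI) (auto intro: has_derivative_ident Ck_on_const)
qed simp

lemma Cinf_on_cong: "open S \<Longrightarrow> (\<And>x. x \<in> S \<Longrightarrow> f x = g x) \<Longrightarrow> Cinf_on S f \<Longrightarrow> Cinf_on S g"
  unfolding Cinf_on_def using Ck_on_cong by blast

section \<open>Smooth functions on the manifold\<close>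

locale manifold =
  fixes M :: "'a crdata"
  assumes M: "smooth_3manifold M"
begin

abbreviation "opn \<equiv> openin (mtop M)"
abbreviation "sm \<equiv> smooth_fun M"
abbreviation "pts \<equiv> topspace (mtop M)"

lemma chart: 
  assumes "(U, \<phi>) \<in> atlas M"
  shows chart_open: "opn U" and chart_inj: "inj_on \<phi> U"
    and chart_image: "opn V \<Longrightarrow> open (\<phi> ` (U \<inter> V))"
proof -
  have c: "is_chart (mtop M) U \<phi>" using M assms by (auto simp: smooth_3manifold_def)
  then show "opn U" by (simp add: is_chart_def)
  have h: "homeomorphic_map (subtopology (mtop M) U) (top_of_set (\<phi> ` U)) \<phi>" and o: "open (\<phi> ` U)"
    using c by (auto simp: is_chart_def)
  have ts: "topspace (subtopology (mtop M) U) = U"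
    using openin_subset[OF \<open>opn U\<close>] by auto
  show "inj_on \<phi> U" using homeomorphic_imp_injective_map[OF h] ts by simp
  show "open (\<phi> ` (U \<inter> V))" if V: "opn V"
  proof -
    have "openin (subtopology (mtop M) U) (U \<inter> V)"
      using V by (metis inf_commute openin_subtopology_Int)
    then have "openin (top_of_set (\<phi> ` U)) (\<phi> ` (U \<inter> V))"
      using homeomorphic_imp_open_map[OF h] by (auto simp: open_map_def)
    then show ?thesis using o openin_open_trans by blast
  qed
qed

lemma chart_inv: "(U, \<phi>) \<in> atlas M \<Longrightarrow> p \<in> U \<Longrightarrow> inv_into U \<phi> (\<phi> p) = p"
  using chart_inj inv_into_f_f by metis

lemma chart_exists: "p \<in> pts \<Longrightarrow> \<exists>U \<phi>. (U, \<phi>) \<in> atlas M \<and> p \<in> U"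
  using M by (auto simp: smooth_3manifold_def)

lemma opn_sub: "opn U \<Longrightarrow> p \<in> U \<Longrightarrow> p \<in> pts"
  using openin_subset by blast

lemma smI:
  assumes "\<And>U \<phi> n. (U, \<phi>) \<in> atlas M \<Longrightarrow> Ck_on n (\<phi> ` (U \<inter> W)) (\<lambda>x. f (inv_into U \<phi> x))"
  shows "sm W f"
  using assms by (auto simp: smooth_fun_def Cinf_on_def o_def)

lemma smD: "sm W f \<Longrightarrow> (U, \<phi>) \<in> atlas M \<Longrightarrow> Ck_on n (\<phi> ` (U \<inter> W)) (\<lambda>x. f (inv_into U \<phi> x))"
  by (auto simp: smooth_fun_def Cinf_on_def o_def)

lemma sm_subset: "sm W f \<Longrightarrow> V \<subseteq> W \<Longrightarrow> sm V f"
  by (rule smI) (rule Ck_on_subset[OF smD], auto)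

lemma sm_cong: 
  assumes W: "opn W" and eq: "\<And>p. p \<in> W \<Longrightarrow> f p = g p" and f: "sm W f"
  shows "sm W g"
  unfolding smooth_fun_def Cinf_on_def
proof (clarify)
  fix U \<phi> n assume c: "(U, \<phi>) \<in> atlas M"
  show "Ck_on n (\<phi> ` (U \<inter> W)) (g \<circ> inv_into U \<phi>)"
  proof (rule Ck_on_cong[OF chart_image[OF c W]])
    show "Ck_on n (\<phi> ` (U \<inter> W)) (f \<circ> inv_into U \<phi>)"
      using f c by (auto simp: smooth_fun_def Cinf_on_def)
    fix x assume "x \<in> \<phi> ` (U \<inter> W)"
    then show "(f \<circ> inv_into U \<phi>) x = (g \<circ> inv_into U \<phi>) x"
      using chart_inv[OF c] eq by auto
  qed
qed

lemma sm_local: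
  assumes "\<And>p. p \<in> W \<Longrightarrow> \<exists>V. opn V \<and> p \<in> V \<and> sm V f"
  shows "sm W f"
  unfolding smooth_fun_def Cinf_on_def
proof (clarify)
  fix U \<phi> n assume c: "(U, \<phi>) \<in> atlas M"
  show "Ck_on n (\<phi> ` (U \<inter> W)) (f \<circ> inv_into U \<phi>)"
  proof (rule Ck_on_local)
    fix x assume "x \<in> \<phi> ` (U \<inter> W)"
    then obtain p where p: "p \<in> U" "p \<in> W" "x = \<phi> p" by auto
    obtain V where V: "opn V" "p \<in> V" "sm V f" using assms p by blast
    have "Ck_on n (\<phi> ` (U \<inter> V)) (f \<circ> inv_into U \<phi>)"
      using V(3) c by (auto simp: smooth_fun_def Cinf_on_def)
    then show "\<exists>T. open T \<and> x \<in> T \<and> Ck_on n T (f \<circ> inv_into U \<phi>)"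
      using chart_image[OF c V(1)] p V by blast
  qed
qed

lemma sm_chartD: "(U, \<phi>) \<in> atlas M \<Longrightarrow> V \<subseteq> U \<Longrightarrow> sm V f \<Longrightarrow> Cinf_on (\<phi> ` V) (f \<circ> inv_into U \<phi>)"
  unfolding smooth_fun_def by (auto simp: Int_absorb1 split: prod.splits)

text \<open>Smoothness is required in all charts, and composition with the smooth transition maps
  transfers it from a single one.\<close>

lemma sm_chartI: 
  assumes c: "(U, \<phi>) \<in> atlas M" and V: "opn V" "V \<subseteq> U" and f: "Cinf_on (\<phi> ` V) (f \<circ> inv_into U \<phi>)"
  shows "sm V f"
  unfolding smooth_fun_def Cinf_on_def
proof (clarify)
  fix W \<psi> n assume d: "(W, \<psi>) \<in> atlas M"
  let ?t = "\<phi> \<circ> inv_into W \<psi>"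
  have o1: "open (\<psi> ` (W \<inter> V))" by (rule chart_image[OF d V(1)])
  have o2: "open (\<phi> ` V)" using chart_image[OF c V(1)] V(2) by (simp add: Int_absorb1)
  have t: "Ck_on n (\<psi> ` (W \<inter> V)) ?t"
  proof -
    have "Cinf_on (\<psi> ` (W \<inter> U)) ?t" using M c d by (auto simp: smooth_3manifold_def)
    then show ?thesis unfolding Cinf_on_def using V(2) by (meson Ck_on_subset Int_mono image_mono order_refl)
  qed
  have "?t ` (\<psi> ` (W \<inter> V)) \<subseteq> \<phi> ` V" using chart_inv[OF d] by auto
  then have "Ck_on n (\<psi> ` (W \<inter> V)) (\<lambda>x. (f \<circ> inv_into U \<phi>) (?t x))"
    using f unfolding Cinf_on_def by (intro Ck_on_compose[OF o1 o2 _ t]) blast+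
  then show "Ck_on n (\<psi> ` (W \<inter> V)) (f \<circ> inv_into W \<psi>)"
  proof (rule Ck_on_cong[OF o1, rotated])
    fix x assume "x \<in> \<psi> ` (W \<inter> V)"
    then obtain p where p: "p \<in> W" "p \<in> V" "x = \<psi> p" by auto
    then have "inv_into W \<psi> x = p" "inv_into U \<phi> (\<phi> p) = p" using chart_inv[OF d] chart_inv[OF c] V(2) by auto
    then show "(f \<circ> inv_into U \<phi>) ((\<phi> \<circ> inv_into W \<psi>) x) = (f \<circ> inv_into W \<psi>) x" by simp
  qed
qed

lemma sm_const: "sm W (\<lambda>p. c)"
  by (rule smI) (rule Ck_on_const)

context
  fixes W assumes W: "opn W"
begin

lemma sm_add: "sm W f \<Longrightarrow> sm W g \<Longrightarrow> sm W (\<lambda>p. f p + g p)"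
  by (rule smI) (intro Ck_on_add smD chart_image W; assumption)

lemma sm_mult: "sm W f \<Longrightarrow> sm W g \<Longrightarrow> sm W (\<lambda>p. f p * g p)"
  by (rule smI) (intro Ck_on_mult smD chart_image W; assumption)

lemma sm_uminus: "sm W f \<Longrightarrow> sm W (\<lambda>p. - f p)"
  using sm_mult[OF sm_const[of W "- 1"]] by simp

lemma sm_diff: "sm W f \<Longrightarrow> sm W g \<Longrightarrow> sm W (\<lambda>p. f p - g p)"
  using sm_add[OF _ sm_uminus] by simp

lemma sm_cnj: "sm W f \<Longrightarrow> sm W (\<lambda>p. cnj (f p))"
  by (rule smI) (intro Ck_on_linear[OF _ bounded_linear_cnj] smD chart_image W; assumption)

lemma sm_exp: "sm W f \<Longrightarrow> sm W (\<lambda>p. exp (f p))"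
  by (rule smI) (intro Ck_on_exp smD chart_image W; assumption)

lemma sm_inverse: 
  assumes "sm W f" "\<And>p. p \<in> W \<Longrightarrow> f p \<noteq> 0" shows "sm W (\<lambda>p. inverse (f p))"
proof (rule smI)
  fix U \<phi> n assume c: "(U, \<phi>) \<in> atlas M"
  show "Ck_on n (\<phi> ` (U \<inter> W)) (\<lambda>x. inverse (f (inv_into U \<phi> x)))"
    using assms(2) chart_inv[OF c] by (intro Ck_on_inverse smD c chart_image W assms(1)) auto
qed

lemma sm_divide: "sm W f \<Longrightarrow> sm W g \<Longrightarrow> (\<And>p. p \<in> W \<Longrightarrow> g p \<noteq> 0) \<Longrightarrow> sm W (\<lambda>p. f p / g p)"
  unfolding divide_inverse by (intro sm_mult sm_inverse)

lemma sm_sum: "(\<And>i. i \<in> I \<Longrightarrow> sm W (f i)) \<Longrightarrow> sm W (\<lambda>p. \<Sum>i\<in>I. f i p)"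
  by (induction I rule: infinite_finite_induct) (auto intro: sm_add sm_const)

end

lemma smooth_atI: "opn U \<Longrightarrow> p \<in> U \<Longrightarrow> sm U f \<Longrightarrow> smooth_at M p f"
  by (auto simp: smooth_at_def)

lemma smooth_at2: 
  assumes "smooth_at M p f" "smooth_at M p g" 
  obtains U where "opn U" "p \<in> U" "sm U f" "sm U g"
proof -
  obtain U V where "opn U" "p \<in> U" "sm U f" "opn V" "p \<in> V" "sm V g" using assms by (auto simp: smooth_at_def)
  then show ?thesis by (intro that[of "U \<inter> V"]) (auto intro: sm_subset openin_Int)
qed

lemma smooth_at_add: "smooth_at M p f \<Longrightarrow> smooth_at M p g \<Longrightarrow> smooth_at M p (\<lambda>q. f q + g q)"
  by (erule smooth_at2, assumption) (auto intro: smooth_atI sm_add)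
lemma smooth_at_mult: "smooth_at M p f \<Longrightarrow> smooth_at M p g \<Longrightarrow> smooth_at M p (\<lambda>q. f q * g q)"
  by (erule smooth_at2, assumption) (auto intro: smooth_atI sm_mult)
lemma smooth_at_diff: "smooth_at M p f \<Longrightarrow> smooth_at M p g \<Longrightarrow> smooth_at M p (\<lambda>q. f q - g q)"
  by (erule smooth_at2, assumption) (auto intro: smooth_atI sm_diff)
lemma smooth_at_const: "p \<in> pts \<Longrightarrow> smooth_at M p (\<lambda>q. c)"
  using smooth_atI[OF openin_topspace _ sm_const] by blast
lemma smooth_at_cnj: "smooth_at M p f \<Longrightarrow> smooth_at M p (\<lambda>q. cnj (f q))"
  by (auto simp: smooth_at_def intro: sm_cnj)
lemma smooth_at_cnj_iff: "smooth_at M p (\<lambda>q. cnj (f q)) \<longleftrightarrow> smooth_at M p f"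
  using smooth_at_cnj[of p "\<lambda>q. cnj (f q)"] smooth_at_cnj[of p f] by auto
lemma smooth_at_cong: "opn V \<Longrightarrow> p \<in> V \<Longrightarrow> (\<And>q. q \<in> V \<Longrightarrow> f q = g q) \<Longrightarrow> smooth_at M p f \<Longrightarrow> smooth_at M p g"
proof -
  assume V: "opn V" "p \<in> V" "\<And>q. q \<in> V \<Longrightarrow> f q = g q" and f: "smooth_at M p f"
  obtain U where U: "opn U" "p \<in> U" "sm U f" using f by (auto simp: smooth_at_def)
  have "sm (U \<inter> V) g" by (rule sm_cong[of _ f]) (use U V in \<open>auto intro: sm_subset\<close>)
  then show ?thesis using U V by (intro smooth_atI[of "U \<inter> V"]) auto
qed
lemma smooth_at_pts: "smooth_at M p f \<Longrightarrow> p \<in> pts"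
  by (auto simp: smooth_at_def intro: opn_sub)
lemma smooth_at_sum: "p \<in> pts \<Longrightarrow> (\<And>i. i \<in> I \<Longrightarrow> smooth_at M p (f i)) \<Longrightarrow> smooth_at M p (\<lambda>q. \<Sum>i\<in>I. f i q)"
  by (induction I rule: infinite_finite_induct) (simp_all add: smooth_at_add smooth_at_const)

section \<open>Tangent vectors\<close>

lemma ct_add: "v \<in> ctangent M p \<Longrightarrow> smooth_at M p f \<Longrightarrow> smooth_at M p g \<Longrightarrow> v (\<lambda>q. f q + g q) = v f + v g"
  and ct_mult: "v \<in> ctangent M p \<Longrightarrow> smooth_at M p f \<Longrightarrow> smooth_at M p g \<Longrightarrow> v (\<lambda>q. f q * g q) = v f * g p + f p * v g"
  and ct_scale: "v \<in> ctangent M p \<Longrightarrow> smooth_at M p f \<Longrightarrow> v (\<lambda>q. c * f q) = c * v f"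
  and ct_nonsmooth: "v \<in> ctangent M p \<Longrightarrow> \<not> smooth_at M p f \<Longrightarrow> v f = 0"
  by (auto simp: ctangent_def)

lemma ctI:
  assumes "\<And>f g. smooth_at M p f \<Longrightarrow> smooth_at M p g \<Longrightarrow> v (\<lambda>q. f q + g q) = v f + v g"
    and "\<And>f g. smooth_at M p f \<Longrightarrow> smooth_at M p g \<Longrightarrow> v (\<lambda>q. f q * g q) = v f * g p + f p * v g"
    and "\<And>c f. smooth_at M p f \<Longrightarrow> v (\<lambda>q. c * f q) = c * v f"
    and "\<And>f. \<not> smooth_at M p f \<Longrightarrow> v f = 0"
  shows "v \<in> ctangent M p"
  using assms by (auto simp: ctangent_def)

lemma ct_tadd: "v \<in> ctangent M p \<Longrightarrow> w \<in> ctangent M p \<Longrightarrow> tadd v w \<in> ctangent M p"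
  by (rule ctI) (auto simp: tadd_def ct_add ct_mult ct_scale ct_nonsmooth algebra_simps)

lemma ct_tscale: "v \<in> ctangent M p \<Longrightarrow> tscale c v \<in> ctangent M p"
  by (rule ctI) (auto simp: tscale_def ct_add ct_mult ct_scale ct_nonsmooth algebra_simps)

lemma ct_tconj: assumes v: "v \<in> ctangent M p" shows "tconj v \<in> ctangent M p"
proof (rule ctI)
  fix f g assume f: "smooth_at M p f" and g: "smooth_at M p g"
  note fg = smooth_at_cnj[OF f] smooth_at_cnj[OF g]
  show "tconj v (\<lambda>q. f q + g q) = tconj v f + tconj v g" "tconj v (\<lambda>q. f q * g q) = tconj v f * g p + f p * tconj v g"
    using ct_add[OF v fg] ct_mult[OF v fg] by (simp_all add: tconj_def)
next
  fix c f assume f: "smooth_at M p f"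
  show "tconj v (\<lambda>q. c * f q) = c * tconj v f"
    using ct_scale[OF v smooth_at_cnj[OF f], of "cnj c"] by (simp add: tconj_def)
qed (simp add: tconj_def ct_nonsmooth[OF v] smooth_at_cnj_iff)

lemma ct_diff: "v \<in> ctangent M p \<Longrightarrow> smooth_at M p f \<Longrightarrow> smooth_at M p g \<Longrightarrow> v (\<lambda>q. f q - g q) = v f - v g"
  using ct_add[of v p f "\<lambda>q. - 1 * g q"] ct_scale[of v p g "- 1"] smooth_at_mult[OF smooth_at_const, of p g "- 1"] smooth_at_pts[of p g]
  by simp

lemma ct_const: "v \<in> ctangent M p \<Longrightarrow> v (\<lambda>q. c) = 0"
proof (cases "p \<in> pts")
  case True
  assume v: "v \<in> ctangent M p"
  have "v (\<lambda>q. 1 * 1) = v (\<lambda>q. 1) * 1 + 1 * v (\<lambda>q. 1)"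
    using ct_mult[OF v smooth_at_const[OF True] smooth_at_const[OF True], of 1 1] .
  then have "v (\<lambda>q. 1) = 0" by simp
  then show ?thesis using ct_scale[OF v smooth_at_const[OF True], of c 1] by simp
next
  case False
  assume v: "v \<in> ctangent M p"
  then show ?thesis using ct_nonsmooth[OF v] smooth_at_pts False by blast
qed

lemma ct_cong:
  assumes v: "v \<in> ctangent M p" and V: "opn V" "p \<in> V" and eq: "\<And>q. q \<in> V \<Longrightarrow> f q = g q"
  shows "v f = v g"
proof (cases "smooth_at M p f")
  case True
  then have g: "smooth_at M p g" using smooth_at_cong[OF V, of f g] eq by blast
  \<comment> \<open>The function ?\<chi> vanishes near p and is 1 off V, so f - g = ?\<chi> (f - g)
    is a product of two functions that vanish at p, and the Leibniz rule kills it.\<close>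
  let ?h = "\<lambda>q. f q - g q" and ?\<chi> = "\<lambda>q. if q \<in> V then 0 else 1 :: complex"
  have h: "smooth_at M p ?h" using True g by (rule smooth_at_diff)
  have c: "smooth_at M p ?\<chi>"
    by (rule smooth_at_cong[OF V, of "\<lambda>q. 0"]) (auto intro: smooth_at_const opn_sub V)
  have "?h = (\<lambda>q. ?\<chi> q * ?h q)" using eq by auto
  then have "v ?h = v ?\<chi> * ?h p + ?\<chi> p * v ?h" using ct_mult[OF v c h] by metis
  then have "v ?h = 0" using V eq by simp
  then show ?thesis using ct_diff[OF v True g] by simp
next
  case False
  then have "\<not> smooth_at M p g" using smooth_at_cong[OF V, of g f] eq by auto
  then show ?thesis using False ct_nonsmooth[OF v] by simp
qed

lemma ct_sum: "v \<in> ctangent M p \<Longrightarrow> p \<in> pts \<Longrightarrow> (\<And>i. i \<in> I \<Longrightarrow> smooth_at M p (f i)) \<Longrightarrow> v (\<lambda>q. \<Sum>i\<in>I. f i q) = (\<Sum>i\<in>I. v (f i))"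
proof (induction I rule: infinite_finite_induct)
  case (insert i I)
  have "smooth_at M p (\<lambda>q. \<Sum>i\<in>I. f i q)" using insert by (intro smooth_at_sum) auto
  then show ?case using insert by (simp add: ct_add[OF insert(4)])
qed (auto simp: ct_const)

lemma smooth_vfieldD:
  "smooth_vfield M U X \<Longrightarrow> p \<in> U \<Longrightarrow> X p \<in> ctangent M p"
  "smooth_vfield M U X \<Longrightarrow> opn V \<Longrightarrow> V \<subseteq> U \<Longrightarrow> sm V f \<Longrightarrow> sm V (\<lambda>p. X p f)"
  by (auto simp: smooth_vfield_def)

lemma smooth_vfield_subset: "smooth_vfield M U X \<Longrightarrow> V \<subseteq> U \<Longrightarrow> smooth_vfield M V X"
  unfolding smooth_vfield_def by blast

lemma smooth_vfield_local:
  assumes "\<And>p. p \<in> U \<Longrightarrow> \<exists>V. opn V \<and> p \<in> V \<and> smooth_vfield M V X"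
  shows "smooth_vfield M U X"
  unfolding smooth_vfield_def
proof (intro conjI allI ballI impI)
  show "X p \<in> ctangent M p" if "p \<in> U" for p using assms[OF that] smooth_vfieldD by blast
  fix V f assume V: "opn V" "V \<subseteq> U" "sm V f"
  show "sm V (\<lambda>p. X p f)"
  proof (rule sm_local)
    fix p assume "p \<in> V"
    then obtain W where W: "opn W" "p \<in> W" "smooth_vfield M W X" using assms V by blast
    have "sm (V \<inter> W) (\<lambda>p. X p f)"
      by (rule smooth_vfieldD(2)[OF W(3)]) (use V W in \<open>auto intro: sm_subset\<close>)
    then show "\<exists>V. opn V \<and> p \<in> V \<and> sm V (\<lambda>p. X p f)" using \<open>p \<in> V\<close> W V by blast
  qed
qed

lemma smooth_vfield_cong:
  assumes "opn U" "smooth_vfield M U X" "\<And>p. p \<in> U \<Longrightarrow> X p = Y p"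
  shows "smooth_vfield M U Y"
  unfolding smooth_vfield_def
proof (intro conjI allI ballI impI)
  show "Y p \<in> ctangent M p" if "p \<in> U" for p
    using smooth_vfieldD(1)[OF assms(2) that] assms(3)[OF that] by simp
  fix V f assume V: "opn V" "V \<subseteq> U" "sm V f"
  show "sm V (\<lambda>p. Y p f)"
    by (rule sm_cong[OF V(1) _ smooth_vfieldD(2)[OF assms(2) V]]) (simp add: assms(3)[OF subsetD[OF V(2)]])
qed

lemma smooth_vfield_tadd: "opn U \<Longrightarrow> smooth_vfield M U X \<Longrightarrow> smooth_vfield M U Y \<Longrightarrow> smooth_vfield M U (\<lambda>p. tadd (X p) (Y p))"
  unfolding smooth_vfield_def by (auto simp: ct_tadd) (simp add: tadd_def sm_add)

lemma smooth_vfield_tscale: 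
  assumes "opn U" "smooth_vfield M U X" "sm U a" shows "smooth_vfield M U (\<lambda>p. tscale (a p) (X p))"
  using assms unfolding smooth_vfield_def by (auto simp: ct_tscale) (auto simp: tscale_def intro!: sm_mult intro: sm_subset)

lemma smooth_vfield_vconj: "opn U \<Longrightarrow> smooth_vfield M U X \<Longrightarrow> smooth_vfield M U (vconj X)"
  unfolding smooth_vfield_def vconj_def by (auto simp: ct_tconj) (auto simp: tconj_def intro!: sm_cnj)

lemma smooth_at_vfield: "opn U \<Longrightarrow> p \<in> U \<Longrightarrow> smooth_vfield M U X \<Longrightarrow> smooth_at M p f \<Longrightarrow> smooth_at M p (\<lambda>q. X q f)"
proof -
  assume U: "opn U" "p \<in> U" "smooth_vfield M U X" and f: "smooth_at M p f"
  then obtain V where V: "opn V" "p \<in> V" "sm V f" by (auto simp: smooth_at_def)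
  have "sm (U \<inter> V) (\<lambda>q. X q f)" by (rule smooth_vfieldD(2)[OF U(3)]) (use U V in \<open>auto intro: sm_subset\<close>)
  then show ?thesis using U V by (intro smooth_atI[of "U \<inter> V"]) auto
qed

lemma lie_bracket_ct:
  assumes U: "opn U" "p \<in> U" and X: "smooth_vfield M U X" and Y: "smooth_vfield M U Y"
  shows "lie_bracket M X Y p \<in> ctangent M p"
proof (rule ctI)
  have Xp: "X p \<in> ctangent M p" and Yp: "Y p \<in> ctangent M p" using smooth_vfieldD(1) X Y U by blast+
  note s = smooth_at_vfield[OF U X] smooth_at_vfield[OF U Y]
  fix f g assume f: "smooth_at M p f" and g: "smooth_at M p g"
  obtain V where V: "opn V" "p \<in> V" "sm V f" "sm V g" using smooth_at2[OF f g] by blast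
  have VU: "opn (U \<inter> V)" "p \<in> U \<inter> V" using U V by auto
  have sa: "smooth_at M q f" "smooth_at M q g" if "q \<in> U \<inter> V" for q using that V smooth_atI by blast+
  have Xa: "X p (\<lambda>q. Y q (\<lambda>q. f q + g q)) = X p (\<lambda>q. Y q f + Y q g)"
    by (rule ct_cong[OF Xp VU]) (use sa smooth_vfieldD(1)[OF Y] ct_add in blast)
  have Ya: "Y p (\<lambda>q. X q (\<lambda>q. f q + g q)) = Y p (\<lambda>q. X q f + X q g)"
    by (rule ct_cong[OF Yp VU]) (use sa smooth_vfieldD(1)[OF X] ct_add in blast)
  show "lie_bracket M X Y p (\<lambda>q. f q + g q) = lie_bracket M X Y p f + lie_bracket M X Y p g"
    using f g s by (simp add: lie_bracket_def smooth_at_add Xa Ya ct_add[OF Xp] ct_add[OF Yp])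
  have Xm: "X p (\<lambda>q. Y q (\<lambda>q. f q * g q)) = X p (\<lambda>q. Y q f * g q + f q * Y q g)"
    by (rule ct_cong[OF Xp VU]) (use sa smooth_vfieldD(1)[OF Y] ct_mult in blast)
  have Ym: "Y p (\<lambda>q. X q (\<lambda>q. f q * g q)) = Y p (\<lambda>q. X q f * g q + f q * X q g)"
    by (rule ct_cong[OF Yp VU]) (use sa smooth_vfieldD(1)[OF X] ct_mult in blast)
  show "lie_bracket M X Y p (\<lambda>q. f q * g q) = lie_bracket M X Y p f * g p + f p * lie_bracket M X Y p g"
    using f g s by (simp add: lie_bracket_def smooth_at_mult Xm Ym ct_add[OF Xp] ct_add[OF Yp] ct_mult[OF Xp] ct_mult[OF Yp] algebra_simps)
next
  have Xp: "X p \<in> ctangent M p" and Yp: "Y p \<in> ctangent M p" using smooth_vfieldD(1) X Y U by blast+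
  note s = smooth_at_vfield[OF U X] smooth_at_vfield[OF U Y]
  fix c f assume f: "smooth_at M p f"
  then obtain V where V: "opn V" "p \<in> V" "sm V f" by (auto simp: smooth_at_def)
  have VU: "opn (U \<inter> V)" "p \<in> U \<inter> V" using U V by auto
  have sa: "smooth_at M q f" if "q \<in> U \<inter> V" for q using that V smooth_atI by blast
  have Xa: "X p (\<lambda>q. Y q (\<lambda>q. c * f q)) = X p (\<lambda>q. c * Y q f)"
    by (rule ct_cong[OF Xp VU]) (use sa smooth_vfieldD(1)[OF Y] ct_scale in blast)
  have Ya: "Y p (\<lambda>q. X q (\<lambda>q. c * f q)) = Y p (\<lambda>q. c * X q f)"
    by (rule ct_cong[OF Yp VU]) (use sa smooth_vfieldD(1)[OF X] ct_scale in blast)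
  have "smooth_at M p (\<lambda>q. c * f q)" by (rule smooth_at_mult[OF smooth_at_const[OF smooth_at_pts[OF f]] f])
  then show "lie_bracket M X Y p (\<lambda>q. c * f q) = c * lie_bracket M X Y p f"
    using f s by (simp add: lie_bracket_def Xa Ya ct_scale[OF Xp] ct_scale[OF Yp] algebra_simps)
next
  fix f assume "\<not> smooth_at M p f"
  then show "lie_bracket M X Y p f = 0" by (simp add: lie_bracket_def)
qed

lemma smooth_lie_bracket:
  assumes U: "opn U" and X: "smooth_vfield M U X" and Y: "smooth_vfield M U Y"
  shows "smooth_vfield M U (lie_bracket M X Y)"
  unfolding smooth_vfield_def
proof (intro conjI allI ballI impI)
  show "lie_bracket M X Y p \<in> ctangent M p" if "p \<in> U" for p by (rule lie_bracket_ct[OF U that X Y])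
  fix V f assume V: "opn V" "V \<subseteq> U" "sm V f"
  have "sm V (\<lambda>p. X p (\<lambda>q. Y q f) - Y p (\<lambda>q. X q f))"
    using smooth_vfieldD(2)[OF X V(1,2)] smooth_vfieldD(2)[OF Y V(1,2)] V by (intro sm_diff) auto
  then show "sm V (\<lambda>p. lie_bracket M X Y p f)"
    by (rule sm_cong[OF V(1), rotated]) (use V smooth_atI in \<open>auto simp: lie_bracket_def\<close>)
qed

section \<open>Coordinate vector fields\<close>

definition dcoord :: "'a set \<Rightarrow> ('a \<Rightarrow> real^3) \<Rightarrow> 3 \<Rightarrow> 'a vfield" where
  "dcoord U \<phi> i p f = (if smooth_at M p f then frechet_derivative (f \<circ> inv_into U \<phi>) (at (\<phi> p)) (axis i 1) else 0)"

definition xcoord :: "('a \<Rightarrow> real^3) \<Rightarrow> 3 \<Rightarrow> 'a \<Rightarrow> complex" where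
  "xcoord \<phi> i p = complex_of_real (\<phi> p $ i)"

context
  fixes U \<phi> assumes c: "(U, \<phi>) \<in> atlas M"
begin

lemma smooth_xcoord: "sm U (xcoord \<phi> i)"
proof (rule sm_chartI[OF c chart_open[OF c] order_refl])
  have o: "open (\<phi> ` U)" using chart_image[OF c chart_open[OF c]] by simp
  have "bounded_linear (\<lambda>x::real^3. complex_of_real (x $ i))"
    by (intro bounded_linear_of_real[THEN bounded_linear_compose] bounded_linear_vec_nth)
  then have "Ck_on n (\<phi> ` U) (\<lambda>x. complex_of_real (x $ i))" for n
    using Ck_on_linear[OF o _ Ck_on_id[OF o]] by blast
  then show "Cinf_on (\<phi> ` U) (xcoord \<phi> i \<circ> inv_into U \<phi>)"
    unfolding Cinf_on_def using Ck_on_cong[OF o, of "\<lambda>x. complex_of_real (x $ i)" "xcoord \<phi> i \<circ> inv_into U \<phi>"]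
    by (auto simp: xcoord_def f_inv_into_f)
qed

lemma smooth_at_deriv:
  assumes "p \<in> U" "smooth_at M p f"
  shows "(f \<circ> inv_into U \<phi> has_derivative frechet_derivative (f \<circ> inv_into U \<phi>) (at (\<phi> p))) (at (\<phi> p))"
proof -
  obtain V where V: "opn V" "p \<in> V" "sm V f" using assms by (auto simp: smooth_at_def)
  have "Cinf_on (\<phi> ` (U \<inter> V)) (f \<circ> inv_into U \<phi>)"
    by (rule sm_chartD[OF c]) (use V in \<open>auto intro: sm_subset\<close>)
  then show ?thesis by (rule Cinf_on_has_derivative) (use assms V in auto)
qed

lemma dcoord_ct: assumes p: "p \<in> U" shows "dcoord U \<phi> i p \<in> ctangent M p"
proof -
  have inv: "inv_into U \<phi> (\<phi> p) = p" by (rule chart_inv[OF c p])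
  show ?thesis
  proof (rule ctI)
    fix f g assume f: "smooth_at M p f" and g: "smooth_at M p g"
    note df = smooth_at_deriv[OF p f] and dg = smooth_at_deriv[OF p g]
    have "((\<lambda>q. f q + g q) \<circ> inv_into U \<phi> has_derivative
      (\<lambda>v. frechet_derivative (f \<circ> inv_into U \<phi>) (at (\<phi> p)) v + frechet_derivative (g \<circ> inv_into U \<phi>) (at (\<phi> p)) v)) (at (\<phi> p))"
      using has_derivative_add[OF df dg] by (simp add: o_def)
    from fun_cong[OF frechet_derivative_at[OF this], of "axis i 1"]
    show "dcoord U \<phi> i p (\<lambda>q. f q + g q) = dcoord U \<phi> i p f + dcoord U \<phi> i p g"
      using f g smooth_at_add[OF f g] by (simp add: dcoord_def)
    have "((\<lambda>q. f q * g q) \<circ> inv_into U \<phi> has_derivative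
      (\<lambda>v. f p * frechet_derivative (g \<circ> inv_into U \<phi>) (at (\<phi> p)) v + frechet_derivative (f \<circ> inv_into U \<phi>) (at (\<phi> p)) v * g p)) (at (\<phi> p))"
      using has_derivative_mult[OF df dg] by (simp add: o_def inv)
    from fun_cong[OF frechet_derivative_at[OF this], of "axis i 1"]
    show "dcoord U \<phi> i p (\<lambda>q. f q * g q) = dcoord U \<phi> i p f * g p + f p * dcoord U \<phi> i p g"
      using f g smooth_at_mult[OF f g] by (simp add: dcoord_def add.commute)
  next
    fix c f assume f: "smooth_at M p f"
    have "((\<lambda>q. c * f q) \<circ> inv_into U \<phi> has_derivative
      (\<lambda>v. c * frechet_derivative (f \<circ> inv_into U \<phi>) (at (\<phi> p)) v)) (at (\<phi> p))"
      using has_derivative_mult_right[OF smooth_at_deriv[OF p f], of c] by (simp add: o_def)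
    from fun_cong[OF frechet_derivative_at[OF this], of "axis i 1"]
    show "dcoord U \<phi> i p (\<lambda>q. c * f q) = c * dcoord U \<phi> i p f"
      using f smooth_at_mult[OF smooth_at_const[OF smooth_at_pts[OF f]] f, of c] by (simp add: dcoord_def)
  qed (simp add: dcoord_def)
qed

lemma smooth_dcoord: "smooth_vfield M U (dcoord U \<phi> i)"
  unfolding smooth_vfield_def
proof (intro conjI allI ballI impI dcoord_ct)
  fix V f assume V: "opn V" "V \<subseteq> U" "sm V f"
  have "Cinf_on (\<phi> ` V) (\<lambda>x. frechet_derivative (f \<circ> inv_into U \<phi>) (at x) (axis i 1))"
    using sm_chartD[OF c V(2,3)] by (rule Cinf_on_deriv)
  moreover have "open (\<phi> ` V)" using chart_image[OF c V(1)] V(2) by (simp add: Int_absorb1)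
  ultimately have "Cinf_on (\<phi> ` V) ((\<lambda>p. dcoord U \<phi> i p f) \<circ> inv_into U \<phi>)"
  proof (rule Cinf_on_cong[rotated 2])
    fix x assume "x \<in> \<phi> ` V"
    then obtain p where p: "p \<in> V" "x = \<phi> p" by auto
    then have "inv_into U \<phi> x = p" using chart_inv[OF c] V(2) by auto
    moreover have "smooth_at M p f" using smooth_atI[OF V(1) p(1) V(3)] .
    ultimately show "frechet_derivative (f \<circ> inv_into U \<phi>) (at x) (axis i 1) = ((\<lambda>p. dcoord U \<phi> i p f) \<circ> inv_into U \<phi>) x"
      using p(2) by (simp add: dcoord_def)
  qed
  then show "sm V (\<lambda>p. dcoord U \<phi> i p f)" by (rule sm_chartI[OF c V(1,2)])
qed

lemma dcoord_xcoord: assumes p: "p \<in> U" shows "dcoord U \<phi> i p (xcoord \<phi> j) = (if i = j then 1 else 0)"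
proof -
  have o: "open (\<phi> ` U)" using chart_image[OF c chart_open[OF c]] by simp
  have "bounded_linear (\<lambda>x::real^3. complex_of_real (x $ j))"
    by (intro bounded_linear_of_real[THEN bounded_linear_compose] bounded_linear_vec_nth)
  then have "((\<lambda>x::real^3. complex_of_real (x $ j)) has_derivative (\<lambda>x. complex_of_real (x $ j))) (at (\<phi> p))"
    by (rule bounded_linear_imp_has_derivative)
  then have "(xcoord \<phi> j \<circ> inv_into U \<phi> has_derivative (\<lambda>x. complex_of_real (x $ j))) (at (\<phi> p))"
    by (rule has_derivative_transform_within_open[OF _ o]) (use p in \<open>auto simp: xcoord_def f_inv_into_f\<close>)
  from fun_cong[OF frechet_derivative_at[OF this], of "axis i 1"] show ?thesis
    using smooth_atI[OF chart_open[OF c] p smooth_xcoord, of j]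
    by (auto simp: dcoord_def axis_def)
qed

end

end

definition comb :: "complex \<Rightarrow> 'a tvec \<Rightarrow> complex \<Rightarrow> 'a tvec \<Rightarrow> complex \<Rightarrow> 'a tvec \<Rightarrow> 'a tvec" where
  "comb a u b v c w = tadd (tscale a u) (tadd (tscale b v) (tscale c w))"

lemma comb_apply: "comb a u b v c w f = a * u f + b * v f + c * w f"
  by (simp add: comb_def tadd_def tscale_def)

lemma tvec_simps: "tadd u v f = u f + v f" "tscale c v f = c * v f" "tzero f = 0"
  "tconj v f = cnj (v (\<lambda>q. cnj (f q)))"
  by (simp_all add: tadd_def tscale_def tzero_def tconj_def)

lemma tconj_tconj [simp]: "tconj (tconj v) = v" by (simp add: tconj_def)
lemma tconj_tadd: "tconj (tadd v w) = tadd (tconj v) (tconj w)" by (simp add: tconj_def tadd_def fun_eq_iff)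
lemma tconj_tscale: "tconj (tscale c v) = tscale (cnj c) (tconj v)" by (simp add: tconj_def tscale_def fun_eq_iff)

section \<open>Frames of a contact form\<close>

locale contact = manifold M for M :: "'a crdata" +
  fixes \<theta> :: "'a oneform"
  assumes CR: "cr_manifold M" and contact: "contact_form M \<theta>"
begin

abbreviation "ct p \<equiv> ctangent M p"

lemmas cr_H = CR[unfolded cr_manifold_def, THEN conjunct2, THEN conjunct1]
  and cr_frame = CR[unfolded cr_manifold_def, THEN conjunct2, THEN conjunct2, THEN conjunct1]
  and cr_J = CR[unfolded cr_manifold_def, THEN conjunct2, THEN conjunct2, THEN conjunct2, THEN conjunct1]
  and cr_J_smooth = CR[unfolded cr_manifold_def, THEN conjunct2, THEN conjunct2, THEN conjunct2, THEN conjunct2]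

lemma H_real: "p \<in> pts \<Longrightarrow> v \<in> Hplane M p \<Longrightarrow> v \<in> ct p \<and> tconj v = v"
  using bspec[OF cr_H, of p] by (auto simp: rtangent_def)

lemma H_frame: "p \<in> pts \<Longrightarrow> \<exists>U X Y. opn U \<and> p \<in> U \<and>
        smooth_vfield M U X \<and> smooth_vfield M U Y \<and>
        (\<forall>q\<in>U.
           Hplane M q = {tadd (tscale (of_real a) (X q)) (tscale (of_real b) (Y q)) | a b :: real. True} \<and>
           (\<forall>a b :: real. tadd (tscale (of_real a) (X q)) (tscale (of_real b) (Y q)) = tzero
              \<longrightarrow> a = 0 \<and> b = 0))"
  by (rule bspec[OF cr_frame])

lemma J_props:
  assumes "p \<in> pts" "v \<in> Hplane M p" "w \<in> Hplane M p"
  shows "Jmap M p v \<in> Hplane M p" "Jmap M p (tadd v w) = tadd (Jmap M p v) (Jmap M p w)"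
    "Jmap M p (tscale (of_real a) v) = tscale (of_real a) (Jmap M p v)" "Jmap M p (Jmap M p v) = tscale (- 1) v"
  using bspec[OF bspec[OF bspec[OF cr_J assms(1)] assms(2)] assms(3)] by simp_all

lemma J_smooth: "opn U \<Longrightarrow> smooth_vfield M U X \<Longrightarrow> (\<And>p. p \<in> U \<Longrightarrow> X p \<in> Hplane M p) \<Longrightarrow> smooth_vfield M U (\<lambda>p. Jmap M p (X p))"
  using cr_J_smooth[rule_format, of U X] by simp

lemma H_comb:
  assumes p: "p \<in> pts" and v: "v \<in> Hplane M p" and w: "w \<in> Hplane M p"
  shows "tadd (tscale (of_real a) v) (tscale (of_real b) w) \<in> Hplane M p"
proof -
  obtain U X Y where q: "p \<in> U" and H: "\<And>q. q \<in> U \<Longrightarrow> Hplane M q = {tadd (tscale (of_real a) (X q)) (tscale (of_real b) (Y q)) | a b :: real. True}"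
    using H_frame[OF p] by blast
  obtain a1 b1 a2 b2 :: real where "v = tadd (tscale a1 (X p)) (tscale b1 (Y p))" "w = tadd (tscale a2 (X p)) (tscale b2 (Y p))"
    using v w H[OF q] by auto
  then have "tadd (tscale (of_real a) v) (tscale (of_real b) w)
    = tadd (tscale (of_real (a * a1 + b * a2)) (X p)) (tscale (of_real (a * b1 + b * b2)) (Y p))"
    by (simp add: fun_eq_iff tvec_simps algebra_simps)
  then show ?thesis using H[OF q] by blast
qed

lemma H_scale: "p \<in> pts \<Longrightarrow> v \<in> Hplane M p \<Longrightarrow> tscale (of_real a) v \<in> Hplane M p"
  using H_comb[of p v v a 0] by (simp add: tadd_def tscale_def)

lemma frame_exists:
  assumes p: "p \<in> pts" shows "\<exists>U Z. frame_vector M U Z \<and> p \<in> U"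
proof -
  obtain U X Y where U: "opn U" "p \<in> U" and X: "smooth_vfield M U X"
    and H: "\<And>q. q \<in> U \<Longrightarrow> Hplane M q = {tadd (tscale (of_real a) (X q)) (tscale (of_real b) (Y q)) | a b :: real. True}"
    and ind: "\<And>q a b. q \<in> U \<Longrightarrow> tadd (tscale (of_real a) (X q)) (tscale (of_real b) (Y q)) = tzero \<Longrightarrow> a = 0 \<and> b = 0"
    using H_frame[OF p] by blast
  have XH: "X q \<in> Hplane M q" if "q \<in> U" for q
  proof -
    have "X q = tadd (tscale (of_real 1) (X q)) (tscale (of_real 0) (Y q))" by (simp add: fun_eq_iff tvec_simps)
    then show ?thesis using H[OF that] by blast
  qed
  \<comment> \<open>Z = X - i J X, the projection of X to the i-eigenspace up to the factor 2; its
    smoothness needs the smoothness of J.\<close>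
  define Z where "Z = (\<lambda>q. tadd (X q) (tscale \<i> (tscale (- 1) (Jmap M q (X q)))))"
  have Zs: "smooth_vfield M U Z"
    unfolding Z_def by (intro smooth_vfield_tadd smooth_vfield_tscale U X J_smooth XH sm_const)
  have Zt: "Z q \<in> T10 M q" if q: "q \<in> U" for q
  proof -
    have qp: "q \<in> pts" using opn_sub U q by blast
    let ?y = "tscale (- 1) (Jmap M q (X q))"
    have J: "Jmap M q (X q) \<in> Hplane M q" using J_props(1)[OF qp XH XH] q by blast
    have y: "?y \<in> Hplane M q" using H_scale[OF qp J, of "- 1"] by simp
    have "Jmap M q ?y = tscale (- 1) (Jmap M q (Jmap M q (X q)))"
      using J_props(3)[OF qp J J, of "- 1"] by simp
    then have "Jmap M q ?y = X q" using J_props(4)[OF qp XH XH] q by (simp add: fun_eq_iff tvec_simps)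
    moreover have "Jmap M q (X q) = tscale (- 1) ?y" by (simp add: fun_eq_iff tvec_simps)
    ultimately show ?thesis unfolding T10_def Z_def using XH[OF q] y by blast
  qed
  have Zn: "Z q \<noteq> tzero" if q: "q \<in> U" for q
  proof
    assume Z0: "Z q = tzero"
    have qp: "q \<in> pts" using opn_sub U q by blast
    have J: "Jmap M q (X q) \<in> Hplane M q" using J_props(1)[OF qp XH XH] q by blast
    have r: "tconj (X q) = X q" "tconj (Jmap M q (X q)) = Jmap M q (X q)"
      using H_real[OF qp] XH[OF q] J by auto
    have "tconj (Z q) = tzero" unfolding Z0 by (simp add: fun_eq_iff tvec_simps)
    then have "tadd (X q) (tscale (- \<i>) (tscale (- 1) (Jmap M q (X q)))) = tzero"
      by (simp add: Z_def tconj_tadd tconj_tscale r)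
    from fun_cong[OF this] have e1: "X q f + \<i> * Jmap M q (X q) f = 0" for f
      by (simp add: tvec_simps)
    have e2: "X q f - \<i> * Jmap M q (X q) f = 0" for f
      using fun_cong[OF Z0, of f] by (simp add: Z_def tvec_simps)
    have "X q f = 0" for f
    proof -
      have "2 * X q f = (X q f + \<i> * Jmap M q (X q) f) + (X q f - \<i> * Jmap M q (X q) f)" by simp
      then show ?thesis unfolding e1 e2 by simp
    qed
    then have "tadd (tscale (of_real 1) (X q)) (tscale (of_real 0) (Y q)) = tzero" by (simp add: fun_eq_iff tvec_simps)
    from ind[OF q this] show False by simp
  qed
  show ?thesis
    using U Zs Zt Zn by (intro exI[of _ U] exI[of _ Z]) (auto simp: frame_vector_def T10_section_def)
qed

context
  fixes p and Z assumes p: "p \<in> pts" and Z: "Z \<in> T10 M p" "Z \<noteq> tzero"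
begin

text \<open>A real relation s x + t y = 0 and its image under J form a linear system of determinant
  s^2 + t^2, so x and y are independent; as H is a plane, they span it, which is Cramer's rule with
  the determinant D below.\<close>

lemma T10_obtain:
  obtains x y where "x \<in> Hplane M p" "y \<in> Hplane M p" "Jmap M p x = tscale (- 1) y" "Jmap M p y = x"
    "Z = tadd x (tscale \<i> y)" "tconj Z = tadd x (tscale (- \<i>) y)" 
    "\<And>v. v \<in> Hplane M p \<Longrightarrow> \<exists>(s::real) (t::real). v = tadd (tscale (of_real s) x) (tscale (of_real t) y)"
proof -
  obtain x y where xy: "x \<in> Hplane M p" "y \<in> Hplane M p" "Jmap M p x = tscale (- 1) y" "Jmap M p y = x"
    and Zxy: "Z = tadd x (tscale \<i> y)"
    using Z(1) by (auto simp: T10_def)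
  have r: "tconj x = x" "tconj y = y" using H_real[OF p] xy by auto
  have ind: "s = 0 \<and> t = 0" if st: "tadd (tscale (of_real s) x) (tscale (of_real t) y) = tzero" for s t :: real
  proof (rule ccontr)
    assume "\<not> (s = 0 \<and> t = 0)"
    then have n: "s\<^sup>2 + t\<^sup>2 \<noteq> 0" by (simp add: sum_power2_eq_zero_iff)
    have "Jmap M p (tadd (tscale (of_real s) x) (tscale (of_real t) y)) = tadd (tscale s (Jmap M p x)) (tscale t (Jmap M p y))"
      using J_props(2)[OF p H_scale[OF p xy(1)] H_scale[OF p xy(2)]] J_props(3)[OF p xy(1) xy(1)] J_props(3)[OF p xy(2) xy(2)] by simp
    moreover have "Jmap M p tzero = tzero"
    proof -
      have z: "tscale (of_real 0) w = tzero" for w by (simp add: fun_eq_iff tvec_simps)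
      show ?thesis using J_props(3)[OF p xy(1) xy(1), of 0] unfolding z .
    qed
    ultimately have st': "tadd (tscale s (tscale (- 1) y)) (tscale t x) = tzero" using st xy by simp
    have x0: "x f = 0" for f
    proof -
      have "s * x f + t * y f = 0" "- (s * y f) + t * x f = 0"
        using fun_cong[OF st, of f] fun_cong[OF st', of f] by (simp_all add: tvec_simps)
      then have "(complex_of_real s * s + complex_of_real t * t) * x f = 0" by algebra
      moreover have "complex_of_real s * s + complex_of_real t * t \<noteq> 0"
        using n by (metis of_real_add of_real_eq_0_iff of_real_mult power2_eq_square)
      ultimately show ?thesis by simp
    qed
    then have "x = tzero" by (simp add: fun_eq_iff tvec_simps)
    then have "tscale (- 1) y = tzero" using xy(3) \<open>Jmap M p tzero = tzero\<close> by simp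
    from fun_cong[OF this] have "y f = 0" for f by (simp add: tvec_simps)
    then have "Z = tzero" using x0 by (simp add: Zxy fun_eq_iff tvec_simps)
    then show False using Z(2) by simp
  qed
  obtain U X Y where q: "p \<in> U" and H: "\<And>q. q \<in> U \<Longrightarrow> Hplane M q = {tadd (tscale (of_real a) (X q)) (tscale (of_real b) (Y q)) | a b :: real. True}"
    using H_frame[OF p] by blast
  obtain a1 b1 a2 b2 :: real where 1: "x = tadd (tscale a1 (X p)) (tscale b1 (Y p))" and 2: "y = tadd (tscale a2 (X p)) (tscale b2 (Y p))"
    using xy H[OF q] by auto
  define D where "D = a1 * b2 - a2 * b1"
  have e1: "tadd (tscale (of_real b2) x) (tscale (of_real (- b1)) y) = tscale (of_real D) (X p)"
    and e2: "tadd (tscale (of_real (- a2)) x) (tscale (of_real a1) y) = tscale (of_real D) (Y p)"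
    by (simp_all add: 1 2 D_def fun_eq_iff tvec_simps algebra_simps)
  have D: "D \<noteq> 0"
  proof
    assume "D = 0"
    then have "tadd (tscale (of_real b2) x) (tscale (of_real (- b1)) y) = tzero" "tadd (tscale (of_real (- a2)) x) (tscale (of_real a1) y) = tzero"
      using e1 e2 by (simp_all add: fun_eq_iff tvec_simps)
    from ind[OF this(1)] ind[OF this(2)] have "x = tzero" "y = tzero" by (simp_all add: 1 2 fun_eq_iff tvec_simps)
    then show False using Z(2) by (simp add: Zxy fun_eq_iff tvec_simps)
  qed
  have span: "\<exists>(s::real) (t::real). v = tadd (tscale (of_real s) x) (tscale (of_real t) y)" if v: "v \<in> Hplane M p" for v
  proof -
    obtain a b :: real where ab: "v = tadd (tscale a (X p)) (tscale b (Y p))" using v H[OF q] by auto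
    have "v f = ((a * b2 - b * a2) / D) * x f + ((b * a1 - a * b1) / D) * y f" for f
    proof -
      have 1: "b2 * x f - b1 * y f = D * X p f" "a1 * y f - a2 * x f = D * Y p f"
        using fun_cong[OF e1, of f] fun_cong[OF e2, of f] by (simp_all add: tvec_simps algebra_simps)
      have "complex_of_real D \<noteq> 0" using D by simp
      moreover have "D * v f = (a * b2 - b * a2) * x f + (b * a1 - a * b1) * y f"
      proof -
        have "D * v f = a * (D * X p f) + b * (D * Y p f)" by (simp add: ab tvec_simps algebra_simps)
        then show ?thesis unfolding 1[symmetric] by (simp add: algebra_simps)
      qed
      ultimately have "v f = ((a * b2 - b * a2) * x f + (b * a1 - a * b1) * y f) / D"
        by (metis nonzero_mult_div_cancel_left)
      then show ?thesis by (simp add: add_divide_distrib)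
    qed
    then show ?thesis by (intro exI[of _ "(a * b2 - b * a2) / D"] exI[of _ "(b * a1 - a * b1) / D"]) (simp add: fun_eq_iff tvec_simps)
  qed
  show ?thesis
    by (rule that[OF xy Zxy _ span]) (simp_all add: Zxy tconj_tadd tconj_tscale r)
qed

lemma H_span: "v \<in> Hplane M p \<Longrightarrow> \<exists>c. v = tadd (tscale c Z) (tscale (cnj c) (tconj Z))"
proof -
  assume v: "v \<in> Hplane M p"
  obtain x y where xy: "Z = tadd x (tscale \<i> y)" "tconj Z = tadd x (tscale (- \<i>) y)" 
    "\<And>v. v \<in> Hplane M p \<Longrightarrow> \<exists>(s::real) (t::real). v = tadd (tscale (of_real s) x) (tscale (of_real t) y)"
    using T10_obtain by metis
  obtain s t :: real where "v = tadd (tscale (of_real s) x) (tscale (of_real t) y)" using xy(3)[OF v] by blast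
  then show ?thesis unfolding xy(2) unfolding xy(1)
    by (intro exI[of _ "Complex (s / 2) (- t / 2)"]) (simp add: fun_eq_iff tvec_simps complex_eq_iff algebra_simps)
qed

lemma T10_span: "v \<in> T10 M p \<Longrightarrow> \<exists>c. v = tscale c Z"
proof -
  assume v: "v \<in> T10 M p"
  obtain x y where xy: "x \<in> Hplane M p" "y \<in> Hplane M p" "Jmap M p x = tscale (- 1) y" "Jmap M p y = x" "Z = tadd x (tscale \<i> y)"
    "\<And>v. v \<in> Hplane M p \<Longrightarrow> \<exists>(s::real) (t::real). v = tadd (tscale (of_real s) x) (tscale (of_real t) y)"
    using T10_obtain by metis
  obtain x' y' where v': "x' \<in> Hplane M p" "v = tadd x' (tscale \<i> y')" "Jmap M p x' = tscale (- 1) y'"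
    using v by (auto simp: T10_def)
  obtain s t :: real where st: "x' = tadd (tscale (of_real s) x) (tscale (of_real t) y)" using xy(6)[OF v'(1)] by blast
  have "Jmap M p x' = tadd (tscale s (Jmap M p x)) (tscale t (Jmap M p y))"
    unfolding st
    using J_props(2)[OF p H_scale[OF p xy(1)] H_scale[OF p xy(2)]] J_props(3)[OF p xy(1) xy(1)] J_props(3)[OF p xy(2) xy(2)] by simp
  then have y': "y' f = s * y f - t * x f" for f
    using fun_cong[OF v'(3), of f] by (simp add: xy tvec_simps algebra_simps)
  show ?thesis unfolding v'(2) st xy(5)
    by (intro exI[of _ "Complex s (- t)"]) (simp add: fun_eq_iff tvec_simps y' complex_eq_iff algebra_simps)
qed

lemma T10_scale: "tscale c Z \<in> T10 M p"
proof -
  obtain x y where xy: "x \<in> Hplane M p" "y \<in> Hplane M p" "Jmap M p x = tscale (- 1) y" "Jmap M p y = x" "Z = tadd x (tscale \<i> y)"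
    using T10_obtain by metis
  let ?x = "tadd (tscale (of_real (Re c)) x) (tscale (of_real (- Im c)) y)" and ?y = "tadd (tscale (of_real (Re c)) y) (tscale (of_real (Im c)) x)"
  have J: "Jmap M p (tadd (tscale (of_real a) u) (tscale (of_real b) w)) = tadd (tscale a (Jmap M p u)) (tscale b (Jmap M p w))"
    if "u \<in> Hplane M p" "w \<in> Hplane M p" for a b u w
    using J_props(2)[OF p H_scale[OF p that(1)] H_scale[OF p that(2)]] J_props(3)[OF p that(1) that(1)] J_props(3)[OF p that(2) that(2)] by simp
  have "tscale c Z = tadd ?x (tscale \<i> ?y)"
    unfolding xy(5) by (simp add: fun_eq_iff tvec_simps complex_eq_iff algebra_simps)
  moreover have "Jmap M p ?x = tscale (- 1) ?y" "Jmap M p ?y = ?x"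
    unfolding J[OF xy(1,2)] J[OF xy(2,1)] xy(3,4) by (simp_all add: fun_eq_iff tvec_simps algebra_simps)
  ultimately show ?thesis unfolding T10_def
    using H_comb[OF p xy(1,2)] H_comb[OF p xy(2,1)] by blast
qed

end

lemmas th_oneform = contact[unfolded contact_form_def, THEN conjunct1]
  and cf_conj = contact[unfolded contact_form_def, THEN conjunct2, THEN conjunct1]
  and cf_ker = contact[unfolded contact_form_def, THEN conjunct2, THEN conjunct2, THEN conjunct1]
  and cf_levi = contact[unfolded contact_form_def, THEN conjunct2, THEN conjunct2, THEN conjunct2]

lemma th_add: "p \<in> pts \<Longrightarrow> v \<in> ct p \<Longrightarrow> w \<in> ct p \<Longrightarrow> \<theta> p (tadd v w) = \<theta> p v + \<theta> p w"
  using th_oneform by (simp add: smooth_oneform_def)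
lemma th_scale: "p \<in> pts \<Longrightarrow> v \<in> ct p \<Longrightarrow> \<theta> p (tscale c v) = c * \<theta> p v"
  using th_oneform by (simp add: smooth_oneform_def)
lemma th_smooth: "opn U \<Longrightarrow> smooth_vfield M U X \<Longrightarrow> sm U (\<lambda>p. \<theta> p (X p))"
  using th_oneform openin_subset[of "mtop M" U] by (simp add: smooth_oneform_def)
lemma th_conj: "p \<in> pts \<Longrightarrow> v \<in> ct p \<Longrightarrow> \<theta> p (tconj v) = cnj (\<theta> p v)"
  using cf_conj by simp
lemma th_ker: "p \<in> pts \<Longrightarrow> v \<in> ct p \<Longrightarrow> tconj v = v \<Longrightarrow> \<theta> p v = 0 \<longleftrightarrow> v \<in> Hplane M p"
  using bspec[OF cf_ker, of p] by (auto simp: rtangent_def)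

lemma T10_ct: assumes p: "p \<in> pts" and Z: "Z \<in> T10 M p" shows "Z \<in> ct p" "\<theta> p Z = 0" "\<theta> p (tconj Z) = 0"
proof -
  obtain x y where xy: "x \<in> Hplane M p" "y \<in> Hplane M p" "Z = tadd x (tscale \<i> y)" using Z by (auto simp: T10_def)
  have c: "x \<in> ct p" "y \<in> ct p" using H_real[OF p] xy by auto
  show Zc: "Z \<in> ct p" unfolding xy(3) by (intro ct_tadd ct_tscale c)
  have "\<theta> p x = 0" "\<theta> p y = 0" using th_ker[OF p] xy H_real[OF p] by blast+
  then show "\<theta> p Z = 0" unfolding xy(3) using th_add[OF p c(1) ct_tscale[OF c(2)]] th_scale[OF p c(2)] by simp
  then show "\<theta> p (tconj Z) = 0" using th_conj[OF p Zc] by simp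
qed

lemma frameD:
  assumes "frame_vector M U Z"
  shows frame_opn: "opn U" and frame_smooth: "smooth_vfield M U Z" "smooth_vfield M U (vconj Z)"
    and frame_T10: "p \<in> U \<Longrightarrow> Z p \<in> T10 M p" "p \<in> U \<Longrightarrow> Z p \<noteq> tzero" and frame_pts: "p \<in> U \<Longrightarrow> p \<in> pts"
    and frame_ct0: "p \<in> U \<Longrightarrow> Z p \<in> ct p" "p \<in> U \<Longrightarrow> vconj Z p \<in> ct p"
    and frame_th: "p \<in> U \<Longrightarrow> \<theta> p (Z p) = 0" "p \<in> U \<Longrightarrow> \<theta> p (vconj Z p) = 0"
proof -
  show o: "opn U" and s: "smooth_vfield M U Z" using assms by (auto simp: frame_vector_def T10_section_def)
  show "smooth_vfield M U (vconj Z)" using smooth_vfield_vconj[OF o s] .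
  show t: "p \<in> U \<Longrightarrow> Z p \<in> T10 M p" "p \<in> U \<Longrightarrow> Z p \<noteq> tzero" using assms by (auto simp: frame_vector_def T10_section_def)
  show q: "p \<in> U \<Longrightarrow> p \<in> pts" using o opn_sub by blast
  show "p \<in> U \<Longrightarrow> Z p \<in> ct p" "p \<in> U \<Longrightarrow> vconj Z p \<in> ct p" "p \<in> U \<Longrightarrow> \<theta> p (Z p) = 0" "p \<in> U \<Longrightarrow> \<theta> p (vconj Z p) = 0"
    using T10_ct[OF q t(1)] ct_tconj by (auto simp: vconj_def)
qed

lemma frame_subset: "frame_vector M U Z \<Longrightarrow> opn V \<Longrightarrow> V \<subseteq> U \<Longrightarrow> frame_vector M V Z"
  by (auto simp: frame_vector_def T10_section_def intro: smooth_vfield_subset)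

abbreviation "hh Z p \<equiv> h11 M \<theta> Z p"

lemma h_real: assumes "frame_vector M U Z" "p \<in> U" obtains r where "r > 0" "hh Z p = complex_of_real r"
  using assms cf_levi[rule_format, of U Z p] that unfolding frame_vector_def h11_def by blast

lemma h_nonzero: "frame_vector M U Z \<Longrightarrow> p \<in> U \<Longrightarrow> hh Z p \<noteq> 0" and h_cnj: "frame_vector M U Z \<Longrightarrow> p \<in> U \<Longrightarrow> cnj (hh Z p) = hh Z p"
  by (erule h_real, assumption, simp)+

lemma ct_zero_near: "v \<in> ct p \<Longrightarrow> opn V \<Longrightarrow> p \<in> V \<Longrightarrow> (\<And>q. q \<in> V \<Longrightarrow> f q = c) \<Longrightarrow> v f = 0"
  using ct_cong[of v p V f "\<lambda>q. c"] ct_const by simp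

lemma th_bracket: assumes F: "frame_vector M U Z" and p: "p \<in> U"
  shows "\<theta> p (lie_bracket M Z (vconj Z) p) = - \<i> * hh Z p"
proof -
  have "Z p (\<lambda>q. \<theta> q (vconj Z q)) = 0" "vconj Z p (\<lambda>q. \<theta> q (Z q)) = 0"
    by (rule ct_zero_near[where V = U and c = 0], use frameD[OF F] p in auto)+
  then show ?thesis by (simp add: h11_def levi_def ext_d_def)
qed

text \<open>Tangent vectors are abstract derivations, whose space is not yet known to be
  three-dimensional. The contact form provides the bound: the bracket of Z with its conjugate is
  transversal to ker \<theta>, and once it is split off, the real and imaginary parts of the
  remainder are real vectors in ker \<theta>, hence lie in H.\<close>

lemma span0:
  assumes F: "frame_vector M U Z" and p: "p \<in> U" and v: "v \<in> ct p"
  shows "\<exists>a b c. v = comb a (lie_bracket M Z (vconj Z) p) b (Z p) c (vconj Z p)"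
proof -
  note fr = frameD[OF F]
  have P: "p \<in> pts" using fr p by blast
  let ?B = "lie_bracket M Z (vconj Z) p"
  have B: "?B \<in> ct p" by (rule lie_bracket_ct[OF fr(1) p fr(2) fr(3)])
  have h: "hh Z p \<noteq> 0" by (rule h_nonzero[OF F p])
  define a where "a = \<i> * \<theta> p v / hh Z p"
  define w where "w = tadd v (tscale (- a) ?B)"
  have w: "w \<in> ct p" unfolding w_def by (intro ct_tadd ct_tscale v B)
  have tw: "\<theta> p w = 0"
  proof -
    have "a * (\<i> * hh Z p) = - \<theta> p v" using h by (simp add: a_def ac_simps)
    then show ?thesis
      unfolding w_def using th_add[OF P v ct_tscale[OF B]] th_scale[OF P B] th_bracket[OF F p] by simp
  qed
  define w1 where "w1 = tadd (tscale (1/2) w) (tscale (1/2) (tconj w))"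
  define w2 where "w2 = tadd (tscale (- \<i>/2) w) (tscale (\<i>/2) (tconj w))"
  have cw: "w1 \<in> ct p" "w2 \<in> ct p" unfolding w1_def w2_def by (intro ct_tadd ct_tscale ct_tconj w)+
  have rw: "tconj w1 = w1" "tconj w2 = w2"
    by (simp_all add: w1_def w2_def tconj_tadd tconj_tscale) (simp_all add: fun_eq_iff tvec_simps)
  have "\<theta> p w1 = 0" "\<theta> p w2 = 0"
    unfolding w1_def w2_def
    using th_add[OF P ct_tscale[OF w] ct_tscale[OF ct_tconj[OF w]]] th_scale[OF P w] th_scale[OF P ct_tconj[OF w]] th_conj[OF P w] tw
    by auto
  then have "w1 \<in> Hplane M p" "w2 \<in> Hplane M p" using th_ker[OF P] cw rw by blast+
  then obtain c1 c2 where c: "w1 = tadd (tscale c1 (Z p)) (tscale (cnj c1) (tconj (Z p)))" "w2 = tadd (tscale c2 (Z p)) (tscale (cnj c2) (tconj (Z p)))"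
    using H_span[OF P fr(4)[OF p] fr(5)[OF p]] by meson
  have "v f = a * ?B f + (c1 + \<i> * c2) * Z p f + (cnj c1 + \<i> * cnj c2) * vconj Z p f" for f
  proof -
    have "w f = w1 f + \<i> * w2 f" by (simp add: w1_def w2_def tvec_simps algebra_simps)
    moreover have "v f = a * ?B f + w f" by (simp add: w_def tvec_simps)
    ultimately show ?thesis by (simp add: c tvec_simps vconj_def algebra_simps)
  qed
  then show ?thesis by (intro exI[of _ a] exI[of _ "c1 + \<i> * c2"] exI[of _ "cnj c1 + \<i> * cnj c2"]) (simp add: fun_eq_iff comb_apply)
qed

text \<open>No Taylor expansion is used. By \<open>span0\<close> three vectors span the tangent
  space, and the three coordinate derivations are independent because of their values on the
  coordinate functions; hence they span as well.\<close>

lemma coord_rep: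
  assumes c: "(U, \<phi>) \<in> atlas M" and p: "p \<in> U" and v: "v \<in> ct p"
  shows "v f = (\<Sum>i\<in>UNIV. v (xcoord \<phi> i) * dcoord U \<phi> i p f)"
proof -
  have P: "p \<in> pts" using opn_sub[OF chart_open[OF c] p] .
  obtain V Z where F: "frame_vector M V Z" "p \<in> V" using frame_exists[OF P] by blast
  define e :: "3 \<Rightarrow> 'a tvec" where "e i = (if i = 1 then lie_bracket M Z (vconj Z) p else if i = 2 then Z p else vconj Z p)" for i
  have span: "\<exists>a :: 3 \<Rightarrow> complex. \<forall>f. v f = (\<Sum>i\<in>UNIV. a i * e i f)" if v: "v \<in> ct p" for v
  proof -
    obtain a b c where v: "v = comb a (lie_bracket M Z (vconj Z) p) b (Z p) c (vconj Z p)"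
      using span0[OF F v] by (elim exE)
    define d where "d = (\<lambda>i :: 3. if i = 1 then a else if i = 2 then b else c)"
    have "d 1 = a" "d 2 = b" "d 3 = c" "e 1 = lie_bracket M Z (vconj Z) p" "e 2 = Z p" "e 3 = vconj Z p"
      by (simp_all add: d_def e_def)
    then have "v f = (\<Sum>i\<in>UNIV. d i * e i f)" for f
      unfolding v sum_3 comb_apply by simp
    then show ?thesis by blast
  qed
  have "\<exists>a. \<forall>f. dcoord U \<phi> i p f = (\<Sum>j\<in>UNIV. a j * e j f)" for i using span[OF dcoord_ct[OF c p]] .
  then obtain C where C: "\<And>i f. dcoord U \<phi> i p f = (\<Sum>j\<in>UNIV. C i j * e j f)" by metis
  define CM :: "complex^3^3" where "CM = (\<chi> i j. C i j)"
  define EM :: "complex^3^3" where "EM = (\<chi> i j. e i (xcoord \<phi> j))"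
  \<comment> \<open>CM expresses the coordinate derivations by the spanning vectors, and EM holds
    the values of the latter on coordinates. For square matrices a one-sided inverse is
    two-sided.\<close>
  have "CM ** EM = mat 1"
    using dcoord_xcoord[OF c p] C
    by (simp add: matrix_matrix_mult_def CM_def EM_def mat_def vec_eq_iff)
  then have "EM ** CM = mat 1" by (simp add: matrix_left_right_inverse)
  then have EC: "(\<Sum>k\<in>UNIV. e i (xcoord \<phi> k) * C k j) = (if i = j then 1 else 0)" for i j
    by (simp add: matrix_matrix_mult_def CM_def EM_def mat_def vec_eq_iff)
  obtain a where a: "\<And>f. v f = (\<Sum>i\<in>UNIV. a i * e i f)" using span[OF v] by blast
  have "(\<Sum>k\<in>UNIV. v (xcoord \<phi> k) * dcoord U \<phi> k p f)
      = (\<Sum>k\<in>UNIV. \<Sum>i\<in>UNIV. \<Sum>j\<in>UNIV. a i * (e i (xcoord \<phi> k) * C k j) * e j f)"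
    by (simp add: a C sum_product mult.assoc)
  also have "\<dots> = (\<Sum>i\<in>UNIV. \<Sum>j\<in>UNIV. \<Sum>k\<in>UNIV. a i * (e i (xcoord \<phi> k) * C k j) * e j f)"
    by (subst sum.swap, rule sum.cong[OF refl], rule sum.swap)
  also have "\<dots> = (\<Sum>i\<in>UNIV. \<Sum>j\<in>UNIV. a i * (if i = j then 1 else 0) * e j f)"
    by (simp only: sum_distrib_left[symmetric] sum_distrib_right[symmetric] EC)
  also have "\<dots> = v f"
  proof -
    have "(\<Sum>j\<in>UNIV. a i * (if i = j then 1 else 0) * e j f) = a i * e i f" for i
      by (simp add: if_distrib[of "\<lambda>x. x * _"] if_distrib[of "(*) _"] cong: if_cong)
    then show ?thesis by (simp add: a)
  qed
  finally show ?thesis by simp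
qed

end

section \<open>The exterior derivative as a pointwise alternating form\<close>

context contact begin

lemma oneform_lin:
  assumes "smooth_oneform M W \<alpha>" "p \<in> W"
  shows of_add: "v \<in> ct p \<Longrightarrow> w \<in> ct p \<Longrightarrow> \<alpha> p (tadd v w) = \<alpha> p v + \<alpha> p w"
    and of_scale: "v \<in> ct p \<Longrightarrow> \<alpha> p (tscale c v) = c * \<alpha> p v"
    and of_comb: "u \<in> ct p \<Longrightarrow> v \<in> ct p \<Longrightarrow> w \<in> ct p \<Longrightarrow> \<alpha> p (comb a u b v c w) = a * \<alpha> p u + b * \<alpha> p v + c * \<alpha> p w"
proof -
  show 1: "v \<in> ct p \<Longrightarrow> w \<in> ct p \<Longrightarrow> \<alpha> p (tadd v w) = \<alpha> p v + \<alpha> p w" for v w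
    using assms by (simp add: smooth_oneform_def)
  show 2: "v \<in> ct p \<Longrightarrow> \<alpha> p (tscale c v) = c * \<alpha> p v" for v c
    using assms by (simp_all add: smooth_oneform_def)
  show "u \<in> ct p \<Longrightarrow> v \<in> ct p \<Longrightarrow> w \<in> ct p \<Longrightarrow> \<alpha> p (comb a u b v c w) = a * \<alpha> p u + b * \<alpha> p v + c * \<alpha> p w"
    unfolding comb_def by (simp add: 1 2 ct_tadd ct_tscale)
qed

lemma of_smooth: "smooth_oneform M W \<alpha> \<Longrightarrow> opn V \<Longrightarrow> V \<subseteq> W \<Longrightarrow> smooth_vfield M V X \<Longrightarrow> sm V (\<lambda>p. \<alpha> p (X p))"
  by (simp add: smooth_oneform_def)

lemma ct_comb: "u \<in> ct p \<Longrightarrow> v \<in> ct p \<Longrightarrow> w \<in> ct p \<Longrightarrow> comb a u b v c w \<in> ct p"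
  unfolding comb_def by (intro ct_tadd ct_tscale)

lemma coord_comb:
  assumes c: "(U, \<phi>) \<in> atlas M" and p: "p \<in> U" and v: "v \<in> ct p"
  shows "v = comb (v (xcoord \<phi> 1)) (dcoord U \<phi> 1 p) (v (xcoord \<phi> 2)) (dcoord U \<phi> 2 p) (v (xcoord \<phi> 3)) (dcoord U \<phi> 3 p)"
  by (rule ext, rule trans[OF coord_rep[OF c p v]]) (simp add: comb_apply sum_3)

lemma of_coord:
  assumes c: "(U, \<phi>) \<in> atlas M" and p: "p \<in> U" and v: "v \<in> ct p" and \<alpha>: "smooth_oneform M W \<alpha>" "p \<in> W"
  shows "\<alpha> p v = (\<Sum>i\<in>UNIV. v (xcoord \<phi> i) * \<alpha> p (dcoord U \<phi> i p))"
  by (subst coord_comb[OF c p v]) (simp add: of_comb[OF \<alpha>] dcoord_ct[OF c p] sum_3)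

definition dd :: "'a set \<Rightarrow> ('a \<Rightarrow> real^3) \<Rightarrow> 'a oneform \<Rightarrow> 'a \<Rightarrow> 'a tvec \<Rightarrow> 'a tvec \<Rightarrow> complex" where
  "dd U \<phi> \<alpha> p v w = (\<Sum>i\<in>UNIV. \<Sum>j\<in>UNIV. v (xcoord \<phi> i) * w (xcoord \<phi> j) *
     (dcoord U \<phi> i p (\<lambda>q. \<alpha> q (dcoord U \<phi> j q)) - dcoord U \<phi> j p (\<lambda>q. \<alpha> q (dcoord U \<phi> i q))))"

text \<open>Tensoriality: in coordinates the derivatives of the components of V and Y cancel against
  the bracket term, and what is left involves only the values of the fields at p.\<close>

lemma ext_d_dd:
  assumes c: "(U, \<phi>) \<in> atlas M" and p: "p \<in> U" "p \<in> W" "p \<in> N" and o: "opn W" "opn N"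
    and \<alpha>: "smooth_oneform M W \<alpha>" and V: "smooth_vfield M N V" and Y: "smooth_vfield M N Y"
  shows "ext_d M \<alpha> V Y p = dd U \<phi> \<alpha> p (V p) (Y p)"
proof -
  let ?N = "N \<inter> (U \<inter> W)"
  have N: "opn ?N" "p \<in> ?N" using o p chart_open[OF c] by auto
  note V' = smooth_vfield_subset[OF V, of ?N, simplified] and Y' = smooth_vfield_subset[OF Y, of ?N, simplified]
  define a where "a j q = \<alpha> q (dcoord U \<phi> j q)" for j q
  have sx: "sm ?N (xcoord \<phi> j)" for j by (rule sm_subset[OF smooth_xcoord[OF c]]) auto
  have sa: "smooth_at M p (a j)" for j
    unfolding a_def
    by (rule smooth_atI[OF N of_smooth[OF \<alpha> N(1)]]) (auto intro: smooth_vfield_subset[OF smooth_dcoord[OF c]])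
  have sX: "smooth_at M p (\<lambda>q. X q (xcoord \<phi> j))" if "smooth_vfield M ?N X" for X j
    by (rule smooth_atI[OF N smooth_vfieldD(2)[OF that N(1) order_refl sx]])
  have P: "p \<in> pts" using opn_sub[OF N] .
  have D: "X p (\<lambda>q. \<alpha> q (X' q)) = (\<Sum>j\<in>UNIV. X p (\<lambda>q. X' q (xcoord \<phi> j)) * a j p
       + X' p (xcoord \<phi> j) * (\<Sum>i\<in>UNIV. X p (xcoord \<phi> i) * dcoord U \<phi> i p (a j)))"
    if X: "smooth_vfield M ?N X" and X': "smooth_vfield M ?N X'" for X X'
  proof -
    have Xp: "X p \<in> ct p" using smooth_vfieldD(1)[OF X N(2)] .
    have "X p (\<lambda>q. \<alpha> q (X' q)) = X p (\<lambda>q. \<Sum>j\<in>UNIV. X' q (xcoord \<phi> j) * a j q)"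
      by (rule ct_cong[OF Xp N]) (auto simp: a_def intro!: of_coord[OF c _ smooth_vfieldD(1)[OF X'] \<alpha>])
    also have "\<dots> = (\<Sum>j\<in>UNIV. X p (\<lambda>q. X' q (xcoord \<phi> j) * a j q))"
      by (rule ct_sum[OF Xp P]) (intro smooth_at_mult sX X' sa)
    also have "\<dots> = (\<Sum>j\<in>UNIV. X p (\<lambda>q. X' q (xcoord \<phi> j)) * a j p + X' p (xcoord \<phi> j) * X p (a j))"
      by (simp add: ct_mult[OF Xp sX[OF X'] sa])
    finally show ?thesis unfolding coord_rep[OF c p(1) Xp, of "a _"] .
  qed
  have B: "\<alpha> p (lie_bracket M V Y p) = (\<Sum>j\<in>UNIV. (V p (\<lambda>q. Y q (xcoord \<phi> j)) - Y p (\<lambda>q. V q (xcoord \<phi> j))) * a j p)"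
    using of_coord[OF c p(1) lie_bracket_ct[OF N V' Y'] \<alpha> p(2)] smooth_atI[OF N sx]
    by (simp add: lie_bracket_def a_def)
  have "ext_d M \<alpha> V Y p = (\<Sum>j\<in>UNIV. \<Sum>i\<in>UNIV. V p (xcoord \<phi> i) * Y p (xcoord \<phi> j) * dcoord U \<phi> i p (a j))
      - (\<Sum>j\<in>UNIV. \<Sum>i\<in>UNIV. Y p (xcoord \<phi> i) * V p (xcoord \<phi> j) * dcoord U \<phi> i p (a j))"
    unfolding ext_d_def B D[OF V' Y'] D[OF Y' V']
    by (simp add: sum_distrib_left sum.distrib sum_subtractf algebra_simps)
  also have "\<dots> = dd U \<phi> \<alpha> p (V p) (Y p)"
    unfolding dd_def a_def[symmetric]
    by (simp only: sum_3) (simp add: algebra_simps)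
  finally show ?thesis .
qed

text \<open>A form on vectors rather than on fields; by \<open>ext_d_dform\<close> its values at the
  point are those of the exterior derivative, whatever chart is picked.\<close>

definition dform :: "'a oneform \<Rightarrow> 'a \<Rightarrow> 'a tvec \<Rightarrow> 'a tvec \<Rightarrow> complex" where
  "dform \<alpha> p = (case (SOME c. c \<in> atlas M \<and> p \<in> fst c) of (U, \<phi>) \<Rightarrow> dd U \<phi> \<alpha> p)"

lemma dform_chart: assumes "p \<in> pts" obtains U \<phi> where "(U, \<phi>) \<in> atlas M" "p \<in> U" "\<And>\<alpha>. dform \<alpha> p = dd U \<phi> \<alpha> p"
proof -
  define c where "c = (SOME c. c \<in> atlas M \<and> p \<in> fst c)"
  have "\<exists>c. c \<in> atlas M \<and> p \<in> fst c" using chart_exists[OF assms] by force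
  then have c: "c \<in> atlas M" "p \<in> fst c" unfolding c_def by (metis (mono_tags, lifting) someI_ex)+
  show ?thesis
    by (rule that[of "fst c" "snd c"]) (use c in \<open>auto simp: dform_def c_def[symmetric] split: prod.splits\<close>)
qed

lemma ext_d_dform:
  assumes "p \<in> W" "p \<in> N" "opn W" "opn N" "smooth_oneform M W \<alpha>" "smooth_vfield M N V" "smooth_vfield M N Y"
  shows "ext_d M \<alpha> V Y p = dform \<alpha> p (V p) (Y p)"
proof -
  obtain U \<phi> where "(U, \<phi>) \<in> atlas M" "p \<in> U" "\<And>\<alpha>. dform \<alpha> p = dd U \<phi> \<alpha> p"
    using dform_chart[OF opn_sub[OF assms(3,1)]] by blast
  then show ?thesis using ext_d_dd[of U \<phi> p W N \<alpha> V Y] assms by simp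
qed

lemma dform_alt:
  assumes "p \<in> pts"
  shows "dform \<alpha> p (comb a u b v c w) y = a * dform \<alpha> p u y + b * dform \<alpha> p v y + c * dform \<alpha> p w y"
    and dform_swap: "dform \<alpha> p x y = - dform \<alpha> p y x"
proof -
  obtain U \<phi> where c: "\<And>\<alpha>. dform \<alpha> p = dd U \<phi> \<alpha> p" using dform_chart[OF assms] by blast
  show "dform \<alpha> p (comb a u b v c w) y = a * dform \<alpha> p u y + b * dform \<alpha> p v y + c * dform \<alpha> p w y"
    unfolding c dd_def comb_apply by (simp add: sum_3 algebra_simps)
  show "dform \<alpha> p x y = - dform \<alpha> p y x"
    unfolding c dd_def by (simp add: sum_3 algebra_simps)
qed

lemma dform_self: "p \<in> pts \<Longrightarrow> dform \<alpha> p x x = 0"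
  using dform_swap[of p \<alpha> x x] by simp

lemmas dform_comb1 = dform_alt(1)

lemma dform_comb2: "p \<in> pts \<Longrightarrow> dform \<alpha> p y (comb a u b v c w) = a * dform \<alpha> p y u + b * dform \<alpha> p y v + c * dform \<alpha> p y w"
  using dform_swap[of p \<alpha> y] dform_comb1[of p \<alpha> a u b v c w y] by simp

lemma dcoord_cnj: assumes c: "(U, \<phi>) \<in> atlas M" and p: "p \<in> U" shows "tconj (dcoord U \<phi> i p) = dcoord U \<phi> i p"
proof
  fix f
  show "tconj (dcoord U \<phi> i p) f = dcoord U \<phi> i p f"
  proof (cases "smooth_at M p f")
    case True
    have "((\<lambda>q. cnj (f q)) \<circ> inv_into U \<phi> has_derivative (\<lambda>v. cnj (frechet_derivative (f \<circ> inv_into U \<phi>) (at (\<phi> p)) v))) (at (\<phi> p))"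
      using has_derivative_cnj[OF smooth_at_deriv[OF c p True]] by (simp add: o_def)
    from fun_cong[OF frechet_derivative_at[OF this], of "axis i 1"] show ?thesis
      using True smooth_at_cnj[OF True] by (simp add: tconj_def dcoord_def) (metis complex_cnj_cnj)
  next
    case False
    then show ?thesis by (simp add: tconj_def dcoord_def smooth_at_cnj_iff)
  qed
qed

lemma xcoord_cnj: "tconj v (xcoord \<phi> i) = cnj (v (xcoord \<phi> i))"
  by (simp add: tconj_def xcoord_def[abs_def])

lemma dform_th_cnj: 
  assumes P: "p \<in> pts" shows "dform \<theta> p (tconj v) (tconj w) = cnj (dform \<theta> p v w)"
proof -
  obtain U \<phi> where c: "(U, \<phi>) \<in> atlas M" "p \<in> U" and d: "\<And>\<alpha>. dform \<alpha> p = dd U \<phi> \<alpha> p" using dform_chart[OF P] by blast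
  have "cnj (dcoord U \<phi> i p (\<lambda>q. \<theta> q (dcoord U \<phi> j q))) = dcoord U \<phi> i p (\<lambda>q. \<theta> q (dcoord U \<phi> j q))" for i j
  proof -
    have "dcoord U \<phi> i p (\<lambda>q. cnj (\<theta> q (dcoord U \<phi> j q))) = dcoord U \<phi> i p (\<lambda>q. \<theta> q (dcoord U \<phi> j q))"
    proof (rule ct_cong[OF dcoord_ct[OF c] chart_open[OF c(1)] c(2)])
      fix q assume q: "q \<in> U"
      show "cnj (\<theta> q (dcoord U \<phi> j q)) = \<theta> q (dcoord U \<phi> j q)"
        using th_conj[OF opn_sub[OF chart_open[OF c(1)] q] dcoord_ct[OF c(1) q], of j] dcoord_cnj[OF c(1) q] by simp
    qed
    then show ?thesis using fun_cong[OF dcoord_cnj[OF c, of i], of "\<lambda>q. \<theta> q (dcoord U \<phi> j q)"]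
      by (simp add: tconj_def)
  qed
  then show ?thesis unfolding d dd_def by (simp add: xcoord_cnj)
qed

lemma extend_field:
  assumes "p \<in> pts" "w \<in> ct p"
  obtains U W where "opn U" "p \<in> U" "smooth_vfield M U W" "W p = w"
proof -
  obtain U \<phi> where c: "(U, \<phi>) \<in> atlas M" "p \<in> U" using chart_exists[OF assms(1)] by blast
  let ?W = "\<lambda>q. comb (w (xcoord \<phi> 1)) (dcoord U \<phi> 1 q) (w (xcoord \<phi> 2)) (dcoord U \<phi> 2 q) (w (xcoord \<phi> 3)) (dcoord U \<phi> 3 q)"
  have "smooth_vfield M U ?W" unfolding comb_def
    by (intro smooth_vfield_tadd smooth_vfield_tscale chart_open[OF c(1)] smooth_dcoord[OF c(1)] sm_const)
  then show ?thesis using that[of U ?W] chart_open[OF c(1)] c(2) coord_comb[OF c assms(2)] by simp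
qed

lemma ext_d_smooth:
  assumes o: "opn N" and s: "N \<subseteq> W" and a: "smooth_oneform M W \<alpha>" and V: "smooth_vfield M N V" and Y: "smooth_vfield M N Y"
  shows "sm N (\<lambda>p. ext_d M \<alpha> V Y p)"
  unfolding ext_d_def
  by (intro sm_diff o smooth_vfieldD(2)[OF V o order_refl] smooth_vfieldD(2)[OF Y o order_refl]
      of_smooth[OF a o s] V Y smooth_lie_bracket)

lemma smooth_vfield_comb:
  "opn U \<Longrightarrow> sm U a \<Longrightarrow> sm U b \<Longrightarrow> sm U c \<Longrightarrow> smooth_vfield M U X \<Longrightarrow> smooth_vfield M U Y \<Longrightarrow> smooth_vfield M U W
     \<Longrightarrow> smooth_vfield M U (\<lambda>p. comb (a p) (X p) (b p) (Y p) (c p) (W p))"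
  unfolding comb_def by (intro smooth_vfield_tadd smooth_vfield_tscale)

section \<open>The Reeb field\<close>

definition is_reeb :: "'a \<Rightarrow> 'a tvec \<Rightarrow> bool" where
  "is_reeb p v \<longleftrightarrow> v \<in> ct p \<and> \<theta> p v = 1 \<and> (\<forall>w\<in>ct p. dform \<theta> p v w = 0)"

definition reeb :: "'a vfield" where "reeb p = (THE v. is_reeb p v)"

context
  fixes U Z assumes F: "frame_vector M U Z"
begin

lemma th_dform: "p \<in> U \<Longrightarrow> opn N \<Longrightarrow> p \<in> N \<Longrightarrow> smooth_vfield M N V \<Longrightarrow> smooth_vfield M N Y \<Longrightarrow> ext_d M \<theta> V Y p = dform \<theta> p (V p) (Y p)"
  using ext_d_dform[of p pts N \<theta> V Y] th_oneform frame_pts[OF F] openin_topspace by blast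

lemma dform_ZZb: "p \<in> U \<Longrightarrow> dform \<theta> p (Z p) (vconj Z p) = \<i> * hh Z p"
  using th_dform[of p U Z "vconj Z"] frameD[OF F] by (simp add: h11_def levi_def)

lemma dform_ZbZ: "p \<in> U \<Longrightarrow> dform \<theta> p (vconj Z p) (Z p) = - \<i> * hh Z p"
  using dform_swap[OF frame_pts[OF F], of p \<theta> "vconj Z p" "Z p"] dform_ZZb by simp

lemma hsm: "sm U (hh Z)"
proof -
  have "sm U (\<lambda>p. - \<i> * ext_d M \<theta> Z (vconj Z) p)"
    by (intro sm_mult sm_const ext_d_smooth[OF _ _ th_oneform] frameD[OF F] openin_subset[OF frame_opn[OF F]])
  then show ?thesis by (simp add: h11_def[abs_def] levi_def)
qed

text \<open>Since \<theta> takes the value -i h on the bracket, \<open>T0\<close> has \<theta>-value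
  1. The coefficients of Z and its conjugate in \<open>reeb_loc\<close> are then obtained by solving
  the two equations d\<theta>(T, Z) = 0 and d\<theta>(T, conjugate of Z) = 0.\<close>

definition "T0 = (\<lambda>q. tscale (\<i> / hh Z q) (lie_bracket M Z (vconj Z) q))"
definition "reeb_loc = (\<lambda>q. comb 1 (T0 q) (\<i> * ext_d M \<theta> T0 (vconj Z) q / hh Z q) (Z q) (- \<i> * ext_d M \<theta> T0 Z q / hh Z q) (vconj Z q))"

lemma T0_smooth: "smooth_vfield M U T0"
  unfolding T0_def
  by (intro smooth_vfield_tscale smooth_lie_bracket frameD[OF F] sm_divide sm_const hsm h_nonzero[OF F])

lemma reeb_loc_smooth: "smooth_vfield M U reeb_loc"
  unfolding reeb_loc_def
  by (intro smooth_vfield_comb frameD[OF F] T0_smooth sm_divide sm_mult sm_const hsm h_nonzero[OF F] ext_d_smooth[OF _ _ th_oneform] openin_subset[OF frame_opn[OF F]])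

lemma B_ct: "p \<in> U \<Longrightarrow> lie_bracket M Z (vconj Z) p \<in> ct p"
  by (rule lie_bracket_ct) (use frameD[OF F] in auto)

lemma is_reeb_loc: assumes p: "p \<in> U" shows "is_reeb p (reeb_loc p)"
  unfolding is_reeb_def
proof (intro conjI ballI)
  note fr = frameD[OF F]
  have P: "p \<in> pts" using fr p by blast
  have T0c: "T0 p \<in> ct p" using smooth_vfieldD(1)[OF T0_smooth p] .
  show "reeb_loc p \<in> ct p" using smooth_vfieldD(1)[OF reeb_loc_smooth p] .
  have h: "hh Z p \<noteq> 0" by (rule h_nonzero[OF F p])
  have tT0: "\<theta> p (T0 p) = 1"
    unfolding T0_def using th_scale[OF P B_ct[OF p]] th_bracket[OF F p] h by simp
  show "\<theta> p (reeb_loc p) = 1"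
    unfolding reeb_loc_def using of_comb[OF th_oneform P T0c fr(7,8)] fr(9,10) p tT0 by simp
  let ?d = "dform \<theta> p"
  have e: "ext_d M \<theta> T0 (vconj Z) p = ?d (T0 p) (vconj Z p)" "ext_d M \<theta> T0 Z p = ?d (T0 p) (Z p)"
    using th_dform[OF p fr(1) p T0_smooth] fr by auto
  have dZ: "?d (reeb_loc p) (Z p) = 0" "?d (reeb_loc p) (vconj Z p) = 0"
    unfolding reeb_loc_def dform_comb1[OF P] e using h dform_ZZb[OF p] dform_ZbZ[OF p] dform_self[OF P]
    by (simp_all add: field_simps)
  \<comment> \<open>The field differs from \<open>T0\<close> by a combination of Z and its
    conjugate, on which the form has just been shown to vanish; so this value equals that of the
    alternating form on a repeated argument.\<close>
  have dT: "?d (reeb_loc p) (T0 p) = 0"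
  proof -
    have "?d (reeb_loc p) (reeb_loc p) = ?d (reeb_loc p) (T0 p)"
      by (subst (2) reeb_loc_def) (simp add: dform_comb2[OF P] dZ)
    then show ?thesis using dform_self[OF P] by simp
  qed
  fix w assume w: "w \<in> ct p"
  obtain a b c where "w = comb a (lie_bracket M Z (vconj Z) p) b (Z p) c (vconj Z p)" using span0[OF F p w] by blast
  then have "w = comb (a * hh Z p / \<i>) (T0 p) b (Z p) c (vconj Z p)"
    using h by (simp add: fun_eq_iff comb_apply T0_def tscale_def mult.left_commute[of \<i> a])
  then show "?d (reeb_loc p) w = 0" by (simp add: dform_comb2[OF P] dZ dT)
qed

lemma is_reeb_unique: assumes p: "p \<in> U" and v: "is_reeb p v" "is_reeb p v'" shows "v = v'"
proof -
  note fr = frameD[OF F]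
  have P: "p \<in> pts" using fr p by blast
  have h: "hh Z p \<noteq> 0" by (rule h_nonzero[OF F p])
  have vc: "v \<in> ct p" "v' \<in> ct p" using v by (auto simp: is_reeb_def)
  define d where "d = comb 1 v (- 1) v' 0 v'"
  have d: "d \<in> ct p" unfolding d_def by (intro ct_comb vc)
  obtain a b c where abc: "d = comb a (lie_bracket M Z (vconj Z) p) b (Z p) c (vconj Z p)" using span0[OF F p d] by blast
  have "\<theta> p d = 0" unfolding d_def using of_comb[OF th_oneform P vc(1) vc(2) vc(2)] v by (simp add: is_reeb_def)
  then have a: "a = 0" unfolding abc using of_comb[OF th_oneform P B_ct[OF p] fr(7,8)[OF p]] fr(9,10)[OF p] th_bracket[OF F p] h by simp
  have "dform \<theta> p d w = 0" if "w \<in> ct p" for w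
    unfolding d_def dform_comb1[OF P] using v that by (simp add: is_reeb_def)
  from this[OF fr(7)[OF p]] this[OF fr(8)[OF p]] have "b = 0" "c = 0"
    unfolding abc dform_comb1[OF P] using a h dform_ZZb[OF p] dform_ZbZ[OF p] dform_self[OF P] by auto
  then have "d f = 0" for f using a abc by (simp add: comb_apply)
  then show ?thesis by (simp add: d_def comb_apply fun_eq_iff)
qed

lemma reeb_eq_loc: "p \<in> U \<Longrightarrow> reeb p = reeb_loc p"
  unfolding reeb_def using is_reeb_loc is_reeb_unique by (metis (mono_tags, lifting) the_equality)

end

lemma is_reeb_reeb: "p \<in> pts \<Longrightarrow> is_reeb p (reeb p)"
  using frame_exists[of p] reeb_eq_loc is_reeb_loc by metis

lemma is_reeb_eq: "p \<in> pts \<Longrightarrow> is_reeb p v \<Longrightarrow> v = reeb p"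
  using frame_exists[of p] is_reeb_unique is_reeb_reeb by metis

lemma reeb_smooth: "smooth_vfield M pts reeb"
proof (rule smooth_vfield_local)
  fix p assume "p \<in> pts"
  then obtain U Z where F: "frame_vector M U Z" "p \<in> U" using frame_exists by blast
  have "smooth_vfield M U reeb"
    by (rule smooth_vfield_cong[OF frame_opn[OF F(1)] reeb_loc_smooth[OF F(1)]]) (simp add: reeb_eq_loc[OF F(1)])
  then show "\<exists>V. opn V \<and> p \<in> V \<and> smooth_vfield M V reeb" using F frame_opn by blast
qed

lemma reeb_ct: "p \<in> pts \<Longrightarrow> reeb p \<in> ct p" and reeb_th: "p \<in> pts \<Longrightarrow> \<theta> p (reeb p) = 1"
  and reeb_d: "p \<in> pts \<Longrightarrow> w \<in> ct p \<Longrightarrow> dform \<theta> p (reeb p) w = 0"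
  using is_reeb_reeb by (auto simp: is_reeb_def)

lemma reeb_real: assumes P: "p \<in> pts" shows "tconj (reeb p) = reeb p"
proof (rule is_reeb_eq[OF P])
  show "is_reeb p (tconj (reeb p))"
    unfolding is_reeb_def
  proof (intro conjI ballI)
    show "tconj (reeb p) \<in> ct p" using ct_tconj reeb_ct[OF P] .
    show "\<theta> p (tconj (reeb p)) = 1" using th_conj[OF P reeb_ct[OF P]] reeb_th[OF P] by simp
    fix w assume "w \<in> ct p"
    then show "dform \<theta> p (tconj (reeb p)) w = 0"
      using dform_th_cnj[OF P, of "reeb p" "tconj w"] reeb_d[OF P ct_tconj] by simp
  qed
qed

theorem reeb_field_reeb: "reeb_field M \<theta> reeb"
  unfolding reeb_field_def rtangent_def
proof (intro conjI ballI allI impI reeb_smooth)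
  show "reeb p \<in> {v \<in> ct p. tconj v = v}" if "p \<in> pts" for p using that reeb_ct reeb_real by auto
  show "\<theta> p (reeb p) = 1" if "p \<in> pts" for p using that reeb_th by auto
  fix U X p assume U: "opn U" "smooth_vfield M U X" "p \<in> U"
  have "ext_d M \<theta> reeb X p = dform \<theta> p (reeb p) (X p)"
    by (rule ext_d_dform[OF _ U(3) openin_topspace U(1) th_oneform])
      (use U opn_sub in \<open>auto intro: smooth_vfield_subset[OF reeb_smooth]\<close>)
  then show "ext_d M \<theta> reeb X p = 0" using reeb_d[of p "X p"] opn_sub[OF U(1,3)] smooth_vfieldD(1)[OF U(2,3)] by simp
qed

theorem reeb_field_unique: assumes T: "reeb_field M \<theta> T" and P: "p \<in> pts" shows "T p = reeb p"
proof (rule is_reeb_eq[OF P])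
  show "is_reeb p (T p)"
    unfolding is_reeb_def
  proof (intro conjI ballI)
    show "T p \<in> ct p" "\<theta> p (T p) = 1" using T P by (auto simp: reeb_field_def rtangent_def)
    fix w assume w: "w \<in> ct p"
    obtain U W where U: "opn U" "p \<in> U" "smooth_vfield M U W" "W p = w" using extend_field[OF P w] by blast
    have Ts: "smooth_vfield M U T" using T openin_subset[OF U(1)] by (auto simp: reeb_field_def intro: smooth_vfield_subset)
    have "ext_d M \<theta> T W p = 0" using T U unfolding reeb_field_def by blast
    then show "dform \<theta> p (T p) w = 0"
      using ext_d_dform[OF P U(2) openin_topspace U(1) th_oneform Ts U(3)] U(4) by simp
  qed
qed

end

section \<open>The dual coframe, rules for Lie brackets, and the connection form\<close>

context contact begin

abbreviation "Fr U Z \<equiv> frame_vector M U Z"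

text \<open>The coframe dual to \<open>reeb, Z, vconj Z\<close> is \<open>\<theta>, k1 Z, k2 Z\<close>.\<close>

definition k1 :: "'a vfield \<Rightarrow> 'a oneform" where
  "k1 Z p v = dform \<theta> p v (vconj Z p) / (\<i> * hh Z p)"

definition k2 :: "'a vfield \<Rightarrow> 'a oneform" where
  "k2 Z p v = cnj (k1 Z p (tconj v))"

context
  fixes U Z assumes F: "Fr U Z"
begin

lemmas fr = frameD[OF F]

lemma k2_alt: assumes p: "p \<in> U" shows "k2 Z p v = dform \<theta> p v (Z p) / (- \<i> * hh Z p)"
proof -
  have "dform \<theta> p (tconj v) (vconj Z p) = cnj (dform \<theta> p v (Z p))"
    unfolding vconj_def by (rule dform_th_cnj[OF fr(6)[OF p]])
  then show ?thesis using h_cnj[OF F p] by (simp add: k2_def k1_def)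
qed

lemma k1_frame: assumes p: "p \<in> U"
  shows "k1 Z p (reeb p) = 0" "k1 Z p (Z p) = 1" "k1 Z p (vconj Z p) = 0"
    "k2 Z p (reeb p) = 0" "k2 Z p (Z p) = 0" "k2 Z p (vconj Z p) = 1"
  using reeb_d[OF fr(6)[OF p]] fr(7,8)[OF p] dform_ZZb[OF F p] dform_ZbZ[OF F p] dform_self[OF fr(6)[OF p]] h_nonzero[OF F p]
  by (simp_all add: k1_def k2_alt[OF p])

lemma k1_comb: assumes p: "p \<in> U"
  shows "k1 Z p (comb a u b v c w) = a * k1 Z p u + b * k1 Z p v + c * k1 Z p w"
    "k2 Z p (comb a u b v c w) = a * k2 Z p u + b * k2 Z p v + c * k2 Z p w"
  by (simp_all add: k1_def k2_alt[OF p] dform_comb1[OF fr(6)[OF p]] add_divide_distrib)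

lemma th_comb: assumes p: "p \<in> U" and "u \<in> ct p" "v \<in> ct p" "w \<in> ct p"
  shows "\<theta> p (comb a u b v c w) = a * \<theta> p u + b * \<theta> p v + c * \<theta> p w"
  using of_comb[OF th_oneform fr(6)[OF p]] assms by blast

lemma frame_ct: assumes p: "p \<in> U" shows "reeb p \<in> ct p" "Z p \<in> ct p" "vconj Z p \<in> ct p"
  using reeb_ct[OF fr(6)[OF p]] fr(7,8)[OF p] by auto

lemma th_frame: assumes p: "p \<in> U" shows "\<theta> p (reeb p) = 1" "\<theta> p (Z p) = 0" "\<theta> p (vconj Z p) = 0"
  using reeb_th[OF fr(6)[OF p]] fr(9,10)[OF p] by auto

lemma frame_span: assumes p: "p \<in> U" and v: "v \<in> ct p"
  shows "v = comb (\<theta> p v) (reeb p) (k1 Z p v) (Z p) (k2 Z p v) (vconj Z p)"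
proof -
  obtain a b c where abc: "v = comb a (lie_bracket M Z (vconj Z) p) b (Z p) c (vconj Z p)" using span0[OF F p v] by blast
  have h: "hh Z p \<noteq> 0" by (rule h_nonzero[OF F p])
  have t: "comb 1 (T0 Z p) b (Z p) c (vconj Z p) = comb (\<i> / hh Z p) (lie_bracket M Z (vconj Z) p) b (Z p) c (vconj Z p)" for b c
    by (simp add: fun_eq_iff comb_apply T0_def[OF F] tscale_def)
  have "\<exists>b' c'. reeb p = comb (\<i> / hh Z p) (lie_bracket M Z (vconj Z) p) b' (Z p) c' (vconj Z p)"
    unfolding reeb_eq_loc[OF F p] reeb_loc_def[OF F] t by blast
  then obtain b' c' where r: "reeb p = comb (\<i> / hh Z p) (lie_bracket M Z (vconj Z) p) b' (Z p) c' (vconj Z p)"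
    by (elim exE)
  define a' where "a' = a * hh Z p / \<i>"
  define t where "t = \<i> / hh Z p"
  have at: "a = a' * t" using h by (simp add: a'_def t_def mult.commute[of a \<i>])
  have "v = comb a' (reeb p) (b - a' * b') (Z p) (c - a' * c') (vconj Z p)"
    unfolding abc r t_def[symmetric] at by (simp add: fun_eq_iff comb_apply algebra_simps)
  then obtain A B C where e: "v = comb A (reeb p) B (Z p) C (vconj Z p)" by blast
  have "\<theta> p v = A" "k1 Z p v = B" "k2 Z p v = C"
    unfolding e th_comb[OF p frame_ct[OF p]] k1_comb[OF p] th_frame[OF p] k1_frame[OF p] by simp_all
  then show ?thesis using e by simp
qed

lemma frame_unique:
  assumes p: "p \<in> U" and e: "comb a (reeb p) b (Z p) c (vconj Z p) = comb a' (reeb p) b' (Z p) c' (vconj Z p)"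
  shows "a = a'" "b = b'" "c = c'"
  using arg_cong[OF e, of "\<theta> p"] arg_cong[OF e, of "k1 Z p"] arg_cong[OF e, of "k2 Z p"]
  by (simp_all add: th_comb[OF p frame_ct[OF p]] k1_comb[OF p] th_frame[OF p] k1_frame[OF p])

lemma coframe1_eq: assumes T: "T p = reeb p" and p: "p \<in> U" and v: "v \<in> ct p"
  shows "coframe1 T Z p v = k1 Z p v"
  unfolding coframe1_def T comb_def[symmetric]
proof (rule the_equality)
  show "\<exists>a c. v = comb a (reeb p) (k1 Z p v) (Z p) c (vconj Z p)" using frame_span[OF p v] by blast
  fix b assume "\<exists>a c. v = comb a (reeb p) b (Z p) c (vconj Z p)"
  then obtain a c where e: "v = comb a (reeb p) b (Z p) c (vconj Z p)" by blast
  show "b = k1 Z p v" using frame_unique[OF p] e frame_span[OF p v] by metis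
qed

lemma k1_smooth:
  assumes "opn N" "N \<subseteq> U" "smooth_vfield M N V"
  shows "sm N (\<lambda>p. k1 Z p (V p))" "sm N (\<lambda>p. k2 Z p (V p))"
proof -
  have s: "smooth_vfield M N Z" "smooth_vfield M N (vconj Z)" by (rule smooth_vfield_subset[OF fr(2) assms(2)] smooth_vfield_subset[OF fr(3) assms(2)])+
  have "sm N (hh Z)" using sm_subset[OF hsm[OF F] assms(2)] .
  have P: "N \<subseteq> pts" using openin_subset[OF assms(1)] .
  have "sm N (\<lambda>p. ext_d M \<theta> V (vconj Z) p / (\<i> * hh Z p))" "sm N (\<lambda>p. ext_d M \<theta> V Z p / (- \<i> * hh Z p))"
    using assms(2) h_nonzero[OF F]
    by (intro sm_divide sm_mult sm_const assms(1) ext_d_smooth[OF assms(1) P th_oneform] assms(3) s \<open>sm N (hh Z)\<close>; auto)+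
  moreover have "ext_d M \<theta> V Y p = dform \<theta> p (V p) (Y p)" if "p \<in> N" "smooth_vfield M N Y" for p Y
    using th_dform[OF F _ assms(1) that(1) assms(3) that(2)] assms(2) that(1) by blast
  ultimately show "sm N (\<lambda>p. k1 Z p (V p))" "sm N (\<lambda>p. k2 Z p (V p))"
    using s assms(2) by (auto intro: sm_cong[OF assms(1), rotated] simp: k1_def k2_alt subset_iff)
qed

lemma k1_lin: assumes p: "p \<in> U"
  shows "k1 Z p (tadd v w) = k1 Z p v + k1 Z p w" "k1 Z p (tscale c v) = c * k1 Z p v"
    "k2 Z p (tadd v w) = k2 Z p v + k2 Z p w" "k2 Z p (tscale c v) = c * k2 Z p v"
proof -
  have t: "tadd v w = comb 1 v 1 w 0 w" "tscale c v = comb c v 0 v 0 v" by (simp_all add: fun_eq_iff comb_apply tvec_simps)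
  show "k1 Z p (tadd v w) = k1 Z p v + k1 Z p w" "k1 Z p (tscale c v) = c * k1 Z p v"
    "k2 Z p (tadd v w) = k2 Z p v + k2 Z p w" "k2 Z p (tscale c v) = c * k2 Z p v"
    unfolding t k1_comb[OF p] by simp_all
qed

lemma k1_oneform: "smooth_oneform M U (k1 Z)"
  unfolding smooth_oneform_def using k1_lin k1_smooth by blast

end

lemma k2_tconj: "k2 Z p (tconj v) = cnj (k1 Z p v)" "k1 Z p (tconj v) = cnj (k2 Z p v)"
  by (simp_all add: k2_def)

lemma lie_bracket_vconj:
  assumes "opn U" "p \<in> U" "smooth_vfield M U X" "smooth_vfield M U Y"
  shows "lie_bracket M (vconj X) (vconj Y) p = tconj (lie_bracket M X Y p)"
  by (rule ext) (simp add: lie_bracket_def vconj_def tconj_def smooth_at_cnj_iff)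

lemma vconj_reeb: "p \<in> pts \<Longrightarrow> vconj reeb p = reeb p"
  by (simp add: vconj_def reeb_real)

lemma vconj_vconj [simp]: "vconj (vconj X) = X"
  by (simp add: vconj_def)

lemma lie_bracket_swap: "lie_bracket M Y X p = tscale (- 1) (lie_bracket M X Y p)"
  by (simp add: fun_eq_iff lie_bracket_def tscale_def)

lemma lie_bracket_cong:
  assumes N: "opn N" "p \<in> N" and X: "smooth_vfield M N X" "smooth_vfield M N Y"
    and e: "\<And>q. q \<in> N \<Longrightarrow> X q = X' q" "\<And>q. q \<in> N \<Longrightarrow> Y q = Y' q"
  shows "lie_bracket M X Y p = lie_bracket M X' Y' p"
proof (rule ext)
  fix f
  have "X p (\<lambda>q. Y q f) = X p (\<lambda>q. Y' q f)" "Y p (\<lambda>q. X q f) = Y p (\<lambda>q. X' q f)"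
    by (rule ct_cong[OF smooth_vfieldD(1)[OF X(1) N(2)] N], simp add: e)
      (rule ct_cong[OF smooth_vfieldD(1)[OF X(2) N(2)] N], simp add: e)
  then show "lie_bracket M X Y p f = lie_bracket M X' Y' p f" using e N by (simp add: lie_bracket_def)
qed

lemma lie_bracket_scale:
  assumes N: "opn N" "p \<in> N" and X: "smooth_vfield M N X" "smooth_vfield M N Y" and g: "sm N g"
  shows "lie_bracket M X (\<lambda>q. tscale (g q) (Y q)) p = tadd (tscale (g p) (lie_bracket M X Y p)) (tscale (X p g) (Y p))"
proof (rule ext)
  fix f
  show "lie_bracket M X (\<lambda>q. tscale (g q) (Y q)) p f = tadd (tscale (g p) (lie_bracket M X Y p)) (tscale (X p g) (Y p)) f"
  proof (cases "smooth_at M p f")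
    case True
    have "X p (\<lambda>q. g q * Y q f) = X p g * Y p f + g p * X p (\<lambda>q. Y q f)"
      by (rule ct_mult[OF smooth_vfieldD(1)[OF X(1) N(2)] smooth_atI[OF N g] smooth_at_vfield[OF N X(2) True]])
    then show ?thesis using True by (simp add: lie_bracket_def tvec_simps algebra_simps)
  next
    case False
    then show ?thesis using ct_nonsmooth[OF smooth_vfieldD(1)[OF X(2) N(2)]] by (simp add: lie_bracket_def tvec_simps)
  qed
qed

lemma lie_bracket_tadd:
  assumes N: "opn N" "p \<in> N" and X: "smooth_vfield M N X" "smooth_vfield M N Y" "smooth_vfield M N W"
  shows "lie_bracket M X (\<lambda>q. tadd (Y q) (W q)) p = tadd (lie_bracket M X Y p) (lie_bracket M X W p)"
proof (rule ext)
  fix f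
  show "lie_bracket M X (\<lambda>q. tadd (Y q) (W q)) p f = tadd (lie_bracket M X Y p) (lie_bracket M X W p) f"
  proof (cases "smooth_at M p f")
    case True
    have "X p (\<lambda>q. Y q f + W q f) = X p (\<lambda>q. Y q f) + X p (\<lambda>q. W q f)"
      by (rule ct_add[OF smooth_vfieldD(1)[OF X(1) N(2)] smooth_at_vfield[OF N X(2) True] smooth_at_vfield[OF N X(3) True]])
    then show ?thesis using True by (simp add: lie_bracket_def tvec_simps algebra_simps)
  qed (simp add: lie_bracket_def tvec_simps)
qed

lemma jacobi:
  assumes N: "opn N" "p \<in> N" and X: "smooth_vfield M N X" "smooth_vfield M N Y" "smooth_vfield M N W"
  shows "lie_bracket M X (lie_bracket M Y W) p = tadd (lie_bracket M (lie_bracket M X Y) W p) (lie_bracket M Y (lie_bracket M X W) p)"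
proof (rule ext)
  fix f
  show "lie_bracket M X (lie_bracket M Y W) p f = tadd (lie_bracket M (lie_bracket M X Y) W p) (lie_bracket M Y (lie_bracket M X W) p) f"
  proof (cases "smooth_at M p f")
    case True
    then obtain V where V: "opn V" "p \<in> V" "sm V f" by (auto simp: smooth_at_def)
    have NV: "opn (N \<inter> V)" "p \<in> N \<inter> V" using N V by auto
    have sa: "smooth_at M q f" if "q \<in> N \<inter> V" for q using smooth_atI[OF V(1) _ V(3)] that by blast
    note s = smooth_at_vfield[OF N]
    have e: "A p (\<lambda>q. lie_bracket M B C q f) = A p (\<lambda>q. B q (\<lambda>r. C r f)) - A p (\<lambda>q. C q (\<lambda>r. B r f))"
      if "smooth_vfield M N A" "smooth_vfield M N B" "smooth_vfield M N C" for A B C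
    proof -
      have A: "A p \<in> ct p" using smooth_vfieldD(1)[OF that(1) N(2)] .
      have "A p (\<lambda>q. lie_bracket M B C q f) = A p (\<lambda>q. B q (\<lambda>r. C r f) - C q (\<lambda>r. B r f))"
        by (rule ct_cong[OF A NV]) (simp add: lie_bracket_def sa)
      then show ?thesis by (simp add: ct_diff[OF A s[OF that(2) s[OF that(3) True]] s[OF that(3) s[OF that(2) True]]])
    qed
    show ?thesis
      using True s[OF X(1) True] s[OF X(2) True] s[OF X(3) True]
      by (simp add: lie_bracket_def[of M _ "lie_bracket M _ _"] lie_bracket_def[of M "lie_bracket M _ _" ] tvec_simps e X)
        (simp add: lie_bracket_def)
  qed (simp add: lie_bracket_def tvec_simps)
qed

end

context manifold begin

lemma ct_inverse:
  assumes v: "v \<in> ctangent M p" and N: "opn N" "p \<in> N" and g: "sm N g" and nz: "\<And>q. q \<in> N \<Longrightarrow> g q \<noteq> 0"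
  shows "v (\<lambda>q. inverse (g q)) = - v g / (g p * g p)"
proof -
  have s: "smooth_at M p g" "smooth_at M p (\<lambda>q. inverse (g q))"
    using smooth_atI[OF N] g sm_inverse[OF N(1) g nz] by auto
  have "v (\<lambda>q. g q * inverse (g q)) = 0"
    using ct_cong[OF v N, of "\<lambda>q. g q * inverse (g q)" "\<lambda>q. 1"] ct_const[OF v, of 1] nz by simp
  then have "v g * inverse (g p) + g p * v (\<lambda>q. inverse (g q)) = 0" using ct_mult[OF v s] by simp
  then show ?thesis using nz[OF N(2)] by (simp add: field_simps eq_neg_iff_add_eq_0)
qed

lemma ct_divide:
  assumes v: "v \<in> ctangent M p" and N: "opn N" "p \<in> N" and f: "sm N f" and g: "sm N g" and nz: "\<And>q. q \<in> N \<Longrightarrow> g q \<noteq> 0"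
  shows "v (\<lambda>q. f q / g q) = v f / g p - f p * v g / (g p * g p)"
proof -
  have "v (\<lambda>q. f q * inverse (g q)) = v f * inverse (g p) + f p * v (\<lambda>q. inverse (g q))"
    by (rule ct_mult[OF v smooth_atI[OF N f] smooth_atI[OF N sm_inverse[OF N(1) g nz]]])
  then show ?thesis using ct_inverse[OF v N g nz] by (simp add: divide_inverse)
qed

end

context contact begin

lemma lie_bracket_comb:
  assumes N: "opn N" "p \<in> N" and X: "smooth_vfield M N X" and ABC: "smooth_vfield M N A" "smooth_vfield M N B" "smooth_vfield M N C"
    and abc: "sm N a" "sm N b" "sm N c"
  shows "lie_bracket M X (\<lambda>q. comb (a q) (A q) (b q) (B q) (c q) (C q)) p
    = tadd (comb (a p) (lie_bracket M X A p) (b p) (lie_bracket M X B p) (c p) (lie_bracket M X C p))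
        (comb (X p a) (A p) (X p b) (B p) (X p c) (C p))"
  unfolding comb_def
  by (subst lie_bracket_tadd[OF N X]; (intro smooth_vfield_tadd smooth_vfield_tscale N ABC abc)?)
    (subst lie_bracket_tadd[OF N X]; (intro smooth_vfield_tadd smooth_vfield_tscale N ABC abc)?;
     simp add: lie_bracket_scale[OF N X] ABC abc fun_eq_iff tvec_simps)

definition "wZb Z q = - k1 Z q (lie_bracket M Z (vconj Z) q)"
definition "wT Z q = k1 Z q (lie_bracket M reeb Z q)"
definition "wZ Z q = Z q (hh Z) / hh Z q - cnj (wZb Z q)"
definition "om Z q v = \<theta> q v * wT Z q + k1 Z q v * wZ Z q + k2 Z q v * wZb Z q"

text \<open>\<open>om Z\<close> is the connection form; its values on the frame are forced by the structure equation and by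
  \<open>\<nabla>h\<^sub>\<theta> = 0\<close>.\<close>

definition nabF :: "'a vfield \<Rightarrow> 'a connection" where
  "nabF Z q v Y = comb (v (\<lambda>r. \<theta> r (Y r))) (reeb q) (v (\<lambda>r. k1 Z r (Y r)) + om Z q v * k1 Z q (Y q)) (Z q)
     (v (\<lambda>r. k2 Z r (Y r)) + cnj (om Z q (tconj v)) * k2 Z q (Y q)) (vconj Z q)"

context
  fixes U Z assumes F: "Fr U Z"
begin

lemmas ff = frameD[OF F]

lemma reeb_U: "smooth_vfield M U reeb"
  using smooth_vfield_subset[OF reeb_smooth openin_subset[OF ff(1)]] .

lemma w_smooth: "sm U (wZb Z)" "sm U (wT Z)" "sm U (wZ Z)"
proof -
  show b: "sm U (wZb Z)" unfolding wZb_def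
    by (intro sm_uminus k1_smooth[OF F ff(1) order_refl] smooth_lie_bracket ff)
  show "sm U (wT Z)" unfolding wT_def
    by (intro k1_smooth[OF F ff(1) order_refl] smooth_lie_bracket ff reeb_U)
  show "sm U (wZ Z)" unfolding wZ_def
    by (intro sm_diff sm_divide sm_cnj b ff hsm[OF F] smooth_vfieldD(2)[OF ff(2) ff(1) order_refl] h_nonzero[OF F])
qed

lemma om_smooth: "opn N \<Longrightarrow> N \<subseteq> U \<Longrightarrow> smooth_vfield M N V \<Longrightarrow> sm N (\<lambda>q. om Z q (V q))"
  unfolding om_def by (intro sm_add sm_mult k1_smooth[OF F] th_smooth sm_subset[OF w_smooth(1)] sm_subset[OF w_smooth(2)] sm_subset[OF w_smooth(3)])

lemma om_frame: "p \<in> U \<Longrightarrow> om Z p (reeb p) = wT Z p" "p \<in> U \<Longrightarrow> om Z p (Z p) = wZ Z p" "p \<in> U \<Longrightarrow> om Z p (vconj Z p) = wZb Z p"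
  by (simp_all add: om_def th_frame[OF F] k1_frame[OF F])

lemma om_comb: "p \<in> U \<Longrightarrow> u \<in> ct p \<Longrightarrow> v \<in> ct p \<Longrightarrow> w \<in> ct p \<Longrightarrow> om Z p (comb a u b v c w) = a * om Z p u + b * om Z p v + c * om Z p w"
  by (simp add: om_def th_comb[OF F] k1_comb[OF F] algebra_simps)

lemma bracket_TZ: assumes p: "p \<in> U"
  shows "\<theta> p (lie_bracket M reeb Z p) = 0" "\<theta> p (lie_bracket M reeb (vconj Z) p) = 0"
proof -
  have *: "\<theta> p (lie_bracket M reeb X p) = 0" if X: "smooth_vfield M U X" and t: "\<And>q. q \<in> U \<Longrightarrow> \<theta> q (X q) = 0" for X
  proof -
    have "ext_d M \<theta> reeb X p = 0" using reeb_field_reeb ff(1) X p unfolding reeb_field_def by blast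
    moreover have "reeb p (\<lambda>q. \<theta> q (X q)) = 0"
      by (rule ct_zero_near[OF reeb_ct[OF ff(6)[OF p]] ff(1) p, of _ 0]) (rule t)
    moreover have "X p (\<lambda>q. \<theta> q (reeb q)) = 0"
      by (rule ct_zero_near[OF smooth_vfieldD(1)[OF X p] ff(1) p, of _ 1]) (simp add: reeb_th ff(6))
    ultimately show ?thesis by (simp add: ext_d_def)
  qed
  show "\<theta> p (lie_bracket M reeb Z p) = 0" "\<theta> p (lie_bracket M reeb (vconj Z) p) = 0" by (rule *; simp add: ff)+
qed

lemma bracket_ct: assumes p: "p \<in> U" shows "lie_bracket M reeb Z p \<in> ct p" "lie_bracket M reeb (vconj Z) p \<in> ct p" "lie_bracket M Z (vconj Z) p \<in> ct p"
  by (intro lie_bracket_ct[OF ff(1) p] reeb_U ff)+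

lemma bracket_conj: assumes p: "p \<in> U"
  shows "lie_bracket M reeb (vconj Z) p = tconj (lie_bracket M reeb Z p)" "tconj (lie_bracket M Z (vconj Z) p) = tscale (- 1) (lie_bracket M Z (vconj Z) p)"
proof -
  have "lie_bracket M reeb (vconj Z) p = lie_bracket M (vconj reeb) (vconj Z) p"
    by (rule lie_bracket_cong[OF ff(1) p reeb_U ff(3)]) (simp_all add: vconj_reeb ff)
  then show "lie_bracket M reeb (vconj Z) p = tconj (lie_bracket M reeb Z p)"
    using lie_bracket_vconj[OF ff(1) p reeb_U ff(2)] by simp
  show "tconj (lie_bracket M Z (vconj Z) p) = tscale (- 1) (lie_bracket M Z (vconj Z) p)"
    using lie_bracket_vconj[OF ff(1) p ff(2,3)] lie_bracket_swap[of "vconj Z" Z p] by simp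
qed

lemma bracket_ZZb: assumes p: "p \<in> U"
  shows "lie_bracket M Z (vconj Z) p = comb (- \<i> * hh Z p) (reeb p) (- wZb Z p) (Z p) (cnj (wZb Z p)) (vconj Z p)"
proof -
  let ?B = "lie_bracket M Z (vconj Z) p"
  have "k2 Z p ?B = cnj (k1 Z p (tconj ?B))" by (simp add: k2_def)
  also have "\<dots> = cnj (wZb Z p)" unfolding bracket_conj(2)[OF p] k1_lin[OF F p] by (simp add: wZb_def)
  finally show ?thesis using frame_span[OF F p bracket_ct(3)[OF p]] th_bracket[OF F p] by (simp add: wZb_def)
qed

lemma bracket_TZ': assumes p: "p \<in> U"
  shows "lie_bracket M reeb Z p = comb 0 (reeb p) (wT Z p) (Z p) (k2 Z p (lie_bracket M reeb Z p)) (vconj Z p)"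
    and "lie_bracket M reeb (vconj Z) p = comb 0 (reeb p) (cnj (k2 Z p (lie_bracket M reeb Z p))) (Z p) (cnj (wT Z p)) (vconj Z p)"
proof -
  show 1: "lie_bracket M reeb Z p = comb 0 (reeb p) (wT Z p) (Z p) (k2 Z p (lie_bracket M reeb Z p)) (vconj Z p)"
    using frame_span[OF F p bracket_ct(1)[OF p]] bracket_TZ(1)[OF p] by (simp add: wT_def)
  show "lie_bracket M reeb (vconj Z) p = comb 0 (reeb p) (cnj (k2 Z p (lie_bracket M reeb Z p))) (Z p) (cnj (wT Z p)) (vconj Z p)"
    using frame_span[OF F p bracket_ct(2)[OF p]] bracket_TZ(2)[OF p] unfolding bracket_conj(1)[OF p] k2_tconj by (simp add: wT_def k2_def)
qed

lemma th_bracket_comb: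
  assumes p: "p \<in> U" and X: "smooth_vfield M U X" and abc: "sm U a" "sm U b" "sm U c"
  shows "\<theta> p (lie_bracket M X (\<lambda>q. comb (a q) (reeb q) (b q) (Z q) (c q) (vconj Z q)) p)
    = X p a + a p * \<theta> p (lie_bracket M X reeb p) + b p * \<theta> p (lie_bracket M X Z p) + c p * \<theta> p (lie_bracket M X (vconj Z) p)"
proof -
  note P = ff(6)[OF p]
  have c: "lie_bracket M X Y p \<in> ct p" if "smooth_vfield M U Y" for Y by (rule lie_bracket_ct[OF ff(1) p X that])
  note cc = c[OF reeb_U] c[OF ff(2)] c[OF ff(3)]
  show ?thesis
    unfolding lie_bracket_comb[OF ff(1) p X reeb_U ff(2) ff(3) abc]
    using th_add[OF P ct_comb[OF cc] ct_comb[OF frame_ct[OF F p]]] th_comb[OF F p cc] th_comb[OF F p frame_ct[OF F p]] th_frame[OF F p]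
    by simp
qed

text \<open>Comes from \<theta> applied to the Jacobi identity for the Reeb field, Z and its
  conjugate. Compatibility with the Levi form in the Reeb direction is thus a consequence; only the
  direction Z is built into the definition of \<open>wZ\<close>.\<close>

lemma T_h: assumes p: "p \<in> U" shows "reeb p (hh Z) = (wT Z p + cnj (wT Z p)) * hh Z p"
proof -
  note P = ff(6)[OF p]
  let ?TZ = "lie_bracket M reeb Z" and ?TZb = "lie_bracket M reeb (vconj Z)" and ?B = "lie_bracket M Z (vconj Z)"
  have sTZ: "smooth_vfield M U ?TZ" "smooth_vfield M U ?TZb" "smooth_vfield M U ?B"
    by (intro smooth_lie_bracket ff reeb_U)+
  let ?b = "\<lambda>q. k2 Z q (?TZ q)"
  have sb: "sm U ?b" by (rule k1_smooth[OF F ff(1) order_refl sTZ(1)])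
  have z: "lie_bracket M X X p = tzero" for X by (simp add: fun_eq_iff lie_bracket_def tvec_simps)
  have tz: "\<theta> p tzero = 0"
  proof -
    have "tzero = tscale 0 (reeb p)" by (simp add: fun_eq_iff tvec_simps)
    then show ?thesis using th_scale[OF P reeb_ct[OF P], of 0] by simp
  qed
  have L: "\<theta> p (lie_bracket M reeb ?B p) = - \<i> * reeb p (hh Z)"
  proof -
    have "lie_bracket M reeb ?B p = lie_bracket M reeb (\<lambda>q. comb (- \<i> * hh Z q) (reeb q) (- wZb Z q) (Z q) (cnj (wZb Z q)) (vconj Z q)) p"
      by (rule lie_bracket_cong[OF ff(1) p reeb_U sTZ(3)]) (simp_all add: bracket_ZZb)
    moreover have "reeb p (\<lambda>q. - \<i> * hh Z q) = - \<i> * reeb p (hh Z)"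
      by (rule ct_scale[OF reeb_ct[OF P] smooth_atI[OF ff(1) p hsm[OF F]]])
    ultimately show ?thesis
      using th_bracket_comb[OF p reeb_U, of "\<lambda>q. - \<i> * hh Z q" "\<lambda>q. - wZb Z q" "\<lambda>q. cnj (wZb Z q)"] bracket_TZ[OF p] z tz
      by (simp add: sm_mult sm_const sm_uminus sm_cnj hsm[OF F] w_smooth ff(1))
  qed
  have R1: "\<theta> p (lie_bracket M ?TZ (vconj Z) p) = - \<i> * hh Z p * wT Z p"
  proof -
    have "lie_bracket M (vconj Z) ?TZ p = lie_bracket M (vconj Z) (\<lambda>q. comb 0 (reeb q) (wT Z q) (Z q) (?b q) (vconj Z q)) p"
      by (rule lie_bracket_cong[OF ff(1) p ff(3) sTZ(1)]) (simp_all add: bracket_TZ'(1)[symmetric])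
    moreover have "vconj Z p (\<lambda>q. 0) = 0" using ct_const[OF ff(8)[OF p]] by simp
    ultimately have "\<theta> p (lie_bracket M (vconj Z) ?TZ p) = wT Z p * \<theta> p (lie_bracket M (vconj Z) Z p)"
      using th_bracket_comb[OF p ff(3), of "\<lambda>q. 0" "wT Z" ?b] z tz by (simp add: sm_const w_smooth sb)
    also have "lie_bracket M (vconj Z) Z p = tscale (- 1) (?B p)" by (rule lie_bracket_swap)
    finally show ?thesis
      using lie_bracket_swap[of ?TZ "vconj Z" p] th_scale[OF P bracket_ct(3)[OF p], of "- 1"] th_bracket[OF F p]
        th_scale[OF P lie_bracket_ct[OF ff(1) p ff(3) sTZ(1)], of "- 1"]
      by simp
  qed
  have R2: "\<theta> p (lie_bracket M Z ?TZb p) = - \<i> * hh Z p * cnj (wT Z p)"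
  proof -
    have "lie_bracket M Z ?TZb p = lie_bracket M Z (\<lambda>q. comb 0 (reeb q) (cnj (?b q)) (Z q) (cnj (wT Z q)) (vconj Z q)) p"
      by (rule lie_bracket_cong[OF ff(1) p ff(2) sTZ(2)]) (simp_all add: bracket_TZ'(2)[symmetric])
    moreover have "Z p (\<lambda>q. 0) = 0" using ct_const[OF ff(7)[OF p]] by simp
    ultimately have "\<theta> p (lie_bracket M Z ?TZb p) = cnj (wT Z p) * \<theta> p (?B p)"
      using th_bracket_comb[OF p ff(2), of "\<lambda>q. 0" "\<lambda>q. cnj (?b q)" "\<lambda>q. cnj (wT Z q)"] z tz
      by (simp add: sm_const sm_cnj w_smooth sb ff(1))
    then show ?thesis using th_bracket[OF F p] by simp
  qed
  have "\<theta> p (lie_bracket M reeb ?B p) = \<theta> p (lie_bracket M ?TZ (vconj Z) p) + \<theta> p (lie_bracket M Z ?TZb p)"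
    unfolding jacobi[OF ff(1) p reeb_U ff(2,3)]
    by (rule th_add[OF P]) (intro lie_bracket_ct[OF ff(1) p] sTZ ff)+
  then have "- \<i> * reeb p (hh Z) = - \<i> * ((wT Z p + cnj (wT Z p)) * hh Z p)"
    unfolding L R1 R2 by (simp add: algebra_simps)
  then show ?thesis by simp
qed

lemma Zb_h: assumes p: "p \<in> U" shows "vconj Z p (hh Z) = (wZb Z p + cnj (wZ Z p)) * hh Z p"
proof -
  have "Z p (\<lambda>q. cnj (hh Z q)) = Z p (hh Z)"
    by (rule ct_cong[OF ff(7)[OF p] ff(1) p]) (simp add: h_cnj[OF F])
  then have "vconj Z p (hh Z) = cnj (Z p (hh Z))" by (simp add: vconj_def tconj_def)
  then show ?thesis using h_nonzero[OF F p] h_cnj[OF F p] by (simp add: wZ_def)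
qed

lemma d_h: assumes p: "p \<in> U" and v: "v \<in> ct p" shows "v (hh Z) = (om Z p v + cnj (om Z p (tconj v))) * hh Z p"
proof -
  have "Z p (hh Z) = (wZ Z p + cnj (wZb Z p)) * hh Z p" using h_nonzero[OF F p] by (simp add: wZ_def)
  then have "v (hh Z) = \<theta> p v * ((wT Z p + cnj (wT Z p)) * hh Z p) + k1 Z p v * ((wZ Z p + cnj (wZb Z p)) * hh Z p)
      + k2 Z p v * ((wZb Z p + cnj (wZ Z p)) * hh Z p)"
    by (subst frame_span[OF F p v]) (simp only: comb_apply T_h[OF p] Zb_h[OF p])
  then show ?thesis using th_conj[OF ff(6)[OF p] v] by (simp add: om_def k2_tconj algebra_simps)
qed

end

section \<open>Change of frame\<close>

context
  fixes U Z U' Z' assumes F: "Fr U Z" and F': "Fr U' Z'"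
begin

definition "gg q = k1 Z q (Z' q)"

lemma N: "opn (U \<inter> U')" using F F' frame_opn by blast

lemma gg_eq: assumes q: "q \<in> U" "q \<in> U'" shows "Z' q = tscale (gg q) (Z q)" "vconj Z' q = tscale (cnj (gg q)) (vconj Z q)" "gg q \<noteq> 0"
proof -
  obtain c where c: "Z' q = tscale c (Z q)"
    using T10_span[OF frame_pts[OF F q(1)] frame_T10[OF F q(1)] frame_T10(1)[OF F' q(2)]] by blast
  have g: "gg q = c" unfolding gg_def c k1_lin[OF F q(1)] using k1_frame[OF F q(1)] by simp
  show 1: "Z' q = tscale (gg q) (Z q)" using c g by simp
  then show "vconj Z' q = tscale (cnj (gg q)) (vconj Z q)" by (simp add: vconj_def tconj_tscale)
  show "gg q \<noteq> 0"
  proof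
    assume "gg q = 0"
    then have "Z' q = tzero" using 1 by (simp add: fun_eq_iff tvec_simps)
    then show False using frame_T10(2)[OF F' q(2)] by simp
  qed
qed

lemma gg_smooth: "sm (U \<inter> U') gg"
  unfolding gg_def by (rule k1_smooth[OF F N]) (use frame_smooth(1)[OF F'] in \<open>auto intro: smooth_vfield_subset\<close>)

lemma dform_scale: "q \<in> U \<Longrightarrow> dform \<theta> q v (tscale c w) = c * dform \<theta> q v w" "q \<in> U \<Longrightarrow> dform \<theta> q (tscale c v) w = c * dform \<theta> q v w"
proof -
  have t: "tscale c v = comb c v 0 v 0 v" for v :: "'a tvec" by (simp add: fun_eq_iff comb_apply tvec_simps)
  show "q \<in> U \<Longrightarrow> dform \<theta> q v (tscale c w) = c * dform \<theta> q v w" "q \<in> U \<Longrightarrow> dform \<theta> q (tscale c v) w = c * dform \<theta> q v w"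
    unfolding t using frame_pts[OF F] by (simp_all add: dform_comb1 dform_comb2)
qed

lemma h_change: assumes q: "q \<in> U" "q \<in> U'" shows "hh Z' q = gg q * cnj (gg q) * hh Z q"
proof -
  have "\<i> * hh Z' q = gg q * (cnj (gg q) * (\<i> * hh Z q))"
    unfolding dform_ZZb[OF F' q(2), symmetric] dform_ZZb[OF F q(1), symmetric] gg_eq(1,2)[OF q] dform_scale[OF q(1)] by simp
  then have "\<i> * hh Z' q = \<i> * (gg q * cnj (gg q) * hh Z q)" by (simp add: algebra_simps)
  then show ?thesis by simp
qed

lemma k1_change: assumes q: "q \<in> U" "q \<in> U'" shows "k1 Z' q v = k1 Z q v / gg q" "k2 Z' q v = k2 Z q v / cnj (gg q)"
proof -
  show 1: "k1 Z' q v = k1 Z q v / gg q" for v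
    unfolding k1_def h_change[OF q] gg_eq(2)[OF q] dform_scale[OF q(1)] using gg_eq(3)[OF q] by simp
  show "k2 Z' q v = k2 Z q v / cnj (gg q)" by (simp add: k2_def 1)
qed

lemma bracket_Tg: assumes q: "q \<in> U" "q \<in> U'"
  shows "wT Z' q = wT Z q + reeb q gg / gg q"
proof -
  have qn: "q \<in> U \<inter> U'" using q by simp
  have s: "smooth_vfield M (U \<inter> U') reeb" "smooth_vfield M (U \<inter> U') Z" "smooth_vfield M (U \<inter> U') Z'"
    using reeb_U[OF F] frame_smooth(1)[OF F] frame_smooth(1)[OF F'] by (auto intro: smooth_vfield_subset)
  have "lie_bracket M reeb Z' q = lie_bracket M reeb (\<lambda>q. tscale (gg q) (Z q)) q"
    by (rule lie_bracket_cong[OF N qn s(1,3)]) (simp_all add: gg_eq)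
  also have "\<dots> = tadd (tscale (gg q) (lie_bracket M reeb Z q)) (tscale (reeb q gg) (Z q))"
    by (rule lie_bracket_scale[OF N qn s(1,2) gg_smooth])
  finally show ?thesis
    unfolding wT_def using gg_eq(3)[OF q]
    by (simp add: k1_change[OF q] k1_lin[OF F q(1)] k1_frame[OF F q(1)] add_divide_distrib)
qed

lemma bracket_ZZbg: assumes q: "q \<in> U" "q \<in> U'"
  shows "wZb Z' q = cnj (gg q) * (wZb Z q + vconj Z q gg / gg q)"
proof -
  have qn: "q \<in> U \<inter> U'" using q by simp
  have s: "smooth_vfield M (U \<inter> U') (vconj Z)" "smooth_vfield M (U \<inter> U') Z" "smooth_vfield M (U \<inter> U') Z'" "smooth_vfield M (U \<inter> U') (vconj Z')"
    using frame_smooth[OF F] frame_smooth[OF F'] by (auto intro: smooth_vfield_subset)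
  let ?gZ = "\<lambda>q. tscale (gg q) (Z q)"
  have sg: "smooth_vfield M (U \<inter> U') ?gZ" by (rule smooth_vfield_tscale[OF N s(2) gg_smooth])
  have "lie_bracket M Z' (vconj Z') q = lie_bracket M ?gZ (\<lambda>q. tscale (cnj (gg q)) (vconj Z q)) q"
    by (rule lie_bracket_cong[OF N qn s(3,4)]) (simp_all add: gg_eq)
  also have "\<dots> = tadd (tscale (cnj (gg q)) (lie_bracket M ?gZ (vconj Z) q)) (tscale (?gZ q (\<lambda>q. cnj (gg q))) (vconj Z q))"
    by (rule lie_bracket_scale[OF N qn sg s(1) sm_cnj[OF N gg_smooth]])
  also have "lie_bracket M ?gZ (vconj Z) q = tscale (- 1) (lie_bracket M (vconj Z) ?gZ q)"
    by (rule lie_bracket_swap)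
  also have "lie_bracket M (vconj Z) ?gZ q = tadd (tscale (gg q) (lie_bracket M (vconj Z) Z q)) (tscale (vconj Z q gg) (Z q))"
    by (rule lie_bracket_scale[OF N qn s(1,2) gg_smooth])
  also have "lie_bracket M (vconj Z) Z q = tscale (- 1) (lie_bracket M Z (vconj Z) q)"
    by (rule lie_bracket_swap)
  finally show ?thesis
    unfolding wZb_def using gg_eq(3)[OF q]
    by (simp add: k1_change[OF q] k1_lin[OF F q(1)] k1_frame[OF F q(1)] field_simps)
qed

lemma wZ_g: assumes q: "q \<in> U" "q \<in> U'"
  shows "wZ Z' q = gg q * (wZ Z q + Z q gg / gg q)"
proof -
  have qn: "q \<in> U \<inter> U'" using q by simp
  note P = frame_pts[OF F q(1)]
  have Zc: "Z q \<in> ct q" using frame_ct[OF F q(1)] by simp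
  have sg: "smooth_at M q gg" "smooth_at M q (\<lambda>r. cnj (gg r))" "smooth_at M q (hh Z)"
    using smooth_atI[OF N qn gg_smooth] smooth_at_cnj smooth_atI[OF frame_opn[OF F] q(1) hsm[OF F]] by auto
  have "Z q (hh Z') = Z q (\<lambda>r. (gg r * cnj (gg r)) * hh Z r)"
    by (rule ct_cong[OF Zc N qn]) (simp add: h_change)
  also have "\<dots> = (Z q gg * cnj (gg q) + gg q * Z q (\<lambda>r. cnj (gg r))) * hh Z q + gg q * cnj (gg q) * Z q (hh Z)"
    using ct_mult[OF Zc smooth_at_mult[OF sg(1,2)] sg(3)] ct_mult[OF Zc sg(1,2)] by simp
  finally have h': "Z q (hh Z') = (Z q gg * cnj (gg q) + gg q * Z q (\<lambda>r. cnj (gg r))) * hh Z q + gg q * cnj (gg q) * Z q (hh Z)" .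
  have c: "cnj (vconj Z q gg) = Z q (\<lambda>r. cnj (gg r))" by (simp add: vconj_def tconj_def)
  show ?thesis
    unfolding wZ_def bracket_ZZbg[OF q] gg_eq(1)[OF q] h_change[OF q] tscale_def h'
    using gg_eq(3)[OF q] h_nonzero[OF F q(1)]
    by (simp add: c field_simps)
qed

lemma om_change: assumes q: "q \<in> U" "q \<in> U'" and v: "v \<in> ct q"
  shows "om Z' q v = om Z q v + v gg / gg q"
proof -
  note fc = frame_ct[OF F q(1)]
  have e: "v gg = \<theta> q v * reeb q gg + k1 Z q v * Z q gg + k2 Z q v * vconj Z q gg"
    by (subst frame_span[OF F q(1) v]) (simp only: comb_apply)
  show ?thesis
    unfolding om_def bracket_Tg[OF q] bracket_ZZbg[OF q] wZ_g[OF q] k1_change[OF q] e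
    using gg_eq(3)[OF q] by (simp add: field_simps)
qed

text \<open>The connection form changes by the logarithmic derivative of the frame factor, which
  compensates the derivative of that factor in the components. The local formulas therefore glue,
  and the choice of a frame in \<open>nabTW\<close> does not matter.\<close>

lemma nabF_change: assumes q: "q \<in> U" "q \<in> U'" and v: "v \<in> ct q" and Y: "opn V" "q \<in> V" "smooth_vfield M V Y"
  shows "nabF Z' q v Y = nabF Z q v Y"
proof -
  let ?N = "V \<inter> (U \<inter> U')"
  have n: "opn ?N" "q \<in> ?N" using N Y q by auto
  have Ys: "smooth_vfield M ?N Y" by (rule smooth_vfield_subset[OF Y(3)]) auto
  have sg: "sm ?N gg" by (rule sm_subset[OF gg_smooth]) auto
  have sk: "sm ?N (\<lambda>r. k1 Z r (Y r))" "sm ?N (\<lambda>r. k2 Z r (Y r))" by (rule k1_smooth[OF F n(1) _ Ys]; auto)+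
  have gn: "r \<in> ?N \<Longrightarrow> gg r \<noteq> 0" for r using gg_eq(3) by auto
  have 1: "v (\<lambda>r. k1 Z' r (Y r)) = v (\<lambda>r. k1 Z r (Y r) / gg r)"
    by (rule ct_cong[OF v n]) (simp add: k1_change)
  have 2: "v (\<lambda>r. k2 Z' r (Y r)) = v (\<lambda>r. k2 Z r (Y r) / cnj (gg r))"
    by (rule ct_cong[OF v n]) (simp add: k1_change)
  have a: "(v (\<lambda>r. k1 Z' r (Y r)) + om Z' q v * k1 Z' q (Y q)) * gg q = v (\<lambda>r. k1 Z r (Y r)) + om Z q v * k1 Z q (Y q)"
  proof -
    have d: "v (\<lambda>r. k1 Z r (Y r) / gg r) = v (\<lambda>r. k1 Z r (Y r)) / gg q - k1 Z q (Y q) * v gg / (gg q * gg q)"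
      by (rule ct_divide[OF v n sk(1) sg gn])
    show ?thesis unfolding 1 d om_change[OF q v] k1_change[OF q] using gg_eq(3)[OF q] by (simp add: field_simps)
  qed
  have c: "cnj (tconj v gg) = v (\<lambda>r. cnj (gg r))" by (simp add: tconj_def)
  have b: "(v (\<lambda>r. k2 Z' r (Y r)) + cnj (om Z' q (tconj v)) * k2 Z' q (Y q)) * cnj (gg q) = v (\<lambda>r. k2 Z r (Y r)) + cnj (om Z q (tconj v)) * k2 Z q (Y q)"
  proof -
    have d: "v (\<lambda>r. k2 Z r (Y r) / cnj (gg r)) = v (\<lambda>r. k2 Z r (Y r)) / cnj (gg q) - k2 Z q (Y q) * v (\<lambda>r. cnj (gg r)) / (cnj (gg q) * cnj (gg q))"
      by (rule ct_divide[OF v n sk(2) sm_cnj[OF n(1) sg]]) (simp add: gn)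
    show ?thesis unfolding 2 d k1_change[OF q] om_change[OF q ct_tconj[OF v]]
      using gg_eq(3)[OF q] by (simp add: c field_simps)
  qed
  show ?thesis
    unfolding nabF_def a[symmetric] b[symmetric] gg_eq(1,2)[OF q] by (simp add: fun_eq_iff comb_apply tscale_def)
qed

end

end

section \<open>The Tanaka--Webster connection\<close>

context contact begin

definition nabTW :: "'a connection" where
  "nabTW p v Y = nabF (SOME Z. \<exists>U. Fr U Z \<and> p \<in> U) p v Y"

lemma nabTW_eq:
  assumes F: "Fr U Z" and p: "p \<in> U" and v: "v \<in> ct p" and Y: "opn V" "p \<in> V" "smooth_vfield M V Y"
  shows "nabTW p v Y = nabF Z p v Y"
proof -
  define Z' where "Z' = (SOME Z. \<exists>U. Fr U Z \<and> p \<in> U)"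
  have ex: "\<exists>Z U. Fr U Z \<and> p \<in> U" using F p by blast
  have "\<exists>U. Fr U Z' \<and> p \<in> U" unfolding Z'_def by (rule someI_ex[OF ex])
  then obtain U' where F': "Fr U' Z'" "p \<in> U'" by blast
  show ?thesis unfolding nabTW_def Z'_def[symmetric] using nabF_change[OF F F'(1) p F'(2) v Y] .
qed

lemma nabTW_frame:
  assumes "p \<in> pts"
  obtains U Z where "Fr U Z" "p \<in> U"
    "\<And>q v V Y. q \<in> U \<Longrightarrow> v \<in> ct q \<Longrightarrow> opn V \<Longrightarrow> q \<in> V \<Longrightarrow> smooth_vfield M V Y \<Longrightarrow> nabTW q v Y = nabF Z q v Y"
  using frame_exists[OF assms] nabTW_eq by metis

lemma om_lin: assumes F: "Fr U Z" and p: "p \<in> U"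
  shows "v \<in> ct p \<Longrightarrow> w \<in> ct p \<Longrightarrow> om Z p (tadd v w) = om Z p v + om Z p w" "v \<in> ct p \<Longrightarrow> om Z p (tscale c v) = c * om Z p v"
  using th_add[OF frame_pts[OF F p]] th_scale[OF frame_pts[OF F p]]
  by (simp_all add: om_def k1_lin[OF F p] algebra_simps)

lemma comp_smooth_at:
  assumes F: "Fr U Z" and p: "p \<in> U" and Y: "opn V" "p \<in> V" "smooth_vfield M V Y"
  shows "smooth_at M p (\<lambda>r. \<theta> r (Y r))" "smooth_at M p (\<lambda>r. k1 Z r (Y r))" "smooth_at M p (\<lambda>r. k2 Z r (Y r))"
proof -
  have N: "opn (U \<inter> V)" "p \<in> U \<inter> V" using frame_opn[OF F] p Y by auto
  have Y': "smooth_vfield M (U \<inter> V) Y" using Y(3) by (rule smooth_vfield_subset) auto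
  show "smooth_at M p (\<lambda>r. \<theta> r (Y r))" "smooth_at M p (\<lambda>r. k1 Z r (Y r))" "smooth_at M p (\<lambda>r. k2 Z r (Y r))"
    by (rule smooth_atI[OF N] th_smooth[OF N(1) Y'] k1_smooth[OF F N(1) _ Y'] | simp)+
qed

lemma nabTW_smooth:
  assumes U: "opn U" and X: "smooth_vfield M U X" and Y: "smooth_vfield M U Y"
  shows "smooth_vfield M U (nab_field nabTW X Y)"
proof (rule smooth_vfield_local)
  fix p assume p: "p \<in> U"
  obtain W Z where F: "Fr W Z" "p \<in> W" and e: "\<And>q v V Y. q \<in> W \<Longrightarrow> v \<in> ct q \<Longrightarrow> opn V \<Longrightarrow> q \<in> V \<Longrightarrow> smooth_vfield M V Y \<Longrightarrow> nabTW q v Y = nabF Z q v Y"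
    using nabTW_frame[OF opn_sub[OF U p]] by blast
  let ?N = "U \<inter> W"
  have N: "opn ?N" "p \<in> ?N" using U p F frame_opn by auto
  note XN = smooth_vfield_subset[OF X, of ?N, simplified] and YN = smooth_vfield_subset[OF Y, of ?N, simplified]
  have sZ: "smooth_vfield M ?N Z" "smooth_vfield M ?N (vconj Z)" "smooth_vfield M ?N reeb"
    using frame_smooth[OF F(1)] reeb_U[OF F(1)] by (auto intro: smooth_vfield_subset)
  have X2: "sm ?N (\<lambda>q. X q f)" if "sm ?N f" for f by (rule smooth_vfieldD(2)[OF XN N(1) order_refl that])
  have k: "sm ?N (\<lambda>q. k1 Z q (Y q))" "sm ?N (\<lambda>q. k2 Z q (Y q))" by (rule k1_smooth[OF F(1) N(1) _ YN]; simp)+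
  have o: "sm ?N (\<lambda>q. om Z q (X q))" by (rule om_smooth[OF F(1) N(1) _ XN]) simp
  have o': "sm ?N (\<lambda>q. om Z q (vconj X q))" by (rule om_smooth[OF F(1) N(1) _ smooth_vfield_vconj[OF N(1) XN]]) simp
  have "smooth_vfield M ?N (\<lambda>q. nabF Z q (X q) Y)"
    unfolding nabF_def
    by (intro smooth_vfield_comb N sZ sm_add sm_mult sm_cnj X2 k o o'[unfolded vconj_def] th_smooth YN)
  then have "smooth_vfield M ?N (nab_field nabTW X Y)"
    by (rule smooth_vfield_cong[OF N(1)]) (use e[OF _ smooth_vfieldD(1)[OF X] U _ Y] in \<open>auto simp: nab_field_def\<close>)
  then show "\<exists>V. opn V \<and> p \<in> V \<and> smooth_vfield M V (nab_field nabTW X Y)" using N by blast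
qed

lemma nabTW_lin:
  assumes U: "opn U" "p \<in> U" and Y: "smooth_vfield M U Y" and v: "v \<in> ct p" "w \<in> ct p"
  shows "nabTW p (tadd v w) Y = tadd (nabTW p v Y) (nabTW p w Y)" "nabTW p (tscale c v) Y = tscale c (nabTW p v Y)"
proof -
  obtain W Z where F: "Fr W Z" "p \<in> W" and e: "\<And>q v V Y. q \<in> W \<Longrightarrow> v \<in> ct q \<Longrightarrow> opn V \<Longrightarrow> q \<in> V \<Longrightarrow> smooth_vfield M V Y \<Longrightarrow> nabTW q v Y = nabF Z q v Y"
    using nabTW_frame[OF opn_sub[OF U]] by blast
  note e' = e[OF F(2) _ U Y]
  show "nabTW p (tadd v w) Y = tadd (nabTW p v Y) (nabTW p w Y)" "nabTW p (tscale c v) Y = tscale c (nabTW p v Y)"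
    by (simp_all add: e' v ct_tadd ct_tscale ct_tconj nabF_def tconj_tadd tconj_tscale om_lin[OF F(1) F(2)] fun_eq_iff comb_apply tvec_simps(1,2) algebra_simps)
qed

lemma nabTW_add:
  assumes U: "opn U" "p \<in> U" and Y: "smooth_vfield M U Y" "smooth_vfield M U Y'" and v: "v \<in> ct p"
  shows "nabTW p v (\<lambda>q. tadd (Y q) (Y' q)) = tadd (nabTW p v Y) (nabTW p v Y')"
proof -
  obtain W Z where F: "Fr W Z" "p \<in> W" and e: "\<And>q v V Y. q \<in> W \<Longrightarrow> v \<in> ct q \<Longrightarrow> opn V \<Longrightarrow> q \<in> V \<Longrightarrow> smooth_vfield M V Y \<Longrightarrow> nabTW q v Y = nabF Z q v Y"
    using nabTW_frame[OF opn_sub[OF U]] by blast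
  note e' = e[OF F(2) v U]
  have N: "opn (U \<inter> W)" "p \<in> U \<inter> W" using U F frame_opn by auto
  note s = comp_smooth_at[OF F U Y(1)] comp_smooth_at[OF F U Y(2)]
  have Yc: "Y q \<in> ct q" "Y' q \<in> ct q" "q \<in> pts" if "q \<in> U" for q using smooth_vfieldD(1) Y that opn_sub[OF U(1)] by auto
  have 1: "v (\<lambda>r. \<theta> r (tadd (Y r) (Y' r))) = v (\<lambda>r. \<theta> r (Y r)) + v (\<lambda>r. \<theta> r (Y' r))"
    using ct_cong[OF v U, of "\<lambda>r. \<theta> r (tadd (Y r) (Y' r))" "\<lambda>r. \<theta> r (Y r) + \<theta> r (Y' r)"] ct_add[OF v s(1,4)] th_add Yc by simp
  have 2: "v (\<lambda>r. k1 Z r (tadd (Y r) (Y' r))) = v (\<lambda>r. k1 Z r (Y r)) + v (\<lambda>r. k1 Z r (Y' r))"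
    using ct_cong[OF v N, of "\<lambda>r. k1 Z r (tadd (Y r) (Y' r))" "\<lambda>r. k1 Z r (Y r) + k1 Z r (Y' r)"] ct_add[OF v s(2,5)] k1_lin[OF F(1)] by simp
  have 3: "v (\<lambda>r. k2 Z r (tadd (Y r) (Y' r))) = v (\<lambda>r. k2 Z r (Y r)) + v (\<lambda>r. k2 Z r (Y' r))"
    using ct_cong[OF v N, of "\<lambda>r. k2 Z r (tadd (Y r) (Y' r))" "\<lambda>r. k2 Z r (Y r) + k2 Z r (Y' r)"] ct_add[OF v s(3,6)] k1_lin[OF F(1)] by simp
  show ?thesis
    unfolding e'[OF Y(1)] e'[OF Y(2)] e'[OF smooth_vfield_tadd[OF U(1) Y]] nabF_def 1 2 3 k1_lin[OF F(1,2)]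
    by (simp add: fun_eq_iff comb_apply tvec_simps(1,2) algebra_simps)
qed

lemma nabTW_scale:
  assumes U: "opn U" "p \<in> U" and f: "sm U f" and Y: "smooth_vfield M U Y" and v: "v \<in> ct p"
  shows "nabTW p v (\<lambda>q. tscale (f q) (Y q)) = tadd (tscale (v f) (Y p)) (tscale (f p) (nabTW p v Y))"
proof -
  obtain W Z where F: "Fr W Z" "p \<in> W" and e: "\<And>q v V Y. q \<in> W \<Longrightarrow> v \<in> ct q \<Longrightarrow> opn V \<Longrightarrow> q \<in> V \<Longrightarrow> smooth_vfield M V Y \<Longrightarrow> nabTW q v Y = nabF Z q v Y"
    using nabTW_frame[OF opn_sub[OF U]] by blast
  note e' = e[OF F(2) v U]
  have N: "opn (U \<inter> W)" "p \<in> U \<inter> W" using U F frame_opn by auto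
  note s = comp_smooth_at[OF F U Y]
  have sf: "smooth_at M p f" using smooth_atI[OF U f] .
  have Yc: "Y q \<in> ct q" "q \<in> pts" if "q \<in> U" for q using smooth_vfieldD(1) Y that opn_sub[OF U(1)] by auto
  have 1: "v (\<lambda>r. \<theta> r (tscale (f r) (Y r))) = v f * \<theta> p (Y p) + f p * v (\<lambda>r. \<theta> r (Y r))"
    using ct_cong[OF v U, of "\<lambda>r. \<theta> r (tscale (f r) (Y r))" "\<lambda>r. f r * \<theta> r (Y r)"] ct_mult[OF v sf s(1)] th_scale Yc by simp
  have 2: "v (\<lambda>r. k1 Z r (tscale (f r) (Y r))) = v f * k1 Z p (Y p) + f p * v (\<lambda>r. k1 Z r (Y r))"
    using ct_cong[OF v N, of "\<lambda>r. k1 Z r (tscale (f r) (Y r))" "\<lambda>r. f r * k1 Z r (Y r)"] ct_mult[OF v sf s(2)] k1_lin[OF F(1)] by simp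
  have 3: "v (\<lambda>r. k2 Z r (tscale (f r) (Y r))) = v f * k2 Z p (Y p) + f p * v (\<lambda>r. k2 Z r (Y r))"
    using ct_cong[OF v N, of "\<lambda>r. k2 Z r (tscale (f r) (Y r))" "\<lambda>r. f r * k2 Z r (Y r)"] ct_mult[OF v sf s(3)] k1_lin[OF F(1)] by simp
  have Yp: "tscale (v f) (Y p) = tscale (v f) (comb (\<theta> p (Y p)) (reeb p) (k1 Z p (Y p)) (Z p) (k2 Z p (Y p)) (vconj Z p))"
    using frame_span[OF F Yc(1)[OF U(2)]] by simp
  show ?thesis
    unfolding Yp e'[OF Y] e'[OF smooth_vfield_tscale[OF U(1) Y f]] nabF_def 1 2 3 k1_lin[OF F(1,2)]
    by (simp add: fun_eq_iff comb_apply tvec_simps(1,2) algebra_simps)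
qed

lemma nabTW_conj:
  assumes U: "opn U" "p \<in> U" and Y: "smooth_vfield M U Y" and v: "v \<in> ct p"
  shows "nabTW p (tconj v) (vconj Y) = tconj (nabTW p v Y)"
proof -
  obtain W Z where F: "Fr W Z" "p \<in> W" and e: "\<And>q v V Y. q \<in> W \<Longrightarrow> v \<in> ct q \<Longrightarrow> opn V \<Longrightarrow> q \<in> V \<Longrightarrow> smooth_vfield M V Y \<Longrightarrow> nabTW q v Y = nabF Z q v Y"
    using nabTW_frame[OF opn_sub[OF U]] by blast
  note e' = e[OF F(2) _ U]
  have Yc: "Y q \<in> ct q" "q \<in> pts" if "q \<in> U" for q using smooth_vfieldD(1) Y that opn_sub[OF U(1)] by auto
  have 1: "tconj v (\<lambda>r. \<theta> r (vconj Y r)) = cnj (v (\<lambda>r. \<theta> r (Y r)))"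
  proof -
    have "tconj v (\<lambda>r. \<theta> r (vconj Y r)) = tconj v (\<lambda>r. cnj (\<theta> r (Y r)))"
      by (rule ct_cong[OF ct_tconj[OF v] U]) (simp add: vconj_def th_conj Yc)
    then show ?thesis by (simp add: tconj_def)
  qed
  have 2: "tconj v (\<lambda>r. k1 Z r (vconj Y r)) = cnj (v (\<lambda>r. k2 Z r (Y r)))" "tconj v (\<lambda>r. k2 Z r (vconj Y r)) = cnj (v (\<lambda>r. k1 Z r (Y r)))"
    by (simp_all add: vconj_def k2_tconj) (simp_all add: tconj_def)
  have 3: "k1 Z p (vconj Y p) = cnj (k2 Z p (Y p))" "k2 Z p (vconj Y p) = cnj (k1 Z p (Y p))"
    by (simp_all add: vconj_def k2_tconj)
  have r: "tconj (comb a (reeb p) b (Z p) c (vconj Z p)) = comb (cnj a) (reeb p) (cnj c) (Z p) (cnj b) (vconj Z p)" for a b c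
    using reeb_real[OF frame_pts[OF F]] by (simp add: comb_def tconj_tadd tconj_tscale vconj_def) (simp add: tadd_def fun_eq_iff)
  show ?thesis
    unfolding e'[OF v Y] e'[OF ct_tconj[OF v] smooth_vfield_vconj[OF U(1) Y]] nabF_def 1 2 3 r by simp
qed

lemma linear_nabTW: "linear_connection M nabTW"
  unfolding linear_connection_def
proof (intro conjI allI impI ballI)
  fix U X Y assume "opn U" "smooth_vfield M U X" "smooth_vfield M U Y"
  then show "smooth_vfield M U (nab_field nabTW X Y)" by (rule nabTW_smooth)
next
  fix U Y p v w c assume U: "opn U" "smooth_vfield M U Y" "p \<in> U" and v: "v \<in> ct p" "w \<in> ct p"
  show "nabTW p (tadd v w) Y = tadd (nabTW p v Y) (nabTW p w Y)" by (rule nabTW_lin(1)[OF U(1,3,2) v])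
next
  fix U Y p v w c assume U: "opn U" "smooth_vfield M U Y" "p \<in> U" and v: "v \<in> ct p" "w \<in> ct p"
  show "nabTW p (tscale c v) Y = tscale c (nabTW p v Y)" by (rule nabTW_lin(2)[OF U(1,3,2) v])
next
  fix U Y Y' p v assume U: "opn U" "smooth_vfield M U Y" "smooth_vfield M U Y'" "p \<in> U" and v: "v \<in> ct p"
  show "nabTW p v (\<lambda>q. tadd (Y q) (Y' q)) = tadd (nabTW p v Y) (nabTW p v Y')" by (rule nabTW_add[OF U(1,4,2,3) v])
next
  fix U f Y p v assume U: "opn U" "sm U f" "smooth_vfield M U Y" "p \<in> U" and v: "v \<in> ct p"
  show "nabTW p v (\<lambda>q. tscale (f q) (Y q)) = tadd (tscale (v f) (Y p)) (tscale (f p) (nabTW p v Y))"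
    by (rule nabTW_scale[OF U(1,4,2,3) v])
next
  fix U Y p v assume U: "opn U" "smooth_vfield M U Y" "p \<in> U" and v: "v \<in> ct p"
  show "nabTW p (tconj v) (vconj Y) = tconj (nabTW p v Y)" by (rule nabTW_conj[OF U(1,3,2) v])
qed

lemma T10_comp: 
  assumes F: "Fr U Z" and p: "p \<in> U" and v: "v \<in> T10 M p"
  shows "v = tscale (k1 Z p v) (Z p)" "\<theta> p v = 0" "k2 Z p v = 0"
proof -
  obtain c where c: "v = tscale c (Z p)" using T10_span[OF frame_pts[OF F p] frame_T10[OF F p] v] by blast
  show "v = tscale (k1 Z p v) (Z p)" "k2 Z p v = 0" unfolding c k1_lin[OF F p] k1_frame[OF F p] by simp_all
  show "\<theta> p v = 0" using T10_ct[OF frame_pts[OF F p] v] by simp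
qed

lemma nabTW_T10:
  assumes U: "opn U" "p \<in> U" and W: "T10_section M U W" and F: "Fr V Z" "p \<in> V" and v: "v \<in> ct p"
  shows "nabTW p v W = tscale (v (\<lambda>r. k1 Z r (W r)) + om Z p v * k1 Z p (W p)) (Z p)"
proof -
  have Ws: "smooth_vfield M U W" and Wt: "\<And>q. q \<in> U \<Longrightarrow> W q \<in> T10 M q" using W by (auto simp: T10_section_def)
  have N: "opn (U \<inter> V)" "p \<in> U \<inter> V" using U F frame_opn by auto
  have "v (\<lambda>r. \<theta> r (W r)) = 0" "v (\<lambda>r. k2 Z r (W r)) = 0"
    by (rule ct_zero_near[OF v N, of _ 0], use T10_comp[OF F(1)] Wt in auto)+
  then show ?thesis
    unfolding nabTW_eq[OF F v U Ws] nabF_def using T10_comp[OF F Wt[OF U(2)]]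
    by (simp add: fun_eq_iff comb_apply tvec_simps)
qed

lemma ext_d_cong:
  assumes N: "opn N" "p \<in> N" and X: "smooth_vfield M N X" "smooth_vfield M N Y"
    and e: "\<And>q v. q \<in> N \<Longrightarrow> v \<in> ct q \<Longrightarrow> \<alpha> q v = \<beta> q v"
  shows "ext_d M \<alpha> X Y p = ext_d M \<beta> X Y p"
proof -
  have A: "A p (\<lambda>q. \<alpha> q (B q)) = A p (\<lambda>q. \<beta> q (B q))" if "smooth_vfield M N A" "smooth_vfield M N B" for A B
  proof (rule ct_cong[OF smooth_vfieldD(1)[OF that(1) N(2)] N])
    fix q assume q: "q \<in> N"
    show "\<alpha> q (B q) = \<beta> q (B q)" by (rule e[OF q smooth_vfieldD(1)[OF that(2) q]])
  qed
  show ?thesis unfolding ext_d_def by (simp only: A[OF X] A[OF X(2,1)] e[OF N(2) lie_bracket_ct[OF N X]])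
qed

context
  fixes U Z assumes F: "Fr U Z"
begin

lemmas f1 = frameD[OF F]

lemma dk1_frame: assumes p: "p \<in> U"
  shows "dform (k1 Z) p (reeb p) (Z p) = - wT Z p" "dform (k1 Z) p (reeb p) (vconj Z p) = - k1 Z p (lie_bracket M reeb (vconj Z) p)"
    "dform (k1 Z) p (Z p) (vconj Z p) = wZb Z p"
proof -
  have e: "ext_d M (k1 Z) X Y p = - k1 Z p (lie_bracket M X Y p)"
    if X: "smooth_vfield M U X" "smooth_vfield M U Y" and c: "\<And>q. q \<in> U \<Longrightarrow> k1 Z q (X q) = a" "\<And>q. q \<in> U \<Longrightarrow> k1 Z q (Y q) = b" for X Y a b
  proof -
    have "X p (\<lambda>q. k1 Z q (Y q)) = 0" by (rule ct_zero_near[OF smooth_vfieldD(1)[OF X(1) p] f1(1) p c(2)])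
    moreover have "Y p (\<lambda>q. k1 Z q (X q)) = 0" by (rule ct_zero_near[OF smooth_vfieldD(1)[OF X(2) p] f1(1) p c(1)])
    ultimately show ?thesis by (simp add: ext_d_def)
  qed
  note d = ext_d_dform[OF p p f1(1) f1(1) k1_oneform[OF F]]
  note k = k1_frame[OF F]
  show "dform (k1 Z) p (reeb p) (Z p) = - wT Z p"
    using e[OF reeb_U[OF F] f1(2) k(1) k(2)] d[OF reeb_U[OF F] f1(2)] by (simp add: wT_def)
  show "dform (k1 Z) p (reeb p) (vconj Z p) = - k1 Z p (lie_bracket M reeb (vconj Z) p)"
    using e[OF reeb_U[OF F] f1(3) k(1) k(3)] d[OF reeb_U[OF F] f1(3)] by simp
  show "dform (k1 Z) p (Z p) (vconj Z p) = wZb Z p"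
    using e[OF f1(2,3) k(2) k(3)] d[OF f1(2,3)] by (simp add: wZb_def)
qed

lemma structure_eq:
  assumes p: "p \<in> U" and v: "v \<in> ct p" and w: "w \<in> ct p"
  shows "dform (k1 Z) p v w = k1 Z p v * om Z p w - k1 Z p w * om Z p v
    + - k1 Z p (lie_bracket M reeb (vconj Z) p) * (\<theta> p v * k2 Z p w - \<theta> p w * k2 Z p v)"
proof -
  note P = f1(6)[OF p]
  have s: "dform (k1 Z) p (Z p) (reeb p) = wT Z p" "dform (k1 Z) p (vconj Z p) (reeb p) = k1 Z p (lie_bracket M reeb (vconj Z) p)"
    "dform (k1 Z) p (vconj Z p) (Z p) = - wZb Z p"
    using dform_swap[OF P, of "k1 Z" "Z p" "reeb p"] dform_swap[OF P, of "k1 Z" "vconj Z p" "reeb p"] dform_swap[OF P, of "k1 Z" "vconj Z p" "Z p"] dk1_frame[OF p]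
    by simp_all
  have "dform (k1 Z) p v w = dform (k1 Z) p (comb (\<theta> p v) (reeb p) (k1 Z p v) (Z p) (k2 Z p v) (vconj Z p))
     (comb (\<theta> p w) (reeb p) (k1 Z p w) (Z p) (k2 Z p w) (vconj Z p))"
    using frame_span[OF F p v] frame_span[OF F p w] by simp
  then show ?thesis
    unfolding dform_comb1[OF P] dform_comb2[OF P] dform_self[OF P] dk1_frame[OF p] s om_def by (simp add: algebra_simps)
qed

lemma conn_form_nabTW:
  assumes p: "p \<in> U" and v: "v \<in> ct p" and T: "T p = reeb p"
  shows "conn_form nabTW T Z p v = om Z p v"
proof -
  have "v (\<lambda>r. k1 Z r (Z r)) = 0" by (rule ct_zero_near[OF v f1(1) p, of _ 1]) (simp add: k1_frame[OF F])
  moreover have "T10_section M U Z" using F by (simp add: frame_vector_def)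
  ultimately have "nabTW p v Z = tscale (om Z p v) (Z p)"
    using nabTW_T10[OF f1(1) p _ F p v, of Z] by (simp add: k1_frame[OF F p])
  then show ?thesis unfolding conn_form_def using coframe1_eq[where T=T and p=p, OF F T p] f1(7)[OF p] by (simp add: ct_tscale k1_lin[OF F p] k1_frame[OF F p])
qed

end

lemma levi_comp:
  assumes F: "Fr U Z" and p: "p \<in> U" and N: "opn N" "p \<in> N" and A: "T10_section M N A" and B: "T10_section M N B"
  shows "levi M \<theta> A B p = k1 Z p (A p) * cnj (k1 Z p (B p)) * hh Z p"
proof -
  have s: "smooth_vfield M N A" "smooth_vfield M N (vconj B)" and t: "A p \<in> T10 M p" "B p \<in> T10 M p"
    using A B N smooth_vfield_vconj[OF N(1)] by (auto simp: T10_section_def)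
  have a: "A p = tscale (k1 Z p (A p)) (Z p)" and b: "B p = tscale (k1 Z p (B p)) (Z p)"
    using T10_comp(1)[OF F p] t by blast+
  have "levi M \<theta> A B p = - \<i> * dform \<theta> p (A p) (vconj B p)"
    using th_dform[OF F p N s] by (simp add: levi_def)
  also have "vconj B p = tscale (cnj (k1 Z p (B p))) (vconj Z p)"
    by (subst vconj_def, subst b) (simp add: tconj_tscale vconj_def)
  also have "dform \<theta> p (A p) (tscale (cnj (k1 Z p (B p))) (vconj Z p)) = k1 Z p (A p) * (cnj (k1 Z p (B p)) * (\<i> * hh Z p))"
    by (subst a) (simp only: dform_scale[OF F F p] dform_ZZb[OF F p] mult.left_commute)
  finally have "levi M \<theta> A B p = - \<i> * (k1 Z p (A p) * (cnj (k1 Z p (B p)) * (\<i> * hh Z p)))" .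
  moreover have "x * (y * (\<i> * z)) = \<i> * (x * y * z)" for x y z by (simp only: mult_ac)
  moreover have "- \<i> * (\<i> * z) = z" for z by (simp add: mult.assoc[symmetric])
  ultimately show ?thesis by (simp only:)
qed

text \<open>Existence is needed alongside uniqueness: \<open>sublaplacian\<close> and later
  \<open>opv\<close> are definite descriptions ranging over all Tanaka-Webster frames at a point,
  and they are determined only when such a frame exists.\<close>

theorem tanaka_webster_nabTW: "tanaka_webster M \<theta> reeb nabTW"
  unfolding tanaka_webster_def
proof (intro conjI linear_nabTW allI impI ballI)
  fix U X W assume U: "opn U" and X: "smooth_vfield M U X" and W: "T10_section M U W"
  show "T10_section M U (nab_field nabTW X W)"
    unfolding T10_section_def
  proof (intro conjI ballI nabTW_smooth U X)
    show "smooth_vfield M U W" using W by (simp add: T10_section_def)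
    fix p assume p: "p \<in> U"
    obtain V Z where F: "Fr V Z" "p \<in> V" using frame_exists[OF opn_sub[OF U p]] by blast
    show "nab_field nabTW X W p \<in> T10 M p"
      unfolding nab_field_def nabTW_T10[OF U p W F smooth_vfieldD(1)[OF X p]]
      by (rule T10_scale[OF frame_pts[OF F] frame_T10[OF F]])
  qed
next
  fix p v assume P: "p \<in> pts" and v: "v \<in> ct p"
  obtain U Z where F: "Fr U Z" "p \<in> U" using frame_exists[OF P] by blast
  have z: "v (\<lambda>r. \<theta> r (reeb r)) = 0" "v (\<lambda>r. k1 Z r (reeb r)) = 0" "v (\<lambda>r. k2 Z r (reeb r)) = 0"
    using ct_zero_near[OF v frame_opn[OF F(1)] F(2), of "\<lambda>r. \<theta> r (reeb r)" 1]
      ct_zero_near[OF v frame_opn[OF F(1)] F(2), of "\<lambda>r. k1 Z r (reeb r)" 0] ct_zero_near[OF v frame_opn[OF F(1)] F(2), of "\<lambda>r. k2 Z r (reeb r)" 0]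
    by (simp_all add: th_frame[OF F(1)] k1_frame[OF F(1)])
  show "nabTW p v reeb = tzero"
    unfolding nabTW_eq[OF F v openin_topspace P reeb_smooth] nabF_def z k1_frame[OF F] by (simp add: fun_eq_iff comb_apply tvec_simps)
next
  fix U X A B p assume U: "opn U" and X: "smooth_vfield M U X" and A: "T10_section M U A" and B: "T10_section M U B" and p: "p \<in> U"
  obtain V Z where F: "Fr V Z" "p \<in> V" using frame_exists[OF opn_sub[OF U p]] by blast
  have N: "opn (U \<inter> V)" "p \<in> U \<inter> V" using U p F frame_opn by auto
  have Xc: "X p \<in> ct p" using smooth_vfieldD(1)[OF X p] .
  have sAB: "smooth_vfield M U A" "smooth_vfield M U B" using A B by (auto simp: T10_section_def)
  let ?a = "\<lambda>r. k1 Z r (A r)" and ?b = "\<lambda>r. k1 Z r (B r)"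
  have s: "smooth_at M p ?a" "smooth_at M p (\<lambda>r. cnj (?b r))" "smooth_at M p (hh Z)"
    using comp_smooth_at[OF F U p sAB(1)] comp_smooth_at[OF F U p sAB(2)] smooth_at_cnj smooth_atI[OF frame_opn[OF F(1)] F(2) hsm[OF F(1)]] by auto
  have TN: "T10_section M (U \<inter> V) W" if "T10_section M U W" for W
    using that smooth_vfield_subset by (auto simp: T10_section_def)
  have L: "X p (levi M \<theta> A B) = X p (\<lambda>r. (?a r * cnj (?b r)) * hh Z r)"
    by (rule ct_cong[OF Xc N]) (rule levi_comp[OF F(1) _ N(1) _ TN[OF A] TN[OF B]]; simp)
  have TA: "T10_section M U (nab_field nabTW Y W)" if "smooth_vfield M U Y" "T10_section M U W" for Y W
    unfolding T10_section_def
  proof (intro conjI ballI nabTW_smooth U that)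
    show "smooth_vfield M U W" using that by (simp add: T10_section_def)
    fix q assume q: "q \<in> U"
    obtain V Z where F: "Fr V Z" "q \<in> V" using frame_exists[OF opn_sub[OF U q]] by blast
    show "nab_field nabTW Y W q \<in> T10 M q"
      unfolding nab_field_def nabTW_T10[OF U q that(2) F smooth_vfieldD(1)[OF that(1) q]]
      by (rule T10_scale[OF frame_pts[OF F] frame_T10[OF F]])
  qed
  have Xb: "smooth_vfield M U (vconj X)" by (rule smooth_vfield_vconj[OF U X])
  have k: "k1 Z p (nab_field nabTW Y W p) = Y p (\<lambda>r. k1 Z r (W r)) + om Z p (Y p) * k1 Z p (W p)"
    if "smooth_vfield M U Y" "T10_section M U W" for Y W
    unfolding nab_field_def nabTW_T10[OF U p that(2) F smooth_vfieldD(1)[OF that(1) p]] by (simp add: k1_lin[OF F] k1_frame[OF F])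
  have c: "cnj (vconj X p ?b) = X p (\<lambda>r. cnj (?b r))" by (simp add: vconj_def tconj_def)
  show "X p (levi M \<theta> A B) = levi M \<theta> (nab_field nabTW X A) B p + levi M \<theta> A (nab_field nabTW (vconj X) B) p"
    unfolding L levi_comp[OF F U p TA[OF X A] B] levi_comp[OF F U p A TA[OF Xb B]] k[OF X A] k[OF Xb B]
    using ct_mult[OF Xc smooth_at_mult[OF s(1,2)] s(3)] ct_mult[OF Xc s(1,2)] d_h[OF F Xc] c
    by (simp add: vconj_def algebra_simps)
next
  fix U Z assume F: "Fr U Z"
  let ?A = "\<lambda>q. - k1 Z q (lie_bracket M reeb (vconj Z) q)"
  show "\<exists>A. sm U A \<and> (\<forall>V X Y. opn V \<longrightarrow> V \<subseteq> U \<longrightarrow> smooth_vfield M V X \<longrightarrow> smooth_vfield M V Y \<longrightarrow>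
              (\<forall>p\<in>V. ext_d M (coframe1 reeb Z) X Y p =
                 wedge (coframe1 reeb Z) (conn_form nabTW reeb Z) X Y p +
                 A p * wedge \<theta> (fconj (coframe1 reeb Z)) X Y p))"
  proof (intro exI[of _ ?A] conjI allI impI ballI)
    show "sm U ?A"
      by (intro sm_uminus k1_smooth[OF F] frame_opn[OF F] order_refl smooth_lie_bracket reeb_U[OF F] frame_smooth(2)[OF F])
    fix V X Y p assume V: "opn V" "V \<subseteq> U" and X: "smooth_vfield M V X" and Y: "smooth_vfield M V Y" and p: "p \<in> V"
    have pU: "p \<in> U" using V p by auto
    have c: "X p \<in> ct p" "Y p \<in> ct p" using smooth_vfieldD(1) X Y p by blast+
    have e: "coframe1 reeb Z q v = k1 Z q v" if "q \<in> U" "v \<in> ct q" for q v by (rule coframe1_eq[where T = reeb and p = q, OF F refl that])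
    have "ext_d M (coframe1 reeb Z) X Y p = ext_d M (k1 Z) X Y p"
      by (rule ext_d_cong[OF V(1) p X Y]) (use V e in auto)
    also have "\<dots> = dform (k1 Z) p (X p) (Y p)"
      by (rule ext_d_dform[OF pU p frame_opn[OF F] V(1) k1_oneform[OF F] X Y])
    finally show "ext_d M (coframe1 reeb Z) X Y p =
                 wedge (coframe1 reeb Z) (conn_form nabTW reeb Z) X Y p +
                 ?A p * wedge \<theta> (fconj (coframe1 reeb Z)) X Y p"
      unfolding structure_eq[OF F pU c] wedge_def fconj_def
      by (simp add: e[OF pU] c ct_tconj conn_form_nabTW[OF F pU] k2_def)
  qed
qed

end

section \<open>The commutation relations of a CR frame\<close>

text \<open>The identities of a CR frame as pure algebra: \<open>XY\<close> and \<open>TX\<close>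
  are the bracket relations, \<open>curv\<close> is the formula for Scal = 4 sg, and
  \<open>w\<close> is the connection form on the Reeb field. Everything about changes of scale is
  deduced from these.\<close>

locale frame_calc = scale_calc S X l half third sg u al
  for S :: "'r::comm_ring_1 set" and X l half third sg u al +
  fixes T :: "'r \<Rightarrow> 'r" and I w :: 'r and A :: "bool \<Rightarrow> 'r"
  assumes T: "deriv_on S T" and wA: "I \<in> S" "w \<in> S" "A b \<in> S" and I: "X b I = 0"
    and XY: "g \<in> S \<Longrightarrow> X True (X False g) - X False (X True g) = - I * T g - u False * X True g - u True * X False g"
    and TX: "g \<in> S \<Longrightarrow> T (X b g) - X b (T g) = sgb b * w * X b g - A b * X (\<not> b) g"
    and curv: "4 * sg = X True (u False) - X False (u True) + I * w + 2 * u True * u False"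
    and al: "al b = sgb b * I * A b"
begin

text \<open>The Ricci identity for a component of charge \<open>p\<close>: the connection
  contributes p times its curvature, and \<open>curv\<close> rewrites this as the scalar curvature,
  with the Reeb part absorbed in the covariant Reeb derivative.\<close>

lemma commE:
  assumes m: "m \<in> S" and p: "p \<in> S" "X True p = 0" "X False p = 0"
  shows "E True (p - 1) (E False p m) - E False (p + 1) (E True p m) = - I * (T m - p * w * m) - p * (4 * sg) * m"
proof -
  have Xc: "X b m \<in> S" for b using deriv_on.X_closed[OF X m] .
  show ?thesis
    unfolding E_def curv using XY[OF m]
    by (simp add: deriv_on.X_diff[OF X] deriv_on.X_mult[OF X] S_closed S Xc p m algebra_simps)
qed

text \<open>The third order expression is a difference of two commutators: one of g, then
  differentiated, and one of its derivative. By \<open>commE\<close> both reduce to Reeb derivatives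
  and curvature; what remains is the commutator of the Reeb field with \<open>X b\<close>, that is
  the torsion, and a curvature term.\<close>

lemma serre_relation: assumes g: "g \<in> S" shows "serre b g = - al b * E (\<not> b) 0 g + 4 * sg * E b 0 g"
proof -
  have Xc: "X b g \<in> S" for b using deriv_on.X_closed[OF X g] .
  have Tc: "T g \<in> S" using deriv_on.X_closed[OF T g] .
  have z: "X b 0 = 0" "X b 1 = 0" "X b (- 1) = 0" for b
    using deriv_on.X_0[OF X] deriv_on.X_1[OF X] deriv_on.X_uminus[OF X S_1] by simp_all
  have Ec: "E b p m \<in> S" if "m \<in> S" "p \<in> S" for b p m
    using that deriv_on.X_closed[OF X] by (simp add: E_def S_closed S)
  have E0: "E b 0 m = X b m" for b m by (simp add: E_def)
  have Xd: "X b (r - s) = X b r - X b s" if "r \<in> S" "s \<in> S" for b r s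
    using deriv_on.X_diff[OF X that] .
  have XI: "X b (- I * T g) = - I * X b (T g)" for b
    using deriv_on.X_const[OF X, of b "- I" "T g"] deriv_on.X_uminus[OF X wA(1), of b] I[of b] wA Tc by (simp add: S_closed)
  have c0: "E True (- 1) (E False 0 g) - E False 1 (E True 0 g) = - I * T g"
    using commE[OF g S_0] z by simp
  have c1: "E True 0 (E False 1 (X True g)) - E False 2 (E True 1 (X True g)) = - I * (T (X True g) - w * X True g) - 4 * sg * X True g"
    using commE[OF Xc[of True] S_1] z by simp
  have c2: "E True (- 2) (E False (- 1) (X False g)) - E False 0 (E True (- 1) (X False g)) = - I * (T (X False g) + w * X False g) + 4 * sg * X False g"
    using commE[OF Xc[of False] S_uminus[OF S_1]] z by simp
  show ?thesis
  proof (cases b)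
    case True
    have "serre True g = E True 0 (E True (- 1) (E False 0 g) - E False 1 (E True 0 g)) - (E True 0 (E False 1 (X True g)) - E False 2 (E True 1 (X True g)))"
      unfolding serre_def using Xd[of "E True (- 1) (E False 0 g)" "E False 1 (E True 0 g)" True]
      by (simp add: E0 Ec Xc S_closed algebra_simps)
    also have "\<dots> = - I * X True (T g) + I * (T (X True g) - w * X True g) + 4 * sg * X True g"
      unfolding c0 c1 unfolding E0 XI by simp
    also have "\<dots> = I * (T (X True g) - X True (T g)) - I * w * X True g + 4 * sg * X True g"
      by (simp add: algebra_simps)
    finally show ?thesis unfolding TX[OF g] using True al[of True] by (simp add: E0 algebra_simps)
  next
    case False
    have "serre False g = - E False 0 (E True (- 1) (E False 0 g) - E False 1 (E True 0 g)) + (E True (- 2) (E False (- 1) (X False g)) - E False 0 (E True (- 1) (X False g)))"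
      unfolding serre_def using Xd[of "E True (- 1) (E False 0 g)" "E False 1 (E True 0 g)" False]
      by (simp add: E0 Ec Xc S_closed algebra_simps)
    also have "\<dots> = I * X False (T g) - I * (T (X False g) + w * X False g) + 4 * sg * X False g"
      unfolding c0 c2 unfolding E0 XI by simp
    also have "\<dots> = - I * (T (X False g) - X False (T g)) - I * w * X False g + 4 * sg * X False g"
      by (simp add: algebra_simps)
    finally show ?thesis unfolding TX[OF g] using False al[of False] by (simp add: E0 algebra_simps)
  qed
qed

end

section \<open>The ring of functions attached to a CR frame\<close>

context contact begin

definition "A11 Z p = - hh Z p * k2 Z p (lie_bracket M reeb Z p)"
definition "S11 Z p = (Z p (wZb Z) - vconj Z p (wZ Z) - om Z p (lie_bracket M Z (vconj Z) p)) / hh Z p"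

text \<open>All functions below vanish off \<open>U\<close>, so that identities valid on \<open>U\<close> become identities in the ring of total
  functions.\<close>

definition "XX U Z b g p = (if p \<in> U then if b then Z p g else vconj Z p g / hh Z p else 0)"
definition "TT U g p = (if p \<in> U then reeb p g else 0)"
definition "uu U Z b p = (if p \<in> U then if b then wZ Z p else wZb Z p / hh Z p else 0)"
definition "ww U Z p = (if p \<in> U then wT Z p else 0)"
definition "AA U Z b p = (if p \<in> U then if b then A11 Z p else cnj (A11 Z p) / (hh Z p)\<^sup>2 else 0)"
definition "SS U Z p = (if p \<in> U then S11 Z p else 0)"

context
  fixes U Z assumes F: "Fr U Z"
begin

lemmas fF = frameD[OF F]

lemma hnz: "p \<in> U \<Longrightarrow> hh Z p \<noteq> 0" using h_nonzero[OF F] .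

lemma sm_on: "sm U f \<Longrightarrow> sm U (\<lambda>p. if p \<in> U then f p else 0)"
  by (rule sm_cong[OF fF(1), of f]) simp

lemma A11_smooth: "sm U (A11 Z)"
  unfolding A11_def
  by (intro sm_mult sm_uminus fF(1) hsm[OF F] k1_smooth[OF F fF(1) order_refl] smooth_lie_bracket reeb_U[OF F] fF(2))

lemma XX_smooth: assumes g: "sm U g" shows "sm U (XX U Z b g)"
proof (cases b)
  case True
  have "sm U (\<lambda>p. Z p g)" by (rule smooth_vfieldD(2)[OF fF(2,1) order_refl g])
  then show ?thesis using sm_on[of "\<lambda>p. Z p g"] True by (simp add: XX_def[abs_def] cong: if_cong)
next
  case False
  have "sm U (\<lambda>p. vconj Z p g / hh Z p)"
    by (intro sm_divide fF(1) hsm[OF F] hnz smooth_vfieldD(2)[OF fF(3,1) order_refl g])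
  then show ?thesis using sm_on[of "\<lambda>p. vconj Z p g / hh Z p"] False by (simp add: XX_def[abs_def] cong: if_cong)
qed

lemma uu_smooth: "sm U (uu U Z b)"
proof (cases b)
  case True
  then show ?thesis using sm_on[OF w_smooth(3)[OF F]] by (simp add: uu_def[abs_def] cong: if_cong)
next
  case False
  have "sm U (\<lambda>p. wZb Z p / hh Z p)" by (intro sm_divide fF(1) hsm[OF F] hnz w_smooth[OF F])
  then show ?thesis using sm_on[of "\<lambda>p. wZb Z p / hh Z p"] False by (simp add: uu_def[abs_def] cong: if_cong)
qed

lemma AA_smooth: "sm U (AA U Z b)"
proof (cases b)
  case True
  then show ?thesis using sm_on[OF A11_smooth] by (simp add: AA_def[abs_def] cong: if_cong)
next
  case False
  have "sm U (\<lambda>p. cnj (A11 Z p) / (hh Z p * hh Z p))"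
    by (intro sm_divide sm_mult sm_cnj A11_smooth fF(1) hsm[OF F]) (simp add: hnz)
  then show ?thesis using sm_on[of "\<lambda>p. cnj (A11 Z p) / (hh Z p * hh Z p)"] False by (simp add: AA_def[abs_def] power2_eq_square cong: if_cong)
qed

lemma SS_smooth: "sm U (SS U Z)"
proof -
  have "sm U (S11 Z)"
    unfolding S11_def
    by (intro sm_divide sm_diff fF(1) hsm[OF F] hnz smooth_vfieldD(2)[OF fF(2,1) order_refl] smooth_vfieldD(2)[OF fF(3,1) order_refl]
        w_smooth[OF F] om_smooth[OF F fF(1) order_refl] smooth_lie_bracket fF(2,3))
  then show ?thesis using sm_on by (simp add: SS_def[abs_def])
qed

lemma subring_sm: "subring {f. sm U f}"
proof
  show "f + g \<in> {f. sm U f}" "f * g \<in> {f. sm U f}" if "f \<in> {f. sm U f}" "g \<in> {f. sm U f}" for f g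
    using that sm_add[OF fF(1), of f g] sm_mult[OF fF(1), of f g] by (simp_all add: plus_fun_def times_fun_def)
  show "- f \<in> {f. sm U f}" if "f \<in> {f. sm U f}" for f
    using that sm_uminus[OF fF(1), of f] by (simp add: fun_Compl_def)
  show "0 \<in> {f. sm U f}" "1 \<in> {f. sm U f}" using sm_const by (simp_all add: zero_fun_def one_fun_def)
qed

lemma deriv_pointwise:
  assumes s: "\<And>g. sm U g \<Longrightarrow> sm U (D g)" and v: "\<And>p. p \<in> U \<Longrightarrow> V p \<in> ct p"
    and e: "\<And>g p. p \<in> U \<Longrightarrow> D g p = V p g * c p" "\<And>g p. p \<notin> U \<Longrightarrow> D g p = 0"
  shows "deriv_on {f. sm U f} D"
proof (intro deriv_on.intro subring_sm deriv_on_axioms.intro)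
  fix f g assume "f \<in> {f. sm U f}" "g \<in> {f. sm U f}"
  then have sf: "sm U f" "sm U g" by auto
  show "D f \<in> {f. sm U f}" using s[OF sf(1)] by simp
  show "D (f + g) = D f + D g"
  proof
    fix p show "D (f + g) p = (D f + D g) p"
      using ct_add[OF v smooth_atI[OF fF(1) _ sf(1)] smooth_atI[OF fF(1) _ sf(2)]] e
      by (cases "p \<in> U") (simp_all add: plus_fun_def algebra_simps)
  qed
  show "D (f * g) = D f * g + f * D g"
  proof
    fix p show "D (f * g) p = (D f * g + f * D g) p"
      using ct_mult[OF v smooth_atI[OF fF(1) _ sf(1)] smooth_atI[OF fF(1) _ sf(2)]] e
      by (cases "p \<in> U") (simp_all add: plus_fun_def times_fun_def algebra_simps)
  qed
qed

lemma deriv_XX: "deriv_on {f. sm U f} (XX U Z b)"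
proof (cases b)
  case True
  show ?thesis
    by (rule deriv_pointwise[where V = Z and c = "\<lambda>p. 1", OF XX_smooth fF(7)]) (simp_all add: XX_def True)
next
  case False
  show ?thesis
    by (rule deriv_pointwise[where V = "vconj Z" and c = "\<lambda>p. 1 / hh Z p", OF XX_smooth fF(8)]) (simp_all add: XX_def False)
qed

lemma TT_smooth: assumes g: "sm U g" shows "sm U (TT U g)"
  using sm_on[OF smooth_vfieldD(2)[OF reeb_U[OF F] fF(1) order_refl g]] by (simp add: TT_def[abs_def])

lemma deriv_TT: "deriv_on {f. sm U f} (TT U)"
  by (rule deriv_pointwise[where V = reeb and c = "\<lambda>p. 1", OF TT_smooth reeb_ct[OF fF(6)]]) (simp_all add: TT_def)

lemma ct_on:
  assumes p: "p \<in> U" and v: "v \<in> ct p"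
  shows "v (XX U Z True g) = v (\<lambda>q. Z q g)" "v (XX U Z False g) = v (\<lambda>q. vconj Z q g / hh Z q)"
    "v (TT U g) = v (\<lambda>q. reeb q g)" "v (uu U Z True) = v (wZ Z)" "v (uu U Z False) = v (\<lambda>q. wZb Z q / hh Z q)"
  by (rule ct_cong[OF v fF(1) p], simp add: XX_def TT_def uu_def)+

lemma Z_h: "p \<in> U \<Longrightarrow> Z p (hh Z) = (wZ Z p + cnj (wZb Z p)) * hh Z p"
  using h_nonzero[OF F] by (simp add: wZ_def)

text \<open>Z^1 is the conjugate of Z divided by h. Differentiating 1/h adds a term that cancels the
  coefficient of the conjugate field in the bracket and leaves the connection form on Z.\<close>

lemma commute_XY:
  assumes g: "sm U g"
  shows "XX U Z True (XX U Z False g) - XX U Z False (XX U Z True g)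
    = - cst \<i> * TT U g - uu U Z False * XX U Z True g - uu U Z True * XX U Z False g" (is "?L = ?R")
proof
  fix p
  show "?L p = ?R p"
  proof (cases "p \<in> U")
    case p: True
    have sa: "smooth_at M p g" by (rule smooth_atI[OF fF(1) p g])
    have 1: "Z p (\<lambda>q. vconj Z q g / hh Z q) = Z p (\<lambda>q. vconj Z q g) / hh Z p - vconj Z p g * Z p (hh Z) / (hh Z p * hh Z p)"
      by (rule ct_divide[OF fF(7)[OF p] fF(1) p smooth_vfieldD(2)[OF fF(3,1) order_refl g] hsm[OF F] hnz])
    have 2: "Z p (\<lambda>q. vconj Z q g) = lie_bracket M Z (vconj Z) p g + vconj Z p (\<lambda>q. Z q g)"
      using sa by (simp add: lie_bracket_def)
    have 3: "lie_bracket M Z (vconj Z) p g = - \<i> * hh Z p * reeb p g - wZb Z p * Z p g + cnj (wZb Z p) * vconj Z p g"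
      unfolding bracket_ZZb[OF F p] by (simp add: comb_apply)
    have "?L p = Z p (\<lambda>q. vconj Z q g / hh Z q) - vconj Z p (\<lambda>q. Z q g) / hh Z p"
      using p by (simp add: XX_def[of U Z _ _ p] ct_on[OF p] fF)
    also have "\<dots> = ?R p"
      unfolding 1 2 3 Z_h[OF p] using p hnz[OF p]
      by (simp add: XX_def TT_def uu_def cst_def field_simps)
    finally show ?thesis .
  qed (simp add: XX_def TT_def uu_def)
qed

lemma commute_TX:
  assumes g: "sm U g"
  shows "TT U (XX U Z b g) - XX U Z b (TT U g) = sgb b * ww U Z * XX U Z b g - AA U Z b * XX U Z (\<not> b) g" (is "?L = ?R")
proof
  fix p
  show "?L p = ?R p"
  proof (cases "p \<in> U")
    case p: True
    have sa: "smooth_at M p g" by (rule smooth_atI[OF fF(1) p g])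
    have T: "reeb p \<in> ct p" using frame_ct[OF F p] by simp
    have A: "k2 Z p (lie_bracket M reeb Z p) = - A11 Z p / hh Z p" using hnz[OF p] by (simp add: A11_def)
    have hc: "cnj (hh Z p) = hh Z p" using h_cnj[OF F p] .
    show ?thesis
    proof (cases b)
      case True
      have 1: "reeb p (\<lambda>q. Z q g) = lie_bracket M reeb Z p g + Z p (\<lambda>q. reeb q g)"
        using sa by (simp add: lie_bracket_def)
      have 2: "lie_bracket M reeb Z p g = wT Z p * Z p g + (- A11 Z p / hh Z p) * vconj Z p g"
        by (subst bracket_TZ'(1)[OF F p]) (simp add: comb_apply A)
      have "?L p = reeb p (\<lambda>q. Z q g) - Z p (\<lambda>q. reeb q g)"
        using p True by (simp add: XX_def[of U Z _ _ p] TT_def[of U _ p] ct_on[OF p] fF T)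
      also have "\<dots> = ?R p" unfolding 1 2 using p True by (simp add: XX_def ww_def AA_def)
      finally show ?thesis .
    next
      case False
      have 1: "reeb p (\<lambda>q. vconj Z q g / hh Z q) = reeb p (\<lambda>q. vconj Z q g) / hh Z p - vconj Z p g * reeb p (hh Z) / (hh Z p * hh Z p)"
        by (rule ct_divide[OF T fF(1) p smooth_vfieldD(2)[OF fF(3,1) order_refl g] hsm[OF F] hnz])
      have 2: "reeb p (\<lambda>q. vconj Z q g) = lie_bracket M reeb (vconj Z) p g + vconj Z p (\<lambda>q. reeb q g)"
        using sa by (simp add: lie_bracket_def)
      have 3: "lie_bracket M reeb (vconj Z) p g = - (cnj (A11 Z p) / hh Z p) * Z p g + cnj (wT Z p) * vconj Z p g"
        by (subst bracket_TZ'(2)[OF F p]) (simp add: comb_apply A hc)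
      have "?L p = reeb p (\<lambda>q. vconj Z q g / hh Z q) - vconj Z p (\<lambda>q. reeb q g) / hh Z p"
        using p False by (simp add: XX_def[of U Z _ _ p] TT_def[of U _ p] ct_on[OF p] fF T)
      also have "\<dots> = ?R p"
        unfolding 1 2 3 T_h[OF F p] using p False hnz[OF p]
        by (simp add: XX_def ww_def AA_def sgb_def field_simps power2_eq_square)
      finally show ?thesis .
    qed
  qed (simp add: XX_def TT_def ww_def AA_def)
qed

lemma curvature_eq:
  "SS U Z = XX U Z True (uu U Z False) - XX U Z False (uu U Z True) + cst \<i> * ww U Z + 2 * uu U Z True * uu U Z False" (is "_ = ?R")
proof
  fix p
  show "SS U Z p = ?R p"
  proof (cases "p \<in> U")
    case p: True
    have 1: "Z p (\<lambda>q. wZb Z q / hh Z q) = Z p (wZb Z) / hh Z p - wZb Z p * Z p (hh Z) / (hh Z p * hh Z p)"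
      by (rule ct_divide[OF fF(7)[OF p] fF(1) p w_smooth(1)[OF F] hsm[OF F] hnz])
    have 2: "om Z p (lie_bracket M Z (vconj Z) p) = - \<i> * hh Z p * wT Z p - wZb Z p * wZ Z p + cnj (wZb Z p) * wZb Z p"
      unfolding bracket_ZZb[OF F p] using om_comb[OF F p frame_ct[OF F p]] om_frame[OF F p] by simp
    have two: "(2 :: 'a \<Rightarrow> complex) p = 2" by (metis cst_def cst_simps(8))
    have "?R p = Z p (\<lambda>q. wZb Z q / hh Z q) - vconj Z p (wZ Z) / hh Z p + \<i> * wT Z p + 2 * wZ Z p * (wZb Z p / hh Z p)"
      using p two by (simp add: XX_def[of U Z _ _ p] uu_def[of U Z _ p] ww_def ct_on[OF p] fF cst_def)
    also have "\<dots> = SS U Z p"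
      unfolding 1 Z_h[OF p] using p hnz[OF p] by (simp add: SS_def S11_def 2 field_simps)
    finally show ?thesis by simp
  next
    case False
    have two: "(2 :: 'a \<Rightarrow> complex) p = 2" by (metis cst_def cst_simps(8))
    show ?thesis using False by (simp add: SS_def XX_def uu_def ww_def two)
  qed
qed

end

definition "dat U Z f = Frame_data {g. sm U g} (XX U Z) (uu U Z)
   (\<lambda>B. case B of Tor \<Rightarrow> AA U Z True | TorBar \<Rightarrow> AA U Z False | ScalCurv \<Rightarrow> SS U Z) f"

lemma dat_simps [simp]: "fS (dat U Z f) = {g. sm U g}" "fX (dat U Z f) = XX U Z" "fu (dat U Z f) = uu U Z"
  "fC (dat U Z f) Tor = AA U Z True" "fC (dat U Z f) TorBar = AA U Z False" "fC (dat U Z f) ScalCurv = SS U Z" "ff (dat U Z f) = f"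
  by (simp_all add: dat_def)

lemma XX_cst: assumes F: "Fr U Z" shows "XX U Z b (cst c) = 0"
proof
  fix p
  show "XX U Z b (cst c) p = 0 p"
    using ct_const[OF frame_ct(2)[OF F, of p], of c] ct_const[OF frame_ct(3)[OF F, of p], of c]
    by (cases "p \<in> U"; cases b) (simp_all add: XX_def cst_def)
qed

lemma good_dat: assumes F: "Fr U Z" and f: "sm U f" shows "good_data (dat U Z f)"
  unfolding good_data_def
proof (intro conjI allI)
  show "fC (dat U Z f) B \<in> fS (dat U Z f)" for B
    using AA_smooth[OF F] SS_smooth[OF F] by (cases B) simp_all
qed (use deriv_XX[OF F] XX_cst[OF F] uu_smooth[OF F] f in \<open>simp_all add: cst_def sm_const\<close>)

lemma frame_calc_dat:
  assumes F: "Fr U Z"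
  shows "frame_calc {g. sm U g} (XX U Z) (cst c) (cst (1/2)) (cst (1/3)) (fsg (dat U Z f)) (uu U Z) (fal (dat U Z f))
    (TT U) (cst \<i>) (ww U Z) (AA U Z)"
proof -
  have c: "sm U (cst d)" for d by (simp add: cst_def sm_const)
  note m = sm_mult[OF frame_opn[OF F]]
  have w: "sm U (ww U Z)" using sm_on[OF F w_smooth(2)[OF F]] by (simp add: ww_def[abs_def])
  have al: "fal (dat U Z f) b = sgb b * cst \<i> * AA U Z b" for b
    by (cases b) (simp_all add: fal_def cst_simps)
  have "2 * cst (1 / 2) = (1 :: 'a \<Rightarrow> complex)" "3 * cst (1 / 3) = (1 :: 'a \<Rightarrow> complex)" "4 * cst (1 / 4) = (1 :: 'a \<Rightarrow> complex)"
    unfolding cst_simps(8)[symmetric] cst_simps(2)[symmetric] by (simp_all add: cst_simps)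
  moreover have "4 * (cst (1/4) * g) = g" for g :: "'a \<Rightarrow> complex" using calculation(3) by (simp add: mult.assoc[symmetric])
  moreover have "sm U (fal (dat U Z f) b)" for b
    using m[OF c AA_smooth[OF F]] by (simp add: fal_def times_fun_def)
  moreover have "sm U (fsg (dat U Z f))"
    using m[OF c SS_smooth[OF F]] by (simp add: fsg_def times_fun_def)
  ultimately show ?thesis
    using c w uu_smooth[OF F] AA_smooth[OF F] XX_cst[OF F] commute_XY[OF F] commute_TX[OF F] curvature_eq[OF F] al
    by (intro frame_calc.intro scale_calc.intro scale_calc_axioms.intro frame_calc_axioms.intro subring_sm[OF F] deriv_XX[OF F] deriv_TT[OF F])
      (simp_all add: fsg_def)
qed

end

section \<open>Uniqueness of the Tanaka-Webster connection and its torsion and curvature in a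
  frame\<close>

locale tw = contact M \<theta> for M :: "'a crdata" and \<theta> +
  fixes T :: "'a vfield" and nab U Z
  assumes TW: "tw_frame M \<theta> T nab U Z"
begin

lemma R: "reeb_field M \<theta> T" and W: "tanaka_webster M \<theta> T nab" and F: "Fr U Z"
  using TW by (auto simp: tw_frame_def)

lemma lc: "linear_connection M nab" using W by (simp add: tanaka_webster_def)

lemmas fF = frameD[OF F] and k = k1_frame[OF F] and kl = k1_lin[OF F]

lemma T_eq: "p \<in> pts \<Longrightarrow> T p = reeb p" using reeb_field_unique[OF R] .

lemma T_smooth: "smooth_vfield M U T"
  by (rule smooth_vfield_cong[OF fF(1) reeb_U[OF F]]) (simp add: T_eq fF)

lemma nab_smooth: "opn V \<Longrightarrow> smooth_vfield M V X \<Longrightarrow> smooth_vfield M V Y \<Longrightarrow> smooth_vfield M V (nab_field nab X Y)"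
  using lc[unfolded linear_connection_def, THEN conjunct1] by blast

lemma nab_lin:
  assumes "opn V" "smooth_vfield M V Y" "p \<in> V" "v \<in> ct p"
  shows "w \<in> ct p \<Longrightarrow> nab p (tadd v w) Y = tadd (nab p v Y) (nab p w Y)" "nab p (tscale c v) Y = tscale c (nab p v Y)"
  using lc[unfolded linear_connection_def, THEN conjunct2, THEN conjunct1, rule_format, OF assms] assms(4) by blast+

lemma nab_scale: "opn V \<Longrightarrow> sm V f \<Longrightarrow> smooth_vfield M V Y \<Longrightarrow> p \<in> V \<Longrightarrow> v \<in> ct p \<Longrightarrow>
    nab p v (\<lambda>q. tscale (f q) (Y q)) = tadd (tscale (v f) (Y p)) (tscale (f p) (nab p v Y))"
  using lc[unfolded linear_connection_def, THEN conjunct2, THEN conjunct2, THEN conjunct2, THEN conjunct1] by blast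

lemma nab_conj: "opn V \<Longrightarrow> smooth_vfield M V Y \<Longrightarrow> p \<in> V \<Longrightarrow> v \<in> ct p \<Longrightarrow> nab p (tconj v) (vconj Y) = tconj (nab p v Y)"
  using lc[unfolded linear_connection_def, THEN conjunct2, THEN conjunct2, THEN conjunct2, THEN conjunct2] by blast

text \<open>Multiplication by the indicator function of V makes the two total fields literally
  equal; that function is smooth on V with derivative 0, so the Leibniz rule removes it
  again.\<close>

lemma nab_local:
  assumes V: "opn V" "p \<in> V" and Y: "smooth_vfield M V Y" "smooth_vfield M V Y'" and e: "\<And>q. q \<in> V \<Longrightarrow> Y q = Y' q" and v: "v \<in> ct p"
  shows "nab p v Y = nab p v Y'"
proof -
  let ?f = "\<lambda>q. if q \<in> V then 1 else 0 :: complex"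
  have f: "sm V ?f" by (rule sm_cong[OF V(1) _ sm_const[of V 1]]) simp
  have c: "v ?f = 0" by (rule ct_zero_near[OF v V, of _ 1]) simp
  have s: "(\<lambda>q. tscale (?f q) (Y q)) = (\<lambda>q. tscale (?f q) (Y' q))" by (auto simp: e fun_eq_iff tvec_simps)
  have n: "nab p v (\<lambda>q. tscale (?f q) (X q)) = nab p v X" if "smooth_vfield M V X" for X
    unfolding nab_scale[OF V(1) f that V(2) v] c using V(2) by (simp add: fun_eq_iff tvec_simps)
  show ?thesis unfolding n[OF Y(1), symmetric] s n[OF Y(2)] ..
qed

lemma nab_ct: assumes V: "opn V" "p \<in> V" and Y: "smooth_vfield M V Y" and v: "v \<in> ct p" shows "nab p v Y \<in> ct p"
proof -
  obtain N X where N: "opn N" "p \<in> N" "smooth_vfield M N X" "X p = v" using extend_field[OF opn_sub[OF V] v] by blast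
  have "smooth_vfield M (N \<inter> V) (nab_field nab X Y)"
    by (rule nab_smooth) (use N V Y in \<open>auto intro: smooth_vfield_subset\<close>)
  from smooth_vfieldD(1)[OF this, of p] show ?thesis using N V by (simp add: nab_field_def)
qed

lemma nab_section: "opn V \<Longrightarrow> smooth_vfield M V X \<Longrightarrow> T10_section M V Y \<Longrightarrow> T10_section M V (nab_field nab X Y)"
  by (rule W[unfolded tanaka_webster_def, THEN conjunct2, THEN conjunct1, THEN spec, THEN spec, THEN spec, THEN mp, THEN mp, THEN mp])

lemma Z_T10: "T10_section M U Z" using F by (simp add: frame_vector_def)

lemma nab_T10: assumes p: "p \<in> U" and v: "v \<in> ct p" shows "nab p v Z \<in> T10 M p"
proof -
  obtain N X where N: "opn N" "p \<in> N" "smooth_vfield M N X" "X p = v" using extend_field[OF fF(6)[OF p] v] by blast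
  have o: "opn (N \<inter> U)" using N fF by auto
  have "T10_section M (N \<inter> U) Z" using Z_T10 by (auto simp: T10_section_def intro: smooth_vfield_subset)
  moreover have "smooth_vfield M (N \<inter> U) X" using N by (auto intro: smooth_vfield_subset)
  ultimately have "T10_section M (N \<inter> U) (nab_field nab X Z)"
    by (intro nab_section[OF o])
  then show ?thesis using N p by (auto simp: T10_section_def nab_field_def)
qed

lemma coframe: "p \<in> U \<Longrightarrow> v \<in> ct p \<Longrightarrow> coframe1 T Z p v = k1 Z p v"
  by (rule coframe1_eq[where T = T and p = p, OF F T_eq[OF fF(6)]])

definition "cf p v = k1 Z p (nab p v Z)"

lemma nab_cf: assumes p: "p \<in> U" and v: "v \<in> ct p" shows "nab p v Z = tscale (cf p v) (Z p)"
  using T10_comp(1)[OF F p nab_T10[OF p v]] by (simp add: cf_def)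

lemma conn_cf: assumes p: "p \<in> U" and v: "v \<in> ct p" shows "conn_form nab T Z p v = cf p v"
  unfolding conn_form_def cf_def by (rule coframe[OF p nab_ct[OF fF(1) p fF(2) v]])

lemma structure_tw:
  obtains A where "\<And>X Y p. smooth_vfield M U X \<Longrightarrow> smooth_vfield M U Y \<Longrightarrow> p \<in> U \<Longrightarrow>
    ext_d M (k1 Z) X Y p = k1 Z p (X p) * cf p (Y p) - k1 Z p (Y p) * cf p (X p)
       + A p * (\<theta> p (X p) * k2 Z p (Y p) - \<theta> p (Y p) * k2 Z p (X p))"
proof -
  obtain A where A0: "\<forall>V X Y. opn V \<longrightarrow> V \<subseteq> U \<longrightarrow> smooth_vfield M V X \<longrightarrow> smooth_vfield M V Y \<longrightarrow>
      (\<forall>p\<in>V. ext_d M (coframe1 T Z) X Y p = wedge (coframe1 T Z) (conn_form nab T Z) X Y p + A p * wedge \<theta> (fconj (coframe1 T Z)) X Y p)"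
    using W[unfolded tanaka_webster_def, THEN conjunct2, THEN conjunct2, THEN conjunct2, THEN conjunct2, THEN spec, THEN spec, THEN mp, OF F]
    by (elim exE conjE)
  have A: "ext_d M (coframe1 T Z) X Y p = wedge (coframe1 T Z) (conn_form nab T Z) X Y p + A p * wedge \<theta> (fconj (coframe1 T Z)) X Y p"
    if "smooth_vfield M U X" "smooth_vfield M U Y" "p \<in> U" for X Y p
    using A0[THEN spec, THEN spec, THEN spec, THEN mp, THEN mp, THEN mp, THEN mp, THEN bspec, OF fF(1) order_refl that] .
  show ?thesis
  proof (rule that[of A])
    fix X Y p assume X: "smooth_vfield M U X" and Y: "smooth_vfield M U Y" and p: "p \<in> U"
    have c: "X p \<in> ct p" "Y p \<in> ct p" using smooth_vfieldD(1) X Y p by blast+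
    have "ext_d M (k1 Z) X Y p = ext_d M (coframe1 T Z) X Y p"
      by (rule ext_d_cong[OF fF(1) p X Y]) (simp add: coframe)
    then show "ext_d M (k1 Z) X Y p = k1 Z p (X p) * cf p (Y p) - k1 Z p (Y p) * cf p (X p)
       + A p * (\<theta> p (X p) * k2 Z p (Y p) - \<theta> p (Y p) * k2 Z p (X p))"
      unfolding A[OF X Y p] wedge_def fconj_def by (simp add: coframe[OF p] conn_cf[OF p] c ct_tconj k2_def)
  qed
qed

text \<open>The structure equation on (Z, conjugate of Z) and on (T, Z) determines the connection
  form on the conjugate field and on T; compatibility with the Levi form along Z gives the remaining
  value.\<close>

lemma cf_om: assumes p: "p \<in> U" and v: "v \<in> ct p" shows "cf p v = om Z p v"
proof -
  obtain A where A: "\<And>X Y p. smooth_vfield M U X \<Longrightarrow> smooth_vfield M U Y \<Longrightarrow> p \<in> U \<Longrightarrow>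
    ext_d M (k1 Z) X Y p = k1 Z p (X p) * cf p (Y p) - k1 Z p (Y p) * cf p (X p)
       + A p * (\<theta> p (X p) * k2 Z p (Y p) - \<theta> p (Y p) * k2 Z p (X p))"
    using structure_tw by blast
  note d = ext_d_dform[OF p p fF(1) fF(1) k1_oneform[OF F]] and dk = dk1_frame[OF F p]
  have b: "cf p (vconj Z p) = wZb Z p"
    using A[OF fF(2,3) p] d[OF fF(2,3)] dk(3) by (simp add: k[OF p] th_frame[OF F p])
  have t: "cf p (reeb p) = wT Z p"
    using A[OF reeb_U[OF F] fF(2) p] d[OF reeb_U[OF F] fF(2)] dk(1) by (simp add: k[OF p] th_frame[OF F p])
  have n: "k1 Z q (nab_field nab X Z q) = cf q (X q)" for X q by (simp add: nab_field_def cf_def)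
  have s: "T10_section M U (nab_field nab X Z)" if "smooth_vfield M U X" for X
    by (rule nab_section[OF fF(1) that Z_T10])
  have "Z p (levi M \<theta> Z Z) = levi M \<theta> (nab_field nab Z Z) Z p + levi M \<theta> Z (nab_field nab (vconj Z) Z) p"
    by (rule W[unfolded tanaka_webster_def, THEN conjunct2, THEN conjunct2, THEN conjunct2, THEN conjunct1,
          THEN spec, THEN spec, THEN spec, THEN spec, THEN mp, THEN mp, THEN mp, THEN mp, THEN bspec, OF fF(1,2) Z_T10 Z_T10 p])
  also have "\<dots> = cf p (Z p) * hh Z p + cnj (cf p (vconj Z p)) * hh Z p"
    unfolding levi_comp[OF F p fF(1) p s[OF fF(2)] Z_T10] levi_comp[OF F p fF(1) p Z_T10 s[OF fF(3)]] n by (simp add: k[OF p])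
  finally have "Z p (hh Z) = cf p (Z p) * hh Z p + cnj (cf p (vconj Z p)) * hh Z p" by (simp add: h11_def[abs_def])
  then have z: "cf p (Z p) = wZ Z p" unfolding b using Z_h[OF F p] h_nonzero[OF F p] by (simp add: distrib_right)
  note l = nab_lin[OF fF(1,2) p]
  have c: "cf p (comb x u y v z w) = x * cf p u + y * cf p v + z * cf p w" if "u \<in> ct p" "v \<in> ct p" "w \<in> ct p" for x y z u v w
    unfolding comb_def cf_def using that by (simp add: l ct_tscale ct_tadd kl[OF p])
  show ?thesis
    by (subst frame_span[OF F p v]) (simp add: c frame_ct[OF F p] b t z om_def)
qed

lemma nab_frame:
  assumes p: "p \<in> U" and v: "v \<in> ct p"
  shows "nab p v T = tscale 0 (T p)" "nab p v Z = tscale (om Z p v) (Z p)"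
    "nab p v (vconj Z) = tscale (cnj (om Z p (tconj v))) (vconj Z p)"
proof -
  have "nab p v T = tzero"
    by (rule W[unfolded tanaka_webster_def, THEN conjunct2, THEN conjunct2, THEN conjunct1, THEN bspec, THEN bspec, OF fF(6)[OF p] v])
  then show "nab p v T = tscale 0 (T p)" by (simp add: fun_eq_iff tvec_simps)
  show "nab p v Z = tscale (om Z p v) (Z p)" using nab_cf[OF p v] cf_om[OF p v] by simp
  have "nab p v (vconj Z) = tconj (nab p (tconj v) Z)" using nab_conj[OF fF(1,2) p ct_tconj[OF v]] by simp
  also have "\<dots> = tscale (cnj (om Z p (tconj v))) (vconj Z p)"
    unfolding nab_cf[OF p ct_tconj[OF v]] cf_om[OF p ct_tconj[OF v]] by (simp add: tconj_tscale vconj_def)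
  finally show "nab p v (vconj Z) = tscale (cnj (om Z p (tconj v))) (vconj Z p)" .
qed

lemma tw_A_eq: assumes p: "p \<in> U" shows "tw_A M \<theta> T nab Z p = A11 Z p"
proof -
  have "ext_d M (coframe1 T Z) T (vconj Z) p = ext_d M (k1 Z) T (vconj Z) p"
    by (rule ext_d_cong[OF fF(1) p T_smooth fF(3)]) (simp add: coframe)
  also have "\<dots> = dform (k1 Z) p (T p) (vconj Z p)"
    by (rule ext_d_dform[OF p p fF(1) fF(1) k1_oneform[OF F] T_smooth fF(3)])
  also have "\<dots> = - k1 Z p (lie_bracket M reeb (vconj Z) p)"
    unfolding T_eq[OF fF(6)[OF p]] by (rule dk1_frame(2)[OF F p])
  also have "lie_bracket M reeb (vconj Z) p = tconj (lie_bracket M reeb Z p)" by (rule bracket_conj(1)[OF F p])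
  finally have 1: "ext_d M (coframe1 T Z) T (vconj Z) p = - cnj (k2 Z p (lie_bracket M reeb Z p))" by (simp add: k2_tconj)
  have 2: "wedge (coframe1 T Z) (conn_form nab T Z) T (vconj Z) p = 0"
    unfolding wedge_def T_eq[OF fF(6)[OF p]] using coframe[OF p] frame_ct[OF F p] k[OF p] by simp
  show ?thesis unfolding tw_A_def 1 2 A11_def using h_cnj[OF F p] by simp
qed

lemma tw_Scal_eq: assumes p: "p \<in> U" shows "tw_Scal M \<theta> T nab Z p = S11 Z p"
proof -
  have e: "X p (\<lambda>q. conn_form nab T Z q (Y q)) = X p (\<lambda>q. om Z q (Y q))" if "smooth_vfield M U X" "smooth_vfield M U Y" for X Y
    by (rule ct_cong[OF smooth_vfieldD(1)[OF that(1) p] fF(1) p]) (simp add: conn_cf cf_om smooth_vfieldD(1)[OF that(2)])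
  have z: "Z p (\<lambda>q. om Z q (vconj Z q)) = Z p (wZb Z)" "vconj Z p (\<lambda>q. om Z q (Z q)) = vconj Z p (wZ Z)"
    by (rule ct_cong[OF _ fF(1) p]; simp add: om_frame[OF F] fF p)+
  have B: "lie_bracket M Z (vconj Z) p \<in> ct p" by (rule bracket_ct(3)[OF F p])
  show ?thesis
    unfolding tw_Scal_def ext_d_def e[OF fF(2,3)] e[OF fF(3,2)] z conn_cf[OF p B] cf_om[OF p B] S11_def ..
qed

end

section \<open>Components of covariant derivatives\<close>

definition PL :: "('a \<Rightarrow> complex) list \<Rightarrow> 'a \<Rightarrow> complex" where "PL cs q = (\<Prod>c\<leftarrow>cs. c q)"

lemma PL_simps [simp]: "PL [] q = 1" "PL (c # cs) q = c q * PL cs q" by (simp_all add: PL_def)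

fun ix :: "bool \<Rightarrow> idx" where "ix True = Ix1" | "ix False = Ix1bar"

definition tr :: "nmon \<Rightarrow> monomial" where
  "tr m = (case m of (c, Bs, ds) \<Rightarrow> (c, map (\<lambda>(B, w). (B, map ix w)) Bs, map ix ds))"

lemma prod_list_apply: "prod_list (fs :: ('a \<Rightarrow> complex) list) p = (\<Prod>f\<leftarrow>fs. f p)"
  by (induction fs) simp_all

lemma sum_list_apply: "sum_list (fs :: ('a \<Rightarrow> complex) list) p = (\<Sum>f\<leftarrow>fs. f p)"
  by (induction fs) simp_all

text \<open>A letter \<open>False\<close> is an upper index 1 and is translated into a lower
  conjugate index, so charge zero is the same as equally many indices of both types.\<close>

lemma tr_balanced:
  assumes "mchg m = 0"
  shows "count_list (monomial_indices (tr m)) Ix1 = count_list (monomial_indices (tr m)) Ix1bar"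
proof -
  obtain c Bs ds where mm: "m = (c, Bs, ds)" by (metis prod.exhaust)
  have cw: "int (count_list (map ix w) Ix1) - int (count_list (map ix w) Ix1bar) = ichg w" for w
    by (induction w) (auto simp: ichg_def ix.simps)
  have "int (count_list (concat (map (\<lambda>(B, js). js @ curv_indices B) (map (\<lambda>(B, w). (B, map ix w)) Bs))) Ix1)
     - int (count_list (concat (map (\<lambda>(B, js). js @ curv_indices B) (map (\<lambda>(B, w). (B, map ix w)) Bs))) Ix1bar) = (\<Sum>(B, w)\<leftarrow>Bs. cchg B + ichg w)"
  proof (induction Bs)
    case (Cons Bw Bs)
    obtain B w where "Bw = (B, w)" by force
    moreover have "int (count_list (curv_indices B) Ix1) - int (count_list (curv_indices B) Ix1bar) = cchg B" by (cases B) simp_all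
    ultimately show ?case using Cons.IH cw[of w] by simp
  qed simp
  then have "int (count_list (monomial_indices (tr m)) Ix1) - int (count_list (monomial_indices (tr m)) Ix1bar) = mchg m"
    using cw[of ds] by (simp add: mm tr_def)
  then show ?thesis using assms by simp
qed

lemma well_formed_tr: "\<forall>m\<in>set E. mchg m = 0 \<Longrightarrow> well_formed (map tr E)"
  using tr_balanced by (auto simp: well_formed_def)

context manifold begin

lemma PL_smooth_at: "p \<in> pts \<Longrightarrow> \<forall>c\<in>set cs. smooth_at M p c \<Longrightarrow> smooth_at M p (PL cs)"
proof (induction cs)
  case Nil then show ?case using smooth_at_const[of p 1] by (simp add: PL_def[abs_def])
next
  case (Cons c cs) then show ?case using smooth_at_mult[of p c "PL cs"] by (simp add: PL_def[abs_def])
qed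

lemma PL_deriv:
  assumes p: "p \<in> pts" and v: "v \<in> ctangent M p"
  shows "\<forall>c\<in>set cs. smooth_at M p c \<Longrightarrow> (\<And>j. j < length cs \<Longrightarrow> d j p = v (cs ! j) + \<omega> j * (cs ! j) p) \<Longrightarrow>
    (\<Sum>j<length cs. PL (cs[j := d j]) p) = v (PL cs) + (\<Sum>j<length cs. \<omega> j) * PL cs p"
proof (induction cs arbitrary: d \<omega>)
  case Nil
  have "PL [] = (\<lambda>q :: 'a. 1)" by (simp add: fun_eq_iff)
  then show ?case using ct_const[OF v, of 1] by simp
next
  case (Cons c cs)
  have s: "smooth_at M p c" "\<forall>c\<in>set cs. smooth_at M p c" using Cons.prems by auto
  have "v (\<lambda>q. c q * PL cs q) = v c * PL cs p + c p * v (PL cs)"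
    by (rule ct_mult[OF v s(1) PL_smooth_at[OF p s(2)]])
  then have e: "v (PL (c # cs)) = v c * PL cs p + c p * v (PL cs)" by (simp add: PL_def[abs_def])
  have IH: "(\<Sum>j<length cs. PL (cs[j := d (Suc j)]) p) = v (PL cs) + (\<Sum>j<length cs. \<omega> (Suc j)) * PL cs p"
    by (rule Cons.IH[OF s(2)]) (use Cons.prems(2)[of "Suc _"] in simp)
  have d0: "d 0 p = v c + \<omega> 0 * c p" using Cons.prems(2)[of 0] by simp
  have "(\<Sum>j<length (c # cs). PL ((c # cs)[j := d j]) p) = d 0 p * PL cs p + c p * (\<Sum>j<length cs. PL (cs[j := d (Suc j)]) p)"
    by (simp only: list.size(4) add_Suc_right add_0_right sum.lessThan_Suc_shift list_update.simps nat.case PL_simps sum_distrib_left)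
  also have "\<dots> = v (PL (c # cs)) + (\<Sum>j<length (c # cs). \<omega> j) * PL (c # cs) p"
    unfolding IH d0 e by (simp add: sum.lessThan_Suc_shift algebra_simps del: sum.lessThan_Suc)
  finally show ?case .
qed

end

context tw begin

abbreviation "Fi \<equiv> frame_field T Z"

definition "wi v i p = (case i of Ix0 \<Rightarrow> 0 | Ix1 \<Rightarrow> om Z p v | Ix1bar \<Rightarrow> cnj (om Z p (tconj v)))"

lemma Fi_smooth: "smooth_vfield M U (Fi i)"
  by (cases i) (simp_all add: T_smooth fF)

lemma Fi_ct: "p \<in> U \<Longrightarrow> Fi i p \<in> ct p" using smooth_vfieldD(1)[OF Fi_smooth] .

lemma nab_Fi: "p \<in> U \<Longrightarrow> v \<in> ct p \<Longrightarrow> nab p v (Fi i) = tscale (wi v i p) (Fi i p)"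
  by (cases i) (simp_all add: nab_frame wi_def)

lemma wi_smooth: "smooth_vfield M U X \<Longrightarrow> sm U (\<lambda>p. wi (X p) i p)"
  using om_smooth[OF F fF(1) order_refl, of X] sm_cnj[OF fF(1) om_smooth[OF F fF(1) order_refl smooth_vfield_vconj[OF fF(1)]], of X]
  by (cases i) (simp_all add: wi_def sm_const vconj_def)

lemma wi_scale: "p \<in> U \<Longrightarrow> v \<in> ct p \<Longrightarrow> wi (tscale c v) i p = c * wi v i p"
  by (cases i) (simp_all add: wi_def om_lin[OF F] tconj_tscale ct_tconj)

text \<open>The recursion of \<open>cov_deriv\<close> evaluates a tensor on covariant derivatives of
  frame fields, which are function multiples of frame fields. The inductive statement therefore has
  to cover all such multiples, with \<open>PL cs\<close> the product of the coefficients.\<close>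

definition "hc t js g \<longleftrightarrow> sm U g \<and> (\<forall>Ys cs. length Ys = length js \<longrightarrow> length cs = length js \<longrightarrow>
   (\<forall>j<length js. sm U (cs ! j) \<and> (\<forall>q\<in>U. (Ys ! j) q = tscale ((cs ! j) q) (Fi (js ! j) q))) \<longrightarrow>
   (\<forall>q\<in>U. t Ys q = PL cs q * g q))"

lemma hcD:
  assumes "hc t js g" "length Ys = length js" "length cs = length js" "\<And>j. j < length js \<Longrightarrow> sm U (cs ! j)"
    "\<And>j q. j < length js \<Longrightarrow> q \<in> U \<Longrightarrow> (Ys ! j) q = tscale ((cs ! j) q) (Fi (js ! j) q)" "q \<in> U"
  shows "t Ys q = PL cs q * g q"
  using assms unfolding hc_def by blast

definition "cdiff i js g p = Fi i p g - (\<Sum>j<length js. wi (Fi i p) (js ! j) p) * g p"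

lemma hc_cov: assumes H: "hc t js g" shows "hc (cov_deriv nab t) (i # js) (cdiff i js g)"
  unfolding hc_def
proof (intro conjI allI impI ballI)
  have g: "sm U g" using H by (simp add: hc_def)
  show "sm U (cdiff i js g)"
    unfolding cdiff_def
    by (intro sm_diff sm_mult sm_sum fF(1) g wi_smooth Fi_smooth smooth_vfieldD(2)[OF Fi_smooth fF(1) order_refl g])
  fix Ys' cs' q assume len: "length Ys' = length (i # js)" "length cs' = length (i # js)" and q: "q \<in> U"
    and a: "\<forall>j<length (i # js). sm U (cs' ! j) \<and> (\<forall>q\<in>U. (Ys' ! j) q = tscale ((cs' ! j) q) (Fi ((i # js) ! j) q))"
  obtain X Ys c cs where l: "Ys' = X # Ys" "cs' = c # cs" "length Ys = length js" "length cs = length js"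
    using len by (cases Ys'; cases cs') auto
  have c: "sm U c" and X: "\<And>q. q \<in> U \<Longrightarrow> X q = tscale (c q) (Fi i q)"
    using a[rule_format, of 0] by (simp_all add: l)
  have cs: "sm U (cs ! j)" and Ys: "\<And>q. q \<in> U \<Longrightarrow> (Ys ! j) q = tscale ((cs ! j) q) (Fi (js ! j) q)" if "j < length js" for j
    using a[rule_format, of "Suc j"] that by (simp_all add: l)
  have sX: "smooth_vfield M U X"
    by (rule smooth_vfield_cong[OF fF(1) smooth_vfield_tscale[OF fF(1) Fi_smooth c]]) (simp add: X)
  have sY: "smooth_vfield M U (Ys ! j)" if "j < length js" for j
    by (rule smooth_vfield_cong[OF fF(1) smooth_vfield_tscale[OF fF(1) Fi_smooth cs[OF that]]]) (simp add: Ys[OF that])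
  have Xc: "X r \<in> ct r" if "r \<in> U" for r using smooth_vfieldD(1)[OF sX that] .
  define d where "d j r = X r (cs ! j) + wi (X r) (js ! j) r * (cs ! j) r" for j r
  have ds: "sm U (d j)" if "j < length js" for j
    unfolding d_def[abs_def]
    by (intro sm_add sm_mult fF(1) cs that wi_smooth sX smooth_vfieldD(2)[OF sX fF(1) order_refl])
  have n: "nab_field nab X (Ys ! j) r = tscale (d j r) (Fi (js ! j) r)" if j: "j < length js" and r: "r \<in> U" for j r
  proof -
    have "nab r (X r) (Ys ! j) = nab r (X r) (\<lambda>q. tscale ((cs ! j) q) (Fi (js ! j) q))"
      by (rule nab_local[OF fF(1) r sY[OF j] smooth_vfield_tscale[OF fF(1) Fi_smooth cs[OF j]] Ys[OF j] Xc[OF r]])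
    also have "\<dots> = tadd (tscale (X r (cs ! j)) (Fi (js ! j) r)) (tscale ((cs ! j) r) (nab r (X r) (Fi (js ! j))))"
      by (rule nab_scale[OF fF(1) cs[OF j] Fi_smooth r Xc[OF r]])
    also have "\<dots> = tscale (d j r) (Fi (js ! j) r)"
      unfolding nab_Fi[OF r Xc[OF r]] by (simp add: d_def fun_eq_iff tvec_simps algebra_simps)
    finally show ?thesis by (simp add: nab_field_def)
  qed
  have t1: "t Ys r = PL cs r * g r" if "r \<in> U" for r
    by (rule hcD[OF H l(3,4) cs Ys that])
  have t2: "t (Ys[j := nab_field nab X (Ys ! j)]) q = PL (cs[j := d j]) q * g q" if j: "j < length js" for j
  proof (rule hcD[OF H _ _ _ _ q])
    show "length (Ys[j := nab_field nab X (Ys ! j)]) = length js" "length (cs[j := d j]) = length js" using l by simp_all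
    fix m assume m: "m < length js"
    show "sm U (cs[j := d j] ! m)" using cs[OF m] ds[OF j] l m by (cases "m = j") simp_all
    fix r assume r: "r \<in> U"
    show "(Ys[j := nab_field nab X (Ys ! j)] ! m) r = tscale ((cs[j := d j] ! m) r) (Fi (js ! m) r)"
      using Ys[OF m r] n[OF j r] l m by (cases "m = j") simp_all
  qed
  have csa: "\<forall>c\<in>set cs. smooth_at M q c"
    using cs l by (auto simp: in_set_conv_nth intro!: smooth_atI[OF fF(1) q])
  have sP: "smooth_at M q (PL cs)" by (rule PL_smooth_at[OF fF(6)[OF q] csa])
  have "X q (t Ys) = X q (\<lambda>r. PL cs r * g r)"
    by (rule ct_cong[OF Xc[OF q] fF(1) q]) (rule t1)
  also have "\<dots> = X q (PL cs) * g q + PL cs q * X q g"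
    by (rule ct_mult[OF Xc[OF q] sP smooth_atI[OF fF(1) q g]])
  finally have 1: "X q (t Ys) = X q (PL cs) * g q + PL cs q * X q g" .
  have "(\<Sum>j<length cs. PL (cs[j := d j]) q) = X q (PL cs) + (\<Sum>j<length cs. wi (X q) (js ! j) q) * PL cs q"
    by (rule PL_deriv[OF fF(6)[OF q] Xc[OF q] csa]) (simp add: d_def)
  then have 2: "(\<Sum>j<length Ys. t (Ys[j := nab_field nab X (Ys ! j)]) q) = (X q (PL cs) + (\<Sum>j<length js. wi (X q) (js ! j) q) * PL cs q) * g q"
    using t2 l by (simp add: sum_distrib_right[symmetric])
  have 3: "wi (X q) m q = c q * wi (Fi i q) m q" for m unfolding X[OF q] by (rule wi_scale[OF q Fi_ct[OF q]])
  have "cov_deriv nab t Ys' q = X q (t Ys) - (\<Sum>j<length Ys. t (Ys[j := nab_field nab X (Ys ! j)]) q)"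
    unfolding l(1) cov_deriv.simps ..
  also have "\<dots> = PL cs q * (X q g - (\<Sum>j<length js. wi (X q) (js ! j) q) * g q)"
    unfolding 1 2 by (simp add: algebra_simps)
  also have "\<dots> = PL cs' q * cdiff i js g q"
    unfolding 3 l(2) cdiff_def sum_distrib_left[symmetric] by (simp add: X[OF q] tscale_def algebra_simps)
  finally show "cov_deriv nab t Ys' q = PL cs' q * cdiff i js g q" .
qed

lemma hc_cong: assumes "hc t js g" "\<And>q. q \<in> U \<Longrightarrow> g q = g' q" shows "hc t js g'"
proof -
  have "sm U g'" by (rule sm_cong[OF fF(1) assms(2)]) (use assms(1) in \<open>auto simp: hc_def\<close>)
  then show ?thesis using assms unfolding hc_def by simp
qed

lemma hc_frame: assumes "hc t js g" "q \<in> U" shows "t (map Fi js) q = g q"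
proof -
  have "PL (replicate n (\<lambda>_. 1)) q = 1" for n by (induction n) simp_all
  moreover have "t (map Fi js) q = PL (replicate (length js) (\<lambda>_. 1)) q * g q"
    by (rule hcD[OF assms(1) _ _ _ _ assms(2)]) (simp_all add: sm_const fun_eq_iff tvec_simps)
  ultimately show ?thesis by simp
qed

lemma hc_scalar: "sm U f \<Longrightarrow> hc (scalar_tensor f) [] f"
  by (simp add: hc_def scalar_tensor_def)

lemma hc_curv:
  "hc (curv_tensor M \<theta> T nab Z B) (curv_indices B) (\<lambda>q. hh Z q ^ count_list (curv_indices B) Ix1bar * fC (dat U Z f) B q)"
proof (cases B)
  case Tor
  have H: "hc (curv_tensor M \<theta> T nab Z Tor) [Ix1, Ix1] (A11 Z)"
    unfolding hc_def
  proof (intro conjI allI impI ballI A11_smooth[OF F])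
    fix Ys cs q assume l: "length Ys = length [Ix1, Ix1]" "length cs = length [Ix1, Ix1]" and q: "q \<in> U"
      and a: "\<forall>j<length [Ix1, Ix1]. sm U (cs ! j) \<and> (\<forall>q\<in>U. (Ys ! j) q = tscale ((cs ! j) q) (Fi ([Ix1, Ix1] ! j) q))"
    obtain X Y c d where e: "Ys = [X, Y]" "cs = [c, d]" using l by (cases Ys; cases cs; cases "tl Ys"; cases "tl cs") auto
    have "X q = tscale (c q) (Z q)" "Y q = tscale (d q) (Z q)" using a[rule_format, of 0] a[rule_format, of 1] q by (simp_all add: e)
    then show "curv_tensor M \<theta> T nab Z Tor Ys q = PL cs q * A11 Z q"
      using q by (simp add: e coframe ct_tscale fF kl k tw_A_eq)
  qed
  show ?thesis unfolding Tor curv_indices.simps by (rule hc_cong[OF H]) (simp add: AA_def)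
next
  case TorBar
  have H: "hc (curv_tensor M \<theta> T nab Z TorBar) [Ix1bar, Ix1bar] (\<lambda>q. cnj (A11 Z q))"
    unfolding hc_def
  proof (intro conjI allI impI ballI sm_cnj fF(1) A11_smooth[OF F])
    fix Ys cs q assume l: "length Ys = length [Ix1bar, Ix1bar]" "length cs = length [Ix1bar, Ix1bar]" and q: "q \<in> U"
      and a: "\<forall>j<length [Ix1bar, Ix1bar]. sm U (cs ! j) \<and> (\<forall>q\<in>U. (Ys ! j) q = tscale ((cs ! j) q) (Fi ([Ix1bar, Ix1bar] ! j) q))"
    obtain X Y c d where e: "Ys = [X, Y]" "cs = [c, d]" using l by (cases Ys; cases cs; cases "tl Ys"; cases "tl cs") auto
    have "X q = tscale (c q) (vconj Z q)" "Y q = tscale (d q) (vconj Z q)" using a[rule_format, of 0] a[rule_format, of 1] q by (simp_all add: e)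
    moreover have "fconj (coframe1 T Z) q (tscale x (vconj Z q)) = x" for x
      using q coframe[OF q, of "tscale (cnj x) (Z q)"] by (simp add: fconj_def tconj_tscale vconj_def ct_tscale fF kl k)
    ultimately show "curv_tensor M \<theta> T nab Z TorBar Ys q = PL cs q * cnj (A11 Z q)"
      using q by (simp add: e tw_A_eq)
  qed
  show ?thesis unfolding TorBar curv_indices.simps
    by (rule hc_cong[OF H]) (use hnz[OF F] in \<open>simp add: AA_def power2_eq_square\<close>)
next
  case ScalCurv
  have "hc (scalar_tensor (tw_Scal M \<theta> T nab Z)) [] (SS U Z)"
    unfolding hc_def scalar_tensor_def using SS_smooth[OF F] by (simp add: SS_def tw_Scal_eq)
  then show ?thesis by (simp add: ScalCurv)
qed

text \<open>A conjugate lower index is h times an upper index 1, and since h is parallel its powers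
  pass through covariant derivatives. What remains is differentiation along Z_1 and Z^1 in which
  only the charge multiplies the connection form.\<close>

lemma hc_word:
  assumes f: "sm U f" and G: "sm U G" and H: "hc t js (\<lambda>q. hh Z q ^ count_list js Ix1bar * G q)" and js: "Ix0 \<notin> set js"
  shows "hc ((cov_deriv nab ^^ length w) t) (map ix w @ js)
    (\<lambda>q. hh Z q ^ count_list (map ix w @ js) Ix1bar * Ew (dat U Z f) (int (count_list js Ix1) - int (count_list js Ix1bar)) w G q)"
proof (induction w)
  case (Cons b w)
  let ?js = "map ix w @ js" and ?p = "int (count_list js Ix1) - int (count_list js Ix1bar)"
  let ?g = "Ew (dat U Z f) ?p w G" and ?m = "count_list (map ix w @ js) Ix1bar"
  have g: "sm U ?g" using Ew_S[OF good_dat[OF F f], of G] G by simp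
  have gh: "sm U (\<lambda>q. hh Z q ^ n)" for n
    by (induction n) (simp_all add: sm_const sm_mult[OF fF(1) hsm[OF F]])
  have p: "?p + ichg w = int (count_list ?js Ix1) - int (count_list ?js Ix1bar)"
    by (induction w) (auto simp: ichg_def ix.simps)
  have 0: "Ix0 \<notin> set ?js" using js by (auto elim: ix.elims[OF sym])
  have "hc (cov_deriv nab ((cov_deriv nab ^^ length w) t)) (ix b # ?js) (cdiff (ix b) ?js (\<lambda>q. hh Z q ^ ?m * ?g q))"
    by (rule hc_cov[OF Cons.IH])
  then have "hc ((cov_deriv nab ^^ length (b # w)) t) (map ix (b # w) @ js) (cdiff (ix b) ?js (\<lambda>q. hh Z q ^ ?m * ?g q))"
    by simp
  then show ?case
  proof (rule hc_cong)
    fix q assume q: "q \<in> U"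
    let ?v = "Fi (ix b) q"
    have v: "?v \<in> ct q" by (rule Fi_ct[OF q])
    have h0: "hh Z q \<noteq> 0" by (rule hnz[OF F q])
    note sh = smooth_atI[OF fF(1) q hsm[OF F]] and sg = smooth_atI[OF fF(1) q g]
    have vh: "?v (\<lambda>q. hh Z q ^ n) * hh Z q = of_nat n * hh Z q ^ n * ?v (hh Z)" for n
    proof (induction n)
      case 0 show ?case using ct_const[OF v, of 1] by simp
    next
      case (Suc n)
      have "?v (\<lambda>q. hh Z q ^ Suc n) = ?v (hh Z) * hh Z q ^ n + hh Z q * ?v (\<lambda>q. hh Z q ^ n)"
        using ct_mult[OF v sh smooth_atI[OF fF(1) q gh[of n]]] by simp
      then show ?case using Suc.IH by (simp add: algebra_simps)
    qed
    have vg: "?v (\<lambda>q. hh Z q ^ ?m * ?g q) = ?v (\<lambda>q. hh Z q ^ ?m) * ?g q + hh Z q ^ ?m * ?v ?g"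
      by (rule ct_mult[OF v smooth_atI[OF fF(1) q gh] sg])
    \<comment> \<open>By \<open>d_h\<close> a conjugate index has connection coefficient v(h)/h -
      om. So the sum is the charge times om plus a term that cancels the derivative of the power of
      h. Multiplication by h avoids the division.\<close>
    have ws: "(\<Sum>j<length ks. wi ?v (ks ! j) q) * hh Z q
        = of_nat (count_list ks Ix1) * (om Z q ?v * hh Z q) + of_nat (count_list ks Ix1bar) * (?v (hh Z) - om Z q ?v * hh Z q)" if "Ix0 \<notin> set ks" for ks
      using that
    proof (induction ks)
      case (Cons i ks)
      have w: "wi ?v i q * hh Z q = (if i = Ix1 then om Z q ?v * hh Z q else ?v (hh Z) - om Z q ?v * hh Z q)"
        using Cons.prems d_h[OF F q v] by (cases i) (simp_all add: wi_def algebra_simps)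
      show ?case
        using Cons w by (cases i) (simp_all add: sum.lessThan_Suc_shift distrib_right algebra_simps del: sum.lessThan_Suc)
    qed simp
    have "cdiff (ix b) ?js (\<lambda>q. hh Z q ^ ?m * ?g q) q * hh Z q = hh Z q ^ ?m * hh Z q *
        (?v ?g - of_int (?p + ichg w) * om Z q ?v * ?g q)"
    proof -
      have "cdiff (ix b) ?js (\<lambda>q. hh Z q ^ ?m * ?g q) q * hh Z q = (?v (\<lambda>q. hh Z q ^ ?m) * hh Z q) * ?g q + hh Z q ^ ?m * hh Z q * ?v ?g
         - ((\<Sum>j<length ?js. wi ?v (?js ! j) q) * hh Z q) * (hh Z q ^ ?m * ?g q)"
        unfolding cdiff_def vg by (simp add: algebra_simps)
      then show ?thesis unfolding vh ws[OF 0] p by (simp add: algebra_simps)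
    qed
    then have c: "cdiff (ix b) ?js (\<lambda>q. hh Z q ^ ?m * ?g q) q = hh Z q ^ ?m * (?v ?g - of_int (?p + ichg w) * om Z q ?v * ?g q)"
      using h0 by (simp add: mult_ac)
    have oi: "(of_int n :: 'a \<Rightarrow> complex) q = of_int n" for n unfolding of_int_cst[OF good_dat[OF F f]] by (simp add: cst_def)
    show "cdiff (ix b) ?js (\<lambda>q. hh Z q ^ ?m * ?g q) q = hh Z q ^ count_list (map ix (b # w) @ js) Ix1bar * Ew (dat U Z f) ?p (b # w) G q"
    proof (cases b)
      case True
      then show ?thesis unfolding c Ew.simps fE_def using q by (simp add: XX_def uu_def om_frame[OF F] oi)
    next
      case False
      then show ?thesis unfolding c Ew.simps fE_def using q h0 by (simp add: XX_def uu_def om_frame[OF F] oi field_simps)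
    qed
  qed
qed (simp add: H)

lemma cov_curv:
  assumes f: "sm U f" and q: "q \<in> U"
  shows "(cov_deriv nab ^^ length w) (curv_tensor M \<theta> T nab Z B) (map Fi (map ix w @ curv_indices B)) q
    = hh Z q ^ count_list (map ix w @ curv_indices B) Ix1bar * Ew (dat U Z f) (cchg B) w (fC (dat U Z f) B) q"
proof -
  have G: "sm U (fC (dat U Z f) B)" using good_dat[OF F f] by (simp add: good_data_def)
  have c: "int (count_list (curv_indices B) Ix1) - int (count_list (curv_indices B) Ix1bar) = cchg B" "Ix0 \<notin> set (curv_indices B)"
    by (cases B; simp)+
  show ?thesis using hc_frame[OF hc_word[OF f G hc_curv c(2)] q] unfolding c(1) .
qed

lemma cov_scalar:
  assumes f: "sm U f" and q: "q \<in> U"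
  shows "(cov_deriv nab ^^ length w) (scalar_tensor f) (map Fi (map ix w)) q
    = hh Z q ^ count_list (map ix w) Ix1bar * Ew (dat U Z f) 0 w f q"
  using hc_frame[OF hc_word[OF f f, of "scalar_tensor f" "[]" w] q] hc_scalar[OF f] by simp

lemma monomial_value_tr:
  assumes f: "sm U f" and q: "q \<in> U" and m: "mchg m = 0"
  shows "monomial_value M \<theta> T nab Z f q (tr m) = nval (dat U Z f) m q"
proof -
  obtain c Bs ds where mm: "m = (c, Bs, ds)" by (metis prod.exhaust)
  let ?h = "hh Z q" and ?F = "dat U Z f"
  have n: "count_list (monomial_indices (tr m)) Ix1 = count_list (monomial_indices (tr m)) Ix1bar" by (rule tr_balanced[OF m])
  have P: "(\<Prod>(B, js)\<leftarrow>map (\<lambda>(B, w). (B, map ix w)) Bs. (cov_deriv nab ^^ length js) (curv_tensor M \<theta> T nab Z B) (map Fi (js @ curv_indices B)) q)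
     = ?h ^ count_list (concat (map (\<lambda>(B, js). js @ curv_indices B) (map (\<lambda>(B, w). (B, map ix w)) Bs))) Ix1bar
       * (\<Prod>(B, w)\<leftarrow>Bs. Ew ?F (cchg B) w (fC ?F B) q)"
  proof (induction Bs)
    case (Cons Bw Bs)
    obtain B w where Bw: "Bw = (B, w)" by force
    show ?case unfolding Bw list.map prod_list.Cons prod.case Cons.IH using cov_curv[OF f q, of w B]
      by (simp add: power_add)
  qed simp
  have a: "(\<Prod>(B, w)\<leftarrow>Bs. Ew ?F (cchg B) w (fC ?F B)) q = (\<Prod>(B, w)\<leftarrow>Bs. Ew ?F (cchg B) w (fC ?F B) q)"
    by (simp add: prod_list_apply o_def case_prod_unfold)
  have "monomial_value M \<theta> T nab Z f q (tr m) = c * (\<Prod>(B, w)\<leftarrow>Bs. Ew ?F (cchg B) w (fC ?F B) q) * Ew ?F 0 ds f q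
      * ?h ^ count_list (monomial_indices (tr m)) Ix1bar / ?h ^ count_list (monomial_indices (tr m)) Ix1"
    using cov_scalar[OF f q, of ds] by (simp add: mm tr_def P power_add del: map_map map_append)
  also have "\<dots> = nval ?F m q" unfolding n using hnz[OF F q] by (simp add: mm a cst_def del: prod_list_apply)
  finally show "monomial_value M \<theta> T nab Z f q (tr m) = nval ?F m q" .
qed

theorem expr_value_tr:
  assumes f: "sm U f" and q: "q \<in> U" and E: "\<forall>m\<in>set E. mchg m = 0"
  shows "expr_value M \<theta> T nab Z (map tr E) f q = nvals (dat U Z f) E q"
proof -
  have "expr_value M \<theta> T nab Z (map tr E) f q = (\<Sum>m\<leftarrow>E. nval (dat U Z f) m q)"
    using E monomial_value_tr[OF f q] unfolding expr_value_def by (induction E) simp_all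
  then show ?thesis by (simp add: nvals_def sum_list_apply o_def)
qed

end

section \<open>Change of frame and scale\<close>

text \<open>\<open>J\<close> will be the ideal of functions vanishing off the domain of the frame, where linear independence
  of the frame gives no information.\<close>

locale frame_change = F1: frame_calc S X l half third sg u al T I w A + F2: frame_calc S X2 l half third sg2 u2 al2 T2 I w2 A2
  for S :: "'r::comm_ring_1 set" and X l half third sg u al T I w A X2 sg2 u2 al2 T2 w2 A2 +
  fixes a ai :: "bool \<Rightarrow> 'r" and ups :: 'r and J :: "'r set"
  assumes a: "a b \<in> S" "ai b \<in> S" "a b * ai b = 1" and X2: "X2 b g = a b * X b g"
    and ups: "ups \<in> S" and aups: "X b (a True * a False) = - (a True * a False) * X b ups"
    and II: "I * I = - 1" and tf: "of_nat (Suc n) * (g::'r) = 0 \<Longrightarrow> g = 0"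
    and J: "f \<in> J \<Longrightarrow> g \<in> J \<Longrightarrow> f + g \<in> J" "f \<in> J \<Longrightarrow> r * f \<in> J"
    and inJ: "X b g \<in> J" "T g \<in> J" "u b \<in> J" "w \<in> J" "A b \<in> J" "u2 b \<in> J" "w2 \<in> J" "A2 b \<in> J"
    and ind: "\<alpha> \<in> J \<Longrightarrow> \<beta> \<in> J \<Longrightarrow> \<gamma> \<in> J \<Longrightarrow>
      (\<And>g. g \<in> S \<Longrightarrow> \<alpha> * T g + \<beta> * X True g + \<gamma> * X False g = 0) \<Longrightarrow> \<alpha> = 0 \<and> \<beta> = 0 \<and> \<gamma> = 0"
begin

lemma J': "f \<in> J \<Longrightarrow> f * r \<in> J" "f \<in> J \<Longrightarrow> - f \<in> J" "f \<in> J \<Longrightarrow> g \<in> J \<Longrightarrow> f - g \<in> J"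
  using J(2)[of f r] J(2)[of f "- 1"] J(1)[of f "- g"] J(2)[of g "- 1"] by (simp_all add: mult.commute)

abbreviation "e \<equiv> a True * a False"
abbreviation "x b \<equiv> X b ups"

lemma Xcl: "g \<in> S \<Longrightarrow> X b g \<in> S" using deriv_on.X_closed[OF F1.X] .
lemma Tcl: "g \<in> S \<Longrightarrow> T g \<in> S" using deriv_on.X_closed[OF F1.T] .

lemma II': "I * (I * g) = - g" using II by (simp add: mult.assoc[symmetric])

lemma ae: "a b * a (\<not> b) = e" by (cases b) (simp_all add: mult.commute)

lemma ac: "a b * g = a b * h \<longleftrightarrow> g = h"
proof
  assume "a b * g = a b * h"
  then have "(a b * ai b) * g = (a b * ai b) * h" by (metis mult.assoc mult.commute)
  then show "g = h" using a(3) by simp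
qed simp

lemma ecl: "e \<in> S" using a F1.S_mult by blast

lemma comm: "g \<in> S \<Longrightarrow> X b (X (\<not> b) g) = X (\<not> b) (X b g) - sgb b * (I * T g + u (\<not> b) * X b g + u b * X (\<not> b) g)"
  using F1.XY[of g] by (cases b) (simp_all add: algebra_simps)

text \<open>The components of the new Reeb field along Z_1 and Z^1, found by solving the relation
  \<open>XY\<close> of the new frame for \<open>T2\<close>; see the lemma \<open>T2\<close>.\<close>

definition "ta b = (if b then I * (u2 False * a True - e * u False - a False * X False (a True))
   else I * (u2 True * a False - e * u True + a True * X True (a False)))"

lemma ta_S: "ta b \<in> S"
  using ecl by (simp add: ta_def F1.S_closed F1.S F2.S a Xcl F1.wA)

lemma ta_J: "ta b \<in> J"
proof -
  have "u2 False * a True - e * u False - a False * X False (a True) \<in> J" "u2 True * a False - e * u True + a True * X True (a False) \<in> J"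
    by (rule J'(3) J(1) J'(1)[OF inJ(6)] J(2)[OF inJ(3)] J(2)[OF inJ(1)])+
  then show ?thesis using J(2) by (simp add: ta_def)
qed

lemma T2: assumes g: "g \<in> S" shows "T2 g = e * T g + ta True * X True g + ta False * X False g"
proof -
  note m = deriv_on.X_mult[OF F1.X]
  have "T2 g = I * (- I * T2 g)" by (simp add: II')
  also have "- I * T2 g = X2 True (X2 False g) - X2 False (X2 True g) + u2 False * X2 True g + u2 True * X2 False g"
    using F2.XY[OF g] by simp
  also have "\<dots> = a True * (X True (a False) * X False g + a False * X True (X False g)) - a False * (X False (a True) * X True g + a True * X False (X True g))
      + u2 False * (a True * X True g) + u2 True * (a False * X False g)"
    unfolding X2 by (simp only: m[OF a(1) Xcl[OF g]])
  also have "X True (X False g) = X False (X True g) - (I * T g + u False * X True g + u True * X False g)"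
    using comm[OF g, of True] by simp
  finally show ?thesis by (simp add: ta_def II' algebra_simps)
qed

lemma bracket2: assumes g: "g \<in> S"
  shows "T2 (X2 b g) - X2 b (T2 g) = (sgb b * I * a b * ta (\<not> b) - a b * X b e) * T g
    + (e * a b * sgb b * w + e * T (a b) + ta b * X b (a b) + ta (\<not> b) * X (\<not> b) (a b) - a b * X b (ta b) + sgb b * a b * ta (\<not> b) * u (\<not> b)) * X b g
    + (- e * a b * A b - a b * X b (ta (\<not> b)) + sgb b * a b * ta (\<not> b) * u b) * X (\<not> b) g"
proof -
  note m = deriv_on.X_mult[OF F1.X] and mT = deriv_on.X_mult[OF F1.T] and ad = deriv_on.X_add[OF F1.X]
  note c = a(1) Xcl[OF g] Tcl[OF g] ta_S ecl F1.S_mult F1.S_add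
  have s: "ta True * X True h + ta False * X False h = ta b * X b h + ta (\<not> b) * X (\<not> b) h" for h
    by (cases b) (simp_all add: algebra_simps)
  have T2': "T2 h = e * T h + (ta b * X b h + ta (\<not> b) * X (\<not> b) h)" if "h \<in> S" for h
    using T2[OF that] s[of h] by (simp add: add.assoc)
  have TX: "T (X b g) = X b (T g) + sgb b * w * X b g - A b * X (\<not> b) g"
    using F1.TX[OF g, of b] by (simp add: algebra_simps)
  have e1: "X b (T2 g) = X b e * T g + e * X b (T g) + (X b (ta b) * X b g + ta b * X b (X b g) + (X b (ta (\<not> b)) * X (\<not> b) g + ta (\<not> b) * X b (X (\<not> b) g)))"
    unfolding T2'[OF g] by (simp only: m ad c)
  have e2: "T2 (a b * X b g) = e * (T (a b) * X b g + a b * T (X b g)) + (ta b * (X b (a b) * X b g + a b * X b (X b g))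
      + ta (\<not> b) * (X (\<not> b) (a b) * X b g + a b * X (\<not> b) (X b g)))"
    by (simp only: T2' m mT c)
  show ?thesis
    unfolding X2 e1 e2 TX comm[OF g, of b] by (simp add: algebra_simps)
qed

text \<open>The relation \<open>TX\<close> of the new frame is written in terms of the old one, and
  independence of the old frame lets the coefficients of T and of the two derivatives be compared.
  This gives the new Reeb field, connection coefficient and torsion at once.\<close>

lemma coeffs:
  shows "sgb b * I * ta (\<not> b) = X b e"
    and "sgb b * w2 * a b = e * a b * sgb b * w + e * T (a b) + ta b * X b (a b) + ta (\<not> b) * X (\<not> b) (a b) - a b * X b (ta b) + sgb b * a b * ta (\<not> b) * u (\<not> b)"
    and "A2 b * a (\<not> b) = e * a b * A b + a b * X b (ta (\<not> b)) - sgb b * a b * ta (\<not> b) * u b"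
proof -
  define k0 k1 k2 where "k0 = sgb b * I * a b * ta (\<not> b) - a b * X b e"
    and "k1 = (e * a b * sgb b * w + e * T (a b) + ta b * X b (a b) + ta (\<not> b) * X (\<not> b) (a b) - a b * X b (ta b) + sgb b * a b * ta (\<not> b) * u (\<not> b)) - sgb b * w2 * a b"
    and "k2 = (- e * a b * A b - a b * X b (ta (\<not> b)) + sgb b * a b * ta (\<not> b) * u b) + A2 b * a (\<not> b)"
  have "k0 * T g + k1 * X b g + k2 * X (\<not> b) g = 0" if g: "g \<in> S" for g
    using bracket2[OF g, of b] F2.TX[OF g, of b] unfolding k0_def k1_def k2_def X2 by (simp add: algebra_simps)
  moreover have "k0 \<in> J" unfolding k0_def by (rule J'(3) J(2)[OF ta_J] J(2)[OF inJ(1)])+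
  moreover have "k1 \<in> J"
    unfolding k1_def
    by (rule J'(3) J(1) J(2)[OF inJ(1)] J(2)[OF inJ(2)] J(2)[OF inJ(3)] J(2)[OF inJ(4)] J'(1)[OF J(2)[OF inJ(7)]])+
  moreover have "k2 \<in> J"
    unfolding k2_def by (rule J'(3) J(1) J(2)[OF inJ(5)] J(2)[OF inJ(1)] J(2)[OF inJ(3)] J'(1)[OF inJ(8)])+
  ultimately have "k0 = 0 \<and> k1 = 0 \<and> k2 = 0"
    using ind[of k0 "if b then k1 else k2" "if b then k2 else k1"] by (cases b) (simp_all add: algebra_simps)
  then have z: "k0 = 0" "k1 = 0" "k2 = 0" by blast+
  have "a b * (sgb b * I * ta (\<not> b)) = a b * X b e" using z(1) by (simp add: k0_def algebra_simps)
  then show "sgb b * I * ta (\<not> b) = X b e" unfolding ac .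
  show "sgb b * w2 * a b = e * a b * sgb b * w + e * T (a b) + ta b * X b (a b) + ta (\<not> b) * X (\<not> b) (a b) - a b * X b (ta b) + sgb b * a b * ta (\<not> b) * u (\<not> b)"
    using z(2) by (simp add: k1_def)
  show "A2 b * a (\<not> b) = e * a b * A b + a b * X b (ta (\<not> b)) - sgb b * a b * ta (\<not> b) * u b"
    using z(3) unfolding k2_def by (simp add: algebra_simps eq_neg_iff_add_eq_0 add_eq_0_iff)
qed

lemma ta: "ta (\<not> b) = I * (sgb b * (e * x b))"
proof -
  have "I * (sgb b * I * ta (\<not> b)) = I * X b e" using coeffs(1)[of b] by simp
  then have "sgb b * (I * (I * ta (\<not> b))) = I * X b e" by (simp only: mult_ac)
  then have "- ta (\<not> b) = sgb b * (I * X b e)" unfolding II' by (metis mult_minus_right sgb_simps(5))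
  then show ?thesis unfolding aups by (simp add: algebra_simps)
qed

lemma Xta: "X b (ta (\<not> b)) = I * (sgb b * (e * (X b (x b) - x b * x b)))"
proof -
  note m = deriv_on.X_mult[OF F1.X]
  have c: "x b \<in> S" "e * x b \<in> S" "sgb b * (e * x b) \<in> S"
    using Xcl[OF ups] ecl F1.S_mult F1.S_sgb by blast+
  show ?thesis
    unfolding ta m[OF F1.wA(1) c(3)] F1.I m[OF F1.S_sgb c(2)] deriv_on.X_sgb[OF F1.X] m[OF ecl c(1)] aups
    by (simp add: algebra_simps)
qed

lemma al2: "al2 b = a b * a b * (al b - F1.E b (sgb b) (x b) + x b * x b)"
proof -
  have "a (\<not> b) * A2 b = a (\<not> b) * (a b * a b * (A b + I * (sgb b * (X b (x b) - sgb b * u b * x b - x b * x b))))"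
    using coeffs(3)[of b] unfolding Xta unfolding ta unfolding ae[of b, symmetric]
    by (simp add: algebra_simps)
  then have "A2 b = a b * a b * (A b + I * (sgb b * (X b (x b) - sgb b * u b * x b - x b * x b)))" unfolding ac .
  then have "al2 b = sgb b * I * (a b * a b * (A b + I * (sgb b * (X b (x b) - sgb b * u b * x b - x b * x b))))"
    using F2.al by simp
  also have "\<dots> = a b * a b * (sgb b * I * A b + (sgb b * sgb b) * (I * I) * (X b (x b) - sgb b * u b * x b - x b * x b))"
    by (simp add: algebra_simps)
  finally show ?thesis unfolding II F1.al F1.E_def by (simp add: algebra_simps)
qed

text \<open>The logarithmic derivative of the factor of a letter along that letter. The one along
  the opposite letter follows, since the product of both factors is e^(-\<Upsilon>).\<close>

definition "xi b = X b (a b) * ai b"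

lemma Xa: "X b (a b) = a b * xi b"
  using a(3)[of b] by (simp add: xi_def mult.left_commute[of "a b"])

lemma Xa': "X b (a (\<not> b)) = a (\<not> b) * (- x b - xi b)"
proof -
  have "X b (a b * a (\<not> b)) = - (a b * a (\<not> b)) * x b" unfolding ae by (rule aups)
  then have "a b * (xi b * a (\<not> b) + X b (a (\<not> b))) = a b * (- a (\<not> b) * x b)"
    unfolding deriv_on.X_mult[OF F1.X a(1) a(1)] Xa by (simp add: algebra_simps)
  then show ?thesis unfolding ac by (simp add: algebra_simps eq_diff_eq)
qed

lemma u2: "u2 b = a b * (u b + sgb b * (x b + x b + xi b))"
proof -
  have "a (\<not> b) * u2 b = a (\<not> b) * (a b * (u b + sgb b * (x b + x b + xi b)))"
  proof (cases b)
    case True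
    have "I * (u2 True * a False - e * u True + a True * X True (a False)) = I * (e * x True)"
      using ta[of True] by (simp add: ta_def)
    then have "u2 True * a False - e * u True + a True * X True (a False) = e * x True"
      by (metis II' minus_minus)
    moreover have "p - q + r = s \<Longrightarrow> p = q - r + s" for p q r s :: 'r by auto
    ultimately have "u2 True * a False = e * u True - a True * (a False * (- x True - xi True)) + e * x True"
      unfolding Xa'[of True, unfolded not_True_eq_False] by blast
    then show ?thesis using True by (simp add: algebra_simps)
  next
    case False
    have "I * (u2 False * a True - e * u False - a False * X False (a True)) = I * (- (e * x False))"
      using ta[of False] by (simp add: ta_def)
    then have "u2 False * a True - e * u False - a False * X False (a True) = - (e * x False)"
      by (metis II' minus_minus)
    moreover have "p - q - r = - s \<Longrightarrow> p = q + r - s" for p q r s :: 'r by (simp add: algebra_simps)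
    ultimately have "u2 False * a True = e * u False + a False * (a True * (- x False - xi False)) - e * x False"
      unfolding Xa'[of False, unfolded not_False_eq_True] by blast
    then show ?thesis using False by (simp add: algebra_simps)
  qed
  then show ?thesis unfolding ac .
qed

lemma xi_S: "xi b \<in> S" using a Xcl F1.S_mult by (simp add: xi_def)

lemma w2: "w2 = e * (w + T (a True) * ai True - I * x False * xi True + I * x True * (- x False - xi False)
    - I * (x True * x False - X True (x False)) + I * x True * u False)"
proof -
  note m = deriv_on.X_mult[OF F1.X]
  have tT: "ta True = - (I * (e * x False))" using ta[of False] by simp
  have tF: "ta False = I * (e * x True)" using ta[of True] by simp
  have XtT: "X True (ta True) = I * (e * (x True * x False - X True (x False)))"
  proof -
    have "X True (- (I * (e * x False))) = - X True (I * (e * x False))"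
      by (rule deriv_on.X_uminus[OF F1.X]) (intro F1.S_mult F1.wA ecl Xcl ups)
    also have "X True (I * (e * x False)) = I * (X True e * x False + e * X True (x False))"
      using m[OF F1.wA(1) F1.S_mult[OF ecl Xcl[OF ups]]] m[OF ecl Xcl[OF ups]] F1.I[of True] by simp
    finally show ?thesis unfolding tT aups by (simp add: algebra_simps)
  qed
  have Ta: "T (a True) = a True * (T (a True) * ai True)"
    using a(3)[of True] by (simp add: mult.left_commute[of "a True"])
  have XF: "X False (a True) = a True * (- x False - xi False)" using Xa'[of False] by simp
  have "a True * w2 = e * a True * w + e * T (a True) + ta True * X True (a True) + ta False * X False (a True) - a True * X True (ta True) + a True * ta False * u False"
    using coeffs(2)[of True] by (simp add: mult.commute)
  also have "\<dots> = e * a True * w + e * (a True * (T (a True) * ai True)) + ta True * (a True * xi True) + ta False * (a True * (- x False - xi False)) - a True * X True (ta True) + a True * ta False * u False"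
    unfolding XF Xa Ta[symmetric] ..
  also have "\<dots> = a True * (e * (w + T (a True) * ai True - I * x False * xi True + I * x True * (- x False - xi False)
    - I * (x True * x False - X True (x False)) + I * x True * u False))"
    unfolding XtT unfolding tF tT by (simp add: algebra_simps)
  finally show ?thesis unfolding ac .
qed

text \<open>The bracket relation applied to the frame factor and divided by it. It serves to
  eliminate second derivatives of this factor, which must not appear in the new scalar
  curvature.\<close>

lemma log_commute:
  "X True (- x False - xi False) - X False (xi True) = - I * (T (a True) * ai True) - u False * xi True - u True * (- x False - xi False)"
proof -
  note m = deriv_on.X_mult[OF F1.X]
  let ?\<eta> = "- x False - xi False"
  have \<eta>: "?\<eta> \<in> S" by (intro F1.S_diff F1.S_uminus Xcl ups xi_S)
  have XF: "X False (a True) = a True * ?\<eta>" using Xa'[of False] by simp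
  have Ta: "T (a True) = a True * (T (a True) * ai True)"
    using a(3)[of True] by (simp add: mult.left_commute[of "a True"])
  have "a True * (X True ?\<eta> - X False (xi True)) = X True (X False (a True)) - X False (X True (a True))"
    unfolding XF Xa m[OF a(1) \<eta>] m[OF a(1) xi_S] by (simp add: XF Xa algebra_simps)
  also have "\<dots> = - I * T (a True) - u False * X True (a True) - u True * X False (a True)"
    by (rule F1.XY[OF a(1)])
  also have "\<dots> = - I * (a True * (T (a True) * ai True)) - u False * (a True * xi True) - u True * (a True * ?\<eta>)"
    unfolding XF Xa Ta[symmetric] ..
  also have "\<dots> = a True * (- I * (T (a True) * ai True) - u False * xi True - u True * ?\<eta>)" by (simp add: algebra_simps)
  finally show ?thesis unfolding ac .
qed

sublocale SC: scale_change S X l half third sg u al ups "\<lambda>b. X b ups"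
  by unfold_locales (use ups F1.serre_relation[OF ups] tf in auto)

text \<open>In the curvature formula of the new frame the frame factor occurs through second
  derivatives and through its Reeb derivative in \<open>w2\<close>. By \<open>log_commute\<close>
  these cancel, and only derivatives of \<Upsilon> are left.\<close>

lemma sg2: "sg2 = e * F1.sg1 (\<lambda>b. x b)"
proof -
  note m = deriv_on.X_mult[OF F1.X] and ad = deriv_on.X_add[OF F1.X]
  define \<eta> where "\<eta> = - x False - xi False"
  define \<tau> where "\<tau> = T (a True) * ai True"
  have \<eta>: "\<eta> \<in> S" unfolding \<eta>_def by (intro F1.S_diff F1.S_uminus Xcl ups xi_S)
  have x: "x b \<in> S" for b using Xcl[OF ups] .
  have uT: "u2 True = a True * (u True + (x True + (x True + xi True)))" using u2[of True] by (simp add: add.assoc)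
  have uF: "u2 False = a False * (u False + (- x False + \<eta>))" using u2[of False] by (simp add: \<eta>_def algebra_simps)
  have mx: "- x False \<in> S" using F1.S_uminus[OF x] .
  have 1: "X2 True (u2 False) = a True * (a False * (- x True - xi True) * (u False + (- x False + \<eta>)) + a False * (X True (u False) + (- X True (x False) + X True \<eta>)))"
    unfolding X2 uF by (simp only: m ad a F1.S_add F1.S \<eta> mx deriv_on.X_uminus[OF F1.X x] Xa'[of True, unfolded not_True_eq_False])
  have 2: "X2 False (u2 True) = a False * (a True * \<eta> * (u True + (x True + (x True + xi True))) + a True * (X False (u True) + (X False (x True) + (X False (x True) + X False (xi True)))))"
    unfolding X2 uT by (simp only: m ad a F1.S_add F1.S x xi_S Xa'[of False, unfolded not_False_eq_True] \<eta>_def)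
  have 3: "X True \<eta> = X False (xi True) + (- I * \<tau> - u False * xi True - u True * \<eta>)"
    using log_commute unfolding \<eta>_def[symmetric] \<tau>_def[symmetric] by (simp add: algebra_simps)
  have 4: "I * w2 = e * (I * w + I * \<tau> + x False * xi True - x True * \<eta> + (x True * x False - X True (x False)) - x True * u False)"
    unfolding w2 \<eta>_def[symmetric] \<tau>_def[symmetric] by (simp add: II' algebra_simps)
  have 5: "4 * sg2 = e * (4 * sg - (X True (x False) + X True (x False) + X False (x True) + X False (x True))
      + u False * x True + u False * x True - u True * x False - u True * x False - x True * x False - x True * x False)"
    unfolding F2.curv F1.curv unfolding 1 2 unfolding 3 4 uT uF by (simp add: algebra_simps)
  have h: "4 * (half * g) = g + g" for g
  proof -
    have "4 * (half * g) = (2 * half) * (2 * g)" by (simp add: algebra_simps)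
    also have "\<dots> = 2 * g" by (simp only: F1.half mult_1_left)
    also have "\<dots> = g + g" by (rule mult_2)
    finally show ?thesis .
  qed
  have 6: "4 * F1.sg1 (\<lambda>b. x b) = 4 * sg - (X True (x False) + X True (x False) + X False (x True) + X False (x True))
      + u False * x True + u False * x True - u True * x False - u True * x False - x True * x False - x True * x False"
    unfolding F1.sg1_def F1.mix_def right_diff_distrib mult.assoc h by (simp add: F1.E_def algebra_simps)
  have "4 * sg2 = e * (4 * F1.sg1 (\<lambda>b. x b))" unfolding 5 6 ..
  then have "4 * (sg2 - e * F1.sg1 (\<lambda>b. x b)) = 0" by (simp only: right_diff_distrib mult.left_commute[of 4]) simp
  then show ?thesis using tf[of 3 "sg2 - e * F1.sg1 (\<lambda>b. x b)"] by simp
qed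

lemma prod_S: "prod_list (map a v) \<in> S"
  by (induction v) (use a F1.S_1 F1.S_mult in auto)

lemma X_prod: "X b (prod_list (map a v)) = prod_list (map a v) * (of_nat (count_list v b) * xi b - of_nat (count_list v (\<not> b)) * (x b + xi b))"
proof (induction v)
  case (Cons c v)
  have e: "X b (a c) = a c * (if c = b then xi b else - x b - xi b)"
  proof (cases "c = b")
    case False
    then have "c = (\<not> b)" by auto
    then show ?thesis using Xa'[of b] by simp
  qed (simp add: Xa)
  have "X b (prod_list (map a (c # v))) = X b (a c) * prod_list (map a v) + a c * X b (prod_list (map a v))"
    using deriv_on.X_mult[OF F1.X a(1) prod_S] by simp
  then show ?case unfolding e Cons.IH by (cases "c = b") (auto simp: algebra_simps)
qed (simp add: deriv_on.X_1[OF F1.X])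

text \<open>Three sources contribute: the factors of the letters, the density factor of weight k,
  and the change of the connection form. The logarithmic derivatives \<open>xi\<close> cancel, and
  the multiples of the gradient of \<Upsilon> add up to k - 2 #b + #(not b), which is the weight
  \<open>wt b k v\<close>.\<close>

lemma D_change:
  assumes m: "m \<in> S" and c: "c \<in> S" "X b c = k * x b * c"
  shows "X2 b (prod_list (map a v) * c * m) - chg v * u2 b * (prod_list (map a v) * c * m)
    = a b * (prod_list (map a v) * c * (X b m - chg v * u b * m + wt b k v * x b * m))"
proof -
  have ch: "chg v * sgb b = (of_nat (count_list v b) - of_nat (count_list v (\<not> b)) :: 'r)"
    by (cases b) (simp_all add: chg_def)
  have e1: "X b (prod_list (map a v) * c * m) = (X b (prod_list (map a v)) * c + prod_list (map a v) * (k * x b * c)) * m + prod_list (map a v) * c * X b m"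
    unfolding deriv_on.X_mult[OF F1.X F1.S_mult[OF prod_S c(1)] m] deriv_on.X_mult[OF F1.X prod_S c(1)] c(2) ..
  have e2: "chg v * u2 b = a b * (chg v * u b + (chg v * sgb b) * (x b + x b + xi b))"
    unfolding u2 by (simp add: algebra_simps)
  show ?thesis
    unfolding X2 e1 e2 ch X_prod wt_def by (simp add: algebra_simps)
qed

lemma sc_S: "F1.al1 (\<lambda>b. x b) b \<in> S" "F1.sg1 (\<lambda>b. x b) \<in> S"
  using SC.al1_S SC.sg1_S by simp_all

lemma Rho1_S: "F1.Rho1 (\<lambda>b. x b) b \<in> S"
  unfolding F1.Rho1_def F1.E_def by (intro F1.S_closed F1.S sc_S Xcl ups)

text \<open>Torsion and scalar curvature scale like the words [b, b] and [True, False], so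
  \<open>D_change\<close> applies to them with density weight 0. Their weights 2 and -1 explain the
  two gradient terms in \<open>Rho1\<close>.\<close>

lemma Rho2: "F2.Rho b = a b * e * F1.Rho1 (\<lambda>b. x b) b"
proof -
  let ?al = "F1.al1 (\<lambda>b. x b) b" and ?sg = "F1.sg1 (\<lambda>b. x b)"
  have z: "X b 1 = 0 * x b * 1" for b by (simp add: deriv_on.X_1[OF F1.X])
  have al: "al2 b = prod_list (map a [b, b]) * 1 * ?al" using al2[of b] by (simp add: F1.al1_def mult.assoc)
  have sg: "sg2 = prod_list (map a [True, False]) * 1 * ?sg" using sg2 by simp
  have c2: "chg [b, b] = (2 * sgb b :: 'r)" "chg [True, False] = (0 :: 'r)" by (cases b; simp add: chg_def)+
  have w2: "wt (\<not> b) 0 [b, b] = (2 :: 'r)" "wt b 0 [True, False] = (- 1 :: 'r)" by (cases b; simp add: wt_def)+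
  have 1: "F2.E (\<not> b) (2 * sgb b) (al2 b) = a (\<not> b) * (a b * a b * (F1.E (\<not> b) (2 * sgb b) ?al + 2 * x (\<not> b) * ?al))"
    using D_change[where m = ?al and c = 1 and k = 0 and b = "\<not> b" and v = "[b, b]", OF sc_S(1) F1.S_1 z] unfolding F2.E_def F1.E_def al c2 w2 by (simp add: algebra_simps)
  have 2: "F2.E b 0 sg2 = a b * (e * (F1.E b 0 ?sg - x b * ?sg))"
    using D_change[where m = ?sg and c = 1 and k = 0 and b = b and v = "[True, False]", OF sc_S(2) F1.S_1 z] unfolding F2.E_def F1.E_def sg c2 w2 by (simp add: algebra_simps)
  show ?thesis
    unfolding F2.Rho_def F1.Rho1_def 1 2 unfolding ae[of b, symmetric] by (simp add: algebra_simps)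
qed

text \<open>Rescaling leads from the new scale to \<open>phi1\<close> with a common factor e^k c, as
  every word has k letters of each kind; \<open>scale_invariance\<close> then replaces
  \<open>phi1\<close> by \<open>phi0\<close> for singular combinations.\<close>

theorem invariance:
  assumes W: "singular l W" "\<And>c w. (c, w) \<in> set W \<Longrightarrow> c \<in> S"
    and bal: "\<And>c w. (c, w) \<in> set W \<Longrightarrow> count_list w True = k \<and> count_list w False = k"
    and f: "f \<in> S" and c: "c \<in> S" "\<And>b. X b c = l * x b * c"
  shows "(\<Sum>(d, w)\<leftarrow>W. d * F2.phi0 (c * f) w) = e ^ k * c * (\<Sum>(d, w)\<leftarrow>W. d * F1.phi0 f w)"
proof -
  have D1: "F1.D1 (\<lambda>b. x b) b w m \<in> S" if "m \<in> S" for b w m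
    unfolding F1.D1_def by (intro F1.S_closed F1.S Xcl ups that)
  have p1: "F1.phi1 (\<lambda>b. x b) f w \<in> S" for w
    by (rule F1.S_phi[OF D1 sc_S Rho1_S F1.S(1) f])
  have "F2.phi0 (c * f) w = prod_list (map a w) * c * F1.phi1 (\<lambda>b. x b) f w" for w
  proof (rule phi_scale)
    fix b w
    show "F2.D0 b w (prod_list (map a w) * c * F1.phi1 (\<lambda>b. x b) f w) = a b * (prod_list (map a w) * c * F1.D1 (\<lambda>b. x b) b w (F1.phi1 (\<lambda>b. x b) f w))"
      using D_change[OF p1[of w] c, of b w] by (simp only: F2.D0_def F1.D1_def)
    show "al2 b = a b * a b * F1.al1 (\<lambda>b. x b) b" by (simp only: al2 F1.al1_def)
  qed (rule sg2 Rho2)+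
  then have "(\<Sum>(d, w)\<leftarrow>W. d * F2.phi0 (c * f) w) = (\<Sum>(d, w)\<leftarrow>W. d * (prod_list (map a w) * c * F1.phi1 (\<lambda>b. x b) f w))"
    by simp
  also have "\<dots> = e ^ k * c * (\<Sum>(d, w)\<leftarrow>W. d * F1.phi1 (\<lambda>b. x b) f w)"
  proof -
    have pr: "prod_list (map a w) = a True ^ count_list w True * a False ^ count_list w False" for w
    proof (induction w)
      case (Cons b w) then show ?case by (cases b) (simp_all add: mult_ac)
    qed simp
    show ?thesis using bal
    proof (induction W)
      case (Cons dw W)
      obtain d w where dw: "dw = (d, w)" by force
      have "prod_list (map a w) = e ^ k" using Cons.prems[of d w] by (simp add: dw pr power_mult_distrib)
      moreover have "(\<Sum>(d, w)\<leftarrow>W. d * (prod_list (map a w) * c * F1.phi1 (\<lambda>b. x b) f w)) = e ^ k * c * (\<Sum>(d, w)\<leftarrow>W. d * F1.phi1 (\<lambda>b. x b) f w)"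
      proof (rule Cons.IH)
        fix c' w assume "(c', w) \<in> set W"
        then have "(c', w) \<in> set (dw # W)" by simp
        then show "count_list w True = k \<and> count_list w False = k" by (rule Cons.prems)
      qed
      ultimately show ?case by (simp add: dw distrib_left mult_ac)
    qed simp
  qed
  also have "(\<Sum>(d, w)\<leftarrow>W. d * F1.phi1 (\<lambda>b. x b) f w) = (\<Sum>(d, w)\<leftarrow>W. d * F1.phi0 f w)"
    by (rule SC.scale_invariance[OF W f])
  finally show ?thesis .
qed

end

definition wsum :: "(complex \<times> bool list) list \<Rightarrow> nat \<Rightarrow> 'a frame_data \<Rightarrow> 'a \<Rightarrow> complex" where
  "wsum W k D = (\<Sum>(c, w)\<leftarrow>W. cst c * fphi (of_nat k / 2 - 1) D w)"

lemma cst_apply: "cst c q = c" by (simp add: cst_def)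

context contact begin

lemma ct_exp:
  assumes v: "v \<in> ct p" and g: "smooth_at M p g" shows "v (\<lambda>q. exp (g q)) = exp (g p) * v g"
proof -
  have P: "p \<in> pts" using smooth_at_pts[OF g] .
  obtain U \<phi> where c: "(U, \<phi>) \<in> atlas M" "p \<in> U" using chart_exists[OF P] by blast
  have s: "smooth_at M p (\<lambda>q. exp (g q))" using g sm_exp by (auto simp: smooth_at_def)
  have "dcoord U \<phi> i p (\<lambda>q. exp (g q)) = exp (g p) * dcoord U \<phi> i p g" for i
  proof -
    let ?g = "g \<circ> inv_into U \<phi>"
    have inv: "inv_into U \<phi> (\<phi> p) = p" by (rule chart_inv[OF c])
    have "((\<lambda>x. exp (?g x)) has_derivative (\<lambda>v. exp (?g (\<phi> p)) * frechet_derivative ?g (at (\<phi> p)) v)) (at (\<phi> p))"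
      using has_derivative_compose[OF smooth_at_deriv[OF c g] DERIV_exp[unfolded has_field_derivative_def]] by simp
    from fun_cong[OF frechet_derivative_at[OF this], of "axis i 1"] show ?thesis
      using s g inv by (simp add: dcoord_def o_def)
  qed
  then show ?thesis
    unfolding coord_rep[OF c v, of "\<lambda>q. exp (g q)"] coord_rep[OF c v, of g] by (simp add: sum_distrib_left mult.left_commute)
qed

end

text \<open>Scale and frame change together, so that \<Upsilon> = 0 yields independence of the
  frame. The set N lies in one chart because the coordinate functions, smooth on N, serve to test
  independence of the frame fields.\<close>

locale scale_pair = A: contact M \<theta> + B: contact M \<theta>' for M :: "'a crdata" and \<theta> \<theta>' +
  fixes \<Upsilon> :: "'a \<Rightarrow> real" and N Z Z' U \<phi>
  assumes Ups: "smooth_fun M (topspace (mtop M)) (\<lambda>p. complex_of_real (\<Upsilon> p))"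
    and th': "p \<in> topspace (mtop M) \<Longrightarrow> v \<in> ctangent M p \<Longrightarrow> \<theta>' p v = complex_of_real (exp (\<Upsilon> p)) * \<theta> p v"
    and F: "frame_vector M N Z" and F': "frame_vector M N Z'" and chart: "(U, \<phi>) \<in> atlas M" "N \<subseteq> U"
begin

definition "ups p = complex_of_real (\<Upsilon> p)"
definition "ga p = (if p \<in> N then A.gg Z Z' p else 1)"
text \<open>The Levi form component changes to e^\<Upsilon> |g|^2 h, so Z^1 acquires the factor
  e^(-\<Upsilon>)/g. The value 1 off N makes the factors invertible in the ring of total
  functions.\<close>

definition "aa b p = (if p \<in> N then if b then ga p else exp (- ups p) / ga p else 1)"

lemma N: "A.opn N" "N \<subseteq> A.pts" using A.frame_opn[OF F] openin_subset by blast+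

lemma ups_sm: "A.sm N ups" using A.sm_subset[OF Ups N(2)] by (simp add: ups_def[abs_def])

lemma ga: assumes p: "p \<in> N" shows "Z' p = tscale (ga p) (Z p)" "vconj Z' p = tscale (cnj (ga p)) (vconj Z p)" "ga p \<noteq> 0"
  using A.gg_eq[OF F F' p p] p by (simp_all add: ga_def)

lemma ga0: "ga p \<noteq> 0" using ga(3)[of p] by (cases "p \<in> N") (auto simp: ga_def)

lemma sm1: "A.sm N f \<Longrightarrow> A.sm N (\<lambda>p. if p \<in> N then f p else c)"
  by (rule A.sm_cong[OF N(1), of f]) simp

lemma ga_sm: "A.sm N ga"
  unfolding ga_def[abs_def] using A.gg_smooth[OF F F'] by (intro sm1) simp

lemma aa_sm: "A.sm N (aa b)" "A.sm N (\<lambda>p. 1 / aa b p)"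
proof -
  have e: "A.sm N (\<lambda>p. exp (- ups p))" "A.sm N (\<lambda>p. exp (ups p))"
    by (intro A.sm_exp A.sm_uminus ups_sm N(1))+
  show "A.sm N (aa b)" unfolding aa_def[abs_def]
    by (intro sm1) (cases b; simp add: ga_sm A.sm_divide e ga0 N(1))
  have "1 / aa b p = (if p \<in> N then if b then 1 / ga p else exp (ups p) * ga p else 1)" for p
    by (simp add: aa_def exp_minus field_simps)
  then show "A.sm N (\<lambda>p. 1 / aa b p)" 
    by (simp only:, intro sm1) (cases b; simp add: ga_sm A.sm_divide A.sm_const A.sm_mult e ga0 N(1))
qed

lemma h': assumes p: "p \<in> N" shows "B.hh Z' p = exp (ups p) * (ga p * cnj (ga p) * A.hh Z p)"
proof -
  have P: "p \<in> A.pts" using p N by blast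
  have "- \<i> * B.hh Z' p = \<theta>' p (lie_bracket M Z' (vconj Z') p)" using B.th_bracket[OF F' p] by simp
  also have "\<dots> = exp (ups p) * \<theta> p (lie_bracket M Z' (vconj Z') p)"
    using th'[OF P A.bracket_ct(3)[OF F' p]] by (simp add: ups_def exp_of_real)
  also have "\<theta> p (lie_bracket M Z' (vconj Z') p) = - \<i> * A.hh Z' p" by (rule A.th_bracket[OF F' p])
  also have "A.hh Z' p = ga p * cnj (ga p) * A.hh Z p" using A.h_change[OF F F' p p] p by (simp add: ga_def)
  finally have "- \<i> * B.hh Z' p = - \<i> * (exp (ups p) * (ga p * cnj (ga p) * A.hh Z p))" by (simp only: mult.left_commute)
  then show ?thesis by simp
qed

lemma XX': "B.XX N Z' b g = aa b * A.XX N Z b g"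
proof
  fix p
  show "B.XX N Z' b g p = (aa b * A.XX N Z b g) p"
  proof (cases "p \<in> N")
    case p: True
    then show ?thesis
      using ga[OF p] h'[OF p] A.h_nonzero[OF F p]
      by (simp add: B.XX_def A.XX_def aa_def tscale_def exp_minus field_simps)
  qed (simp add: B.XX_def A.XX_def)
qed

definition "J = {f :: 'a \<Rightarrow> complex. \<forall>p. p \<notin> N \<longrightarrow> f p = 0}"

lemma independent:
  assumes z: "\<And>g. A.sm N g \<Longrightarrow> \<alpha> * A.TT N g + \<beta> * A.XX N Z True g + \<gamma> * A.XX N Z False g = 0" and p: "p \<in> N"
  shows "\<alpha> p = 0" "\<beta> p = 0" "\<gamma> p = 0"
proof -
  let ?v = "comb (\<alpha> p) (A.reeb p) (\<beta> p) (Z p) (\<gamma> p / A.hh Z p) (vconj Z p)"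
  have v: "?v \<in> A.ct p" using A.ct_comb A.frame_ct[OF F p] by blast
  have "?v (A.xcoord \<phi> i) = 0" for i
  proof -
    have "A.sm N (A.xcoord \<phi> i)" using A.sm_subset[OF A.smooth_xcoord[OF chart(1)] chart(2)] .
    from fun_cong[OF z[OF this], of p] show ?thesis using p by (simp add: comb_apply A.TT_def A.XX_def)
  qed
  then have "?v = comb 0 (A.reeb p) 0 (Z p) 0 (vconj Z p)"
    using A.coord_rep[OF chart(1) _ v] p chart(2) by (simp add: fun_eq_iff comb_apply subset_iff)
  from A.frame_unique[OF F p this] show "\<alpha> p = 0" "\<beta> p = 0" "\<gamma> p = 0"
    using A.h_nonzero[OF F p] by simp_all
qed

lemma frame_change_dat:
  "frame_change {g. A.sm N g} (A.XX N Z) (cst l) (cst (1/2)) (cst (1/3)) (fsg (A.dat N Z f)) (A.uu N Z) (fal (A.dat N Z f))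
    (A.TT N) (cst \<i>) (A.ww N Z) (A.AA N Z)
    (B.XX N Z') (fsg (B.dat N Z' f')) (B.uu N Z') (fal (B.dat N Z' f')) (B.TT N) (B.ww N Z') (B.AA N Z')
    aa (\<lambda>b p. 1 / aa b p) ups J"
proof (intro frame_change.intro A.frame_calc_dat[OF F] B.frame_calc_dat[OF F'] frame_change_axioms.intro)
  show "aa b \<in> {g. A.sm N g}" "(\<lambda>p. 1 / aa b p) \<in> {g. A.sm N g}" "ups \<in> {g. A.sm N g}" for b
    using aa_sm ups_sm by simp_all
  have "aa b p \<noteq> 0" for b p using ga0 by (simp add: aa_def)
  then show "aa b * (\<lambda>p. 1 / aa b p) = 1" for b by (simp add: fun_eq_iff)
  show "B.XX N Z' b g = aa b * A.XX N Z b g" for b g by (rule XX')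
  have e: "aa True * aa False = (\<lambda>p. if p \<in> N then exp (- ups p) else 1)"
    using ga0 by (simp add: fun_eq_iff aa_def)
  show "A.XX N Z b (aa True * aa False) = - (aa True * aa False) * A.XX N Z b ups" for b
  proof
    fix p
    show "A.XX N Z b (aa True * aa False) p = (- (aa True * aa False) * A.XX N Z b ups) p"
    proof (cases "p \<in> N")
      case p: True
      have "v (aa True * aa False) = - exp (- ups p) * v ups" if v: "v \<in> A.ct p" for v
      proof -
        have s: "smooth_at M p ups" "smooth_at M p (\<lambda>q. - ups q)"
          using A.smooth_atI[OF N(1) p ups_sm] A.smooth_atI[OF N(1) p A.sm_uminus[OF N(1) ups_sm]] by auto
        have 1: "v (aa True * aa False) = v (\<lambda>q. exp (- ups q))" by (rule A.ct_cong[OF v N(1) p]) (simp add: e)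
        have 2: "v (\<lambda>q. - ups q) = - v ups" using A.ct_scale[OF v s(1), of "- 1"] by simp
        show ?thesis unfolding 1 A.ct_exp[OF v s(2)] 2 by simp
      qed
      from this[OF A.frame_ct(2)[OF F p]] this[OF A.frame_ct(3)[OF F p]] show ?thesis using p by (simp add: A.XX_def e)
    qed (simp add: A.XX_def)
  qed
  show "cst \<i> * cst \<i> = - 1" by (simp add: cst_def fun_eq_iff)
  show "g = 0" if "of_nat (Suc n) * (g :: 'a \<Rightarrow> complex) = 0" for n g
  proof
    fix p
    have "(cst (of_nat (Suc n)) * g) p = 0" unfolding cst_simps that by simp
    then have "of_nat (Suc n) * g p = 0" by (simp only: times_fun_apply cst_apply)
    then show "g p = 0 p" using of_nat_neq_0[of n, where 'a = complex] by (simp del: of_nat_Suc)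
  qed
  show "f + g \<in> J" if "f \<in> J" "g \<in> J" for f g using that by (simp_all add: J_def)
  show "r * f \<in> J" if "f \<in> J" for f r using that by (simp add: J_def)
  show "A.XX N Z b g \<in> J" "A.TT N g \<in> J" "A.uu N Z b \<in> J" "A.ww N Z \<in> J" "A.AA N Z b \<in> J" "B.uu N Z' b \<in> J" "B.ww N Z' \<in> J" "B.AA N Z' b \<in> J" for b g
    by (simp_all add: J_def A.XX_def A.TT_def A.uu_def A.ww_def A.AA_def B.uu_def B.ww_def B.AA_def)
  show "\<alpha> = 0 \<and> \<beta> = 0 \<and> \<gamma> = 0" if "\<alpha> \<in> J" "\<beta> \<in> J" "\<gamma> \<in> J"
    "\<And>g. g \<in> {g. A.sm N g} \<Longrightarrow> \<alpha> * A.TT N g + \<beta> * A.XX N Z True g + \<gamma> * A.XX N Z False g = 0" for \<alpha> \<beta> \<gamma>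
  proof -
    have "\<alpha> p = 0 \<and> \<beta> p = 0 \<and> \<gamma> p = 0" for p
    proof (cases "p \<in> N")
      case True
      then show ?thesis using independent[of \<alpha> \<beta> \<gamma> p] that(4) by simp
    next
      case False
      then show ?thesis using that(1-3) by (simp add: J_def)
    qed
    then show ?thesis by (simp add: fun_eq_iff)
  qed
qed

lemma of_int_chg: "(of_int (ichg w) :: 'a \<Rightarrow> complex) = chg w" by (rule of_int_ichg)

lemma fphi_alt:
  assumes fc: "frame_calc {g. A.sm N g} (fX D) (cst l) (cst (1/2)) (cst (1/3)) (fsg D) (fu D) (fal D) T I w AA"
  shows "fphi l D = phi (cst l) (scale_calc.D0 (fX D) (fu D)) (fal D) (fsg D) (scale_calc.Rho (fX D) (cst (1/3)) (fsg D) (fu D) (fal D)) (ff D)"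
proof -
  interpret frame_calc "{g. A.sm N g}" "fX D" "cst l" "cst (1/2)" "cst (1/3)" "fsg D" "fu D" "fal D" T I w AA by (rule fc)
  have "fD D = D0" by (simp add: fun_eq_iff fD_def fE_def D0_def of_int_chg)
  moreover have "fRho D = Rho"
  proof
    fix b show "fRho D b = Rho b" by (cases b) (simp_all add: fRho_def Rho_def fE_def E_def)
  qed
  ultimately show ?thesis by simp
qed

text \<open>The k letters of each kind give e^(-k \<Upsilon>) and the density gives e^((k/2 -
  1)\<Upsilon>); the exponents add up to -k/2 - 1.\<close>

theorem word_sum_invariance:
  assumes W: "singular_vector k W" and f: "A.sm N f" and p: "p \<in> N"
  shows "wsum W k (B.dat N Z' (\<lambda>q. exp ((of_nat k / 2 - 1) * ups q) * f q)) p = exp ((- of_nat k / 2 - 1) * ups p) * wsum W k (A.dat N Z f) p"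
proof -
  let ?l = "of_nat k / 2 - 1 :: complex"
  let ?c = "\<lambda>p. exp (?l * ups p)"
  let ?W = "map (\<lambda>(c, w). (cst c, w)) W :: (('a \<Rightarrow> complex) \<times> bool list) list"
  interpret C: frame_change "{g. A.sm N g}" "A.XX N Z" "cst ?l" "cst (1/2)" "cst (1/3)" "fsg (A.dat N Z f)" "A.uu N Z" "fal (A.dat N Z f)"
    "A.TT N" "cst \<i>" "A.ww N Z" "A.AA N Z"
    "B.XX N Z'" "fsg (B.dat N Z' (?c * f))" "B.uu N Z'" "fal (B.dat N Z' (?c * f))" "B.TT N" "B.ww N Z'" "B.AA N Z'"
    aa "\<lambda>b p. 1 / aa b p" ups J
    by (rule frame_change_dat)
  have sing: "singular (cst ?l) ?W"
    unfolding singular_def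
  proof (intro allI)
    fix d and \<psi> :: "bool list \<Rightarrow> 'a \<Rightarrow> complex"
    have r: "rem d (cst ?l) \<psi> w q = rem d ?l (\<lambda>v. \<psi> v q) w" for w q
    proof (rule rem_hom[where h = "\<lambda>f. f q"])
      show "(wt c (cst ?l) w * x) q = wt c ?l w * x q" for c w and x :: "'a \<Rightarrow> complex"
        unfolding cst_wt[symmetric] by (simp add: cst_def)
    qed simp_all
    have "(\<Sum>(c, w)\<leftarrow>?W. c * rem d (cst ?l) \<psi> w) q = (\<Sum>(c, w)\<leftarrow>W. c * rem d ?l (\<lambda>v. \<psi> v q) w)" for q
      by (simp add: sum_list_apply o_def case_prod_unfold r cst_apply)
    then show "(\<Sum>(c, w)\<leftarrow>?W. c * rem d (cst ?l) \<psi> w) = 0"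
      using W by (simp add: singular_vector_def fun_eq_iff)
  qed
  have WS: "c \<in> {g. A.sm N g}" and bal: "count_list w True = k \<and> count_list w False = k" if "(c, w) \<in> set ?W" for c w
    using that W A.sm_const by (auto simp: singular_vector_def cst_def)
  have csm: "A.sm N ?c" by (intro A.sm_exp A.sm_mult A.sm_const ups_sm N(1))
  have cX: "A.XX N Z b ?c = cst ?l * A.XX N Z b ups * ?c" for b
  proof
    fix q
    show "A.XX N Z b ?c q = (cst ?l * A.XX N Z b ups * ?c) q"
    proof (cases "q \<in> N")
      case q: True
      have "v ?c = ?c q * (?l * v ups)" if v: "v \<in> A.ct q" for v
        using A.ct_exp[OF v A.smooth_atI[OF N(1) q A.sm_mult[OF N(1) A.sm_const ups_sm]], of ?l]
          A.ct_scale[OF v A.smooth_atI[OF N(1) q ups_sm], of ?l] by simp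
      from this[OF A.frame_ct(2)[OF F q]] this[OF A.frame_ct(3)[OF F q]] show ?thesis using q by (simp add: A.XX_def cst_def)
    qed (simp add: A.XX_def)
  qed
  note pA = fphi_alt[of "A.dat N Z f" ?l, simplified, OF A.frame_calc_dat[OF F]]
  note pB = fphi_alt[of "B.dat N Z' (?c * f)" ?l, simplified, OF B.frame_calc_dat[OF F']]
  have wA: "wsum W k (A.dat N Z f) = (\<Sum>(d, w)\<leftarrow>?W. d * C.F1.phi0 f w)"
    unfolding wsum_def by (simp add: pA o_def case_prod_unfold)
  have wB: "wsum W k (B.dat N Z' (?c * f)) = (\<Sum>(d, w)\<leftarrow>?W. d * C.F2.phi0 (?c * f) w)"
    unfolding wsum_def by (simp add: pB o_def case_prod_unfold)
  have "wsum W k (B.dat N Z' (?c * f)) = (aa True * aa False) ^ k * ?c * wsum W k (A.dat N Z f)"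
    unfolding wA wB by (rule C.invariance[OF sing WS bal]) (use f csm cX in simp_all)
  moreover have "?c * f = (\<lambda>q. ?c q * f q)" by (simp add: fun_eq_iff)
  moreover have "((aa True * aa False) ^ k * ?c) p = exp ((- of_nat k / 2 - 1) * ups p)"
  proof -
    have pw: "(g ^ k) p = g p ^ k" for g :: "'a \<Rightarrow> complex" by (induction k) simp_all
    have "(aa True * aa False) p = exp (- ups p)" using p ga0 by (simp add: aa_def)
    then have "((aa True * aa False) ^ k * ?c) p = exp (of_nat k * (- ups p)) * exp (?l * ups p)"
      by (simp add: pw exp_of_nat_mult[symmetric] del: mult_minus_right)
    also have "\<dots> = exp (of_nat k * (- ups p) + ?l * ups p)" by (simp only: exp_add)
    also have "of_nat k * (- ups p) + ?l * ups p = (- of_nat k / 2 - 1) * ups p" by (simp add: field_simps)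
    finally show ?thesis .
  qed
  ultimately show ?thesis by simp
qed

end

section \<open>Differential operators in a chart\<close>

context contact begin

fun PD :: "'a set \<Rightarrow> ('a \<Rightarrow> real^3) \<Rightarrow> 3 list \<Rightarrow> ('a \<Rightarrow> complex) \<Rightarrow> 'a \<Rightarrow> complex" where
  "PD U \<phi> [] f = f"
| "PD U \<phi> (i # is) f = (\<lambda>q. dcoord U \<phi> i q (PD U \<phi> is f))"

text \<open>Order less than n in the ordinary sense, on an open subset N of the chart. Coefficients
  indexed by lists are convenient for composition though not unique; the latter is repaired in
  \<open>patch\<close>.\<close>

definition ordl :: "'a set \<Rightarrow> ('a \<Rightarrow> real^3) \<Rightarrow> 'a set \<Rightarrow> nat \<Rightarrow> (('a \<Rightarrow> complex) \<Rightarrow> 'a \<Rightarrow> complex) \<Rightarrow> bool" where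
  "ordl U \<phi> N n D \<longleftrightarrow> (\<exists>b. (\<forall>is. sm N (b is)) \<and>
     (\<forall>f. sm N f \<longrightarrow> (\<forall>q\<in>N. D f q = (\<Sum>is | length is < n. b is q * PD U \<phi> is f q))))"

lemma finite_lists: "finite {is :: 3 list. length is < n}"
  by (rule finite_subset[OF _ finite_lists_length_le[of "UNIV :: 3 set" n]]) auto

context
  fixes U \<phi> N assumes c: "(U, \<phi>) \<in> atlas M" and N: "opn N" "N \<subseteq> U"
begin

abbreviation "Od \<equiv> ordl U \<phi> N"

lemma PD_smooth: "sm N f \<Longrightarrow> sm N (PD U \<phi> is f)"
proof (induction "is")
  case (Cons i "is")
  show ?case using smooth_vfieldD(2)[OF smooth_dcoord[OF c] N Cons.IH[OF Cons.prems]] by simp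
qed simp

lemma OI: "(\<And>is. sm N (b is)) \<Longrightarrow> (\<And>f q. sm N f \<Longrightarrow> q \<in> N \<Longrightarrow> D f q = (\<Sum>is | length is < n. b is q * PD U \<phi> is f q)) \<Longrightarrow> Od n D"
  unfolding ordl_def by blast

lemma OE: assumes "Od n D" obtains b where "\<And>is. sm N (b is)" "\<And>f q. sm N f \<Longrightarrow> q \<in> N \<Longrightarrow> D f q = (\<Sum>is | length is < n. b is q * PD U \<phi> is f q)"
  using assms unfolding ordl_def by blast

lemma O_cong: assumes "Od n D" "\<And>f q. sm N f \<Longrightarrow> q \<in> N \<Longrightarrow> D f q = D' f q" shows "Od n D'"
  using assms unfolding ordl_def by metis

lemma O_id: "Od 1 (\<lambda>f. f)"
proof (rule OI[of "\<lambda>_ _. 1"])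
  have "{is :: 3 list. length is < 1} = {[]}" by auto
  then show "f q = (\<Sum>is | length is < 1. 1 * PD U \<phi> is f q)" for f q by simp
qed (rule sm_const)

lemma O_0: "Od n (\<lambda>f q. 0)"
  by (rule OI[of "\<lambda>_ _. 0"]) (simp_all add: sm_const)

lemma O_add: assumes "Od n D" "Od n D'" shows "Od n (\<lambda>f q. D f q + D' f q)"
proof -
  obtain b b' where b: "\<And>is. sm N (b is)" "\<And>f q. sm N f \<Longrightarrow> q \<in> N \<Longrightarrow> D f q = (\<Sum>is | length is < n. b is q * PD U \<phi> is f q)"
    "\<And>is. sm N (b' is)" "\<And>f q. sm N f \<Longrightarrow> q \<in> N \<Longrightarrow> D' f q = (\<Sum>is | length is < n. b' is q * PD U \<phi> is f q)"
    using assms by (elim OE) blast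
  show ?thesis
    by (rule OI[of "\<lambda>is q. b is q + b' is q"]) (simp_all add: b sm_add[OF N(1)] sum.distrib distrib_right)
qed

lemma O_mult: assumes "Od n D" "sm N g" shows "Od n (\<lambda>f q. g q * D f q)"
proof -
  obtain b where b: "\<And>is. sm N (b is)" "\<And>f q. sm N f \<Longrightarrow> q \<in> N \<Longrightarrow> D f q = (\<Sum>is | length is < n. b is q * PD U \<phi> is f q)"
    using assms by (elim OE) blast
  show ?thesis
    by (rule OI[of "\<lambda>is q. g q * b is q"]) (simp_all add: b assms(2) sm_mult[OF N(1)] sum_distrib_left mult.assoc)
qed

lemma O_uminus: "Od n D \<Longrightarrow> Od n (\<lambda>f q. - D f q)"
  using O_mult[of n D "\<lambda>_. - 1"] by (simp add: sm_const)

lemma O_diff: "Od n D \<Longrightarrow> Od n D' \<Longrightarrow> Od n (\<lambda>f q. D f q - D' f q)"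
  using O_add[OF _ O_uminus, of n D D'] by simp

lemma O_mono: assumes "Od n D" "n \<le> m" shows "Od m D"
proof -
  obtain b where b: "\<And>is. sm N (b is)" "\<And>f q. sm N f \<Longrightarrow> q \<in> N \<Longrightarrow> D f q = (\<Sum>is | length is < n. b is q * PD U \<phi> is f q)"
    using assms by (elim OE) blast
  show ?thesis
  proof (rule OI[of "\<lambda>is. if length is < n then b is else (\<lambda>_. 0)"])
    show "sm N (if length is < n then b is else (\<lambda>_. 0))" for "is" by (simp add: b sm_const)
    fix f q assume f: "sm N f" "q \<in> N"
    show "D f q = (\<Sum>is | length is < m. (if length is < n then b is else (\<lambda>_. 0)) q * PD U \<phi> is f q)"
      unfolding b(2)[OF f] by (rule sum.mono_neutral_cong_left) (use assms(2) finite_lists in auto)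
  qed
qed

lemma O_comp:
  assumes "Od n D" and V: "smooth_vfield M N V" shows "Od (Suc n) (\<lambda>f q. V q (D f))"
proof -
  obtain b where b: "\<And>is. sm N (b is)" "\<And>f q. sm N f \<Longrightarrow> q \<in> N \<Longrightarrow> D f q = (\<Sum>is | length is < n. b is q * PD U \<phi> is f q)"
    using assms by (elim OE) blast
  \<comment> \<open>Either the field differentiates the coefficient, or, expanded in coordinates, it
    prepends an index to the list of derivatives.\<close>
  let ?a = "\<lambda>is q. (if length is < n then V q (b is) else 0) + (case is of [] \<Rightarrow> 0 | i # js \<Rightarrow> V q (xcoord \<phi> i) * b js q)"
  have x: "sm N (xcoord \<phi> i)" for i by (rule sm_subset[OF smooth_xcoord[OF c] N(2)])
  have Vs: "sm N (\<lambda>q. V q f)" if "sm N f" for f by (rule smooth_vfieldD(2)[OF V N(1) order_refl that])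
  show ?thesis
  proof (rule OI[of ?a])
    show "sm N (?a is)" for "is"
      by (cases "length is < n"; cases "is") (simp_all add: sm_add sm_mult sm_const Vs b(1) x N(1))
    fix f q assume f: "sm N f" "q \<in> N"
    have v: "V q \<in> ct q" by (rule smooth_vfieldD(1)[OF V f(2)])
    have P: "q \<in> pts" using opn_sub N(1) f(2) by blast
    have qU: "q \<in> U" using f(2) N(2) by blast
    have s: "smooth_at M q (b is)" "smooth_at M q (PD U \<phi> is f)" for "is"
      by (rule smooth_atI[OF N(1) f(2)], rule b)(rule smooth_atI[OF N(1) f(2) PD_smooth[OF f(1)]])
    have "V q (D f) = V q (\<lambda>r. \<Sum>is | length is < n. b is r * PD U \<phi> is f r)"
      by (rule ct_cong[OF v N(1) f(2)]) (rule b(2)[OF f(1)])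
    also have "\<dots> = (\<Sum>is | length is < n. V q (\<lambda>r. b is r * PD U \<phi> is f r))"
      by (rule ct_sum[OF v P smooth_at_mult[OF s]])
    also have "\<dots> = (\<Sum>is | length is < n. V q (b is) * PD U \<phi> is f q + (\<Sum>i\<in>UNIV. V q (xcoord \<phi> i) * b is q * PD U \<phi> (i # is) f q))"
    proof (rule sum.cong[OF refl])
      fix "is" :: "3 list"
      have "V q (PD U \<phi> is f) = (\<Sum>i\<in>UNIV. V q (xcoord \<phi> i) * dcoord U \<phi> i q (PD U \<phi> is f))" by (rule coord_rep[OF c qU v])
      then show "V q (\<lambda>r. b is r * PD U \<phi> is f r) = V q (b is) * PD U \<phi> is f q + (\<Sum>i\<in>UNIV. V q (xcoord \<phi> i) * b is q * PD U \<phi> (i # is) f q)"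
        unfolding ct_mult[OF v s] by (simp add: sum_distrib_left mult_ac)
    qed
    also have "\<dots> = (\<Sum>is | length is < Suc n. ?a is q * PD U \<phi> is f q)"
    proof -
      have 1: "(\<Sum>is | length is < n. V q (b is) * PD U \<phi> is f q) = (\<Sum>is | length is < Suc n. (if length is < n then V q (b is) else 0) * PD U \<phi> is f q)"
        by (rule sum.mono_neutral_cong_left) (auto simp: finite_lists)
      have "(\<Sum>is | length is < n. \<Sum>i\<in>UNIV. V q (xcoord \<phi> i) * b is q * PD U \<phi> (i # is) f q)
        = (\<Sum>(i, is)\<in>UNIV \<times> {is. length is < n}. V q (xcoord \<phi> i) * b is q * PD U \<phi> (i # is) f q)"
        by (subst sum.swap) (simp add: sum.cartesian_product)
      also have "\<dots> = (\<Sum>is \<in> (\<lambda>(i, is). i # is) ` (UNIV \<times> {is. length is < n}). (case is of [] \<Rightarrow> 0 | i # js \<Rightarrow> V q (xcoord \<phi> i) * b js q) * PD U \<phi> is f q)"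
        by (subst sum.reindex) (auto simp: inj_on_def intro!: sum.cong)
      also have "\<dots> = (\<Sum>is | length is < Suc n. (case is of [] \<Rightarrow> 0 | i # js \<Rightarrow> V q (xcoord \<phi> i) * b js q) * PD U \<phi> is f q)"
      proof (rule sum.mono_neutral_left[OF finite_lists])
        show "\<forall>is\<in>{is. length is < Suc n} - (\<lambda>(i, is). i # is) ` (UNIV \<times> {is. length is < n}). (case is of [] \<Rightarrow> 0 | i # js \<Rightarrow> V q (xcoord \<phi> i) * b js q) * PD U \<phi> is f q = 0"
        proof
          fix js :: "3 list" assume j: "js \<in> {is. length is < Suc n} - (\<lambda>(i, is). i # is) ` (UNIV \<times> {is. length is < n})"
          then have "js = []"
          proof (cases js)
            case (Cons i ks)
            then have "js = (\<lambda>(i, is). i # is) (i, ks)" "(i, ks) \<in> UNIV \<times> {is. length is < n}" using j by auto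
            then show ?thesis using j by blast
          qed
          then show "(case js of [] \<Rightarrow> 0 | i # js \<Rightarrow> V q (xcoord \<phi> i) * b js q) * PD U \<phi> js f q = 0" by simp
        qed
      qed auto
      finally show ?thesis by (simp add: sum.distrib 1 distrib_right)
    qed
    finally show "V q (D f) = (\<Sum>is | length is < Suc n. ?a is q * PD U \<phi> is f q)" .
  qed
qed

end

end

section \<open>Principal parts of words and of powers of the sublaplacian\<close>

lemma wt_cst_apply: "wt d (cst l) w q = wt d l w"
  unfolding cst_wt[symmetric] by (simp add: cst_def)

lemma sgb_apply: "sgb b q = (sgb b :: complex)"
  by (simp add: sgb_def)

context contact begin

fun XW :: "'a set \<Rightarrow> 'a vfield \<Rightarrow> bool list \<Rightarrow> ('a \<Rightarrow> complex) \<Rightarrow> 'a \<Rightarrow> complex" where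
  "XW N Z [] f = f"
| "XW N Z (b # w) f = XX N Z b (XW N Z w f)"

definition EL :: "'a set \<Rightarrow> 'a vfield \<Rightarrow> ('a \<Rightarrow> complex) \<Rightarrow> 'a \<Rightarrow> complex" where
  "EL N Z g = - (Ew (dat N Z g) 0 [True, False] g + Ew (dat N Z g) 0 [False, True] g)"

context
  fixes U \<phi> N Z assumes c: "(U, \<phi>) \<in> atlas M" and NU: "N \<subseteq> U" and F: "Fr N Z"
begin

abbreviation "Oo \<equiv> ordl U \<phi> N"

lemma No: "opn N" using frame_opn[OF F] .

lemmas Oadd = O_add[OF c No NU] and Ocong = O_cong[OF c No NU] and Omult = O_mult[OF c No NU] and Omono = O_mono[OF c No NU]
  and Odiff = O_diff[OF c No NU] and Ouminus = O_uminus[OF c No NU]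

lemma O_trans: assumes "Oo n (\<lambda>f q. D f q - D' f q)" "Oo n (\<lambda>f q. D' f q - D'' f q)" shows "Oo n (\<lambda>f q. D f q - D'' f q)"
  using Oadd[OF assms] by simp

lemma O_XX: assumes "Oo n D" shows "Oo (Suc n) (\<lambda>f. XX N Z b (D f))"
proof (cases b)
  case True
  show ?thesis
    by (rule Ocong[OF O_comp[OF c No NU assms frame_smooth(1)[OF F]]]) (simp add: True XX_def)
next
  case False
  have h: "sm N (\<lambda>q. 1 / hh Z q)"
    by (intro sm_divide sm_const hsm[OF F] No) (rule h_nonzero[OF F])
  show ?thesis
    by (rule Ocong[OF Omult[OF O_comp[OF c No NU assms frame_smooth(2)[OF F]] h]]) (simp add: False XX_def)
qed

lemma O_TT: assumes "Oo n D" shows "Oo (Suc n) (\<lambda>f. TT N (D f))"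
  by (rule Ocong[OF O_comp[OF c No NU assms reeb_U[OF F]]]) (simp add: TT_def)

lemma XX_sm: "sm N g \<Longrightarrow> sm N (XX N Z b g)" by (rule XX_smooth[OF F])

lemma XW_sm: "sm N f \<Longrightarrow> sm N (XW N Z w f)"
  by (induction w) (simp_all add: XX_sm)

lemma O_XW: "Oo (Suc (length w)) (XW N Z w)"
proof (induction w)
  case Nil
  have "XW N Z [] = (\<lambda>f. f)" by (simp add: fun_eq_iff)
  then show ?case using O_id[OF c No NU] by simp
next
  case (Cons b w)
  have "XW N Z (b # w) = (\<lambda>f. XX N Z b (XW N Z w f))" by (simp add: fun_eq_iff)
  then show ?case using O_XX[OF Cons.IH, of b] by simp
qed

lemma XX_diff: "sm N f \<Longrightarrow> sm N g \<Longrightarrow> XX N Z b (\<lambda>q. f q - g q) q = XX N Z b f q - XX N Z b g q"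
  using deriv_on.X_diff[OF deriv_XX[OF F], of f g b] by (simp add: fun_diff_def fun_eq_iff)

lemma O_XXdiff:
  assumes "Oo n (\<lambda>f q. D f q - D' f q)" "\<And>f. sm N f \<Longrightarrow> sm N (D f)" "\<And>f. sm N f \<Longrightarrow> sm N (D' f)"
  shows "Oo (Suc n) (\<lambda>f q. XX N Z b (D f) q - XX N Z b (D' f) q)"
  by (rule Ocong[OF O_XX[OF assms(1), of b]]) (simp add: XX_diff assms(2,3))

text \<open>The commutator of the two fields is a single first order operator: in the usual sense
  the Reeb field has order one. So an exchange of neighbouring letters costs one order, and all
  words with the same letters agree to top order.\<close>

lemma O_swap: "Oo (Suc (Suc (length w))) (\<lambda>f q. XW N Z (b # (\<not> b) # w) f q - XW N Z ((\<not> b) # b # w) f q)"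
proof -
  let ?R = "\<lambda>f q. - \<i> * TT N (XW N Z w f) q - (uu N Z False q * XX N Z True (XW N Z w f) q + uu N Z True q * XX N Z False (XW N Z w f) q)"
  have 1: "Oo (Suc (Suc (length w))) ?R"
    by (intro Odiff Oadd Omult sm_const uu_smooth[OF F] O_TT O_XX O_XW)
  have e: "XX N Z True (XX N Z False (XW N Z w f)) q - XX N Z False (XX N Z True (XW N Z w f)) q = ?R f q" if "sm N f" for f q
    using fun_cong[OF commute_XY[OF F XW_sm[OF that, of w]], of q] by (simp add: cst_def)
  show ?thesis
  proof (cases b)
    case True
    show ?thesis by (rule Ocong[OF 1]) (simp add: True e)
  next
    case False
    show ?thesis
    proof (rule Ocong[OF Ouminus[OF 1]])
      fix f q assume f: "sm N f"
      show "- ?R f q = XW N Z (b # (\<not> b) # w) f q - XW N Z ((\<not> b) # b # w) f q"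
        unfolding e[OF f, symmetric] by (simp add: False)
    qed
  qed
qed

lemma O_push: "Oo (Suc (n + length v)) (\<lambda>f q. XW N Z (False # replicate n True @ v) f q - XW N Z (replicate n True @ False # v) f q)"
proof (induction n)
  case 0
  show ?case using O_0[OF c No NU] by simp
next
  case (Suc n)
  have 1: "Oo (Suc (Suc n + length v)) (\<lambda>f q. XW N Z (False # True # replicate n True @ v) f q - XW N Z (True # False # replicate n True @ v) f q)"
    using O_swap[of "replicate n True @ v" False] by simp
  have 2: "Oo (Suc (Suc n + length v)) (\<lambda>f q. XW N Z (True # False # replicate n True @ v) f q - XW N Z (True # replicate n True @ False # v) f q)"
    using O_XXdiff[OF Suc.IH XW_sm XW_sm, of True] by simp
  show ?case using O_trans[OF 1 2] by simp
qed

definition "nf w = replicate (count_list w True) True @ replicate (count_list w False) False"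

lemma O_nf: "Oo (length w) (\<lambda>f q. XW N Z w f q - XW N Z (nf w) f q)"
proof (induction w)
  case Nil
  show ?case using O_0[OF c No NU] by (simp add: nf_def)
next
  case (Cons b w)
  have len: "count_list w True + count_list w False = length w" by (induction w) auto
  have 1: "Oo (length (b # w)) (\<lambda>f q. XW N Z (b # w) f q - XW N Z (b # nf w) f q)"
    using O_XXdiff[OF Cons.IH XW_sm XW_sm, of b] by simp
  have 2: "Oo (length (b # w)) (\<lambda>f q. XW N Z (b # nf w) f q - XW N Z (nf (b # w)) f q)"
  proof (cases b)
    case True
    then show ?thesis using O_0[OF c No NU] by (simp add: nf_def)
  next
    case False
    then show ?thesis using O_push[of "count_list w True" "replicate (count_list w False) False"] len by (simp add: nf_def)
  qed
  show ?case by (rule O_trans[OF 1 2])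
qed

lemma of_int_apply: "(of_int n :: 'a \<Rightarrow> complex) q = of_int n"
  using of_int_cst[OF good_dat[OF F sm_const[of N 0]], of n] by (simp add: cst_def)

lemma fE_apply: "fE (dat N Z f) b p g q = XX N Z b g q - of_int p * uu N Z b q * g q"
  by (simp add: fE_def of_int_apply)

lemma O_rem:
  "(\<And>v. Suc (length v) = length w \<Longrightarrow> Oo n (\<lambda>f. \<psi> f v)) \<Longrightarrow> Oo n (\<lambda>f q. rem d (cst l) (\<psi> f) w q)"
proof (induction w arbitrary: \<psi>)
  case (Cons b w)
  have 1: "Oo n (\<lambda>f q. rem d (cst l) (\<lambda>v. \<psi> f (b # v)) w q)" by (rule Cons.IH) (simp add: Cons.prems)
  have 2: "Oo n (\<lambda>f q. (if b = d then wt d l w else 0) * \<psi> f w q)" by (rule Omult[OF Cons.prems sm_const]) simp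
  show ?case using Oadd[OF 2 1] by (cases "b = d") (simp_all add: wt_cst_apply)
qed (use O_0[OF c No NU] in \<open>simp add: zero_fun_def\<close>)

lemma O_rem0:
  "(\<And>v. Suc (Suc (length v)) = length w \<Longrightarrow> Oo n (\<lambda>f. \<psi> f v)) \<Longrightarrow> Oo n (\<lambda>f q. rem0 (cst l) (\<psi> f) w q)"
proof (induction w arbitrary: \<psi>)
  case (Cons b w)
  have 1: "Oo n (\<lambda>f q. rem0 (cst l) (\<lambda>v. \<psi> f (b # v)) w q)" by (rule Cons.IH) (simp add: Cons.prems)
  have 2: "Oo n (\<lambda>f q. sgb b * rem (\<not> b) (cst l) (\<psi> f) w q)"
    by (rule Omult[OF O_rem sm_const]) (simp add: Cons.prems)
  show ?case using Odiff[OF 1 2] by (simp add: sgb_apply)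
qed (use O_0[OF c No NU] in \<open>simp add: zero_fun_def\<close>)

lemma phi_sm: assumes f: "sm N f" shows "sm N (fphi l (dat N Z f) w)"
proof -
  note S = frame_calc_dat[OF F, of l f]
  interpret C: frame_calc "{g. sm N g}" "XX N Z" "cst l" "cst (1/2)" "cst (1/3)" "fsg (dat N Z f)" "uu N Z" "fal (dat N Z f)"
    "TT N" "cst \<i>" "ww N Z" "AA N Z" by (rule S)
  have E: "fE (dat N Z f) b p g \<in> {g. sm N g}" if "g \<in> {g. sm N g}" for b p g
    using fE_S[OF good_dat[OF F f], of g b p] that by simp
  have third: "cst (1/3) \<in> {g. sm N g}" by (rule C.S(3))
  have "fphi l (dat N Z f) w \<in> {g. sm N g}"
  proof (rule C.S_phi)
    show "fD (dat N Z f) b w m \<in> {g. sm N g}" if "m \<in> {g. sm N g}" for b w m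
      unfolding fD_def by (rule E[OF that])
    show "fRho (dat N Z f) b \<in> {g. sm N g}" for b
      unfolding fRho_def by (intro C.S_mult C.S_diff C.S_sgb third E C.S)
  qed (use f C.S in auto)
  then show ?thesis by simp
qed

text \<open>Frame data contain f as well. The curvature coefficients are separated from it here, as
  the coefficients of a differential operator must be the same for all f.\<close>

lemma fal_dat: "fal (dat N Z f) = fal (dat N Z 0)" "fsg (dat N Z f) = fsg (dat N Z 0)" "fRho (dat N Z f) = fRho (dat N Z 0)"
  by (simp_all add: fal_def fsg_def fRho_def fE_def fun_eq_iff)

lemma curv_sm: "sm N (fal (dat N Z 0) b)" "sm N (fsg (dat N Z 0))" "sm N (fRho (dat N Z 0) b)"
proof -
  have z: "sm N 0" using sm_const[of N 0] by (simp add: zero_fun_def)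
  interpret C: frame_calc "{g. sm N g}" "XX N Z" "cst 0" "cst (1/2)" "cst (1/3)" "fsg (dat N Z 0)" "uu N Z" "fal (dat N Z 0)"
    "TT N" "cst \<i>" "ww N Z" "AA N Z" by (rule frame_calc_dat[OF F])
  show "sm N (fal (dat N Z 0) b)" "sm N (fsg (dat N Z 0))" using C.S by auto
  have E: "fE (dat N Z 0) b p g \<in> {g. sm N g}" if "g \<in> {g. sm N g}" for b p g
    using fE_S[OF good_dat[OF F z], of g b p] that by simp
  have third: "cst (1/3) \<in> {g. sm N g}" by (rule C.S(3))
  have "fRho (dat N Z 0) b \<in> {g. sm N g}"
    unfolding fRho_def by (intro C.S_mult C.S_diff C.S_sgb third E C.S)
  then show "sm N (fRho (dat N Z 0) b)" by simp
qed

text \<open>Every correction in the recursion involves a shorter word, or the connection form times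
  a shorter derivative, and so has lower order than the plain iterated derivative.\<close>

lemma O_phi: "Oo (length w) (\<lambda>f q. fphi l (dat N Z f) w q - XW N Z w f q)"
proof (induction w rule: length_induct)
  case (1 w)
  show ?case
  proof (cases w)
    case Nil then show ?thesis using O_0[OF c No NU] by simp
  next
    case (Cons b v)
    let ?p = "\<lambda>f. fphi l (dat N Z f)"
    have IH: "Oo (length y) (\<lambda>f q. ?p f y q - XW N Z y f q)" if "length y \<le> length v" for y
      using 1[rule_format, of y] that Cons by simp
    have P: "Oo (Suc (length y)) (\<lambda>f. ?p f y)" if "length y \<le> length v" for y
      using Oadd[OF Omono[OF IH[OF that]] O_XW[of y]] by simp
    have r: "Oo (Suc (length v)) (\<lambda>f q. rem d (cst l) (?p f) v q)" for d
      by (rule O_rem, rule Omono[OF P]) auto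
    have r0: "Oo (Suc (length v)) (\<lambda>f q. rem0 (cst l) (?p f) v q)"
      by (rule O_rem0, rule Omono[OF P]) auto
    have D: "Oo (Suc (length v)) (\<lambda>f q. XX N Z b (?p f v) q - XX N Z b (XW N Z v f) q)"
      by (rule O_XXdiff[OF IH[OF order_refl] phi_sm XW_sm])
    have "Oo (Suc (length v)) (\<lambda>f q. (XX N Z b (?p f v) q - XX N Z b (XW N Z v f) q)
        + ((- of_int (ichg v) * uu N Z b q) * ?p f v q + (fal (dat N Z 0) b q * rem b (cst l) (?p f) v q
          + (fsg (dat N Z 0) q * rem (\<not> b) (cst l) (?p f) v q + fRho (dat N Z 0) b q * rem0 (cst l) (?p f) v q))))"
      by (intro Oadd Omult D P r r0 curv_sm sm_mult No sm_const uu_smooth[OF F] order_refl)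
    then have "Oo (Suc (length v)) (\<lambda>f q. ?p f w q - XW N Z w f q)"
    proof (rule Ocong)
      fix f q
      show "(XX N Z b (?p f v) q - XX N Z b (XW N Z v f) q)
        + ((- of_int (ichg v) * uu N Z b q) * ?p f v q + (fal (dat N Z 0) b q * rem b (cst l) (?p f) v q
          + (fsg (dat N Z 0) q * rem (\<not> b) (cst l) (?p f) v q + fRho (dat N Z 0) b q * rem0 (cst l) (?p f) v q))) = ?p f w q - XW N Z w f q"
        unfolding Cons phi_Cons fal_dat[of f, symmetric] fD_def XW.simps plus_fun_apply times_fun_apply fE_apply by simp
    qed
    then show ?thesis unfolding Cons by simp
  qed
qed

lemma O_wsum:
  assumes W: "\<And>c w. (c, w) \<in> set W \<Longrightarrow> count_list w True = k \<and> count_list w False = k"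
  shows "Oo (2 * k) (\<lambda>f q. wsum W k (dat N Z f) q - (\<Sum>(c, w)\<leftarrow>W. c) * XW N Z (replicate k True @ replicate k False) f q)"
  using W
proof (induction W)
  case Nil show ?case using O_0[OF c No NU] by (simp add: wsum_def)
next
  case (Cons dw W)
  obtain d w where dw: "dw = (d, w)" by force
  have IH: "Oo (2 * k) (\<lambda>f q. wsum W k (dat N Z f) q - (\<Sum>(c, w)\<leftarrow>W. c) * XW N Z (replicate k True @ replicate k False) f q)"
  proof (rule Cons.IH)
    fix c w assume "(c, w) \<in> set W"
    then have "(c, w) \<in> set (dw # W)" by simp
    then show "count_list w True = k \<and> count_list w False = k" by (rule Cons.prems)
  qed
  have w: "count_list w True = k" "count_list w False = k" using Cons.prems[of d w] by (simp_all add: dw)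
  have "count_list w True + count_list w False = length w" for w by (induction w) auto
  then have len: "length w = 2 * k" using w by (metis mult_2)
  have "Oo (2 * k) (\<lambda>f q. fphi (of_nat k / 2 - 1) (dat N Z f) w q - XW N Z (nf w) f q)"
    using O_trans[OF O_phi O_nf, of w] unfolding len .
  then have "Oo (2 * k) (\<lambda>f q. d * (fphi (of_nat k / 2 - 1) (dat N Z f) w q - XW N Z (nf w) f q))"
    by (rule Omult[OF _ sm_const])
  from Oadd[OF this IH] show ?case
    by (rule Ocong) (simp add: dw wsum_def cst_apply nf_def w algebra_simps)
qed

lemma EL_apply: "EL N Z g q = - (XX N Z True (XX N Z False g) q + uu N Z True q * XX N Z False g q
   + XX N Z False (XX N Z True g) q - uu N Z False q * XX N Z True g q)"
proof -
  have 0: "fE (dat N Z g) b 0 g = XX N Z b g" for b by (rule ext) (simp add: fE_apply)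
  show ?thesis by (simp add: EL_def ichg_def 0 fE_apply)
qed

lemma EL_sm: "sm N g \<Longrightarrow> sm N (EL N Z g)"
  unfolding EL_apply[abs_def] by (intro sm_uminus sm_add sm_diff sm_mult XX_sm uu_smooth[OF F] No)

text \<open>Each sublaplacian is minus the sum of the two mixed second derivatives, which coincide
  to top order. This is the origin of the factor -2 and hence of the normalisation of the singular
  vector.\<close>

lemma O_EL: "Oo (2 * k) (\<lambda>f q. (EL N Z ^^ k) f q - (- 2) ^ k * XW N Z (replicate k True @ replicate k False) f q)"
proof (induction k)
  case 0 show ?case using O_0[OF c No NU] by simp
next
  case (Suc k)
  let ?w = "replicate k True @ replicate k False" and ?v = "replicate (Suc k) True @ replicate (Suc k) False"
  let ?D = "\<lambda>f. (EL N Z ^^ k) f" and ?D' = "\<lambda>f q. (- 2) ^ k * XW N Z ?w f q"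
  have s: "sm N (?D f)" if "sm N f" for f using that by (induction k) (simp_all add: EL_sm)
  have s': "sm N (?D' f)" if "sm N f" for f by (intro sm_mult sm_const XW_sm No that)
  have d2: "Oo (2 * Suc k) (\<lambda>f q. XX N Z b (XX N Z (\<not> b) (?D f)) q - XX N Z b (XX N Z (\<not> b) (?D' f)) q)" for b
    using O_XXdiff[OF O_XXdiff[OF Suc.IH s s'] XX_sm[OF s] XX_sm[OF s'], of b "\<not> b"] by simp
  have d1: "Oo (2 * Suc k) (\<lambda>f q. uu N Z (\<not> b) q * XX N Z b (?D f) q)" for b
  proof (rule Omult[OF _ uu_smooth[OF F]])
    have "Oo (Suc (2 * k)) ?D'" by (rule Omono[OF Omult[OF O_XW sm_const]]) (simp add: mult_2)
    from Oadd[OF Omono[OF Suc.IH] this] have "Oo (Suc (2 * k)) ?D" by simp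
    then show "Oo (2 * Suc k) (\<lambda>f. XX N Z b (?D f))" using O_XX[of "Suc (2 * k)" ?D b] by simp
  qed
  have X: "XX N Z b (\<lambda>q. x * g q) = (\<lambda>q. x * XX N Z b g q)" if g: "sm N g" for b x g
    using deriv_on.X_const[OF deriv_XX[OF F] XX_cst[OF F, of b x], of g] g by (simp add: cst_def sm_const times_fun_def)
  have XD: "XX N Z b (XX N Z (\<not> b) (?D' f)) q = (- 2) ^ k * XW N Z (b # (\<not> b) # ?w) f q" if f: "sm N f" for b f q
    using X[OF XW_sm[OF f]] X[OF XX_sm[OF XW_sm[OF f]]] by simp
  have n: "Oo (2 * Suc k) (\<lambda>f q. XW N Z (b # (\<not> b) # ?w) f q - XW N Z ?v f q)" for b
  proof -
    have "nf (b # (\<not> b) # ?w) = ?v" "length (b # (\<not> b) # ?w) = 2 * Suc k" by (cases b; simp add: nf_def count_replicate)+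
    then show ?thesis using O_nf[of "b # (\<not> b) # ?w"] by (simp only:)
  qed
  have "Oo (2 * Suc k) (\<lambda>f q. - ((XX N Z True (XX N Z (\<not> True) (?D f)) q - XX N Z True (XX N Z (\<not> True) (?D' f)) q)
      + (XX N Z False (XX N Z (\<not> False) (?D f)) q - XX N Z False (XX N Z (\<not> False) (?D' f)) q)
      + (uu N Z (\<not> False) q * XX N Z False (?D f) q - uu N Z (\<not> True) q * XX N Z True (?D f) q)
      + (- 2) ^ k * (XW N Z (True # (\<not> True) # ?w) f q - XW N Z ?v f q)
      + (- 2) ^ k * (XW N Z (False # (\<not> False) # ?w) f q - XW N Z ?v f q)))"
    by (intro Ouminus Oadd Odiff d2 d1 Omult[OF n] sm_const) 
  then show ?case
  proof (rule Ocong)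
    fix f q assume f: "sm N f" "q \<in> N"
    show "- ((XX N Z True (XX N Z (\<not> True) (?D f)) q - XX N Z True (XX N Z (\<not> True) (?D' f)) q)
      + (XX N Z False (XX N Z (\<not> False) (?D f)) q - XX N Z False (XX N Z (\<not> False) (?D' f)) q)
      + (uu N Z (\<not> False) q * XX N Z False (?D f) q - uu N Z (\<not> True) q * XX N Z True (?D f) q)
      + (- 2) ^ k * (XW N Z (True # (\<not> True) # ?w) f q - XW N Z ?v f q)
      + (- 2) ^ k * (XW N Z (False # (\<not> False) # ?w) f q - XW N Z ?v f q))
      = (EL N Z ^^ Suc k) f q - (- 2) ^ Suc k * XW N Z ?v f q"
      unfolding XD[OF f(1)] funpow.simps o_apply EL_apply by (simp add: algebra_simps)
  qed
qed

theorem O_main: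
  assumes W: "\<And>c w. (c, w) \<in> set W \<Longrightarrow> count_list w True = k \<and> count_list w False = k" and S: "(\<Sum>(c, w)\<leftarrow>W. c) = (- 2) ^ k"
  shows "Oo (2 * k) (\<lambda>f q. wsum W k (dat N Z f) q - (EL N Z ^^ k) f q)"
  using Odiff[OF O_wsum[where W = W, OF W] O_EL[of k]] unfolding S by simp

end

end

section \<open>Uniqueness of coefficients and gluing of local representations\<close>

lemma sum_canonical:
  assumes "finite L" and c: "\<And>x. x \<in> L \<Longrightarrow> c (m x) \<in> L \<and> m (c (m x)) = m x" and g: "\<And>x y. m x = m y \<Longrightarrow> g x = (g y :: complex)"
  shows "(\<Sum>x\<in>L. (if x = c (m x) then (\<Sum>y | y \<in> L \<and> m y = m x. b y) else 0) * g x) = (\<Sum>y\<in>L. b y * g y)"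
proof -
  have "(\<Sum>x\<in>L. (if x = c (m x) then (\<Sum>y | y \<in> L \<and> m y = m x. b y) else 0) * g x)
    = (\<Sum>x\<in>L. \<Sum>y\<in>L. if x = c (m x) \<and> m y = m x then b y * g y else 0)"
  proof (rule sum.cong[OF refl])
    fix x
    have "(\<Sum>y | y \<in> L \<and> m y = m x. b y) * g x = (\<Sum>y\<in>L. if m y = m x then b y * g y else 0)"
      unfolding sum_distrib_right sum.inter_filter[OF assms(1), symmetric] by (rule sum.cong) (auto intro: g)
    then show "(if x = c (m x) then (\<Sum>y | y \<in> L \<and> m y = m x. b y) else 0) * g x = (\<Sum>y\<in>L. if x = c (m x) \<and> m y = m x then b y * g y else 0)"
      by (cases "x = c (m x)") simp_all
  qed
  also have "\<dots> = (\<Sum>y\<in>L. \<Sum>x\<in>L. if x = c (m x) \<and> m y = m x then b y * g y else 0)" by (rule sum.swap)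
  also have "\<dots> = (\<Sum>y\<in>L. b y * g y)"
  proof (rule sum.cong[OF refl])
    fix y assume y: "y \<in> L"
    have "(\<Sum>x\<in>L. if x = c (m x) \<and> m y = m x then b y * g y else 0) = (\<Sum>x\<in>L. if x = c (m y) then b y * g y else 0)"
      by (rule sum.cong[OF refl]) (use c[OF y] in auto)
    also have "\<dots> = b y * g y" using c[OF y] assms(1) by (simp add: sum.delta)
    finally show "(\<Sum>x\<in>L. if x = c (m x) \<and> m y = m x then b y * g y else 0) = b y * g y" .
  qed
  finally show ?thesis .
qed

text \<open>The factor produced when the partial derivatives listed in \<open>is\<close> act on a
  monomial with exponent multiset \<open>M\<close>: every step contributes the exponent still
  present.\<close>

fun kap :: "'i list \<Rightarrow> 'i multiset \<Rightarrow> nat" where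
  "kap [] M = 1"
| "kap (i # is) M = kap is M * count (M - mset is) i"

lemma kap_nonzero: "kap is M \<noteq> 0 \<longleftrightarrow> mset is \<subseteq># M"
proof (induction "is")
  case (Cons i "is")
  have "mset (i # is) \<subseteq># M \<longleftrightarrow> mset is \<subseteq># M \<and> count (M - mset is) i \<noteq> 0"
  proof
    assume "mset (i # is) \<subseteq># M"
    then have *: "count (mset (i # is)) a \<le> count M a" for a by (rule mset_subset_eq_count)
    have "count (mset is) a \<le> count M a" for a using *[of a] by (simp split: if_splits)
    moreover have "count (mset is) i < count M i" using *[of i] by simp
    ultimately show "mset is \<subseteq># M \<and> count (M - mset is) i \<noteq> 0" by (simp add: subseteq_mset_def)
  next
    assume *: "mset is \<subseteq># M \<and> count (M - mset is) i \<noteq> 0"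
    then have "count (mset (i # is)) a \<le> count M a" for a
      by (cases "a = i") (simp_all add: subseteq_mset_def)
    then show "mset (i # is) \<subseteq># M" by (simp only: subseteq_mset_def) simp
  qed
  then show ?case using Cons.IH by simp
qed simp

context contact begin

context
  fixes U \<phi> assumes c: "(U, \<phi>) \<in> atlas M"
begin

abbreviation "P \<equiv> PD U \<phi>"

lemma Uo: "opn U" by (rule chart_open[OF c])

lemma PD_sm: "sm U f \<Longrightarrow> sm U (P is f)" by (rule PD_smooth[OF c Uo order_refl])

lemma d_ct: "q \<in> U \<Longrightarrow> dcoord U \<phi> i q \<in> ct q" by (rule dcoord_ct[OF c])

text \<open>The bracket of two coordinate fields kills the coordinate functions, and a tangent
  vector is determined by its values on these.\<close>

lemma dcoord_commute:
  assumes g: "sm U g" and q: "q \<in> U"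
  shows "dcoord U \<phi> i q (\<lambda>r. dcoord U \<phi> j r g) = dcoord U \<phi> j q (\<lambda>r. dcoord U \<phi> i r g)"
proof -
  let ?B = "lie_bracket M (dcoord U \<phi> i) (dcoord U \<phi> j) q"
  have B: "?B \<in> ct q" by (rule lie_bracket_ct[OF Uo q smooth_dcoord[OF c] smooth_dcoord[OF c]])
  have z: "dcoord U \<phi> a q (\<lambda>r. dcoord U \<phi> b r (xcoord \<phi> k)) = 0" for a b k
    by (rule ct_zero_near[OF d_ct[OF q] Uo q, of _ "if b = k then 1 else 0"]) (rule dcoord_xcoord[OF c])
  have "?B (xcoord \<phi> k) = 0" for k by (simp add: lie_bracket_def z)
  then have "?B g = 0" using coord_rep[OF c q B, of g] by simp
  then show ?thesis using smooth_atI[OF Uo q g] by (simp add: lie_bracket_def)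
qed

lemma PD_front:
  assumes f: "sm U f" shows "k \<in> set is \<Longrightarrow> q \<in> U \<Longrightarrow> P is f q = P (k # remove1 k is) f q"
proof (induction "is" arbitrary: q)
  case (Cons i "is")
  show ?case
  proof (cases "i = k")
    case False
    then have k: "k \<in> set is" using Cons.prems by simp
    have "P (i # is) f q = dcoord U \<phi> i q (P (k # remove1 k is) f)"
      using ct_cong[OF d_ct[OF Cons.prems(2)] Uo Cons.prems(2), of "P is f" "P (k # remove1 k is) f"] Cons.IH[OF k] by simp
    also have "\<dots> = P (k # i # remove1 k is) f q"
      using dcoord_commute[OF PD_sm[OF f] Cons.prems(2)] by simp
    finally show ?thesis using False by simp
  qed simp
qed simp

lemma PD_perm:
  assumes f: "sm U f" shows "mset is = mset js \<Longrightarrow> q \<in> U \<Longrightarrow> P is f q = P js f q"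
proof (induction "is" arbitrary: js q)
  case (Cons i "is")
  have i: "i \<in> set js" using Cons.prems(1) by (metis list.set_intros(1) mset_eq_setD)
  have m: "mset is = mset (remove1 i js)" using Cons.prems(1) by (metis add_mset_remove_trivial mset.simps(2) mset_remove1)
  have "P (i # is) f q = P (i # remove1 i js) f q"
    using ct_cong[OF d_ct[OF Cons.prems(2)] Uo Cons.prems(2), of "P is f" "P (remove1 i js) f"] Cons.IH[OF m] by simp
  then show ?case using PD_front[OF f i Cons.prems(2)] by simp
qed simp

definition mon :: "'a \<Rightarrow> 3 multiset \<Rightarrow> 'a \<Rightarrow> complex" where
  "mon p A q = (\<Prod>i\<in>#A. xcoord \<phi> i q - xcoord \<phi> i p)"

lemma mon_simps: "mon p {#} = (\<lambda>q. 1)" "mon p (add_mset i A) = (\<lambda>q. (xcoord \<phi> i q - xcoord \<phi> i p) * mon p A q)"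
  by (simp_all add: mon_def fun_eq_iff)

lemma mon_sm: "sm U (mon p A)"
proof (induction A)
  case empty show ?case unfolding mon_simps by (rule sm_const)
next
  case (add i A) show ?case unfolding mon_simps by (intro sm_mult sm_diff Uo smooth_xcoord[OF c] sm_const add.IH)
qed

lemma mon_at: "mon p A p = (if A = {#} then 1 else 0)"
  by (cases A) (simp_all add: mon_def)

lemma dcoord_mon: assumes q: "q \<in> U" shows "dcoord U \<phi> k q (mon p A) = of_nat (count A k) * mon p (A - {#k#}) q"
proof (induction A)
  case empty
  show ?case using ct_const[OF d_ct[OF q], of k 1] by (simp add: mon_simps)
next
  case (add i A)
  let ?x = "\<lambda>q. xcoord \<phi> i q - xcoord \<phi> i p"
  have P: "q \<in> pts" using opn_sub[OF Uo q] .
  have s: "smooth_at M q (xcoord \<phi> i)" "smooth_at M q ?x" "smooth_at M q (mon p A)"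
    by (rule smooth_atI[OF Uo q smooth_xcoord[OF c]], rule smooth_atI[OF Uo q sm_diff[OF Uo smooth_xcoord[OF c] sm_const]], rule smooth_atI[OF Uo q mon_sm])
  have "dcoord U \<phi> k q ?x = (if k = i then 1 else 0)"
    using ct_diff[OF d_ct[OF q] s(1) smooth_at_const[OF P]] ct_const[OF d_ct[OF q]] dcoord_xcoord[OF c q] by simp
  then have "dcoord U \<phi> k q (mon p (add_mset i A)) = (if k = i then 1 else 0) * mon p A q + ?x q * (of_nat (count A k) * mon p (A - {#k#}) q)"
    unfolding mon_simps ct_mult[OF d_ct[OF q] s(2,3)] add.IH by simp
  also have "\<dots> = of_nat (count (add_mset i A) k) * mon p (add_mset i A - {#k#}) q"
  proof (cases "k \<in># A")
    case True
    then obtain A' where A: "A = add_mset k A'" by (metis insert_DiffM)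
    show ?thesis by (cases "k = i") (simp_all add: A mon_simps algebra_simps)
  next
    case False
    then show ?thesis by (cases "k = i") (simp_all add: mon_simps not_in_iff)
  qed
  finally show ?case .
qed

lemma PD_mon: "q \<in> U \<Longrightarrow> P is (mon p A) q = of_nat (kap is A) * mon p (A - mset is) q"
proof (induction "is" arbitrary: q)
  case (Cons i "is")
  have s: "smooth_at M q (mon p (A - mset is))" by (rule smooth_atI[OF Uo Cons.prems mon_sm])
  have "P (i # is) (mon p A) q = dcoord U \<phi> i q (\<lambda>q. of_nat (kap is A) * mon p (A - mset is) q)"
    using ct_cong[OF d_ct[OF Cons.prems] Uo Cons.prems, of "P is (mon p A)"] Cons.IH by simp
  then show ?case
    unfolding ct_scale[OF d_ct[OF Cons.prems] s] dcoord_mon[OF Cons.prems] by simp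
qed simp

lemma PD_mon_at:
  assumes p: "p \<in> U" shows "P is (mon p A) p = (if mset is = A then of_nat (kap is A) else 0)"
proof (cases "mset is \<subseteq># A")
  case True
  then have "A - mset is = {#} \<longleftrightarrow> mset is = A" unfolding Diff_eq_empty_iff_mset by (blast intro: subset_mset.antisym)
  then show ?thesis unfolding PD_mon[OF p] mon_at by auto
next
  case False
  then show ?thesis unfolding PD_mon[OF p] using kap_nonzero[of "is" A] by auto
qed

text \<open>Coefficients indexed by lists are not unique, but their sums over all lists with the same underlying
  multiset are, as they can be read off from the action on monomials. Moving each such sum to one list makes local
  representations agree on overlaps.\<close>

theorem patch:
  assumes L: "\<And>p. p \<in> U \<Longrightarrow> \<exists>N b. opn N \<and> p \<in> N \<and> N \<subseteq> U \<and> (\<forall>is. sm N (b is)) \<and>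
      (\<forall>f. sm U f \<longrightarrow> (\<forall>q\<in>N. D f q = (\<Sum>is | length is < n. b is q * P is f q)))"
  shows "\<exists>a. (\<forall>is. sm U (a is)) \<and> (\<forall>f. sm U f \<longrightarrow> (\<forall>q\<in>U. D f q = (\<Sum>is | length is < n. a is q * P is f q)))"
proof -
  define cl where "cl A = (SOME js. mset js = A)" for A :: "3 multiset"
  have cl: "mset (cl A) = A" for A unfolding cl_def by (rule someI_ex) (rule ex_mset)
  \<comment> \<open>The coefficient is read off from D itself, by its action on monomials centred at
    q, and so does not refer to any local representation. It is attached to one chosen list per
    multiset.\<close>
  define a where "a is q = (if is = cl (mset is) \<and> length is < n then D (mon q (mset is)) q / of_nat (kap is (mset is)) else 0)" for "is" q
  let ?L = "{is :: 3 list. length is < n}"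
  have key: "a is q = (if is = cl (mset is) then (\<Sum>js | js \<in> ?L \<and> mset js = mset is. b js q) else 0)"
    if N: "\<And>f q. sm U f \<Longrightarrow> q \<in> N \<Longrightarrow> D f q = (\<Sum>is | length is < n. b is q * P is f q)" "N \<subseteq> U" and q: "q \<in> N" and l: "length is < n" for b N q "is"
  proof (cases "is = cl (mset is)")
    case True
    have qU: "q \<in> U" using N(2) q by blast
    let ?A = "mset is"
    have k: "kap js ?A = kap is ?A" if "mset js = ?A" for js
      using PD_perm[OF mon_sm that qU, of q ?A] unfolding PD_mon_at[OF qU] using that by simp
    have "D (mon q ?A) q = (\<Sum>js\<in>?L. b js q * P js (mon q ?A) q)" by (rule N(1)[OF mon_sm q])
    also have "\<dots> = (\<Sum>js\<in>?L. if mset js = ?A then b js q * of_nat (kap is ?A) else 0)"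
    proof (rule sum.cong[OF refl])
      fix js
      show "b js q * P js (mon q ?A) q = (if mset js = ?A then b js q * of_nat (kap is ?A) else 0)"
        unfolding PD_mon_at[OF qU] using k[of js] by (cases "mset js = ?A") (simp_all only: if_True if_False mult_zero_right simp_thms)
    qed
    also have "\<dots> = (\<Sum>js | js \<in> ?L \<and> mset js = ?A. b js q) * of_nat (kap is ?A)"
      unfolding sum.inter_filter[OF finite_lists, symmetric] sum_distrib_right ..
    finally have "D (mon q ?A) q = (\<Sum>js | js \<in> ?L \<and> mset js = ?A. b js q) * of_nat (kap is ?A)" .
    moreover have "kap is ?A \<noteq> 0" by (simp only: kap_nonzero)
    ultimately show ?thesis using True l unfolding a_def by simp
  qed (simp add: a_def)
  have a0: "a is = (\<lambda>q. 0)" if "\<not> length is < n" for "is" using that by (simp add: a_def fun_eq_iff)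
  show ?thesis
  proof (intro exI[of _ a] conjI allI impI ballI)
    fix "is" show "sm U (a is)"
    proof (cases "length is < n")
      case True
      show ?thesis
      proof (rule sm_local)
        fix p assume p: "p \<in> U"
        obtain N b where N: "opn N" "p \<in> N" "N \<subseteq> U" "\<And>is. sm N (b is)" "\<And>f q. sm U f \<Longrightarrow> q \<in> N \<Longrightarrow> D f q = (\<Sum>is | length is < n. b is q * P is f q)"
          using L[OF p] by (elim exE conjE) blast
        have "sm N (\<lambda>q. if is = cl (mset is) then (\<Sum>js | js \<in> ?L \<and> mset js = mset is. b js q) else 0)"
          by (cases "is = cl (mset is)") (simp_all add: sm_const sm_sum[OF N(1) N(4)])
        then have "sm N (a is)" by (rule sm_cong[OF N(1), rotated]) (simp add: key[OF N(5,3) _ True])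
        then show "\<exists>V. opn V \<and> p \<in> V \<and> sm V (a is)" using N by blast
      qed
    qed (simp add: a0 sm_const)
  next
    fix f q assume f: "sm U f" and q: "q \<in> U"
    obtain N b where N: "opn N" "q \<in> N" "N \<subseteq> U" "\<And>f q. sm U f \<Longrightarrow> q \<in> N \<Longrightarrow> D f q = (\<Sum>is | length is < n. b is q * P is f q)"
      using L[OF q] by (elim exE conjE) blast
    have "(\<Sum>is\<in>?L. a is q * P is f q) = (\<Sum>is\<in>?L. (if is = cl (mset is) then (\<Sum>js | js \<in> ?L \<and> mset js = mset is. b js q) else 0) * P is f q)"
      by (rule sum.cong[OF refl]) (simp add: key[OF N(4,3,2)])
    also have "\<dots> = (\<Sum>is\<in>?L. b is q * P is f q)"
    proof (rule sum_canonical[OF finite_lists])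
      fix x y :: "3 list"
      have "length (cl (mset x)) = length x" using cl[of "mset x"] by (metis size_mset)
      then show "x \<in> ?L \<Longrightarrow> cl (mset x) \<in> ?L \<and> mset (cl (mset x)) = mset x" by (simp add: cl)
      show "mset x = mset y \<Longrightarrow> P x f q = P y f q" by (rule PD_perm[OF f _ q])
    qed
    finally show "D f q = (\<Sum>is | length is < n. a is q * P is f q)" using N(4)[OF f N(2)] by simp
  qed
qed

lemma partials_PD:
  assumes f: "sm U f" shows "p \<in> U \<Longrightarrow> partials is (f \<circ> inv_into U \<phi>) (\<phi> p) = P is f p"
proof (induction "is" arbitrary: p)
  case Nil
  then show ?case using chart_inv[OF c] by simp
next
  case (Cons i "is")
  let ?g = "f \<circ> inv_into U \<phi>"
  have s: "smooth_at M p (P is f)" by (rule smooth_atI[OF Uo Cons.prems PD_sm[OF f]])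
  have o: "open (\<phi> ` U)" using chart_image[OF c Uo] by simp
  have "(P is f \<circ> inv_into U \<phi> has_derivative frechet_derivative (P is f \<circ> inv_into U \<phi>) (at (\<phi> p))) (at (\<phi> p))"
    by (rule smooth_at_deriv[OF c Cons.prems s])
  then have "(partials is ?g has_derivative frechet_derivative (P is f \<circ> inv_into U \<phi>) (at (\<phi> p))) (at (\<phi> p))"
  proof (rule has_derivative_transform_within_open[OF _ o])
    show "\<phi> p \<in> \<phi> ` U" using Cons.prems by blast
    fix x assume "x \<in> \<phi> ` U"
    then obtain q where q: "q \<in> U" "x = \<phi> q" by blast
    then have "(P is f \<circ> inv_into U \<phi>) x = P is f q" using chart_inv[OF c q(1)] by simp
    then show "(P is f \<circ> inv_into U \<phi>) x = partials is ?g x" unfolding q(2) Cons.IH[OF q(1)] .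
  qed
  from fun_cong[OF frechet_derivative_at[OF this], of "axis i 1"] s show ?case
    unfolding partials.simps PD.simps dcoord_def by (simp only: if_True)
qed

end

end

section \<open>Independence of the frame\<close>

context contact begin

context
  fixes N Z assumes F: "Fr N Z"
begin

lemma EL_local:
  assumes p: "p \<in> N"
  shows "EL N Z g p = - (Z p (\<lambda>q. vconj Z q g / hh Z q) + wZ Z p * (vconj Z p g / hh Z p)
     + vconj Z p (\<lambda>q. Z q g) / hh Z p - wZb Z p / hh Z p * Z p g)"
proof -
  have oi: "(of_int n :: 'a \<Rightarrow> complex) q = of_int n" for n q
    using of_int_cst[OF good_dat[OF F sm_const[of N 0]], of n] by (simp add: cst_def)
  have E: "fE (dat N Z f) b n h q = XX N Z b h q - of_int n * uu N Z b q * h q" for f b n h q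
    by (simp add: fE_def oi)
  have 0: "fE (dat N Z f) b 0 h = XX N Z b h" for f b h by (rule ext) (simp add: E)
  have "EL N Z g p = - (XX N Z True (XX N Z False g) p + uu N Z True p * XX N Z False g p
     + XX N Z False (XX N Z True g) p - uu N Z False p * XX N Z True g p)"
    by (simp add: EL_def ichg_def 0 E)
  then show ?thesis
    using p ct_on[OF F p frame_ct(2)[OF F p]] ct_on[OF F p frame_ct(3)[OF F p]] by (simp add: XX_def[of N Z _ _ p] uu_def)
qed

lemma EL_cong:
  assumes V: "opn V" "p \<in> V" and p: "p \<in> N" and e: "\<And>q. q \<in> V \<Longrightarrow> f q = g q" shows "EL N Z f p = EL N Z g p"
proof -
  have VN: "opn (V \<inter> N)" "p \<in> V \<inter> N" using V p frame_opn[OF F] by auto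
  have v: "v f = v g" if "v \<in> ct q" "q \<in> V \<inter> N" for v q
    by (rule ct_cong[OF that(1) VN(1) that(2)]) (simp add: e)
  have 1: "Z p f = Z p g" "vconj Z p f = vconj Z p g" using v[OF frame_ct(2)[OF F p] VN(2)] v[OF frame_ct(3)[OF F p] VN(2)] by auto
  have 2: "Z p (\<lambda>q. vconj Z q f / hh Z q) = Z p (\<lambda>q. vconj Z q g / hh Z q)"
    by (rule ct_cong[OF frame_ct(2)[OF F p] VN]) (use v frame_ct(3)[OF F] in auto)
  have 3: "vconj Z p (\<lambda>q. Z q f) = vconj Z p (\<lambda>q. Z q g)"
    by (rule ct_cong[OF frame_ct(3)[OF F p] VN]) (use v frame_ct(2)[OF F] in auto)
  show ?thesis unfolding EL_local[OF p] 1 2 3 ..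
qed

lemma wsum_cong:
  assumes e: "\<And>q. q \<in> N \<Longrightarrow> f q = g q" and p: "p \<in> N" shows "wsum W k (dat N Z f) p = wsum W k (dat N Z g) p"
proof -
  \<comment> \<open>h truncates functions to N. Truncation commutes with every operation in the
    recursion, and it makes functions that agree on N equal.\<close>
  define h where "h f q = (if q \<in> N then f q else 0 :: complex)" for f :: "'a \<Rightarrow> complex" and q
  have hX: "h (XX N Z b m) = XX N Z b (h m)" for b m
  proof
    fix q show "h (XX N Z b m) q = XX N Z b (h m) q"
    proof (cases "q \<in> N")
      case True
      have "v m = v (h m)" if "v \<in> ct q" for v
        by (rule ct_cong[OF that frame_opn[OF F] True]) (simp add: h_def)
      from this[OF frame_ct(2)[OF F True]] this[OF frame_ct(3)[OF F True]] show ?thesis by (simp add: h_def XX_def)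
    qed (simp add: h_def XX_def)
  qed
  have "h (fphi l (dat N Z f') w) = phi (cst l) (fD (dat N Z 0)) (fal (dat N Z 0)) (fsg (dat N Z 0)) (fRho (dat N Z 0)) (h f') w" for f' l w
    unfolding dat_simps(7)
  proof (rule phi_hom[where h = h and n = "length w"])
    have al: "fal (dat N Z f') = fal (dat N Z 0)" "fsg (dat N Z f') = fsg (dat N Z 0)" "fRho (dat N Z f') = fRho (dat N Z 0)"
      by (simp_all add: fal_def fsg_def fRho_def fE_def fun_eq_iff)
    show "h (fal (dat N Z f') b * x) = fal (dat N Z 0) b * h x" "h (fsg (dat N Z f') * x) = fsg (dat N Z 0) * h x"
      "h (fRho (dat N Z f') b * x) = fRho (dat N Z 0) b * h x" for b x
      unfolding al by (simp_all add: h_def fun_eq_iff)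
    show "h (fD (dat N Z f') b v m) = fD (dat N Z 0) b v (h m)" for b v m
    proof -
      have "h (of_int n * u * m) = of_int n * u * h m" for n u by (simp add: h_def fun_eq_iff)
      moreover have "h (x - y) = h x - h y" for x y by (simp add: h_def fun_eq_iff)
      ultimately show ?thesis by (simp add: fD_def fE_def hX)
    qed
  qed (simp_all add: h_def fun_eq_iff)
  moreover have "h f = h g" using e by (simp add: h_def fun_eq_iff)
  ultimately have "h (fphi l (dat N Z f) w) p = h (fphi l (dat N Z g) w) p" for l w by simp
  then have "fphi l (dat N Z f) w p = fphi l (dat N Z g) w p" for l w using p by (simp add: h_def)
  then show ?thesis by (simp add: wsum_def sum_list_apply o_def case_prod_unfold)
qed

end

lemma frame_shrink: "Fr U Z \<Longrightarrow> opn V \<Longrightarrow> Fr (U \<inter> V) Z"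
  by (rule frame_subset) (auto simp: frame_opn)

lemma tw_shrink: "tw_frame M \<theta> T nab U Z \<Longrightarrow> opn V \<Longrightarrow> tw M \<theta> T nab (U \<inter> V) Z"
  using frame_shrink[of U Z V] contact_axioms by (simp add: tw_def tw_axioms_def tw_frame_def)

lemma tw_frame_exists: "Fr U Z \<Longrightarrow> tw_frame M \<theta> reeb nabTW U Z"
  using contact reeb_field_reeb tanaka_webster_nabTW by (simp add: tw_frame_def)

end

context scale_pair begin

text \<open>For \<Upsilon> = 0 the factors of the two letters are inverse to each other on N, so a
  word of charge zero takes the same value in both frames.\<close>

lemma EL_invariance:
  assumes U0: "\<And>p. \<Upsilon> p = 0" and f: "A.sm N f" and p: "p \<in> N" shows "B.EL N Z' f p = A.EL N Z f p"
proof -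
  have u0: "ups = 0" by (simp add: ups_def[abs_def] U0 zero_fun_def)
  interpret C: frame_change "{g. A.sm N g}" "A.XX N Z" "cst 0" "cst (1/2)" "cst (1/3)" "fsg (A.dat N Z f)" "A.uu N Z" "fal (A.dat N Z f)"
    "A.TT N" "cst \<i>" "A.ww N Z" "A.AA N Z"
    "B.XX N Z'" "fsg (B.dat N Z' f)" "B.uu N Z'" "fal (B.dat N Z' f)" "B.TT N" "B.ww N Z'" "B.AA N Z'"
    aa "\<lambda>b p. 1 / aa b p" ups J
    by (rule frame_change_dat)
  have x0: "A.XX N Z b ups = 0" for b unfolding u0 using deriv_on.X_0[OF A.deriv_XX[OF F]] .
  have one: "A.XX N Z b 1 = 0 * A.XX N Z b ups * 1" for b using deriv_on.X_1[OF A.deriv_XX[OF F]] by simp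
  have f': "f \<in> {g. A.sm N g}" using f by simp
  have D: "fE (B.dat N Z' f) b (ichg w) (prod_list (map aa w) * m) = prod_list (map aa (b # w)) * fE (A.dat N Z f) b (ichg w) m" if "A.sm N m" for b w m
    using C.D_change[where b = b and v = w and k = 0 and c = 1, OF _ C.F1.S_1 one, of m] that
    by (simp add: fE_def of_int_chg x0 mult_ac)
  have E: "Ew (B.dat N Z' f) 0 w f = prod_list (map aa w) * Ew (A.dat N Z f) 0 w f" for w
  proof (induction w)
    case (Cons b w)
    have "A.sm N (Ew (A.dat N Z f) 0 w f)" using Ew_S[OF A.good_dat[OF F f], of f] f by simp
    from D[OF this, of b w] show ?case unfolding Ew.simps Cons.IH by simp
  qed simp
  have "(aa True * aa False) p = 1" using p ga0 by (simp add: aa_def u0)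
  then have aa: "aa True p * aa False p = 1" by simp
  have "prod_list (map aa [True, False]) p = 1" "prod_list (map aa [False, True]) p = 1" using aa by (simp_all add: mult.commute)
  then have "Ew (B.dat N Z' f) 0 [True, False] f p = Ew (A.dat N Z f) 0 [True, False] f p"
    "Ew (B.dat N Z' f) 0 [False, True] f p = Ew (A.dat N Z f) 0 [False, True] f p"
    unfolding E by (simp_all only: times_fun_apply mult_1_left)
  then show ?thesis unfolding A.EL_def B.EL_def by simp
qed

end

context contact begin

lemma scale_pair_same:
  assumes "Fr N Z" "Fr N Z'" "(U, \<phi>) \<in> atlas M" "N \<subseteq> U" shows "scale_pair M \<theta> \<theta> (\<lambda>_. 0) N Z Z' U \<phi>"
  using assms contact_axioms by (simp add: scale_pair_def scale_pair_axioms_def sm_const)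

lemma common_frame:
  assumes "Fr U Z" "Fr U' Z'" "opn V" "p \<in> U" "p \<in> U'" "p \<in> V"
  obtains N W \<phi> where "Fr N Z" "Fr N Z'" "p \<in> N" "N \<subseteq> U" "N \<subseteq> U'" "N \<subseteq> V" "(W, \<phi>) \<in> atlas M" "N \<subseteq> W"
proof -
  obtain W \<phi> where c: "(W, \<phi>) \<in> atlas M" "p \<in> W" using chart_exists[OF opn_sub[OF assms(3,6)]] by blast
  have "opn (U \<inter> U' \<inter> V \<inter> W)" using assms(3) frame_opn[OF assms(1)] frame_opn[OF assms(2)] chart_open[OF c(1)] by blast
  then show ?thesis
    using that[of "U \<inter> U' \<inter> V \<inter> W" W \<phi>] frame_subset[OF assms(1), of "U \<inter> U' \<inter> V \<inter> W"] frame_subset[OF assms(2), of "U \<inter> U' \<inter> V \<inter> W"] c assms by blast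
qed

lemma EL_unique:
  assumes F: "Fr U Z" "Fr U' Z'" and p: "p \<in> U" "p \<in> U'" and V: "opn V" "p \<in> V" "sm V f"
  shows "EL U' Z' f p = EL U Z f p"
proof -
  obtain N W \<phi> where N: "Fr N Z" "Fr N Z'" "p \<in> N" "N \<subseteq> U" "N \<subseteq> U'" "N \<subseteq> V" "(W, \<phi>) \<in> atlas M" "N \<subseteq> W"
    by (rule common_frame[OF F V(1) p V(2)])
  have "EL N Z' f p = EL N Z f p"
    by (rule scale_pair.EL_invariance[OF scale_pair_same[OF N(1,2,7,8)] refl sm_subset[OF V(3) N(6)] N(3)])
  then show ?thesis unfolding EL_local[OF N(1,3)] EL_local[OF N(2,3)] EL_local[OF F(1) p(1)] EL_local[OF F(2) p(2)] .
qed

text \<open>The definite description collapses: every Tanaka-Webster frame yields \<open>EL\<close>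
  for its own frame by the component formula \<open>cov_scalar\<close>, \<open>EL_unique\<close>
  removes the frame, and one such frame exists.\<close>

lemma sublaplacian_EL:
  assumes F: "Fr U Z" and p: "p \<in> U" and f: "opn V" "p \<in> V" "sm V f"
  shows "sublaplacian M \<theta> f p = EL U Z f p"
  unfolding sublaplacian_def
proof (rule the_equality)
  let ?val = "\<lambda>nab Z. - (((cov_deriv nab ^^ 2) (scalar_tensor f) [Z, vconj Z] p + (cov_deriv nab ^^ 2) (scalar_tensor f) [vconj Z, Z] p) / h11 M \<theta> Z p)"
  have v: "EL U Z f p = ?val nab Z'" if tw: "tw_frame M \<theta> T nab U' Z'" and p': "p \<in> U'" for T nab U' Z'
  proof -
    have F': "Fr U' Z'" using tw by (simp add: tw_frame_def)
    interpret tw M \<theta> T nab "U' \<inter> V" Z' by (rule tw_shrink[OF tw f(1)])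
    have q: "p \<in> U' \<inter> V" and s: "sm (U' \<inter> V) f" using p' f sm_subset by auto
    have h: "hh Z' p \<noteq> 0" by (rule h_nonzero[OF F' p'])
    have "?val nab Z' = EL (U' \<inter> V) Z' f p"
      using cov_scalar[OF s q, of "[True, False]"] cov_scalar[OF s q, of "[False, True]"] h
      by (simp add: EL_def numeral_2_eq_2 add_divide_distrib del: Ew.simps)
    also have "\<dots> = EL U Z f p"
      by (rule EL_unique[OF \<open>Fr U Z\<close> frame_shrink[OF F' f(1)] p q f])
    finally show ?thesis by simp
  qed
  show "\<forall>T nab U' Z'. tw_frame M \<theta> T nab U' Z' \<longrightarrow> p \<in> U' \<longrightarrow> EL U Z f p = ?val nab Z'" using v by blast
  fix c assume "\<forall>T nab U' Z'. tw_frame M \<theta> T nab U' Z' \<longrightarrow> p \<in> U' \<longrightarrow> c = ?val nab Z'"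
  then show "c = EL U Z f p" using v[OF tw_frame_exists[OF F] p] tw_frame_exists[OF F] p by metis
qed

lemma sublaplacian_smooth:
  assumes V: "opn V" and f: "sm V f" shows "sm V (sublaplacian M \<theta> f)"
proof (rule sm_local)
  fix p assume p: "p \<in> V"
  obtain U Z where F: "Fr U Z" "p \<in> U" using frame_exists[OF opn_sub[OF V p]] by blast
  obtain W \<phi> where c: "(W, \<phi>) \<in> atlas M" "p \<in> W" using chart_exists[OF opn_sub[OF V p]] by blast
  let ?N = "U \<inter> (V \<inter> W)"
  have FN: "Fr ?N Z" by (rule frame_shrink[OF F(1)]) (use V chart_open[OF c(1)] in blast)
  have fN: "sm ?N f" by (rule sm_subset[OF f]) auto
  have "sm ?N (EL ?N Z f)" by (rule EL_sm[OF c(1) _ FN fN]) auto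
  then have "sm ?N (sublaplacian M \<theta> f)"
    by (rule sm_cong[OF frame_opn[OF FN], rotated]) (simp add: sublaplacian_EL[OF FN _ frame_opn[OF FN] _ fN])
  then show "\<exists>N. opn N \<and> p \<in> N \<and> sm N (sublaplacian M \<theta> f)" using frame_opn[OF FN] F p c by blast
qed

lemma sublaplacian_power:
  assumes F: "Fr N Z" and f: "sm N f"
  shows "p \<in> N \<Longrightarrow> (sublaplacian M \<theta> ^^ k) f p = (EL N Z ^^ k) f p"
proof (induction k arbitrary: p)
  case (Suc k)
  have s: "sm N ((sublaplacian M \<theta> ^^ k) f)"
    by (induction k) (simp_all add: f sublaplacian_smooth[OF frame_opn[OF F]])
  have "(sublaplacian M \<theta> ^^ Suc k) f p = EL N Z ((sublaplacian M \<theta> ^^ k) f) p"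
    using sublaplacian_EL[OF F Suc.prems frame_opn[OF F] Suc.prems s] by simp
  also have "\<dots> = EL N Z ((EL N Z ^^ k) f) p"
    by (rule EL_cong[OF F frame_opn[OF F] Suc.prems Suc.prems]) (rule Suc.IH)
  finally show ?case by simp
qed simp

end

section \<open>The invariant operator\<close>

text \<open>A definite description over all frames and connections at p, so that the operator is
  defined globally without choices; that the value is unique is \<open>opv_eq\<close>.\<close>

definition opv :: "universal_expr \<Rightarrow> 'a crdata \<Rightarrow> 'a oneform \<Rightarrow> ('a \<Rightarrow> complex) \<Rightarrow> 'a \<Rightarrow> complex" where
  "opv E M \<theta> f p = (THE c. \<forall>T nab U Z. tw_frame M \<theta> T nab U Z \<longrightarrow> p \<in> U \<longrightarrow> c = expr_value M \<theta> T nab Z E f p)"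

text \<open>\<open>dummy\<close> ties the locale to the point type over which the frame data in the
  assumption on \<open>nvals\<close> range.\<close>

locale invariant_expr =
  fixes k W and E :: "nmon list" and dummy :: "'a"
  assumes W: "singular_vector k W"
    and E0: "\<forall>m\<in>set E. mchg m = 0" and E: "\<And>D :: 'a frame_data. good_data D \<Longrightarrow> nvals D E = wsum W k D"
begin

lemma value_wsum:
  fixes M :: "'a crdata"
  assumes "contact M \<theta>" and tw: "tw_frame M \<theta> T nab U Z" and FN: "frame_vector M N Z" "N \<subseteq> U" "p \<in> N" and f: "smooth_fun M N f"
  shows "expr_value M \<theta> T nab Z (map tr E) f p = wsum W k (contact.dat M \<theta> N Z f) p"
proof -
  interpret contact M \<theta> by fact
  have "U \<inter> N = N" using FN(2) by auto
  then interpret tw M \<theta> T nab N Z using tw_shrink[OF tw frame_opn[OF FN(1)]] by simp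
  show ?thesis using expr_value_tr[OF f FN(3) E0] E[OF good_dat[OF FN(1) f]] by simp
qed

lemma value_invariance:
  fixes M :: "'a crdata"
  assumes C: "contact M \<theta>" "contact M \<theta>'"
    and Ups: "smooth_fun M (topspace (mtop M)) (\<lambda>p. complex_of_real (\<Upsilon> p))"
    and th': "\<And>p v. p \<in> topspace (mtop M) \<Longrightarrow> v \<in> ctangent M p \<Longrightarrow> \<theta>' p v = complex_of_real (exp (\<Upsilon> p)) * \<theta> p v"
    and tw: "tw_frame M \<theta> T nab U Z" "tw_frame M \<theta>' T' nab' U' Z'" and p: "p \<in> U" "p \<in> U'"
    and V: "openin (mtop M) V" "p \<in> V" "smooth_fun M V f"
  shows "expr_value M \<theta>' T' nab' Z' (map tr E) (\<lambda>q. exp ((of_nat k / 2 - 1) * complex_of_real (\<Upsilon> q)) * f q) p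
    = exp ((- of_nat k / 2 - 1) * complex_of_real (\<Upsilon> p)) * expr_value M \<theta> T nab Z (map tr E) f p"
proof -
  interpret A: contact M \<theta> by fact
  interpret B: contact M \<theta>' by fact
  have F: "A.Fr U Z" "A.Fr U' Z'" using tw by (auto simp: tw_frame_def)
  obtain N W \<phi> where N: "A.Fr N Z" "A.Fr N Z'" "p \<in> N" "N \<subseteq> U" "N \<subseteq> U'" "N \<subseteq> V" "(W, \<phi>) \<in> atlas M" "N \<subseteq> W"
    by (rule A.common_frame[OF F V(1) p V(2)])
  interpret S: scale_pair M \<theta> \<theta>' \<Upsilon> N Z Z' W \<phi>
    using C Ups th' N by (simp add: scale_pair_def scale_pair_axioms_def)
  let ?f = "\<lambda>q. exp ((of_nat k / 2 - 1) * complex_of_real (\<Upsilon> q)) * f q"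
  have f: "A.sm N f" by (rule A.sm_subset[OF V(3) N(6)])
  have u: "A.sm N (\<lambda>q. complex_of_real (\<Upsilon> q))" by (rule A.sm_subset[OF Ups S.N(2)])
  have f': "A.sm N ?f" by (intro A.sm_mult A.sm_exp A.sm_const u f S.N(1))
  show ?thesis
    unfolding value_wsum[OF C(1) tw(1) N(1,4,3) f] value_wsum[OF C(2) tw(2) N(2,5,3) f']
    using S.word_sum_invariance[OF W f N(3)] by (simp add: S.ups_def)
qed

text \<open>Independence of frame and connection within one scale is the case \<Upsilon> = 0 of
  \<open>value_invariance\<close>.\<close>

lemma opv_eq:
  fixes M :: "'a crdata"
  assumes C: "contact M \<theta>" and tw: "tw_frame M \<theta> T nab U Z" and p: "p \<in> U" and V: "openin (mtop M) V" "p \<in> V" "smooth_fun M V f"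
  shows "opv (map tr E) M \<theta> f p = expr_value M \<theta> T nab Z (map tr E) f p"
  unfolding opv_def
proof (rule the_equality)
  interpret contact M \<theta> by fact
  show "\<forall>T' nab' U' Z'. tw_frame M \<theta> T' nab' U' Z' \<longrightarrow> p \<in> U' \<longrightarrow> expr_value M \<theta> T nab Z (map tr E) f p = expr_value M \<theta> T' nab' Z' (map tr E) f p"
  proof (intro allI impI)
    fix T' nab' U' Z' assume tw': "tw_frame M \<theta> T' nab' U' Z'" and p': "p \<in> U'"
    show "expr_value M \<theta> T nab Z (map tr E) f p = expr_value M \<theta> T' nab' Z' (map tr E) f p"
      using value_invariance[OF C C, of "\<lambda>_. 0", OF _ _ tw tw' p p' V] by (simp add: sm_const)
  qed
qed (use tw p in blast)

lemma opv_wsum: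
  fixes M :: "'a crdata"
  assumes C: "contact M \<theta>" and F: "frame_vector M N Z" and p: "p \<in> N" and f: "smooth_fun M N f"
  shows "opv (map tr E) M \<theta> f p = wsum W k (contact.dat M \<theta> N Z f) p"
proof -
  interpret contact M \<theta> by fact
  show ?thesis
    using opv_eq[OF C tw_frame_exists[OF F] p frame_opn[OF F] p f] value_wsum[OF C tw_frame_exists[OF F] F order_refl p f] by simp
qed

lemma opv_smooth:
  fixes M :: "'a crdata"
  assumes C: "contact M \<theta>" and V: "openin (mtop M) V" and f: "smooth_fun M V f"
  shows "smooth_fun M V (opv (map tr E) M \<theta> f)"
proof -
  interpret contact M \<theta> by fact
  show ?thesis
  proof (rule sm_local)
    fix p assume p: "p \<in> V"
    obtain U Z where F: "Fr U Z" "p \<in> U" using frame_exists[OF opn_sub[OF V p]] by blast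
    let ?N = "U \<inter> V"
    have FN: "Fr ?N Z" by (rule frame_shrink[OF F(1) V])
    obtain X \<phi> where c: "(X, \<phi>) \<in> atlas M" "p \<in> X" using chart_exists[OF opn_sub[OF V p]] by blast
    let ?N = "U \<inter> (V \<inter> X)"
    have FN: "Fr ?N Z" by (rule frame_shrink[OF F(1)]) (use V chart_open[OF c(1)] in blast)
    have fN: "sm ?N f" by (rule sm_subset[OF f]) auto
    have "sm ?N (wsum W k (dat ?N Z f))"
    proof -
      have ph: "sm ?N (fphi l (dat ?N Z f) w)" for l w by (rule phi_sm[OF c(1) _ FN fN]) auto
      have "sm ?N (\<Sum>(d, w)\<leftarrow>L. cst d * fphi (of_nat k / 2 - 1) (dat ?N Z f) w)" for L
      proof (induction L)
        case Nil then show ?case using sm_const[of ?N 0] by (simp add: zero_fun_def)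
      next
        case (Cons dw L)
        obtain d w where dw: "dw = (d, w)" by force
        have "sm ?N (\<lambda>q. d * fphi (of_nat k / 2 - 1) (dat ?N Z f) w q + (\<Sum>(d, w)\<leftarrow>L. cst d * fphi (of_nat k / 2 - 1) (dat ?N Z f) w) q)"
          by (intro sm_add sm_mult sm_const ph Cons.IH frame_opn[OF FN])
        then show ?case by (simp add: dw plus_fun_def times_fun_def cst_def)
      qed
      then show ?thesis unfolding wsum_def .
    qed
    then have "sm ?N (opv (map tr E) M \<theta> f)"
      by (rule sm_cong[OF frame_opn[OF FN], rotated]) (simp add: opv_wsum[OF C FN _ fN])
    then show "\<exists>N. opn N \<and> p \<in> N \<and> sm N (opv (map tr E) M \<theta> f)" using frame_opn[OF FN] F p c by blast
  qed
qed

lemma opv_cong: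
  fixes M :: "'a crdata"
  assumes C: "contact M \<theta>" and V: "openin (mtop M) V" "p \<in> V" "smooth_fun M V f" "smooth_fun M V g" and e: "\<And>q. q \<in> V \<Longrightarrow> f q = g q"
  shows "opv (map tr E) M \<theta> f p = opv (map tr E) M \<theta> g p"
proof -
  interpret contact M \<theta> by fact
  obtain U Z where F: "Fr U Z" "p \<in> U" using frame_exists[OF opn_sub[OF V(1,2)]] by blast
  let ?N = "U \<inter> V"
  have FN: "Fr ?N Z" by (rule frame_shrink[OF F(1) V(1)])
  have s: "sm ?N f" "sm ?N g" by (rule sm_subset[OF V(3)], simp) (rule sm_subset[OF V(4)], simp)
  have p: "p \<in> ?N" using F V by simp
  show ?thesis unfolding opv_wsum[OF C FN p s(1)] opv_wsum[OF C FN p s(2)]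
    by (rule wsum_cong[OF FN _ p]) (simp add: e)
qed

lemma opv_scale:
  fixes M :: "'a crdata"
  assumes C: "contact M \<theta>" "contact M \<theta>'"
    and Ups: "smooth_fun M (topspace (mtop M)) (\<lambda>p. complex_of_real (\<Upsilon> p))"
    and th': "\<And>p v. p \<in> topspace (mtop M) \<Longrightarrow> v \<in> ctangent M p \<Longrightarrow> \<theta>' p v = complex_of_real (exp (\<Upsilon> p)) * \<theta> p v"
    and f: "smooth_fun M (topspace (mtop M)) f" "smooth_fun M (topspace (mtop M)) f'"
    and e: "\<And>q. q \<in> topspace (mtop M) \<Longrightarrow> f' q = complex_of_real (exp ((real k / 2 - 1) * \<Upsilon> q)) * f q"
    and p: "p \<in> topspace (mtop M)"
  shows "opv (map tr E) M \<theta>' f' p = complex_of_real (exp ((- real k / 2 - 1) * \<Upsilon> p)) * opv (map tr E) M \<theta> f p"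
proof -
  interpret A: contact M \<theta> by fact
  interpret B: contact M \<theta>' by fact
  let ?g = "\<lambda>q. exp ((of_nat k / 2 - 1) * complex_of_real (\<Upsilon> q)) * f q"
  obtain U Z where F: "A.Fr U Z" "p \<in> U" using A.frame_exists[OF p] by blast
  note tw = A.tw_frame_exists[OF F(1)] and tw' = B.tw_frame_exists[OF F(1)]
  have o: "A.opn A.pts" by simp
  have g: "A.sm A.pts ?g" by (intro A.sm_mult A.sm_exp A.sm_const Ups f o)
  have "opv (map tr E) M \<theta>' f' p = opv (map tr E) M \<theta>' ?g p"
    by (rule opv_cong[OF C(2) o p f(2) g]) (simp add: e exp_of_real[symmetric])
  also have "\<dots> = exp ((- of_nat k / 2 - 1) * complex_of_real (\<Upsilon> p)) * opv (map tr E) M \<theta> f p"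
    unfolding opv_eq[OF C(2) tw' F(2) o p g] opv_eq[OF C(1) tw F(2) o p f(1)]
    by (rule value_invariance[OF C Ups th' tw tw' F(2) F(2) o p f(1)])
  finally show ?thesis by (simp add: exp_of_real[symmetric])
qed

text \<open>On a frame domain inside the chart the difference is of lower order by
  \<open>O_main\<close>. The frame may not exist on the whole chart, hence the gluing by
  \<open>patch\<close>.\<close>

lemma opv_order:
  fixes M :: "'a crdata"
  assumes C: "contact M \<theta>" and S: "(\<Sum>(c, w)\<leftarrow>W. c) = (- 2) ^ k"
  shows "diff_op_order_less M (2 * k) (\<lambda>f p. opv (map tr E) M \<theta> f p - (sublaplacian M \<theta> ^^ k) f p)"
  unfolding diff_op_order_less_def
proof (clarify)
  interpret contact M \<theta> by fact
  fix U \<phi> assume c: "(U, \<phi>) \<in> atlas M"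
  let ?D = "\<lambda>f p. opv (map tr E) M \<theta> f p - (sublaplacian M \<theta> ^^ k) f p"
  have bal: "count_list w True = k \<and> count_list w False = k" if "(d, w) \<in> set W" for d w
    using W that by (auto simp: singular_vector_def)
  have "\<exists>a. (\<forall>is. sm U (a is)) \<and> (\<forall>f. sm U f \<longrightarrow> (\<forall>q\<in>U. ?D f q = (\<Sum>is | length is < 2 * k. a is q * PD U \<phi> is f q)))"
  proof (rule patch[OF c])
    fix p assume p: "p \<in> U"
    obtain V Z where F: "Fr V Z" "p \<in> V" using frame_exists[OF opn_sub[OF chart_open[OF c] p]] by blast
    let ?N = "V \<inter> U"
    have FN: "Fr ?N Z" by (rule frame_shrink[OF F(1) chart_open[OF c]])
    have "ordl U \<phi> ?N (2 * k) (\<lambda>f q. wsum W k (dat ?N Z f) q - (EL ?N Z ^^ k) f q)"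
      by (rule O_main[OF c _ FN bal S]) auto
    then obtain b where b: "\<forall>is. sm ?N (b is)" "\<forall>f. sm ?N f \<longrightarrow> (\<forall>q\<in>?N. wsum W k (dat ?N Z f) q - (EL ?N Z ^^ k) f q = (\<Sum>is | length is < 2 * k. b is q * PD U \<phi> is f q))"
      unfolding ordl_def by blast
    have "?D f q = (\<Sum>is | length is < 2 * k. b is q * PD U \<phi> is f q)" if f: "sm U f" and q: "q \<in> ?N" for f q
    proof -
      have s: "sm ?N f" by (rule sm_subset[OF f]) auto
      show ?thesis unfolding opv_wsum[OF C FN q s] sublaplacian_power[OF FN s q] using b(2) s q by blast
    qed
    then show "\<exists>N b. opn N \<and> p \<in> N \<and> N \<subseteq> U \<and> (\<forall>is. sm N (b is)) \<and>
      (\<forall>f. sm U f \<longrightarrow> (\<forall>q\<in>N. ?D f q = (\<Sum>is | length is < 2 * k. b is q * PD U \<phi> is f q)))"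
      using b(1) frame_opn[OF FN] p F(2) by (intro exI[of _ ?N] exI[of _ b]) auto
  qed
  then obtain a where a: "\<forall>is. sm U (a is)" "\<forall>f. sm U f \<longrightarrow> (\<forall>q\<in>U. ?D f q = (\<Sum>is | length is < 2 * k. a is q * PD U \<phi> is f q))"
    by blast
  show "\<exists>a. (\<forall>is. sm U (a is)) \<and> (\<forall>f. sm pts f \<longrightarrow> (\<forall>p\<in>U. ?D f p = (\<Sum>is | length is < 2 * k. a is p * partials is (f \<circ> inv_into U \<phi>) (\<phi> p))))"
  proof (intro exI[of _ a] conjI a(1) allI impI ballI)
    fix f p assume f: "sm pts f" and p: "p \<in> U"
    have s: "sm U f" by (rule sm_subset[OF f openin_subset[OF chart_open[OF c]]])
    show "?D f p = (\<Sum>is | length is < 2 * k. a is p * partials is (f \<circ> inv_into U \<phi>) (\<phi> p))"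
      unfolding partials_PD[OF c s p] using a(2) s p by blast
  qed
qed

end

theorem theorem1p3:
  fixes k :: nat
  assumes "1 \<le> k"
  shows "\<exists>P :: real \<Rightarrow> 'a crdata \<Rightarrow> 'a density \<Rightarrow> 'a density.
    (\<forall>\<mu>. cr_invariant_operator (real k / 2 - 1) (- real k / 2 - 1) (P \<mu>)) \<and>
    (\<forall>M. cr_manifold M \<longrightarrow> strictly_pseudoconvex M \<longrightarrow>
       polynomial_family M (real k / 2 - 1) (real k / 3) (\<lambda>\<mu>. P \<mu> M) \<and>
       (\<forall>\<mu>. principal_part_sublaplacian_power M (real k / 2 - 1) k (P \<mu> M)))"
proof -
  obtain W0 where W0: "singular_vector k W0" using singular_vector_exists by blast
  \<comment> \<open>Scales the sum of the coefficients to (-2)^k, the factor with which the common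
    top order word occurs in the k-th power of the sublaplacian.\<close>
  define \<kappa> where "\<kappa> = (- 2) ^ k / (\<Sum>(c, w)\<leftarrow>W0. c)"
  define W where "W = map (\<lambda>(c, w). (\<kappa> * c, w)) W0"
  have S0: "(\<Sum>(c, w)\<leftarrow>W0. c) \<noteq> 0" using W0 by (simp add: singular_vector_def)
  have sc: "(\<Sum>(c, w)\<leftarrow>W. c * g w) = \<kappa> * (\<Sum>(c, w)\<leftarrow>W0. c * g w)" for g :: "bool list \<Rightarrow> complex"
    unfolding W_def by (induction W0) (auto simp: algebra_simps)
  have S: "(\<Sum>(c, w)\<leftarrow>W. c) = (- 2) ^ k" using sc[of "\<lambda>_. 1"] S0 by (simp add: \<kappa>_def)
  have bal: "\<forall>(c, w)\<in>set W. count_list w True = k \<and> count_list w False = k"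
    using W0 by (auto simp: singular_vector_def W_def)
  have W: "singular_vector k W"
    unfolding singular_vector_def
  proof (intro conjI allI bal)
    show "(\<Sum>(c, w)\<leftarrow>W. c * rem d (of_nat k / 2 - 1) \<psi> w) = 0" for d \<psi>
      unfolding sc using W0 by (simp add: singular_vector_def)
    show "(\<Sum>(c, w)\<leftarrow>W. c) \<noteq> 0" unfolding S by simp
  qed
  have "representable 0 (\<lambda>D :: 'a frame_data. wsum W k D)"
    unfolding wsum_def by (rule representable_word_sum) (use bal in \<open>auto simp: ichg_def\<close>)
  then obtain E where E: "\<forall>m\<in>set E. mchg m = 0" "\<And>D :: 'a frame_data. good_data D \<Longrightarrow> nvals D E = wsum W k D"
    unfolding representable_def by blast
  interpret I: invariant_expr k W E "undefined :: 'a"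
    by unfold_locales (use W E in auto)
  define P0 where "P0 M F \<theta> p = opv (map tr E) M \<theta> (F \<theta>) p" for M :: "'a crdata" and F :: "'a density" and \<theta> p
  have contactI: "contact M \<theta>" if "cr_manifold M" "contact_form M \<theta>" for M :: "'a crdata" and \<theta>
    using that by (simp add: contact_def contact_axioms_def manifold_def cr_manifold_def)
  have dens: "smooth_fun M (topspace (mtop M)) (F \<theta>)" if "F \<in> densities M w" "contact_form M \<theta>" for M :: "'a crdata" and F w \<theta>
    using that by (simp add: densities_def)
  have inv: "cr_invariant_operator (real k / 2 - 1) (- real k / 2 - 1) P0"
    unfolding cr_invariant_operator_def
  proof (intro exI[of _ "map tr E"] conjI allI impI ballI)
    show "well_formed (map tr E)" by (rule well_formed_tr[OF E(1)])
    fix M :: "'a crdata" and F assume M: "cr_manifold M" and F: "F \<in> densities M (real k / 2 - 1)"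
    show "P0 M F \<in> densities M (- real k / 2 - 1)"
      unfolding densities_def
    proof (intro CollectI conjI allI impI ballI)
      fix \<theta> assume t: "contact_form M \<theta>"
      have "P0 M F \<theta> = opv (map tr E) M \<theta> (F \<theta>)" by (simp add: P0_def fun_eq_iff)
      then show "smooth_fun M (topspace (mtop M)) (P0 M F \<theta>)"
        using I.opv_smooth[OF contactI[OF M t] openin_topspace dens[OF F t]] by simp
    next
      fix \<theta> \<theta>' \<Upsilon> p assume t: "contact_form M \<theta>" "contact_form M \<theta>'" and U: "smooth_fun M (topspace (mtop M)) (\<lambda>p. complex_of_real (\<Upsilon> p))"
        and e: "\<forall>p\<in>topspace (mtop M). \<forall>v\<in>ctangent M p. \<theta>' p v = complex_of_real (exp (\<Upsilon> p)) * \<theta> p v" and p: "p \<in> topspace (mtop M)"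
      have F': "F \<theta>' q = complex_of_real (exp ((real k / 2 - 1) * \<Upsilon> q)) * F \<theta> q" if "q \<in> topspace (mtop M)" for q
        using F t U e that unfolding densities_def by blast
      show "P0 M F \<theta>' p = complex_of_real (exp ((- real k / 2 - 1) * \<Upsilon> p)) * P0 M F \<theta> p"
        unfolding P0_def
        by (rule I.opv_scale[OF contactI[OF M t(1)] contactI[OF M t(2)] U _ dens[OF F t(1)] dens[OF F t(2)] F' p]) (use e in blast)
    qed
    fix \<theta> T nab U Z p assume tw: "tw_frame M \<theta> T nab U Z" and p: "p \<in> U"
    have t: "contact_form M \<theta>" and P: "p \<in> topspace (mtop M)"
      using tw p openin_subset by (auto simp: tw_frame_def frame_vector_def)
    show "P0 M F \<theta> p = expr_value M \<theta> T nab Z (map tr E) (F \<theta>) p"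
      unfolding P0_def by (rule I.opv_eq[OF contactI[OF M t] tw p openin_topspace P dens[OF F t]])
  qed
  have poly: "polynomial_family M (real k / 2 - 1) (real k / 3) (\<lambda>\<mu>. P0 M)" for M :: "'a crdata"
    unfolding polynomial_family_def
  proof (intro exI[of _ "\<lambda>j F \<theta> p. if j = 0 then P0 M F \<theta> p else 0"] allI ballI impI)
    fix \<mu> :: real and F \<theta> p
    have "finite {j. real j \<le> real k / 3}"
      by (rule finite_subset[of _ "{..k}"]) auto
    then have "(\<Sum>j | real j \<le> real k / 3. complex_of_real (\<mu> ^ j) * (if j = 0 then P0 M F \<theta> p else 0))
      = (\<Sum>j\<in>{0}. complex_of_real (\<mu> ^ j) * (if j = 0 then P0 M F \<theta> p else 0))"
      by (intro sum.mono_neutral_right) auto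
    then show "P0 M F \<theta> p = (\<Sum>j | real j \<le> real k / 3. complex_of_real (\<mu> ^ j) * (if j = 0 then P0 M F \<theta> p else 0))" by simp
  qed
  have pp: "principal_part_sublaplacian_power M (real k / 2 - 1) k (P0 M)" if M: "cr_manifold M" for M :: "'a crdata"
    unfolding principal_part_sublaplacian_power_def
  proof (intro allI impI)
    fix \<theta> assume t: "contact_form M \<theta>"
    show "\<exists>D. diff_op_order_less M (2 * k) D \<and> (\<forall>F \<in> densities M (real k / 2 - 1). \<forall>p\<in>topspace (mtop M).
           P0 M F \<theta> p - (sublaplacian M \<theta> ^^ k) (F \<theta>) p = D (F \<theta>) p)"
      using I.opv_order[OF contactI[OF M t] S] by (intro exI[of _ "\<lambda>f p. opv (map tr E) M \<theta> f p - (sublaplacian M \<theta> ^^ k) f p"]) (simp add: P0_def)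
  qed
  show ?thesis
    by (intro exI[of _ "\<lambda>\<mu>. P0"] conjI allI impI inv poly pp)
qed

end
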